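(* For the Kovalevskaya–Sokolov top, in the extended space $\mathbb{R}^3(\ell,h,\varepsilon_1)$ the union of the Smale diagrams defines seven regions $\mathbb{A},\mathbb{B},\mathbb{C},\mathbb{D},\mathbb{E},\mathbb{F},\mathbb{G}$ with nonempty isoenergetic manifolds $Q^3_{\ell,h}=\{H=h\}\cap\mathcal{P}^4_{a,\ell}$ (below all the parabolas of the diagram $Q^3_{\ell,h}=\varnothing$). The isoenergetic manifolds in these regions are: $$\mathbb{A}:\ S^3;\quad \mathbb{B}:\ \mathbb{R}P^3;\quad \mathbb{C}:\ S^2\times S^1;\quad \mathbb{D}:\ N^3_2;\quad \mathbb{E}:\ 2S^3;\quad \mathbb{F}:\ S^2\times S^1;\quad \mathbb{G}:\ N^3_3,$$ where $N^3_m$ denotes the connected sum of $m$ copies of $S^2\times S^1$ and $2S^3$ is the disjoint union of two copies of $S^3$.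
   Context: Fix $a,\varepsilon_0>0$ and let $\varepsilon_1>0$; put $\zeta_1=\varepsilon_0/(2a)$, $\zeta_2=\varepsilon_0/a$, $\zeta_3=(5+3\sqrt3)\varepsilon_0/a$. On $\mathbb{R}^6(\mathbf{M},\boldsymbol\alpha)$ with bracket $\{M_i,M_j\}=\epsilon_{ijk}M_k$, $\{M_i,\alpha_j\}=\epsilon_{ijk}\alpha_k$, $\{\alpha_i,\alpha_j\}=0$ let $L=\frac12\mathbf{M}\cdot\boldsymbol\alpha$ and $$H=\tfrac14(M_1^2+M_2^2+2M_3^2)+\varepsilon_1(\alpha_3M_2-\alpha_2M_3)-\varepsilon_0\alpha_1 .$$ The Kovalevskaya–Sokolov top is the system $\dot x=\{H,x\}$ on $\mathcal{P}^5=\{\boldsymbol\alpha^2=a^2\}$; $\mathcal{P}^4_{a,\ell}=\{L=\ell,\ \boldsymbol\alpha^2=a^2\}$. The Smale diagram for given $\varepsilon_1$ is the set of critical values $(\ell,h)$ of $L\times H$ on $\mathcal{P}^5$. It is symmetric in $\ell\mapsto-\ell$ and consists of the curves (parameter $\Omega$): the parabolas $\delta_1$: $h=-\varepsilon_0a+\ell^2/a^2$; $\delta_2$: $h=\varepsilon_0a+\ell^2/a^2$; $\delta_4$ (only for $\varepsilon_1^2>\zeta_1$): $h=-\frac{\varepsilon_0^2}{4\varepsilon_1^2}-\varepsilon_1^2a^2+\ell^2/a^2$, lying below the other curves; and $$\ell=\frac{\Omega[\varepsilon_0^2+a^2(\varepsilon_1^2-\Omega^2)^2]}{2(\varepsilon_1^2-\Omega^2)^2},\qquad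 h=-\frac{\varepsilon_0^2(\varepsilon_1^2-3\Omega^2)+a^2(\varepsilon_1^2-\Omega^2)^3}{2(\varepsilon_1^2-\Omega^2)^2},$$ which is called $\delta_3'$ for $\Omega^2\ge\varepsilon_1^2+\zeta_2$ and $\delta_3''$ for $0\le\Omega^2\le\varepsilon_1^2-\zeta_2$ (the latter only for $\varepsilon_1^2>\zeta_2$). In the half-plane $\ell\ge0$: $\delta_3'$ starts at the point $T_1$ where it touches $\delta_2$, has a unique cusp $C$ below $\delta_2$, then crosses $\delta_2$ at a unique point $I_1$ and goes to infinity above $\delta_2$. For $\varepsilon_1^2>\zeta_3$ it also crosses $\delta_1$ at exactly two points, one on the arc $T_1C$ and one on the arc $CI_1$ (the cusp $C$ is then below $\delta_1$). The curve $\delta_3''$ goes from the axis $\ell=0$, below $\delta_1$, to the point $T_2$ where it touches $\delta_1$. Let $\Delta$ be the curvilinear triangle with vertices $T_1,C,I_1$ bounded by the arcs $T_1C$, $CI_1$ of $\delta_3'$ and the arc $I_1T_1$ of $\delta_2$. The regions (for $\ell\ge0$, extended by symmetry) are: $\mathbb{A}$: between $\delta_1$ and $\delta_2$, outside $\Delta$; $\mathbb{B}$: above $\delta_2$ and above the arc of $\delta_3'$ going from $I_1$ to infinity; $\mathbb{C}$: above $\delta_2$ and below that arc; $\mathbb{D}$: the part of $\Delta$ above $\delta_1$ (all of $\Delta$ if $\varepsilon_1^2<\zeta_3$); $\mathbb{E}$ ($\varepsilon_1^2>\zeta_1$): above $\delta_4$ and below $\delta_1$, and, if $\delta_3''$ exists,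 below $\delta_3''$ over its range of $\ell$; $\mathbb{F}$ ($\varepsilon_1^2>\zeta_2$): between $\delta_3''$ and $\delta_1$, outside $\Delta$; $\mathbb{G}$ ($\varepsilon_1^2>\zeta_3$): the part of $\Delta$ below $\delta_1$. *)

theory Defs
  imports "HOL-Analysis.Analysis"
begin

section \<open>The Kovalevskaya--Sokolov top\<close>

text \<open>Points of $R^6$ are pairs $(M, \alpha)$; \<open>a\<close>, \<open>e0\<close>, \<open>e1\<close> stand for
  $a$, $\varepsilon_0$, $\varepsilon_1$.\<close>

type_synonym phase = "(real^3) \<times> (real^3)"

definition ksL :: "phase \<Rightarrow> real" where
  "ksL = (\<lambda>(M, \<alpha>). (M \<bullet> \<alpha>) / 2)"

definition ksH :: "real \<Rightarrow> real \<Rightarrow> phase \<Rightarrow> real" where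
  "ksH e0 e1 = (\<lambda>(M, \<alpha>).
     ((M$1)\<^sup>2 + (M$2)\<^sup>2 + 2 * (M$3)\<^sup>2) / 4
     + e1 * (\<alpha>$3 * M$2 - \<alpha>$2 * M$3) - e0 * \<alpha>$1)"

definition alpha_sq :: "phase \<Rightarrow> real" where
  "alpha_sq = (\<lambda>(M, \<alpha>). \<alpha> \<bullet> \<alpha>)"

definition P5 :: "real \<Rightarrow> phase set" where
  "P5 a = {x. alpha_sq x = a\<^sup>2}"

definition P4 :: "real \<Rightarrow> real \<Rightarrow> phase set" where
  "P4 a l = {x \<in> P5 a. ksL x = l}"

definition Q3 :: "real \<Rightarrow> real \<Rightarrow> real \<Rightarrow> real \<Rightarrow> real \<Rightarrow> phase set" where
  "Q3 a e0 e1 l h = {x. ksH e0 e1 x = h} \<inter> P4 a l"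

text \<open>For $a > 0$ the tangent space of \<open>P5 a\<close> at \<open>x\<close> is the kernel of the differential of
  \<open>alpha_sq\<close>; a point is critical for $L \times H$ restricted to \<open>P5 a\<close> if the restricted
  differential is not onto $R^2$.\<close>

definition tangent_P5 :: "phase \<Rightarrow> phase set" where
  "tangent_P5 x = {v. frechet_derivative alpha_sq (at x) v = 0}"

definition critical_points :: "real \<Rightarrow> real \<Rightarrow> real \<Rightarrow> phase set" where
  "critical_points a e0 e1 = {x \<in> P5 a.
     frechet_derivative (\<lambda>y. (ksL y, ksH e0 e1 y)) (at x) ` tangent_P5 x \<noteq> UNIV}"

definition smale_diagram :: "real \<Rightarrow> real \<Rightarrow> real \<Rightarrow> (real \<times> real) set" where
  "smale_diagram a e0 e1 = (\<lambda>x. (ksL x, ksH e0 e1 x)) ` critical_points a e0 e1"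

text \<open>Points $(\ell, h, \varepsilon_1)$ of the extended space with $\varepsilon_1 > 0$ that lie
  off the Smale diagrams and have a nonempty isoenergetic manifold.\<close>

definition regular_values :: "real \<Rightarrow> real \<Rightarrow> (real \<times> real \<times> real) set" where
  "regular_values a e0 =
     {(l, h, e1). 0 < e1 \<and> Q3 a e0 e1 l h \<noteq> {} \<and> (l, h) \<notin> smale_diagram a e0 e1}"


section \<open>The curves\<close>

definition zeta1 :: "real \<Rightarrow> real \<Rightarrow> real" where "zeta1 a e0 = e0 / (2 * a)"
definition zeta2 :: "real \<Rightarrow> real \<Rightarrow> real" where "zeta2 a e0 = e0 / a"
definition zeta3 :: "real \<Rightarrow> real \<Rightarrow> real" where "zeta3 a e0 = (5 + 3 * sqrt 3) * e0 / a"

definition delta1 :: "real \<Rightarrow> real \<Rightarrow> real \<Rightarrow> real" where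
  "delta1 a e0 l = - e0 * a + l\<^sup>2 / a\<^sup>2"

definition delta2 :: "real \<Rightarrow> real \<Rightarrow> real \<Rightarrow> real" where
  "delta2 a e0 l = e0 * a + l\<^sup>2 / a\<^sup>2"

definition delta4 :: "real \<Rightarrow> real \<Rightarrow> real \<Rightarrow> real \<Rightarrow> real" where
  "delta4 a e0 e1 l = - e0\<^sup>2 / (4 * e1\<^sup>2) - e1\<^sup>2 * a\<^sup>2 + l\<^sup>2 / a\<^sup>2"

definition ell3 :: "real \<Rightarrow> real \<Rightarrow> real \<Rightarrow> real \<Rightarrow> real" where
  "ell3 a e0 e1 w =
     w * (e0\<^sup>2 + a\<^sup>2 * (e1\<^sup>2 - w\<^sup>2)\<^sup>2) / (2 * (e1\<^sup>2 - w\<^sup>2)\<^sup>2)"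

definition h3 :: "real \<Rightarrow> real \<Rightarrow> real \<Rightarrow> real \<Rightarrow> real" where
  "h3 a e0 e1 w =
     - (e0\<^sup>2 * (e1\<^sup>2 - 3 * w\<^sup>2) + a\<^sup>2 * (e1\<^sup>2 - w\<^sup>2)^3) / (2 * (e1\<^sup>2 - w\<^sup>2)\<^sup>2)"

text \<open>Values of the parameter $\Omega$ at $T_1$ and $I_1$ on the branch $\Omega > 0$ of $\delta_3'$,
  which is the part of $\delta_3'$ in $\ell \ge 0$.\<close>

definition omega_T1 :: "real \<Rightarrow> real \<Rightarrow> real \<Rightarrow> real" where
  "omega_T1 a e0 e1 = sqrt (e1\<^sup>2 + zeta2 a e0)"

definition omega_I1 :: "real \<Rightarrow> real \<Rightarrow> real \<Rightarrow> real" where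
  "omega_I1 a e0 e1 =
     (THE w. omega_T1 a e0 e1 < w \<and> h3 a e0 e1 w = delta2 a e0 (ell3 a e0 e1 w))"

text \<open>The cusp $C$ lies on $\delta_3'$ between $T_1$ and $I_1$, so the arcs $T_1C$ and $CI_1$ together
  are the arc of $\delta_3'$ from $T_1$ to $I_1$.\<close>

definition triangle_boundary :: "real \<Rightarrow> real \<Rightarrow> real \<Rightarrow> (real \<times> real) set" where
  "triangle_boundary a e0 e1 =
     (\<lambda>w. (ell3 a e0 e1 w, h3 a e0 e1 w)) ` {omega_T1 a e0 e1 .. omega_I1 a e0 e1}
     \<union> (\<lambda>l. (l, delta2 a e0 l)) `
         closed_segment (ell3 a e0 e1 (omega_I1 a e0 e1)) (ell3 a e0 e1 (omega_T1 a e0 e1))"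

definition open_triangle :: "real \<Rightarrow> real \<Rightarrow> real \<Rightarrow> (real \<times> real) set" where
  "open_triangle a e0 e1 = inside (triangle_boundary a e0 e1)"

definition closed_triangle :: "real \<Rightarrow> real \<Rightarrow> real \<Rightarrow> (real \<times> real) set" where
  "closed_triangle a e0 e1 = triangle_boundary a e0 e1 \<union> open_triangle a e0 e1"

text \<open>Parameters of the part of $\delta_3''$ in $\ell \ge 0$; empty if $\delta_3''$ does not exist.\<close>

definition delta3''_params :: "real \<Rightarrow> real \<Rightarrow> real \<Rightarrow> real set" where
  "delta3''_params a e0 e1 =
     {w. 0 \<le> w \<and> w\<^sup>2 \<le> e1\<^sup>2 - zeta2 a e0 \<and> zeta2 a e0 < e1\<^sup>2}"


section \<open>The regions in the half-space $\ell \ge 0$\<close>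

definition regionA :: "real \<Rightarrow> real \<Rightarrow> (real \<times> real \<times> real) set" where
  "regionA a e0 = {(l, h, e1). 0 < e1 \<and> 0 \<le> l \<and>
     delta1 a e0 l < h \<and> h < delta2 a e0 l \<and> (l, h) \<notin> closed_triangle a e0 e1}"

definition regionB :: "real \<Rightarrow> real \<Rightarrow> (real \<times> real \<times> real) set" where
  "regionB a e0 = {(l, h, e1). 0 < e1 \<and> 0 \<le> l \<and> delta2 a e0 l < h \<and>
     (\<forall>w \<ge> omega_I1 a e0 e1. ell3 a e0 e1 w = l \<longrightarrow> h3 a e0 e1 w < h)}"

definition regionC :: "real \<Rightarrow> real \<Rightarrow> (real \<times> real \<times> real) set" where
  "regionC a e0 = {(l, h, e1). 0 < e1 \<and> 0 \<le> l \<and> delta2 a e0 l < h \<and>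
     (\<exists>w \<ge> omega_I1 a e0 e1. ell3 a e0 e1 w = l \<and> h < h3 a e0 e1 w)}"

definition regionD :: "real \<Rightarrow> real \<Rightarrow> (real \<times> real \<times> real) set" where
  "regionD a e0 = {(l, h, e1). 0 < e1 \<and> 0 \<le> l \<and>
     (l, h) \<in> open_triangle a e0 e1 \<and> delta1 a e0 l < h}"

definition regionE :: "real \<Rightarrow> real \<Rightarrow> (real \<times> real \<times> real) set" where
  "regionE a e0 = {(l, h, e1). 0 < e1 \<and> 0 \<le> l \<and> zeta1 a e0 < e1\<^sup>2 \<and>
     delta4 a e0 e1 l < h \<and> h < delta1 a e0 l \<and>
     (\<forall>w \<in> delta3''_params a e0 e1. ell3 a e0 e1 w = l \<longrightarrow> h < h3 a e0 e1 w)}"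

definition regionF :: "real \<Rightarrow> real \<Rightarrow> (real \<times> real \<times> real) set" where
  "regionF a e0 = {(l, h, e1). 0 < e1 \<and> 0 \<le> l \<and> zeta2 a e0 < e1\<^sup>2 \<and>
     (\<exists>w \<in> delta3''_params a e0 e1. ell3 a e0 e1 w = l \<and> h3 a e0 e1 w < h) \<and>
     h < delta1 a e0 l \<and> (l, h) \<notin> closed_triangle a e0 e1}"

definition regionG :: "real \<Rightarrow> real \<Rightarrow> (real \<times> real \<times> real) set" where
  "regionG a e0 = {(l, h, e1). 0 < e1 \<and> 0 \<le> l \<and> zeta3 a e0 < e1\<^sup>2 \<and>
     (l, h) \<in> open_triangle a e0 e1 \<and> h < delta1 a e0 l}"

text \<open>Extension of a region in $\ell \ge 0$ by the symmetry $\ell \mapsto -\ell$.\<close>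

definition symm :: "(real \<times> real \<times> real) set \<Rightarrow> (real \<times> real \<times> real) set" where
  "symm R = {(l, h, e1). (\<bar>l\<bar>, h, e1) \<in> R}"


definition regions :: "real \<Rightarrow> real \<Rightarrow> (real \<times> real \<times> real) set list" where
  "regions a e0 = [regionA a e0, regionB a e0, regionC a e0, regionD a e0,
                   regionE a e0, regionF a e0, regionG a e0]"


section \<open>The model 3-manifolds\<close>

abbreviation S3 :: "(real^4) topology" where
  "S3 \<equiv> top_of_set (sphere 0 1)"

abbreviation S2xS1 :: "((real^3) \<times> (real^2)) topology" where
  "S2xS1 \<equiv> prod_topology (top_of_set (sphere 0 1)) (top_of_set (sphere 0 1))"

abbreviation two_S3 :: "(bool \<times> (real^4)) topology" where
  "two_S3 \<equiv> sum_topology (\<lambda>_. S3) UNIV"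

text \<open>\<open>X\<close> is the quotient of $S^3$ by the antipodal map.\<close>

definition is_RP3 :: "'a topology \<Rightarrow> bool" where
  "is_RP3 X \<longleftrightarrow> (\<exists>p. quotient_map S3 X p \<and>
     (\<forall>x \<in> sphere 0 1. \<forall>y \<in> sphere 0 1. p x = p y \<longleftrightarrow> x = y \<or> x = - y))"

text \<open>The unit ball of a chart defined on the ball of radius 2 has a bicollared boundary sphere.
  Remove from \<open>Y\<close> and \<open>Z\<close> the images of the open unit ball under two such charts and glue the
  boundary spheres along the charts. For oriented manifolds the result may depend on whether the
  gluing respects the orientations; for copies of $S^2 \times S^1$ it does not, since
  $S^2 \times S^1$ has an orientation-reversing homeomorphism.\<close>

definition ball_chart :: "'a topology \<Rightarrow> (real^3 \<Rightarrow> 'a) \<Rightarrow> bool" where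
  "ball_chart Y e \<longleftrightarrow> embedding_map (top_of_set (ball 0 2)) Y e \<and> openin Y (e ` ball 0 2)"

definition is_connected_sum :: "'a topology \<Rightarrow> 'a topology \<Rightarrow> 'b topology \<Rightarrow> bool" where
  "is_connected_sum Y Z X \<longleftrightarrow> (\<exists>e f p. ball_chart Y e \<and> ball_chart Z f \<and>
     (let W = sum_topology (\<lambda>b. if b then subtopology Y (- e ` ball 0 1)
                                     else subtopology Z (- f ` ball 0 1)) UNIV
      in quotient_map W X p \<and>
         (\<forall>u \<in> topspace W. \<forall>v \<in> topspace W.
            p u = p v \<longleftrightarrow> u = v \<or> (\<exists>x \<in> sphere 0 1. {u, v} = {(True, e x), (False, f x)}))))"

text \<open>\<open>is_N3 m X\<close>: the space \<open>X\<close> is homeomorphic to the connected sum of \<open>m\<close> copies of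
  $S^2 \times S^1$. The intermediate spaces carry arbitrary topologies on subsets of the type \<open>'a\<close>,
  which is no restriction as soon as \<open>'a\<close> has the cardinality of the continuum.\<close>

inductive is_N3 :: "nat \<Rightarrow> 'a topology \<Rightarrow> bool" where
  one: "X homeomorphic_space S2xS1 \<Longrightarrow> is_N3 1 X"
| add: "is_N3 m Y \<Longrightarrow> Z homeomorphic_space S2xS1 \<Longrightarrow> is_connected_sum Y Z X \<Longrightarrow> is_N3 (Suc m) X"

end

theory Submission
 imports Defs "HOL-Computational_Algebra.Polynomial"
begin

text \<open>Rescaling reduces the system to \<open>a = 1\<close> with the parameters \<open>e = a e0\<close>, \<open>n = a e1\<close> and \<open>l / a\<close>, called
 \<open>l\<close> again (\<open>Q3_scale\<close>). Over a unit vector \<open>v = (x, y, z)\<close>, a value of the second component, the Hamiltonian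
 is a quadratic function of \<open>M\<close> on the plane \<open>L = l\<close>, with positive definite leading part. With \<open>psi v\<close> the energy minus its
 minimum, the fibre of \<open>Q3\<close> over \<open>v\<close> is a circle, a point or empty according to the sign of \<open>psi v\<close>.
 If \<open>psi\<close> is positive everywhere, \<open>Q3\<close> is the unit tangent bundle of the sphere, hence \<open>RP3\<close>
 (\<open>Q3_RP3\<close>). If \<open>psi\<close> is negative somewhere, the circle bundle is trivial, and \<open>Q3\<close> is the product of
 \<open>{psi \<ge> 0}\<close> with a circle, collapsed over \<open>psi = 0\<close> (\<open>Q3_homeomorphic_circ\<close>).

 Put \<open>E = n^2\<close>, \<open>m = l^2\<close>, \<open>k = h - m\<close>. On a circle \<open>x = const\<close> the region \<open>psi \<ge> 0\<close> is given by a
 diagonal quadratic form \<open>g \<zeta>^2 + p \<eta>^2 \<ge> 0\<close>, where \<open>p\<close> has the sign of \<open>k - Kf\<close> for a function \<open>Kf\<close> of one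
 variable, the profile. In general it is empty, two arcs or the whole circle. So \<open>{psi \<ge> 0}\<close> is a disc doubled along boundary arcs,
 and the topology of \<open>Q3\<close> depends only on the sequence of signs of \<open>k - Kf\<close> on the interval where
 \<open>g \<ge> 0\<close> (\<open>Q3_homeomorphic_Mod\<close>). The sequence - gives two copies of \<open>S3\<close>, -+ gives \<open>S3\<close>, both -+- and
 +-+ give \<open>S2xS1\<close> (\<open>Mod_S2xS1\<close>); -+-+ and -+-+- give discs with two and three holes, and cutting \<open>Q3\<close>
 along 2-spheres that separate the holes exhibits it as \<open>N3\<close> with two and three summands
 (\<open>chain_connected_sum\<close>, \<open>Mod_N3_2\<close>, \<open>Mod_N3_3\<close>).

 The critical values are \<open>k = \<plusminus>e\<close> (the values of \<open>Kf\<close> at \<open>\<mp>1\<close>), the critical values of \<open>Kf\<close> on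
 \<open>(-1, 1)\<close>, which form \<open>\<delta>\<^sub>3\<close>, and, for \<open>e < 2 E\<close>, \<open>\<delta>\<^sub>4\<close>, where \<open>max g = 0\<close> (\<open>regular_values_iff\<close>). Off these values, the
 sign of \<open>k \<plusminus> e\<close> and the existence of points of \<open>(-1, 0)\<close> or \<open>(0, 1)\<close> with \<open>Kf\<close> on a given side of \<open>k\<close>
 split the parameters into seven classes. In each of them the sign sequence is known, because
 \<open>2 (1 + x^2) (k - Kf x)\<close> is a quartic polynomial and \<open>Kf\<close> has no interior maximum on the positive axis
 (\<open>Q3_topology\<close>). The triangle \<open>\<Delta>\<close> is where \<open>k < e\<close> and \<open>Kf\<close> rises across the level \<open>k\<close> within \<open>(-1, 0)\<close>
 (\<open>open_triangle_iff\<close>), so the classes are the regions (\<open>regions_iff\<close>).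

 The regions are the components of the regular set in \<open>l \<ge> 0\<close>, as each is relatively open (\<open>RS_open\<close>) and connected: the
 conditions at fixed points of the profile are affine in \<open>(E, m, k)\<close>, so a class is a union of convex
 sets that a continuous family of parameters meets (\<open>PR_selection\<close>).\<close>


section \<open>Collapsed circle bundles\<close>

lemma continuous_on_scaleR_sgn:
 fixes \<phi> :: "'a::topological_space => real" and u :: "'a => 'b::real_normed_vector"
 assumes \<phi>: "continuous_on S \<phi>" and u: "continuous_on S u"
  and z: "!!x. x \<in> S ==> u x = 0 ==> \<phi> x = 0"
 shows "continuous_on S (%x. \<phi> x *\<^sub>R sgn (u x))"
 unfolding continuous_on_def
proof
 fix x assume x: "x \<in> S"
 have l\<phi>: "(\<phi> \<longlongrightarrow> \<phi> x) (at x within S)" and lu: "(u \<longlongrightarrow> u x) (at x within S)"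
  using \<phi> u x unfolding continuous_on_def by auto
 show "((%x. \<phi> x *\<^sub>R sgn (u x)) \<longlongrightarrow> \<phi> x *\<^sub>R sgn (u x)) (at x within S)"
 proof (cases "u x = 0")
  case False
  then show ?thesis using l\<phi> lu by (intro tendsto_intros tendsto_sgn) auto
 next
  case True
  then have "\<phi> x = 0" using z x by auto
  then have "((%x. \<bar>\<phi> x\<bar>) \<longlongrightarrow> 0) (at x within S)"
   using tendsto_rabs[OF l\<phi>] by simp
  then have "((%x. \<phi> x *\<^sub>R sgn (u x)) \<longlongrightarrow> 0) (at x within S)"
   by (rule Lim_null_comparison[rotated]) (auto simp: norm_sgn)
  then show ?thesis using \<open>\<phi> x = 0\<close> by simp
 qed
qed

text \<open>The sphere bundle over \<open>V\<close> with spheres of radius \<open>ro\<close>; a sphere collapses to a point where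
 \<open>ro\<close> vanishes.\<close>

definition circ :: "'a set => ('a => real) => ('a \<times> 'b::real_normed_vector) set" where
 "circ V ro = {(v, u). v \<in> V & norm u = ro v}"

lemma compact_circ:
 fixes V :: "'a::t2_space set" and ro :: "'a => real"
 assumes V: "compact V" and ro: "continuous_on V ro" and pos: "!!v. v \<in> V ==> 0 <= ro v"
 shows "compact (circ V ro :: ('a \<times> 'b::euclidean_space) set)"
proof -
 have "circ V ro = (%(v,w::'b). (v, ro v *\<^sub>R w)) ` (V \<times> sphere 0 1)" (is "_ = ?R")
 proof (intro equalityI subsetI)
  fix x :: "'a \<times> 'b" assume "x \<in> circ V ro"
  then obtain v u where x: "x = (v,u)" "v \<in> V" "norm u = ro v" by (auto simp: circ_def)
  show "x \<in> ?R"
  proof (cases "u = 0")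
   case True
   obtain b :: 'b where "b \<in> Basis" using nonempty_Basis by blast
   then have "(v,b) \<in> V \<times> sphere 0 1" "x = (%(v,w). (v, ro v *\<^sub>R w)) (v,b)"
    using x True by auto
   then show ?thesis by blast
  next
   case False
   then have "(v,sgn u) \<in> V \<times> sphere 0 1" "x = (%(v,w). (v, ro v *\<^sub>R w)) (v,sgn u)"
    using x by (auto simp: norm_sgn) (metis norm_sgn scaleR_one sgn_div_norm divideR_right norm_eq_zero)
   then show ?thesis by blast
  qed
 qed (use pos in \<open>auto simp: circ_def\<close>)
 moreover have "compact ?R"
  unfolding case_prod_unfold
  by (intro compact_continuous_image compact_Times V compact_sphere continuous_intros
    continuous_on_compose2[OF ro]) auto
 ultimately show ?thesis by simp
qed

text \<open>Up to homeomorphism only the base and the zero set of the radius matter.\<close>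

lemma circ_reparam:
 fixes V :: "'a::t2_space set" and V' :: "'c::t2_space set"
 assumes V: "compact V" and f: "continuous_on V f" "inj_on f V" "f ` V = V'"
  and ro: "continuous_on V ro" "!!v. v \<in> V ==> 0 <= ro v"
  and ro': "continuous_on V' ro'" "!!v. v \<in> V' ==> 0 <= ro' v"
  and z: "!!v. v \<in> V ==> ro v = 0 \<longleftrightarrow> ro' (f v) = 0"
 shows "(circ V ro :: ('a \<times> 'b::euclidean_space) set) homeomorphic (circ V' ro' :: ('c \<times> 'b) set)"
proof (rule homeomorphic_compact)
 let ?F = "%x::'a \<times> 'b. (f (fst x), ro' (f (fst x)) *\<^sub>R sgn (snd x))"
 have fst: "continuous_on (circ V ro) (fst :: 'a \<times> 'b => 'a)" "fst ` circ V ro \<subseteq> V"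
  by (auto intro!: continuous_intros simp: circ_def)
 have cf: "continuous_on (circ V ro) (%x::'a \<times> 'b. f (fst x))"
  by (rule continuous_on_compose2[OF f(1) fst])
 show "compact (circ V ro :: ('a \<times> 'b) set)" using compact_circ V ro by blast
 show "continuous_on (circ V ro) ?F"
 proof (intro continuous_on_Pair cf continuous_on_scaleR_sgn)
  show "continuous_on (circ V ro) (%x::'a \<times> 'b. ro' (f (fst x)))"
   by (rule continuous_on_compose2[OF ro'(1) cf]) (use f in \<open>auto simp: circ_def\<close>)
  show "continuous_on (circ V ro) (snd :: 'a \<times> 'b => 'b)" by (intro continuous_intros)
  show "ro' (f (fst x)) = 0" if "x \<in> circ V ro" "snd x = 0" for x :: "'a \<times> 'b"
   using that z by (auto simp: circ_def)
 qed
 show "?F ` circ V ro = circ V' ro'"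
 proof (intro equalityI subsetI)
  fix y assume "y \<in> ?F ` circ V ro"
  then obtain v u where vu: "v \<in> V" "norm u = ro v" "y = ?F (v,u)" by (auto simp: circ_def)
  have "f v \<in> V'" using vu f by auto
  then have "0 <= ro' (f v)" using ro' by auto
  moreover have "u = 0 ==> ro' (f v) = 0" using z vu by auto
  ultimately show "y \<in> circ V' ro'"
   using vu \<open>f v \<in> V'\<close> by (cases "u = 0") (auto simp: circ_def norm_sgn)
 next
  fix y :: "'c \<times> 'b" assume "y \<in> circ V' ro'"
  then obtain v u where vu: "v \<in> V" "norm u = ro' (f v)" "y = (f v,u)"
   using f by (auto simp: circ_def)
  have "(v, ro v *\<^sub>R sgn u) \<in> circ V ro"
   using vu z ro by (cases "u = 0") (auto simp: circ_def norm_sgn)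
  moreover have "y = ?F (v, ro v *\<^sub>R sgn u)"
  proof (cases "u = 0")
   case True
   then show ?thesis using vu by simp
  next
   case False
   then have "0 < ro v" using vu z ro(2)[OF vu(1)] by (metis norm_eq_zero order_le_less)
   then have "sgn (ro v *\<^sub>R sgn u) = sgn u"
    using False by (simp add: sgn_scaleR sgn_div_norm[of "sgn u"] norm_sgn)
   moreover have "norm u *\<^sub>R sgn u = u" using False by (simp add: sgn_div_norm)
   ultimately show ?thesis using vu by simp
  qed
  ultimately show "y \<in> ?F ` circ V ro" by blast
 qed
 show "inj_on ?F (circ V ro)"
 proof (rule inj_onI)
  fix x y :: "'a \<times> 'b" assume x: "x \<in> circ V ro" and y: "y \<in> circ V ro" and eq: "?F x = ?F y"
  obtain v u where xx: "x = (v,u)" "v \<in> V" "norm u = ro v" using x by (auto simp: circ_def)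
  obtain w t where yy: "y = (w,t)" "w \<in> V" "norm t = ro w" using y by (auto simp: circ_def)
  have vw: "v = w" using eq xx yy f by (auto dest: inj_onD)
  then have nn: "norm u = norm t" using xx yy by simp
  show "x = y"
  proof (cases "u = 0")
   case True then show ?thesis using nn vw xx yy by simp
  next
   case False
   then have "ro' (f v) ~= 0" using z xx by (metis norm_eq_zero)
   then have "sgn u = sgn t" using eq vw xx yy by auto
   moreover have "t ~= 0" using False nn by auto
   then have "norm u *\<^sub>R sgn u = u" "norm t *\<^sub>R sgn t = t"
    using False by (simp_all add: sgn_div_norm)
   ultimately show ?thesis using nn vw xx yy by metis
  qed
 qed
qed

text \<open>The collapsed circle bundle over the double of \<open>V\<close>: the two copies of \<open>V\<close> are glued where
 \<open>i\<close> vanishes, the circles collapse where \<open>ro\<close> vanishes.\<close>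

definition dbl :: "'a set => ('a => real) => ('a => real) => (('a \<times> real) \<times> complex) set" where
 "dbl V i ro = circ (circ V i) (%(v, s). ro v)"

lemma dbl_iff: "((v, s), u) \<in> dbl V i ro \<longleftrightarrow> v \<in> V & \<bar>s\<bar> = i v & norm u = ro v"
 by (auto simp: dbl_def circ_def)

lemma compact_dbl:
 fixes V :: "'a::t2_space set"
 assumes "compact V" "continuous_on V i" "!!v. v \<in> V ==> 0 <= i v"
  and "continuous_on V ro" "!!v. v \<in> V ==> 0 <= ro v"
 shows "compact (dbl V i ro)"
 unfolding dbl_def case_prod_unfold
proof (intro compact_circ)
 show "continuous_on (circ V i) (%p::'a \<times> real. ro (fst p))"
  by (intro continuous_on_compose2[OF assms(4)] continuous_intros) (auto simp: circ_def)
qed (use assms in \<open>auto simp: circ_def\<close>)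

lemma dbl_reparam:
 fixes V :: "'a::t2_space set" and V' :: "'c::t2_space set"
 assumes V: "compact V" and f: "continuous_on V f" "inj_on f V" "f ` V = V'"
  and i: "continuous_on V i" "!!v. v \<in> V ==> 0 <= i v"
  and i': "continuous_on V' i'" "!!v. v \<in> V' ==> 0 <= i' v"
  and ro: "continuous_on V ro" "!!v. v \<in> V ==> 0 <= ro v"
  and ro': "continuous_on V' ro'" "!!v. v \<in> V' ==> 0 <= ro' v"
  and zi: "!!v. v \<in> V ==> i v = 0 \<longleftrightarrow> i' (f v) = 0"
  and zr: "!!v. v \<in> V ==> ro v = 0 \<longleftrightarrow> ro' (f v) = 0"
 shows "dbl V i ro homeomorphic dbl V' i' ro'"
proof -
 let ?F = "%x::'a \<times> real. (f (fst x), i' (f (fst x)) *\<^sub>R sgn (snd x))"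
 have fst: "continuous_on (circ V i) (fst :: 'a \<times> real => 'a)" "fst ` circ V i \<subseteq> V"
  by (auto intro!: continuous_intros simp: circ_def)
 have fV: "f v \<in> V'" if "v \<in> V" for v using that f by auto
 have cf: "continuous_on (circ V i) (%x::'a \<times> real. f (fst x))"
  by (rule continuous_on_compose2[OF f(1) fst])
 have c: "continuous_on (circ V i) ?F"
 proof (intro continuous_on_Pair cf continuous_on_scaleR_sgn)
  show "continuous_on (circ V i) (%x::'a \<times> real. i' (f (fst x)))"
   by (rule continuous_on_compose2[OF i'(1) cf]) (use f in \<open>auto simp: circ_def\<close>)
  show "continuous_on (circ V i) (snd :: 'a \<times> real => real)" by (intro continuous_intros)
  show "i' (f (fst x)) = 0" if "x \<in> circ V i" "snd x = 0" for x :: "'a \<times> real"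
   using that zi by (auto simp: circ_def)
 qed
 have inj: "inj_on ?F (circ V i)"
 proof (rule inj_onI)
  fix x y :: "'a \<times> real" assume x: "x \<in> circ V i" and y: "y \<in> circ V i" and eq: "?F x = ?F y"
  obtain v u where xx: "x = (v,u)" "v \<in> V" "\<bar>u\<bar> = i v" using x by (auto simp: circ_def)
  obtain w t where yy: "y = (w,t)" "w \<in> V" "\<bar>t\<bar> = i w" using y by (auto simp: circ_def)
  have vw: "v = w" using eq xx yy f by (auto dest: inj_onD)
  have "i v = 0 | sgn u = sgn t" using eq vw xx yy zi by auto
  then show "x = y" using xx yy vw by (auto simp: sgn_if split: if_splits)
 qed
 have im: "?F ` circ V i = circ V' i'"
 proof (intro equalityI subsetI)
  fix y assume "y \<in> ?F ` circ V i"
  then obtain v u where vu: "v \<in> V" "\<bar>u\<bar> = i v" "y = ?F (v,u)" by (auto simp: circ_def)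
  have "0 <= i' (f v)" "u = 0 ==> i' (f v) = 0" using fV vu i' zi by auto
  then show "y \<in> circ V' i'"
   using vu fV by (cases "u = 0") (auto simp: circ_def sgn_if)
 next
  fix y :: "'c \<times> real" assume "y \<in> circ V' i'"
  then obtain v u where vu: "v \<in> V" "\<bar>u\<bar> = i' (f v)" "y = (f v,u)"
   using f by (auto simp: circ_def)
  have a: "(v, i v * sgn u) \<in> circ V i"
   using vu zi i by (cases "u = 0") (auto simp: circ_def abs_mult abs_sgn_eq)
  have "u ~= 0 ==> 0 < i v" using vu zi i(2)[OF vu(1)] by (smt (verit))
  then have "y = ?F (v, i v * sgn u)"
   using vu by (cases "u = 0") (auto simp: sgn_mult sgn_if split: if_splits)
  with a show "y \<in> ?F ` circ V i" by blast
 qed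
 have cr: "continuous_on (circ V i :: ('a \<times> real) set) (%p. ro (fst p))"
  by (intro continuous_on_compose2[OF ro(1)] continuous_intros) (auto simp: circ_def)
 have cr': "continuous_on (circ V' i' :: ('c \<times> real) set) (%p. ro' (fst p))"
  by (intro continuous_on_compose2[OF ro'(1)] continuous_intros) (auto simp: circ_def)
 show ?thesis
  unfolding dbl_def case_prod_unfold
 proof (rule circ_reparam[where f = ?F])
  show "compact (circ V i :: ('a \<times> real) set)" using compact_circ V i by blast
  show "ro (fst p) = 0 \<longleftrightarrow> ro' (fst (?F p)) = 0" if "p \<in> circ V i" for p
   using that zr by (auto simp: circ_def)
 qed (use c inj im cr cr' ro ro' in \<open>auto simp: circ_def\<close>)
qed

section \<open>Models over the closed disc\<close>

lemma continuous_on_mult_bounded: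
 fixes \<phi> \<psi> :: "'a::t2_space => real"
 assumes \<phi>: "continuous_on S \<phi>" and \<psi>: "continuous_on {x \<in> S. \<phi> x ~= 0} \<psi>"
  and B: "!!x. x \<in> S ==> \<bar>\<psi> x\<bar> <= B"
 shows "continuous_on S (%x. \<phi> x*\<psi> x)"
 unfolding continuous_on_def
proof
 fix x assume x: "x \<in> S"
 have l\<phi>: "(\<phi> \<longlongrightarrow> \<phi> x) (at x within S)" using \<phi> x unfolding continuous_on_def by auto
 show "((%x. \<phi> x*\<psi> x) \<longlongrightarrow> \<phi> x*\<psi> x) (at x within S)"
 proof (cases "\<phi> x = 0")
  case False
  have o: "openin (top_of_set S) {x \<in> S. \<phi> x ~= 0}"
  proof -
   have "{x \<in> S. \<phi> x ~= 0} = S \<inter> \<phi> -` (- {0})" by auto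
   then show ?thesis
    using continuous_openin_preimage_gen[OF \<phi> open_Compl[OF closed_singleton[of 0]]] by simp
  qed
  then obtain T where T: "open T" "{x \<in> S. \<phi> x ~= 0} = S \<inter> T" by (meson openin_open)
  have "(\<psi> \<longlongrightarrow> \<psi> x) (at x within S \<inter> T)"
   using \<psi> x False T unfolding continuous_on_def by auto
  moreover have "x \<in> T" using T False x by blast
  ultimately have "(\<psi> \<longlongrightarrow> \<psi> x) (at x within S)"
   using at_within_nhd[of x T "S \<inter> T" S] T(1) by auto
  then show ?thesis using l\<phi> by (intro tendsto_intros)
 next
  case True
  then have "((%x. \<bar>\<phi> x\<bar>*B) \<longlongrightarrow> 0) (at x within S)"
   using tendsto_mult[OF tendsto_rabs[OF l\<phi>] tendsto_const[of B]] by simp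
  moreover have "\<forall>\<^sub>F y in at x within S. norm (\<phi> y*\<psi> y) <= \<bar>\<phi> y\<bar>*B"
   unfolding eventually_at_filter
   by (rule always_eventually) (auto simp: abs_mult intro!: mult_left_mono B)
  ultimately have "((%x. \<phi> x*\<psi> x) \<longlongrightarrow> 0) (at x within S)"
   by (rule Lim_null_comparison[rotated])
  then show ?thesis using True by simp
 qed
qed

text \<open>\<open>sim p a b P c d\<close>: an increasing homeomorphism from \<open>{a..b}\<close> to \<open>{c..d}\<close> takes the signs of \<open>p\<close> to
 the signs of \<open>P\<close>.\<close>

definition sim :: "(real => real) => real => real => (real => real) => real => real => bool" where
 "sim p a b P c d \<longleftrightarrow> (EX \<xi>. continuous_on {a..b} \<xi> & strict_mono_on {a..b} \<xi> & \<xi> a = c & \<xi> b = d &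
  (\<forall>x\<in>{a..b}. sgn (p x) = sgn (P (\<xi> x))))"

lemma sim_const:
 assumes "a < b" "c < d" "sgn (p a) = sgn (P c)" "sgn (p b) = sgn (P d)"
  and "!!x. a < x ==> x < b ==> sgn (p x) = s" "!!x. c < x ==> x < d ==> sgn (P x) = s"
 shows "sim p a b P c d"
proof -
 define \<xi> where "\<xi> x = c + (d - c)/(b - a)*(x - a)" for x
 have m: "\<xi> x < \<xi> y" if "x < y" for x y
 proof -
  have "(d - c)/(b - a)*(x - a) < (d - c)/(b - a)*(y - a)"
   using that assms by (intro mult_strict_left_mono) auto
  then show ?thesis by (simp add: \<xi>_def)
 qed
 have e: "\<xi> a = c" "\<xi> b = d" using assms by (auto simp: \<xi>_def)
 have "sgn (p x) = sgn (P (\<xi> x))" if x: "x \<in> {a..b}" for x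
 proof -
  consider "x = a" | "x = b" | "a < x" "x < b" using x by (metis atLeastAtMost_iff order_le_less)
  then show ?thesis using assms e m[of a x] m[of x b] by cases auto
 qed
 moreover have "continuous_on {a..b} \<xi>" unfolding \<xi>_def by (intro continuous_intros)
 ultimately show ?thesis unfolding sim_def using e m by (auto simp: strict_mono_on_def intro!: exI[of _ \<xi>])
qed

lemma sim_glue:
 assumes "a <= b" "b <= b'" "sim p a b P c d" "sim p b b' P d d'"
 shows "sim p a b' P c d'"
proof -
 obtain \<xi> where x: "continuous_on {a..b} \<xi>" "strict_mono_on {a..b} \<xi>" "\<xi> a = c" "\<xi> b = d"
  "\<forall>x\<in>{a..b}. sgn (p x) = sgn (P (\<xi> x))" using assms(3) sim_def by auto
 obtain \<eta> where y: "continuous_on {b..b'} \<eta>" "strict_mono_on {b..b'} \<eta>" "\<eta> b = d" "\<eta> b' = d'"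
  "\<forall>x\<in>{b..b'}. sgn (p x) = sgn (P (\<eta> x))" using assms(4) sim_def by auto
 let ?z = "%x. if x <= b then \<xi> x else \<eta> x"
 have "continuous_on ({a..b} \<union> {b..b'}) ?z"
  by (rule continuous_on_cases) (use x y in auto)
 then have "continuous_on {a..b'} ?z" using assms by (simp add: ivl_disj_un_two_touch)
 moreover have "strict_mono_on {a..b'} ?z"
 proof (rule strict_mono_onI)
  fix r s assume rs: "r \<in> {a..b'}" "s \<in> {a..b'}" "r < s"
  consider "s <= b" | "b < r" | "r <= b" "b < s" by linarith
  then show "?z r < ?z s"
  proof cases
   case 1 then show ?thesis using rs x(2) by (auto simp: strict_mono_on_def)
  next
   case 2 then show ?thesis using rs y(2) by (auto simp: strict_mono_on_def)
  next
   case 3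
   have "\<xi> r <= \<xi> b" using strict_mono_onD[OF x(2), of r b] rs 3 assms(1) by (cases "r = b") auto
   moreover have "\<eta> b < \<eta> s" using rs 3 y(2) by (auto simp: strict_mono_on_def)
   ultimately show ?thesis using 3 x y by auto
  qed
 qed
 moreover have "?z a = c" "?z b' = d'" using x y assms by auto
 moreover have "\<forall>t\<in>{a..b'}. sgn (p t) = sgn (P (?z t))" using x y by auto
 ultimately show ?thesis unfolding sim_def by blast
qed

lemma mono_image_Icc:
 fixes \<xi> :: "real => real"
 assumes "a <= b" "continuous_on {a..b} \<xi>" "strict_mono_on {a..b} \<xi>"
 shows "\<xi> ` {a..b} = {\<xi> a..\<xi> b}"
proof (intro equalityI subsetI)
 fix y assume "y \<in> \<xi> ` {a..b}"
 then show "y \<in> {\<xi> a..\<xi> b}"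
  using assms strict_mono_on_leD by fastforce
next
 fix y assume "y \<in> {\<xi> a..\<xi> b}"
 then show "y \<in> \<xi> ` {a..b}" using IVT'[of \<xi> a y b] assms by auto
qed

text \<open>The closed unit disc, as pairs of reals.\<close>
definition disc :: "(real \<times> real) set" where "disc = {(x, h). x^2 + h^2 <= 1}"

text \<open>The model with pattern \<open>P\<close>: of the boundary points \<open>(x, h)\<close> of the disc, those with \<open>P x \<ge> 0\<close> form
 the part along which the two copies of the disc are glued, and over those with \<open>P x <= 0\<close> the
 circles collapse.\<close>

definition Mod :: "(real => real) => (((real \<times> real) \<times> real) \<times> complex) set" where
 "Mod P = dbl disc (%(x, h). 1 - x^2 - h^2 + max 0 (- P x)) (%(x, h). 1 - x^2 - h^2 + max 0 (P x))"

lemma disc_eq: "disc = (%z. (Re z, Im z)) ` cball 0 1"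
proof (intro equalityI subsetI)
 fix v assume "v \<in> disc"
 then have "v = (Re (Complex (fst v) (snd v)), Im (Complex (fst v) (snd v)))"
  "Complex (fst v) (snd v) \<in> cball 0 1" by (auto simp: disc_def cmod_def)
 then show "v \<in> (%z. (Re z, Im z)) ` cball 0 1" by blast
qed (auto simp: disc_def cmod_def)

lemma compact_disc: "compact disc"
 unfolding disc_eq by (intro compact_continuous_image continuous_intros compact_cball)

lemma disc_abs: "(x, h) \<in> disc ==> \<bar>x\<bar> <= 1 & \<bar>h\<bar> <= sqrt (1 - x^2)"
proof -
 assume "(x, h) \<in> disc"
 then have "x^2 + h^2 <= 1" by (auto simp: disc_def)
 then have "h^2 <= 1 - x^2" "x^2 <= 1" using zero_le_power2[of h] by (linarith, linarith)
 then show ?thesis using abs_square_le_1 real_sqrt_le_iff[of "h^2" "1 - x^2"] by auto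
qed

lemma continuous_on_disc_Mod:
 assumes "continuous_on {-1..1} P"
 shows "continuous_on disc (%(x, h). 1 - x^2 - h^2 + max 0 (- P x))"
  "continuous_on disc (%(x, h). 1 - x^2 - h^2 + max 0 (P x))"
proof -
 have c: "continuous_on disc (%v. P (fst v))"
  using disc_abs by (auto intro!: continuous_on_compose2[OF assms] continuous_intros simp: abs_le_iff)
 show "continuous_on disc (%(x, h). 1 - x^2 - h^2 + max 0 (- P x))"
  "continuous_on disc (%(x, h). 1 - x^2 - h^2 + max 0 (P x))"
  unfolding case_prod_unfold by (intro continuous_intros c)+
qed

lemma disc_Mod_nonneg: "v \<in> disc ==> 0 <= (case v of (x, h) => 1 - x^2 - h^2 + max 0 (P x))"
 by (auto simp: disc_def max_def)

lemma Mod_reparam: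
 fixes V :: "'a::t2_space set"
 assumes "compact V" and f: "continuous_on V f" "inj_on f V" "f ` V = disc"
  and i: "continuous_on V i" "!!v. v \<in> V ==> 0 <= i v"
  and ro: "continuous_on V ro" "!!v. v \<in> V ==> 0 <= ro v"
  and P: "continuous_on {-1..1} P"
  and zi: "!!v x h. v \<in> V ==> f v = (x, h) ==> i v = 0 \<longleftrightarrow> x^2 + h^2 = 1 & 0 <= P x"
  and zr: "!!v x h. v \<in> V ==> f v = (x, h) ==> ro v = 0 \<longleftrightarrow> x^2 + h^2 = 1 & P x <= 0"
 shows "dbl V i ro homeomorphic Mod P"
 unfolding Mod_def
proof (rule dbl_reparam[OF assms(1) f i _ _ ro])
 fix v assume v: "v \<in> V"
 obtain x h where xh: "f v = (x,h)" by (cases "f v")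
 then have "(x,h) \<in> disc" using f(3) v by (metis imageI)
 then have d: "x^2 + h^2 <= 1" by (auto simp: disc_def)
 show "(i v = 0) = ((case f v of (x, h) => 1 - x^2 - h^2 + max 0 (- P x)) = 0)"
  using zi[OF v xh] d xh by (auto simp: max_def)
 show "(ro v = 0) = ((case f v of (x, h) => 1 - x^2 - h^2 + max 0 (P x)) = 0)"
  using zr[OF v xh] d xh by (auto simp: max_def)
qed (use continuous_on_disc_Mod[OF P] disc_Mod_nonneg in \<open>auto\<close>)

lemma compact_lens:
 fixes a b :: real and \<beta> :: "real => real"
 assumes "continuous_on {a..b} \<beta>"
 shows "compact {(x, h). a <= x & x <= b & \<bar>h\<bar> <= \<beta> x}" (is "compact ?V")
proof -
 have "?V = (%(x,t). (x, t*\<beta> x)) ` {(x,t). x \<in> {a..b} & t \<in> {-1..1} & 0 <= \<beta> x}"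
 proof (intro equalityI subsetI)
  fix v assume "v \<in> ?V"
  then obtain x h where v: "v = (x,h)" "a <= x" "x <= b" "\<bar>h\<bar> <= \<beta> x" by auto
  then have v': "v = (%(x,t). (x, t*\<beta> x)) (x, h/\<beta> x)" "0 <= \<beta> x" "\<bar>h/\<beta> x\<bar> <= 1"
   by (auto simp: divide_simps)
  then have "-1 <= h/\<beta> x" "h/\<beta> x <= 1" by (simp_all only: abs_le_iff) auto
  then show "v \<in> (%(x,t). (x, t*\<beta> x)) ` {(x,t). x \<in> {a..b} & t \<in> {-1..1} & 0 <= \<beta> x}"
   using v v' by (intro image_eqI[where x = "(x, h/\<beta> x)"]) auto
 next
  fix v assume "v \<in> (%(x,t). (x, t*\<beta> x)) ` {(x,t). x \<in> {a..b} & t \<in> {-1..1} & 0 <= \<beta> x}"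
  then obtain x t where v: "v = (x, t*\<beta> x)" "x \<in> {a..b}" "\<bar>t\<bar> <= 1" "0 <= \<beta> x" by force
  then show "v \<in> ?V" using mult_left_le_one_le[of "\<beta> x" "\<bar>t\<bar>"] by (auto simp: abs_mult)
 qed
 moreover have "compact {(x,t). x \<in> {a..b} & t \<in> {-1..1::real} & 0 <= \<beta> x}"
 proof -
  have "closed ({a..b} \<inter> \<beta> -` {0..})"
   by (intro continuous_closed_preimage[OF assms] closed_atLeastAtMost closed_atLeast)
  then have "compact ({a..b} \<inter> ({a..b} \<inter> \<beta> -` {0..}))" by (intro compact_Int_closed) auto
  then have "compact (({a..b} \<inter> ({a..b} \<inter> \<beta> -` {0..})) \<times> {-1..1::real})"
   by (intro compact_Times) auto
  moreover have "{(x,t). x \<in> {a..b} & t \<in> {-1..1::real} & 0 <= \<beta> x} = ({a..b} \<inter> ({a..b} \<inter> \<beta> -` {0..})) \<times> {-1..1::real}"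
   by auto
  ultimately show ?thesis by simp
 qed
 then have "compact ((%(x,t). (x, t*\<beta> x)) ` {(x,t). x \<in> {a..b} & t \<in> {-1..1::real} & 0 <= \<beta> x})"
  by (rule compact_continuous_image[rotated])
   (auto simp: case_prod_unfold intro!: continuous_intros continuous_on_compose2[OF assms])
 ultimately show ?thesis by simp
qed

lemma lens_disc:
 fixes \<beta> \<xi> :: "real => real"
 assumes ab: "a < b" and \<beta>: "continuous_on {a..b} \<beta>" "!!x. a < x ==> x < b ==> 0 < \<beta> x" "\<beta> a = 0" "\<beta> b = 0"
  and V: "V = {(x, h). a <= x & x <= b & \<bar>h\<bar> <= \<beta> x}"
  and \<xi>: "continuous_on {a..b} \<xi>" "strict_mono_on {a..b} \<xi>" "\<xi> a = -1" "\<xi> b = 1"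
  and f: "f = (%v. (\<xi> (fst v), sqrt (1 - (\<xi> (fst v))^2)*(snd v/\<beta> (fst v))))"
 shows "continuous_on V f" "inj_on f V" "f ` V = disc"
  "!!x h X H. (x, h) \<in> V ==> f (x, h) = (X, H) ==> X^2 + H^2 = 1 \<longleftrightarrow> \<bar>h\<bar> = \<beta> x"
proof -
 have im: "\<xi> ` {a..b} = {-1..1}" using mono_image_Icc[OF _ \<xi>(1,2)] ab \<xi> by auto
 have inj: "x = y" if "x \<in> {a..b}" "y \<in> {a..b}" "\<xi> x = \<xi> y" for x y
  using that \<xi>(2) by (meson inj_onD strict_mono_on_imp_inj_on)
 have sq: "(\<xi> x)^2 <= 1" if "a <= x" "x <= b" for x
 proof -
  have "\<xi> x \<in> {-1..1}" using that im by (metis atLeastAtMost_iff imageI)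
  then show ?thesis by (auto simp: abs_square_le_1)
 qed
 have sql: "(\<xi> x)^2 < 1" if "a < x" "x < b" for x
  using that strict_mono_onD[OF \<xi>(2), of a x] strict_mono_onD[OF \<xi>(2), of x b] \<xi>
  by (auto simp: abs_square_less_1)
 have Vx: "fst v \<in> {a..b}" if "v \<in> V" for v using that V by auto
 have \<xi>f: "continuous_on V (%v. \<xi> (fst v))"
  using Vx by (auto intro!: continuous_on_compose2[OF \<xi>(1)] continuous_intros)
 have be: "0 < \<beta> x | (x = a | x = b)" if "a <= x" "x <= b" for x using that \<beta> by force
 have b1: "\<bar>snd v/\<beta> (fst v)\<bar> <= 1" if "v \<in> V" for v
  using that be[of "fst v"] \<beta> V by (auto simp: divide_simps)
 have fc: "continuous_on V f" unfolding f
 proof (intro continuous_on_Pair \<xi>f continuous_on_mult_bounded[OF _ _ b1])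
  have s: "{v \<in> V. sqrt (1 - (\<xi> (fst v))^2) ~= 0} \<subseteq> {v \<in> V. \<beta> (fst v) ~= 0}"
   using be V \<xi> by auto (metis \<xi>(3,4) less_irrefl power2_minus power_one)
  show "continuous_on {v \<in> V. sqrt (1 - (\<xi> (fst v))^2) ~= 0} (%v. snd v/\<beta> (fst v))"
   by (rule continuous_on_subset[OF _ s])
    (use Vx in \<open>auto intro!: continuous_intros continuous_on_compose2[OF \<beta>(1)]\<close>)
 qed (intro continuous_intros \<xi>f)
 have H2: "(sqrt (1 - (\<xi> x)^2)*(h/\<beta> x))^2 = (1 - (\<xi> x)^2)*(h/\<beta> x)^2" if "a <= x" "x <= b" for x h
  using sq[OF that] by (simp only: power_mult_distrib real_sqrt_pow2 diff_ge_0_iff_ge)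
 have fV: "f ` V = disc"
 proof (intro equalityI subsetI)
  fix w assume "w \<in> f ` V"
  then obtain x h where v: "(x,h) \<in> V" "w = f (x,h)" by auto
  then have x: "a <= x" "x <= b" using V by auto
  have "(h/\<beta> x)^2 <= 1" using b1[OF v(1)] by (simp add: abs_square_le_1)
  then have "(1 - (\<xi> x)^2)*(h/\<beta> x)^2 <= 1 - (\<xi> x)^2"
   using sq[OF x] by (intro mult_left_le) auto
  then show "w \<in> disc" using v H2[OF x] by (auto simp: f disc_def)
 next
  fix w assume "w \<in> disc"
  then obtain X H where w: "w = (X,H)" "(X,H) \<in> disc" by (cases w) auto
  have X: "\<bar>X\<bar> <= 1" "\<bar>H\<bar> <= sqrt (1 - X^2)" using disc_abs[OF w(2)] by auto
  then obtain x where x: "x \<in> {a..b}" "\<xi> x = X" using im by (metis abs_le_iff atLeastAtMost_iff imageE minus_le_iff)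
  define h where "h = \<beta> x*(H/sqrt (1 - X^2))"
  have b0: "0 <= \<beta> x" using be[of x] x \<beta> by force
  have "\<bar>H/sqrt (1 - X^2)\<bar> <= 1" using X by (auto simp: divide_simps)
  then have "\<bar>h\<bar> <= \<beta> x" using mult_left_le[OF _ b0] b0 by (simp only: h_def abs_mult abs_of_nonneg)
  then have "(x,h) \<in> V" using V x by auto
  moreover have "f (x,h) = w"
  proof (cases "x = a | x = b")
   case True
   then have "X^2 = 1" using x \<xi> by auto
   then show ?thesis using X x w by (auto simp: f h_def)
  next
   case False
   then have "a < x" "x < b" using x by auto
   then have "0 < \<beta> x" "X^2 < 1" using \<beta> sql x by auto
   then show ?thesis using x w by (auto simp: f h_def)
  qed
  ultimately show "w \<in> f ` V" by blast
 qed
 have fi: "inj_on f V"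
 proof (rule inj_onI)
  fix v w assume vw: "v \<in> V" "w \<in> V" "f v = f w"
  then have e: "fst v = fst w" using inj Vx by (auto simp: f)
  show "v = w"
  proof (cases "fst v = a | fst v = b")
   case True
   then show ?thesis using e vw V \<beta> by (auto simp: prod_eq_iff)
  next
   case False
   then have s: "a < fst v" "fst v < b" using Vx[OF vw(1)] by auto
   show ?thesis using vw(3) \<beta>(2)[OF s] sql[OF s] e by (auto simp: f prod_eq_iff)
  qed
 qed
 have bd: "1 - (\<xi> x)^2 - (sqrt (1 - (\<xi> x)^2)*(h/\<beta> x))^2 \<ge> 0 &
  (1 - (\<xi> x)^2 - (sqrt (1 - (\<xi> x)^2)*(h/\<beta> x))^2 = 0 \<longleftrightarrow> \<bar>h\<bar> = \<beta> x)" if v: "(x,h) \<in> V" for x h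
 proof -
  have x: "a <= x" "x <= b" "\<bar>h\<bar> <= \<beta> x" using v V by auto
  have e: "1 - (\<xi> x)^2 - (sqrt (1 - (\<xi> x)^2)*(h/\<beta> x))^2 = (1 - (\<xi> x)^2)*(1 - (h/\<beta> x)^2)"
   using H2[OF x(1,2)] by (simp add: algebra_simps)
  show ?thesis
  proof (cases "x = a | x = b")
   case True
   then show ?thesis using x \<xi> \<beta> by auto
  next
   case False
   then have s: "a < x" "x < b" using x by auto
   have "(h/\<beta> x)^2 <= 1" using b1[OF v] by (simp add: abs_square_le_1)
   moreover have "(h/\<beta> x)^2 = 1 \<longleftrightarrow> \<bar>h/\<beta> x\<bar> = 1"
    by (metis abs_square_eq_1)
   moreover have "\<bar>h/\<beta> x\<bar> = 1 \<longleftrightarrow> \<bar>h\<bar> = \<beta> x"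
    using \<beta>(2)[OF s] by (auto simp: abs_divide)
   ultimately show ?thesis unfolding e using sql[OF s] by auto
  qed
 qed
 show "continuous_on V f" "inj_on f V" "f ` V = disc" by (fact fc fi fV)+
 show "X^2 + H^2 = 1 \<longleftrightarrow> \<bar>h\<bar> = \<beta> x" if "(x, h) \<in> V" "f (x, h) = (X, H)" for x h X H
  using bd[OF that(1)] that(2) by (auto simp: f)
qed

text \<open>The double of a lens, glued along the boundary arcs where \<open>p \<ge> 0\<close> and with circles collapsed over those
 where \<open>p <= 0\<close>, is determined by the signs of \<open>p\<close>.\<close>
lemma lens_homeomorphic_Mod:
 fixes i ro :: "real \<times> real => real"
 assumes ab: "a < b" and \<beta>: "continuous_on {a..b} \<beta>" "!!x. a < x ==> x < b ==> 0 < \<beta> x" "\<beta> a = 0" "\<beta> b = 0"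
  and V: "V = {(x, h). a <= x & x <= b & \<bar>h\<bar> <= \<beta> x}"
  and i: "continuous_on V i" "!!v. v \<in> V ==> 0 <= i v"
  and ro: "continuous_on V ro" "!!v. v \<in> V ==> 0 <= ro v"
  and zi: "!!x h. (x, h) \<in> V ==> i (x, h) = 0 \<longleftrightarrow> \<bar>h\<bar> = \<beta> x & 0 <= p x"
  and zr: "!!x h. (x, h) \<in> V ==> ro (x, h) = 0 \<longleftrightarrow> \<bar>h\<bar> = \<beta> x & p x <= 0"
  and P: "continuous_on {-1..1} P" and sim: "sim p a b P (-1) 1"
 shows "dbl V i ro homeomorphic Mod P"
proof -
 obtain \<xi> where \<xi>: "continuous_on {a..b} \<xi>" "strict_mono_on {a..b} \<xi>" "\<xi> a = -1" "\<xi> b = 1"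
  "!!x. x\<in>{a..b} ==> sgn (p x) = sgn (P (\<xi> x))" using sim sim_def by auto
 define f where "f v = (\<xi> (fst v), sqrt (1 - (\<xi> (fst v))^2)*(snd v/\<beta> (fst v)))" for v
 note f = lens_disc[OF ab \<beta> V \<xi>(1-4) f_def[abs_def, THEN meta_eq_to_obj_eq]]
 show ?thesis
 proof (rule Mod_reparam[OF _ f(1-3) i ro P])
  show "compact V" unfolding V by (rule compact_lens[OF \<beta>(1)])
  fix v x h assume v: "v \<in> V" "f v = (x,h)"
  obtain x0 h0 where vv: "v = (x0,h0)" by (cases v)
  have s: "sgn (p x0) = sgn (P x)" using \<xi>(5)[of x0] V v vv by (auto simp: f_def)
  then have ss: "0 <= p x0 \<longleftrightarrow> 0 <= P x" "p x0 <= 0 \<longleftrightarrow> P x <= 0"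
   by (metis sgn_less not_less)+ (metis sgn_greater not_less s)
  show "(i v = 0) = (x^2 + h^2 = 1 & 0 <= P x)"
   using zi[of x0 h0] v vv ss f(4)[of x0 h0 x h] by auto
  show "(ro v = 0) = (x^2 + h^2 = 1 & P x <= 0)"
   using zr[of x0 h0] v vv ss f(4)[of x0 h0 x h] by auto
 qed
qed

section \<open>The model manifolds\<close>

lemma homeomorphic_space_top_of_set:
 assumes "S homeomorphic T"
 shows "top_of_set S homeomorphic_space top_of_set T"
proof -
 obtain f g where "homeomorphism S T f g" using assms homeomorphic_def by blast
 then have "homeomorphic_maps (top_of_set S) (top_of_set T) f g"
  unfolding homeomorphism_def homeomorphic_maps_def by (auto simp: continuous_map_in_subtopology)
 then show ?thesis unfolding homeomorphic_space_def by blast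
qed

lemma continuous_map_sum_topology:
 assumes "!!j. j \<in> I ==> continuous_map (X j) Y (%x. f (j, x))"
 shows "continuous_map (sum_topology X I) Y f"
 unfolding continuous_map_def
proof (intro conjI funcsetI allI impI)
 show "f x \<in> topspace Y" if "x \<in> topspace (sum_topology X I)" for x
  using that assms by (fastforce simp: continuous_map_def)
 fix U assume U: "openin Y U"
 have "openin (X j) {x. (j, x) \<in> topspace (sum_topology X I) & f (j, x) \<in> U}" if j: "j \<in> I" for j
  using openin_continuous_map_preimage[OF assms[OF j] U] j by simp
 then show "openin (sum_topology X I) {x \<in> topspace (sum_topology X I). f x \<in> U}"
  by (auto simp: openin_sum_topology)
qed

lemma compact_space_sum_topology:
 assumes "finite I" "!!j. j \<in> I ==> compact_space (X j)"
 shows "compact_space (sum_topology X I)"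
proof -
 have "topspace (sum_topology X I) = (\<Union>j\<in>I. Pair j ` topspace (X j))" by auto
 moreover have "compactin (sum_topology X I) (Pair j ` topspace (X j))" if "j \<in> I" for j
 proof (rule image_compactin)
  show "compactin (X j) (topspace (X j))" using assms that by (simp add: compact_space_def)
  show "continuous_map (X j) (sum_topology X I) (Pair j)"
   using that by (auto simp: continuous_map_def openin_sum_topology Collect_conj_eq)
 qed
 ultimately show ?thesis
  using assms(1) by (auto simp: compact_space_def intro!: compactin_Union)
qed

text \<open>The coordinates of \<open>real^4\<close>, grouped in pairs.\<close>
definition R4 :: "real^4 => (real \<times> real) \<times> real \<times> real" where
 "R4 v = ((v$1, v$2), (v$3, v$4))"

lemma continuous_on_R4 [continuous_intros]: "continuous_on S R4"
 unfolding R4_def by (intro continuous_intros)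

lemma R4_inj: "R4 v = R4 w \<longleftrightarrow> v = w"
 by (auto simp: R4_def vec_eq_iff forall_4)

lemma R4_surj: "EX v. R4 v = ((a, b), (c, d))"
proof -
 have "R4 (\<chi> j. if j = 1 then a else if j = 2 then b else if j = 3 then c else d) = ((a, b), (c, d))"
  by (auto simp: R4_def)
 then show ?thesis by blast
qed

lemma sphere4: "v \<in> sphere (0::real^4) 1 \<longleftrightarrow> (v$1)^2 + (v$2)^2 + (v$3)^2 + (v$4)^2 = 1"
 by (auto simp: norm_vec_def L2_set_def sum_4)

lemma sphere3: "v \<in> sphere (0::real^3) 1 \<longleftrightarrow> (v$1)^2 + (v$2)^2 + (v$3)^2 = 1"
 by (auto simp: norm_vec_def L2_set_def sum_3)

lemma sphere2: "v \<in> sphere (0::real^2) 1 \<longleftrightarrow> (v$1)^2 + (v$2)^2 = 1"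
 by (auto simp: norm_vec_def L2_set_def sum_2)

lemma disc_sqrt: "(x, h) \<in> disc ==> h^2 <= 1 & \<bar>x\<bar> <= sqrt (1 - h^2)"
 using disc_abs[of h x] by (auto simp: disc_def abs_square_le_1 add.commute)

lemma Mod_S3: "Mod (%x. x) homeomorphic sphere (0::real^4) 1"
proof -
 (* Radii with i^2 + ro^2 = 1 - h^2, so that (h, s, u) runs through the unit sphere. *)
 define r where "r h = sqrt (1 - h^2)" for h :: real
 define i where "i = (%(x, h). sqrt ((r h - x)*r h/2))"
 define ro where "ro = (%(x, h). sqrt ((r h + x)*r h/2))"
 have r: "\<bar>x\<bar> <= r h" "0 <= r h" "(r h)^2 = 1 - h^2" "h^2 <= 1" if "(x,h) \<in> disc" for x h
  using disc_sqrt[OF that] by (auto simp: r_def)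
 have pos: "0 <= (r h - x)*r h" "0 <= (r h + x)*r h" if "(x,h) \<in> disc" for x h
  using r[OF that] by (auto intro!: mult_nonneg_nonneg)
 have ci: "continuous_on disc i" "continuous_on disc ro"
  unfolding i_def ro_def r_def case_prod_unfold by (intro continuous_intros; simp)+
 have bd: "x^2 + h^2 = 1 \<longleftrightarrow> x = r h | x = - r h" if "(x,h) \<in> disc" for x h
  using r[OF that] by (metis add.commute diff_add_cancel eq_diff_eq power2_eq_iff)
 have "dbl disc i ro homeomorphic Mod (%x. x)"
 proof (rule Mod_reparam[OF compact_disc _ _ _ ci(1) _ ci(2), where f = id])
  show "0 <= i v" "0 <= ro v" if "v \<in> disc" for v
   using pos that by (auto simp: i_def ro_def split: prod.splits)
  fix v x h assume v: "v \<in> disc" "id v = (x,h)"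
  then have d: "(x,h) \<in> disc" by auto
  show "(i v = 0) = (x^2 + h^2 = 1 & 0 <= x)" "(ro v = 0) = (x^2 + h^2 = 1 & x <= 0)"
   using bd[OF d] r[OF d] v by (auto simp: i_def ro_def)
 qed auto
 moreover have "dbl disc i ro homeomorphic R4 ` sphere 0 1"
 proof (rule homeomorphic_compact)
  let ?f = "%p::((real \<times> real) \<times> real) \<times> complex. ((snd (fst (fst p)), snd (fst p)), (Re (snd p), Im (snd p)))"
  show "compact (dbl disc i ro)"
   using compact_dbl[OF compact_disc ci(1) _ ci(2)] pos by (auto simp: i_def ro_def split: prod.splits)
  show "continuous_on (dbl disc i ro) ?f" by (intro continuous_intros)
  have sq: "s^2 = (r h - x)*r h/2 & (cmod u)^2 = (r h + x)*r h/2"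
   if "(((x,h),s),u) \<in> dbl disc i ro" for x h s u
  proof -
   have "(x,h) \<in> disc" "\<bar>s\<bar> = i (x,h)" "cmod u = ro (x,h)" using that by (simp_all add: dbl_iff)
   moreover have "s^2 = \<bar>s\<bar>^2" by simp
   ultimately show ?thesis using pos by (simp add: i_def ro_def)
  qed
  show "?f ` dbl disc i ro = R4 ` sphere 0 1"
  proof (intro equalityI subsetI)
   fix y assume "y \<in> ?f ` dbl disc i ro"
   then obtain x h s u where y: "(((x,h),s),u) \<in> dbl disc i ro" "y = ((h,s),(Re u,Im u))" by force
   have d: "(x,h) \<in> disc" using y by (simp add: dbl_iff)
   obtain v where v: "R4 v = y" using R4_surj y by blast
   have "s^2 + (cmod u)^2 = (r h)^2" using sq[OF y(1)] by (simp add: power2_eq_square field_simps)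
   then have "v \<in> sphere 0 1" using v y r[OF d] unfolding sphere4 by (auto simp: R4_def cmod_power2)
   then show "y \<in> R4 ` sphere 0 1" using v by blast
  next
   fix y assume "y \<in> R4 ` sphere 0 1"
   then obtain v where v: "v \<in> sphere 0 1" "y = R4 v" by blast
   define h s u where "h = v$1" and "s = v$2" and "u = Complex (v$3) (v$4)"
   have e: "h^2 + s^2 + (cmod u)^2 = 1" using v(1) unfolding sphere4 by (simp add: h_def s_def u_def cmod_power2)
   have rr: "0 <= r h" "(r h)^2 = s^2 + (cmod u)^2"
   proof -
    have "h^2 <= 1" "1 - h^2 = s^2 + (cmod u)^2"
     using e zero_le_power2[of s] zero_le_power2[of "cmod u"] by linarith+
    then show "0 <= r h" "(r h)^2 = s^2 + (cmod u)^2" unfolding r_def by simp_all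
   qed
   define x where "x = ((cmod u)^2 - s^2)/r h"
   have xr: "x*r h = (cmod u)^2 - s^2"
    using rr by (cases "r h = 0") (auto simp: x_def add_nonneg_eq_0_iff)
   have "\<bar>x\<bar> <= r h"
   proof (cases "r h = 0")
    case False
    then have "0 < r h" using rr by auto
    moreover have "\<bar>x\<bar>*r h <= r h*r h"
    proof -
     have "\<bar>x\<bar>*r h = \<bar>x*r h\<bar>" using rr by (simp add: abs_mult)
     also have "... <= (r h)^2"
      unfolding xr rr using zero_le_power2[of s] zero_le_power2[of "cmod u"] by linarith
     finally show ?thesis by (simp add: power2_eq_square)
    qed
    ultimately show ?thesis by (simp add: mult_le_cancel_right)
   qed (auto simp: x_def)
   then have "x^2 <= (r h)^2" using power_mono[of "\<bar>x\<bar>" "r h" 2] by simp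
   then have d: "(x,h) \<in> disc" using e rr by (auto simp: disc_def)
   have "s^2 = (r h - x)*r h/2" "(cmod u)^2 = (r h + x)*r h/2"
    using xr rr by (simp_all add: algebra_simps power2_eq_square)
   then have "\<bar>s\<bar> = i (x,h)" "cmod u = ro (x,h)"
    unfolding i_def ro_def prod.case by (metis real_sqrt_abs) (metis abs_norm_cancel real_sqrt_abs \<open>(cmod u)^2 = _\<close>)
   then have "(((x,h),s),u) \<in> dbl disc i ro" using d by (simp add: dbl_iff)
   moreover have "y = ?f (((x,h),s),u)" using v by (simp add: R4_def h_def s_def u_def)
   ultimately show "y \<in> ?f ` dbl disc i ro" by blast
  qed
  show "inj_on ?f (dbl disc i ro)"
  proof (rule inj_onI)
   fix p q assume pq: "p \<in> dbl disc i ro" "q \<in> dbl disc i ro" "?f p = ?f q"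
   obtain x h s u where p: "p = (((x,h),s),u)" by (metis surj_pair)
   obtain x' h' s' u' where q: "q = (((x',h'),s'),u')" by (metis surj_pair)
   have e: "h' = h" "s' = s" "u' = u" using pq p q by (auto simp: complex_eq_iff)
   have d: "(x,h) \<in> disc" "(x',h) \<in> disc" using pq p q e by (simp_all add: dbl_iff)
   have "(r h - x)*r h = (r h - x')*r h"
    using sq[of x h s u] sq[of x' h s u] pq p q e by auto
   then have "x = x'" using r[OF d(1)] r[OF d(2)] by auto
   then show "p = q" using p q e by simp
  qed
 qed
 moreover have "sphere (0::real^4) 1 homeomorphic R4 ` sphere 0 1"
  by (rule homeomorphic_compact[OF compact_sphere]) (auto intro!: continuous_intros inj_onI simp: R4_inj)
 ultimately show ?thesis by (meson homeomorphic_sym homeomorphic_trans)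
qed

lemma Mod_two_S3: "top_of_set (Mod (%_. -1)) homeomorphic_space two_S3"
proof -
 define ro where "ro = (%(x, h). sqrt (1 - x^2 - h^2))"
 have d: "x^2 + h^2 <= 1" if "(x,h) \<in> disc" for x h using that by (auto simp: disc_def)
 have "dbl disc (%_. 1) ro homeomorphic Mod (%_. -1)"
 proof (rule Mod_reparam[OF compact_disc, where f = id])
  show "continuous_on disc ro" unfolding ro_def case_prod_unfold by (intro continuous_intros)
  show "0 <= ro v" if "v \<in> disc" for v using that d by (auto simp: ro_def split: prod.splits) (smt (verit) d)
 qed (auto simp: ro_def intro!: continuous_intros)
 then have 1: "top_of_set (dbl disc (%_. 1) ro) homeomorphic_space top_of_set (Mod (%_. -1))"
  by (rule homeomorphic_space_top_of_set)
 let ?f = "%p::bool \<times> (real^4). (((snd p$1, snd p$2), if fst p then 1 else (-1::real)), Complex (snd p$3) (snd p$4))"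
 have "homeomorphic_map two_S3 (top_of_set (dbl disc (%_. 1) ro)) ?f"
 proof (rule continuous_imp_homeomorphic_map)
  show "compact_space two_S3"
   by (rule compact_space_sum_topology) (auto simp: compact_space_subtopology)
  show "Hausdorff_space (top_of_set (dbl disc (%_. 1) ro))" by (simp add: Hausdorff_space_subtopology)
  have in1: "(((v$1, v$2), s), Complex (v$3) (v$4)) \<in> dbl disc (%_. 1) ro \<longleftrightarrow> v \<in> sphere 0 1 & \<bar>s\<bar> = 1"
   for v :: "real^4" and s
  proof -
   have "cmod (Complex (v$3) (v$4)) = sqrt ((v$3)^2 + (v$4)^2)" by (simp add: cmod_def)
   moreover have "0 <= (v$3)^2 + (v$4)^2" by simp
   ultimately show ?thesis
    unfolding dbl_iff sphere4 by (auto simp: ro_def disc_def) (smt (verit) zero_le_power2)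
  qed
  show "continuous_map two_S3 (top_of_set (dbl disc (%_. 1) ro)) ?f"
   by (rule continuous_map_sum_topology)
    (use in1 in \<open>auto simp: continuous_map_in_subtopology intro!: continuous_intros\<close>)
  show "?f ` topspace two_S3 = topspace (top_of_set (dbl disc (%_. 1) ro))"
  proof (intro equalityI subsetI)
   fix y assume "y \<in> topspace (top_of_set (dbl disc (%_. 1) ro))"
   then obtain x h s u where y: "(((x,h),s),u) \<in> dbl disc (%_. 1) ro" "y = (((x,h),s),u)"
    by (metis surj_pair topspace_euclidean_subtopology)
   obtain v where v: "R4 v = ((x,h),(Re u, Im u))" using R4_surj by blast
   then have e: "(((v$1, v$2), s), Complex (v$3) (v$4)) = y" using y by (auto simp: R4_def complex_eq_iff)
   then have "v \<in> sphere 0 1" "\<bar>s\<bar> = 1" using in1 y by auto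
   then have "(s = 1, v) \<in> topspace two_S3" "?f (s = 1, v) = y" using e by (auto simp: abs_if split: if_splits)
   then show "y \<in> ?f ` topspace two_S3" by blast
  qed (use in1 in auto)
  show "inj_on ?f (topspace two_S3)"
   by (rule inj_onI) (auto simp: vec_eq_iff forall_4 split: if_splits)
 qed
 then show ?thesis
  using 1 by (meson homeomorphic_map_imp_homeomorphic_space homeomorphic_space_sym homeomorphic_space_trans)
qed

text \<open>On the unit circle \<open>x^2 - 1 / 2 = 1 / 2 - h^2\<close>: exchange the coordinates.\<close>
lemma Mod_swap: "Mod (%x. x^2 - 1/2) homeomorphic Mod (%x. 1/2 - x^2)"
proof -
 let ?i = "%(x, h). 1 - x^2 - h^2 + max 0 (- ((%x. x^2 - 1/2) x))"
 let ?r = "%(x, h). 1 - x^2 - h^2 + max 0 ((%x. x^2 - 1/2) x)"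
 have c: "continuous_on {-1..1} (%x::real. x^2 - 1/2)" by (intro continuous_intros)
 have n: "0 <= ?i v" "0 <= ?r v" if "v \<in> disc" for v
  using disc_Mod_nonneg[OF that, of "%x. - (x^2 - 1/2)"] disc_Mod_nonneg[OF that, of "%x. x^2 - 1/2"]
  by simp_all
 have "dbl disc ?i ?r homeomorphic Mod (%x. 1/2 - x^2)"
 proof (rule Mod_reparam[OF compact_disc _ _ _ continuous_on_disc_Mod(1)[OF c] n(1) continuous_on_disc_Mod(2)[OF c] n(2), where f = prod.swap])
  show "prod.swap ` disc = disc" by (force simp: disc_def add.commute)
  fix v x h assume v: "v \<in> disc" "prod.swap v = (x, h)"
  then have vv: "v = (h,x)" by (cases v) auto
  then have "h^2 + x^2 <= 1" using v by (auto simp: disc_def)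
  then show "(?i v = 0) = (x^2 + h^2 = 1 & 0 <= 1/2 - x^2)"
   "(?r v = 0) = (x^2 + h^2 = 1 & 1/2 - x^2 <= 0)"
   unfolding vv by (auto simp: max_def)
 qed (auto intro!: continuous_intros continuous_on_swap)
 then show ?thesis by (simp only: Mod_def)
qed

text \<open>The map \<open>(t, w) \<mapsto> (t \<surd>(1 - w^2/2), w \<surd>(1 - t^2/2))\<close> takes the square to the disc, with
 \<open>1 - x^2 - h^2 = (1 - t^2) (1 - w^2)\<close>; the sides \<open>w = \<plusminus>1\<close> go to the arcs \<open>x^2 <= 1/2\<close>.\<close>

lemma Mod_S2xS1: "top_of_set (Mod (%x. 1/2 - x^2)) homeomorphic_space S2xS1"
proof -
 define sq :: "(real \<times> real) set" where "sq = {-1..1} \<times> {-1..1}"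
 define f :: "real \<times> real => real \<times> real" where
  "f = (%(t, w). (t * sqrt (1 - w^2/2), w * sqrt (1 - t^2/2)))"
 define i :: "real \<times> real => real" where "i = (%(t, w). sqrt (1 - w^2))"
 define ro :: "real \<times> real => real" where "ro = (%(t, w). sqrt (1 - t^2))"
 have sqI: "(t,w) \<in> sq \<longleftrightarrow> t^2 <= 1 & w^2 <= 1" for t w
  by (auto simp: sq_def abs_square_le_1)
 have f2: "x^2 = t^2*(1 - w^2/2)" "h^2 = w^2*(1 - t^2/2)" if "(t,w) \<in> sq" "f (t,w) = (x,h)" for t w x h
  using that sqI by (auto simp: f_def power_mult_distrib)
 have f1: "1 - x^2 - h^2 = (1 - t^2)*(1 - w^2)" if "(t,w) \<in> sq" "f (t,w) = (x,h)" for t w x h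
  using f2[OF that] by (simp add: algebra_simps)
 have fim: "f ` sq = disc"
 proof (intro equalityI subsetI)
  fix y assume "y \<in> f ` sq"
  then obtain t w x h where y: "(t,w) \<in> sq" "f (t,w) = (x,h)" "y = (x,h)" by (metis imageE surj_pair)
  have "0 <= (1 - t^2)*(1 - w^2)" using y sqI by auto
  then show "y \<in> disc" using f1[OF y(1,2)] y by (auto simp: disc_def)
 next
  fix y assume "y \<in> disc"
  then obtain X H where y: "y = (X,H)" "X^2 + H^2 <= 1" by (auto simp: disc_def)
  \<comment> \<open>\<open>p = 1 - t^2\<close> and \<open>q = 1 - w^2\<close> have product \<open>C\<close> and difference \<open>B\<close>.\<close>
  define B C where "B = X^2 - H^2" and "C = 1 - X^2 - H^2"
  define D where "D = sqrt (B^2 + 4*C)"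
  define p q where "p = (D - B)/2" and "q = (D + B)/2"
  have C0: "0 <= C" using y by (simp add: C_def)
  then have D2: "D^2 = B^2 + 4*C" by (simp add: D_def)
  have D0: "\<bar>B\<bar> <= D" unfolding D_def using C0 by (intro real_le_rsqrt) auto
  have pq: "p*q = C" "q - p = B" using D2 by (simp_all add: p_def q_def power2_eq_square field_simps)
  have "D^2 <= (2 + B)^2" "D^2 <= (2 - B)^2" unfolding D2 by (simp_all add: power2_eq_square B_def C_def algebra_simps)
  moreover have "X^2 <= 1" "H^2 <= 1" using y zero_le_power2[of X] zero_le_power2[of H] by linarith+
  then have "0 <= 2 + B" "0 <= 2 - B" using zero_le_power2[of X] zero_le_power2[of H] unfolding B_def by linarith+
  ultimately have "D <= 2 + B" "D <= 2 - B" using power2_le_imp_le by blast+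
  then have p01: "0 <= p" "p <= 1" "0 <= q" "q <= 1" using D0 by (auto simp: p_def q_def)
  define t w where "t = sgn X * sqrt (1 - p)" and "w = sgn H * sqrt (1 - q)"
  have X2: "X^2 = (1 - p)*(1 + q)/2" "H^2 = (1 - q)*(1 + p)/2"
   using pq unfolding B_def C_def by (simp_all add: algebra_simps)
  have t2: "t^2 = 1 - p"
  proof (cases "X = 0")
   case True
   then have "(1 - p)*(1 + q) = 0" using X2 by auto
   then show ?thesis using p01 True by (auto simp: t_def)
  qed (use p01 in \<open>auto simp: t_def power_mult_distrib sgn_if\<close>)
  have w2: "w^2 = 1 - q"
  proof (cases "H = 0")
   case True
   then have "(1 - q)*(1 + p) = 0" using X2 by auto
   then show ?thesis using p01 True by (auto simp: w_def)
  qed (use p01 in \<open>auto simp: w_def power_mult_distrib sgn_if\<close>)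
  have "(t,w) \<in> sq" using sqI t2 w2 p01 by auto
  moreover have "f (t,w) = y"
  proof -
   have "\<bar>X\<bar> = sqrt (1 - p) * sqrt (1 - w^2/2)" "\<bar>H\<bar> = sqrt (1 - q) * sqrt (1 - t^2/2)"
    unfolding real_sqrt_mult[symmetric] t2 w2 real_sqrt_abs[symmetric] X2 by (simp_all add: field_simps)
   then have "t * sqrt (1 - w^2/2) = sgn X*\<bar>X\<bar>" "w * sqrt (1 - t^2/2) = sgn H*\<bar>H\<bar>"
    by (simp_all add: t_def w_def)
   then show ?thesis unfolding f_def y by (simp add: sgn_mult_abs)
  qed
  ultimately show "y \<in> f ` sq" by blast
 qed
 have finj: "inj_on f sq"
 proof (rule inj_onI)
  fix a b assume ab: "a \<in> sq" "b \<in> sq" "f a = f b"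
  obtain t w where a: "a = (t,w)" by (cases a)
  obtain t' w' where b: "b = (t',w')" by (cases b)
  obtain x h where xh: "f (t,w) = (x,h)" "f (t',w') = (x,h)" using ab a b by (cases "f a") auto
  have s: "(t,w) \<in> sq" "(t',w') \<in> sq" using ab a b by auto
  have "(1 - t^2)*(1 - w^2) = (1 - t'^2)*(1 - w'^2)" using f1[OF s(1) xh(1)] f1[OF s(2) xh(2)] by simp
  moreover have d: "(1 - w^2) - (1 - t^2) = (1 - w'^2) - (1 - t'^2)"
   using f2[OF s(1) xh(1)] f2[OF s(2) xh(2)] by (simp add: algebra_simps)
  moreover have "q = q'" if "p*q = p'*q'" "q - p = q' - p'" "0 <= p" "0 <= q" "0 <= p'" "0 <= q'" for p q p' q' :: real
  proof -
   have p: "p = q - q' + p'" using that by simp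
   have "(q - q')*(p + q') = 0" using that(1) unfolding p by (simp add: algebra_simps)
   then have "q = q' | p + q' = 0" by simp
   then show ?thesis using that(2-) by linarith
  qed
  ultimately have "1 - w^2 = 1 - w'^2" using s sqI by simp
  then have w: "w^2 = w'^2" and t: "t^2 = t'^2" using d by simp_all
  have "w^2 <= 1" "t^2 <= 1" using s sqI by auto
  then have "0 < sqrt (1 - w^2/2)" "0 < sqrt (1 - t^2/2)" by auto
  moreover have "t * sqrt (1 - w^2/2) = t' * sqrt (1 - w^2/2)" "w * sqrt (1 - t^2/2) = w' * sqrt (1 - t^2/2)"
   using xh[unfolded f_def prod.case prod.inject] by (metis w, metis t)
  ultimately show "a = b" unfolding a b by simp
 qed
 have cf: "continuous_on sq f" unfolding f_def case_prod_unfold by (intro continuous_intros) auto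
 have ci: "continuous_on sq i" "continuous_on sq ro"
  unfolding i_def ro_def case_prod_unfold by (intro continuous_intros)+
 have n: "0 <= i v" "0 <= ro v" if "v \<in> sq" for v
  using that sqI by (auto simp: i_def ro_def split: prod.splits)
 have csq: "compact sq" unfolding sq_def by (intro compact_Times compact_Icc)
 have "dbl sq i ro homeomorphic Mod (%x. 1/2 - x^2)"
 proof (rule Mod_reparam[OF csq cf finj fim ci(1) n(1) ci(2) n(2)])
  fix v x h assume v: "v \<in> sq" "f v = (x,h)"
  obtain t w where tw: "v = (t,w)" by (cases v)
  have 1: "t^2 <= 1" "w^2 <= 1" "x^2 = t^2*(1 - w^2/2)"
   using f2[of t w x h] v sqI tw by auto
  have "1 - x^2 - h^2 = (1 - t^2)*(1 - w^2)" using f1[of t w x h] v tw by blast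
  then have "x^2 + h^2 = 1 \<longleftrightarrow> (1 - t^2)*(1 - w^2) = 0" by linarith
  then have 2: "x^2 + h^2 = 1 \<longleftrightarrow> t^2 = 1 | w^2 = 1" unfolding mult_eq_0_iff by linarith
  have 3: "t^2 = 1 ==> x^2 = 1 - w^2/2" "w^2 = 1 ==> x^2 = t^2/2" using 1 by auto
  show "(i v = 0) = (x^2 + h^2 = 1 & 0 <= 1/2 - x^2)"
   unfolding 2 using 1 3 by (auto simp: i_def tw)
  show "(ro v = 0) = (x^2 + h^2 = 1 & 1/2 - x^2 <= 0)"
   unfolding 2 using 1 3 by (auto simp: ro_def tw)
 qed (auto intro!: continuous_intros)
 moreover have "(sphere (0::real^3) 1 \<times> sphere (0::real^2) 1) homeomorphic dbl sq i ro"
 proof (rule homeomorphic_compact)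
  let ?g = "%p::(real^3) \<times> (real^2). (((fst p$1, snd p$1), snd p$2), Complex (fst p$2) (fst p$3))"
  have in1: "(((n$1, m$1), m$2), Complex (n$2) (n$3)) \<in> dbl sq i ro \<longleftrightarrow> n \<in> sphere 0 1 & m \<in> sphere 0 1"
   for n :: "real^3" and m :: "real^2"
  proof -
   have 1: "\<bar>m$2\<bar> = sqrt A \<longleftrightarrow> (m$2)^2 = A" for A by (metis real_sqrt_abs real_sqrt_eq_iff)
   have 2: "cmod (Complex (n$2) (n$3)) = sqrt A \<longleftrightarrow> (n$2)^2 + (n$3)^2 = A" for A
    by (simp add: cmod_def)
   have "0 <= (n$2)^2" "0 <= (n$3)^2" "0 <= (m$2)^2" by simp_all
   then show ?thesis
    unfolding dbl_iff sphere3 sphere2 sqI i_def ro_def prod.case 1 2 by linarith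
  qed
  show "compact (sphere (0::real^3) 1 \<times> sphere (0::real^2) 1)" by (intro compact_Times compact_sphere)
  show "continuous_on (sphere (0::real^3) 1 \<times> sphere (0::real^2) 1) ?g" by (intro continuous_intros)
  show "inj_on ?g (sphere (0::real^3) 1 \<times> sphere (0::real^2) 1)"
   by (rule inj_onI) (auto simp: vec_eq_iff forall_3 forall_2)
  show "?g ` (sphere (0::real^3) 1 \<times> sphere (0::real^2) 1) = dbl sq i ro"
  proof (intro equalityI subsetI)
   fix y assume "y \<in> dbl sq i ro"
   moreover obtain x h s u where y: "y = (((x,h),s),u)" by (metis surj_pair)
   define n :: "real^3" where "n = vector [x, Re u, Im u]"
   define m :: "real^2" where "m = vector [h, s]"
   have "(((n$1, m$1), m$2), Complex (n$2) (n$3)) = y" by (simp add: n_def m_def y)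
   ultimately have "(n,m) \<in> sphere 0 1 \<times> sphere 0 1" "?g (n,m) = y" using in1 by auto
   then show "y \<in> ?g ` (sphere (0::real^3) 1 \<times> sphere (0::real^2) 1)" by blast
  qed (use in1 in auto)
 qed
 ultimately have "Mod (%x. 1/2 - x^2) homeomorphic (sphere (0::real^3) 1 \<times> sphere (0::real^2) 1)"
  by (meson homeomorphic_sym homeomorphic_trans)
 then show ?thesis by (simp add: homeomorphic_space_top_of_set)
qed

section \<open>Chains and connected sums\<close>

text \<open>The planar domain \<open>max 0 (- q H) <= s^2 <= gm H\<close>, \<open>a <= H <= b\<close>, has a hole for every interval on which
 \<open>q\<close> is negative. A chain is the circle bundle over it with circles collapsed over the boundary.
 Over an interval on which \<open>q \<ge> 1\<close> it is the hypersurface of revolution \<open>s^2 + |u|^2 = gm H\<close>.\<close>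

definition Chain :: "real => real => (real => real) => (real => real) => (real \<times> real \<times> complex) set" where
 "Chain a b gm q = {(H, s, u). a <= H & H <= b & s^2 <= gm H & 0 <= s^2 + q H &
  (norm u)^2 = (gm H - s^2)*min 1 (s^2 + q H)}"

text \<open>As \<open>gm + q > 0\<close>, the outer boundary \<open>s^2 = gm H\<close> does not meet the holes \<open>s^2 < - q H\<close>.\<close>
definition chain_data :: "real => real => (real => real) => (real => real) => bool" where
 "chain_data a b gm q \<longleftrightarrow> a < b & continuous_on {a..b} gm & continuous_on {a..b} q & gm a = 0 & gm b = 0 &
  (ALL H. a < H --> H < b --> 0 < gm H) & (\<forall>H\<in>{a..b}. 0 < gm H + q H)"

text \<open>The half \<open>s \<ge> 0\<close> of the planar domain of a chain is a disc, doubled along the intervals of \<open>s = 0\<close>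
 where \<open>q \<ge> 0\<close>. They correspond to the parts of the right half of the unit circle where \<open>P \<ge> 0\<close>; the
 ordinate is \<open>\<theta> H\<close>.\<close>
lemma Chain_homeomorphic_Mod:
 fixes \<theta> :: "real => real"
 assumes "chain_data a b gm q"
  and \<theta>: "continuous_on {a..b} \<theta>" "strict_mono_on {a..b} \<theta>" "\<theta> a = -1" "\<theta> b = 1"
  and sg: "!!H. a < H ==> H < b ==> sgn (q H) = sgn (P (sqrt (1 - (\<theta> H)^2)))"
  and P: "continuous_on {-1..1} P" "!!x. -1 <= x ==> x < 0 ==> P x < 0" "P 0 = 0"
 shows "Chain a b gm q homeomorphic Mod P"
proof -
 have ab: "a < b" and gm: "continuous_on {a..b} gm" "gm a = 0" "gm b = 0" "!!H. a < H ==> H < b ==> 0 < gm H"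
  and q: "continuous_on {a..b} q" and gq: "!!H. H \<in> {a..b} ==> 0 < gm H + q H"
  using assms(1) by (auto simp: chain_data_def)
 (* The coordinate x replaces s^2 = \<sigma>, which runs from m H to gm H. *)
 define m where "m H = max 0 (- q H)" for H
 define \<beta> where "\<beta> H = (gm H - m H)/2" for H
 define V where "V = {(H, x). a <= H & H <= b & \<bar>x\<bar> <= \<beta> H}"
 define \<sigma> where "\<sigma> = (%(H, x). m H + \<beta> H - x)"
 define i where "i v = sqrt (\<sigma> v)" for v
 define ro where "ro v = sqrt ((gm (fst v) - \<sigma> v)*min 1 (\<sigma> v + q (fst v)))" for v
 have q0: "0 < q a" "0 < q b" using gq[of a] gq[of b] gm ab by auto
 have m0: "m a = 0" "m b = 0" using q0 by (auto simp: m_def)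
 have mm: "0 <= m H" "0 <= m H + q H" for H by (auto simp: m_def)
 have cm: "continuous_on {a..b} m" unfolding m_def by (intro continuous_intros q)
 have \<beta>: "continuous_on {a..b} \<beta>" "!!H. a < H ==> H < b ==> 0 < \<beta> H" "\<beta> a = 0" "\<beta> b = 0"
 proof -
  show "continuous_on {a..b} \<beta>" unfolding \<beta>_def by (intro continuous_intros cm gm(1)) simp
  show "0 < \<beta> H" if "a < H" "H < b" for H
   using gm(4)[OF that] gq[of H] that by (auto simp: \<beta>_def m_def max_def)
  show "\<beta> a = 0" "\<beta> b = 0" using m0 gm by (auto simp: \<beta>_def)
 qed
 define f where "f = (%v. (\<theta> (fst v), sqrt (1 - (\<theta> (fst v))^2)*(snd v/\<beta> (fst v))))"
 note f = lens_disc[OF ab \<beta> V_def \<theta> f_def]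
 have cV: "continuous_on V (%v. g (fst v))" if "continuous_on {a..b} g" for g :: "real => real"
  by (intro continuous_on_compose2[OF that] continuous_intros) (auto simp: V_def)
 have c\<sigma>: "continuous_on V \<sigma>" unfolding \<sigma>_def case_prod_unfold by (intro continuous_intros cV cm \<beta>)
 have ci: "continuous_on V i" "continuous_on V ro"
  unfolding i_def ro_def by (intro continuous_intros c\<sigma> cV gm q)+
 have sig: "m H <= \<sigma> (H,x)" "\<sigma> (H,x) <= gm H" if "(H,x) \<in> V" for H x
  using that by (auto simp: V_def \<sigma>_def \<beta>_def abs_le_iff field_simps)
 have pos: "0 <= \<sigma> (H,x)" "0 <= (gm H - \<sigma> (H,x))*min 1 (\<sigma> (H,x) + q H)" if "(H,x) \<in> V" for H x
  using sig[OF that] mm[of H] by (auto intro!: mult_nonneg_nonneg)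
 have cpV: "compact V" unfolding V_def by (rule compact_lens[OF \<beta>(1)])
 have 1: "dbl V i ro homeomorphic Mod P"
 proof (rule Mod_reparam[OF cpV _ _ _ ci(1) _ ci(2) _ P(1), where f = "prod.swap \<circ> f"])
  show "continuous_on V (prod.swap \<circ> f)" by (intro continuous_on_compose f continuous_on_swap)
  show "inj_on (prod.swap \<circ> f) V" by (intro comp_inj_on f) (auto simp: inj_on_def prod_eq_iff)
  show "(prod.swap \<circ> f) ` V = disc"
  proof -
   have "prod.swap ` disc = disc" by (force simp: disc_def add.commute)
   then show ?thesis using f(3) by (metis image_comp)
  qed
  show "0 <= i v" "0 <= ro v" if "v \<in> V" for v
   using pos[of "fst v" "snd v"] that by (simp_all add: i_def ro_def)
  fix v X K assume v: "v \<in> V" "(prod.swap \<circ> f) v = (X, K)"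
  obtain H x where vv: "v = (H,x)" by (cases v)
  have fv: "f (H,x) = (K,X)" using v vv by (cases "f v") auto
  have bd: "X^2 + K^2 = 1 \<longleftrightarrow> \<bar>x\<bar> = \<beta> H" using f(4)[of H x K X] fv v vv by auto
  have Kf: "K = \<theta> H" "X = sqrt (1 - (\<theta> H)^2)*(x/\<beta> H)" using fv by (auto simp: f_def)
  have Hab: "a <= H" "H <= b" "\<bar>x\<bar> <= \<beta> H" using v vv by (auto simp: V_def)
  have i0: "i v = 0 \<longleftrightarrow> \<sigma> (H,x) = 0" by (simp add: i_def vv)
  have r0: "ro v = 0 \<longleftrightarrow> gm H = \<sigma> (H,x) | \<sigma> (H,x) + q H = 0"
   by (auto simp: ro_def vv min_def)
  show "(i v = 0) = (X^2 + K^2 = 1 & 0 <= P X)" "(ro v = 0) = (X^2 + K^2 = 1 & P X <= 0)"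
  proof -
   have "(\<sigma> (H,x) = 0 \<longleftrightarrow> \<bar>x\<bar> = \<beta> H & 0 <= P X) &
    (gm H = \<sigma> (H,x) | \<sigma> (H,x) + q H = 0 \<longleftrightarrow> \<bar>x\<bar> = \<beta> H & P X <= 0)"
   proof (cases "H = a | H = b")
    case True
    then have "\<beta> H = 0" "x = 0" "m H = 0" "gm H = 0" using \<beta> Hab m0 gm by auto
    then show ?thesis using Kf P by (auto simp: \<sigma>_def)
   next
    case False
    then have Hs: "a < H" "H < b" using Hab by auto
    have b0: "0 < \<beta> H" using \<beta> Hs by auto
    have "-1 < \<theta> H" "\<theta> H < 1"
     using strict_mono_onD[OF \<theta>(2), of a H] strict_mono_onD[OF \<theta>(2), of H b] Hs \<theta> by auto
    then have R0: "0 < sqrt (1 - (\<theta> H)^2)" and R1: "sqrt (1 - (\<theta> H)^2) <= 1"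
     by (auto simp: abs_square_less_1)
    have qP: "0 <= q H \<longleftrightarrow> 0 <= P (sqrt (1 - (\<theta> H)^2))" "q H <= 0 \<longleftrightarrow> P (sqrt (1 - (\<theta> H)^2)) <= 0"
     using sg[OF Hs] by (metis sgn_less not_less) (metis sgn_greater not_less sg[OF Hs])
    have gH: "gm H = m H + 2*\<beta> H" by (simp add: \<beta>_def field_simps)
    consider "x = \<beta> H" | "x = - \<beta> H" | "\<bar>x\<bar> < \<beta> H" using Hab by linarith
    then show ?thesis
    proof cases
     case 1
     then have "X = sqrt (1 - (\<theta> H)^2)" "\<sigma> (H,x) = m H" using Kf b0 by (auto simp: \<sigma>_def)
     then show ?thesis using qP gH b0 1 by (auto simp: m_def max_def)
    next
     case 2
     then have X: "X = - sqrt (1 - (\<theta> H)^2)" "\<sigma> (H,x) = gm H" using Kf b0 gH by (auto simp: \<sigma>_def)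
     have "P X < 0" by (rule P(2)) (use X R0 R1 in auto)
     then show ?thesis using X gm(4)[OF Hs] 2 b0 by auto
    next
     case 3
     then show ?thesis using mm[of H] gH b0 by (auto simp: \<sigma>_def)
    qed
   qed
   then show "(i v = 0) = (X^2 + K^2 = 1 & 0 <= P X)" "(ro v = 0) = (X^2 + K^2 = 1 & P X <= 0)"
    unfolding i0 r0 bd by auto
  qed
 qed
 have "dbl V i ro homeomorphic Chain a b gm q"
 proof (rule homeomorphic_compact)
  let ?g = "%p::((real \<times> real) \<times> real) \<times> complex. (fst (fst (fst p)), snd (fst p), snd p)"
  show "compact (dbl V i ro)"
  proof (rule compact_dbl[OF cpV ci(1) _ ci(2)])
   show "0 <= i v" "0 <= ro v" if "v \<in> V" for v
    using pos[of "fst v" "snd v"] that by (simp_all add: i_def ro_def)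
  qed
  show "continuous_on (dbl V i ro) ?g" by (intro continuous_intros)
  have sq: "s^2 = \<sigma> (H,x) & (cmod u)^2 = (gm H - \<sigma> (H,x))*min 1 (\<sigma> (H,x) + q H) & (H,x) \<in> V"
   if "(((H,x),s),u) \<in> dbl V i ro" for x H s u
  proof -
   have "(H,x) \<in> V" "\<bar>s\<bar> = i (H,x)" "cmod u = ro (H,x)" using that by (simp_all add: dbl_iff)
   moreover have "s^2 = \<bar>s\<bar>^2" by simp
   ultimately show ?thesis using pos by (simp add: i_def ro_def)
  qed
  show "?g ` dbl V i ro = Chain a b gm q"
  proof (intro equalityI subsetI)
   fix y assume "y \<in> ?g ` dbl V i ro"
   then obtain H x s u where y: "(((H,x),s),u) \<in> dbl V i ro" "y = (H,s,u)" by force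
   then show "y \<in> Chain a b gm q"
    using sq[OF y(1)] sig[of H x] mm[of H] by (auto simp: Chain_def V_def)
  next
   fix y assume "y \<in> Chain a b gm q"
   then obtain H s u where y: "y = (H,s,u)" "a <= H" "H <= b" "s^2 <= gm H" "0 <= s^2 + q H"
    "(cmod u)^2 = (gm H - s^2)*min 1 (s^2 + q H)" by (auto simp: Chain_def)
   define x where "x = m H + \<beta> H - s^2"
   have "m H <= s^2" using y by (auto simp: m_def)
   then have V: "(H,x) \<in> V" using y by (auto simp: V_def x_def \<beta>_def field_simps abs_le_iff)
   have s: "\<sigma> (H,x) = s^2" by (simp add: \<sigma>_def x_def)
   have "\<bar>s\<bar> = i (H,x)" "cmod u = ro (H,x)"
    unfolding i_def ro_def s fst_conv y(6)[symmetric] by simp_all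
   then have "(((H,x),s),u) \<in> dbl V i ro" using V by (simp add: dbl_iff)
   then show "y \<in> ?g ` dbl V i ro" using y by (force intro: image_eqI)
  qed
  show "inj_on ?g (dbl V i ro)"
  proof (rule inj_onI)
   fix p p' assume p: "p \<in> dbl V i ro" "p' \<in> dbl V i ro" "?g p = ?g p'"
   obtain H x s u where a: "p = (((H,x),s),u)" by (metis surj_pair)
   obtain H' x' s' u' where b: "p' = (((H',x'),s'),u')" by (metis surj_pair)
   have "H' = H" "s' = s" "u' = u" using p a b by auto
   moreover have "x = x'" using sq[of H x s u] sq[of H x' s u] p a b calculation by (auto simp: \<sigma>_def)
   ultimately show "p = p'" using a b by simp
  qed
 qed
 then show ?thesis using 1 by (meson homeomorphic_sym homeomorphic_trans)
qed

text \<open>To recognise a connected sum \<open>X\<close> it suffices to embed both pieces, with open balls removed, in \<open>X\<close>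
 such that they cover \<open>X\<close> and meet exactly along the boundary spheres.\<close>
lemma is_connected_sumI:
 fixes Y Z :: "'a::t2_space set" and X :: "'b topology" and e f :: "real^3 => 'a"
 assumes Y: "compact Y" and Z: "compact Z" and X: "Hausdorff_space X"
  and e: "continuous_on (cball 0 2) e" "inj_on e (cball 0 2)" "e ` cball 0 2 \<subseteq> Y" "openin (top_of_set Y) (e ` ball 0 2)"
  and f: "continuous_on (cball 0 2) f" "inj_on f (cball 0 2)" "f ` cball 0 2 \<subseteq> Z" "openin (top_of_set Z) (f ` ball 0 2)"
  and pY: "continuous_map (top_of_set (Y - e ` ball 0 1)) X pY" "inj_on pY (Y - e ` ball 0 1)"
  and pZ: "continuous_map (top_of_set (Z - f ` ball 0 1)) X pZ" "inj_on pZ (Z - f ` ball 0 1)"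
  and cov: "topspace X \<subseteq> pY ` (Y - e ` ball 0 1) \<union> pZ ` (Z - f ` ball 0 1)"
  and glue: "!!y z. y \<in> Y - e ` ball 0 1 ==> z \<in> Z - f ` ball 0 1 ==>
   pY y = pZ z \<longleftrightarrow> (\<exists>x\<in>sphere 0 1. y = e x & z = f x)"
 shows "is_connected_sum (top_of_set Y) (top_of_set Z) X"
proof -
 have chart: "ball_chart (top_of_set M) g & openin (top_of_set M) (g ` ball 0 1)"
  if g: "continuous_on (cball 0 2) g" "inj_on g (cball 0 2)" "g ` cball 0 2 \<subseteq> M" "openin (top_of_set M) (g ` ball 0 2)"
  for M :: "'a set" and g :: "real^3 => 'a"
 proof -
  obtain h where "homeomorphism (cball 0 2) (g ` cball 0 2) g h"
   using homeomorphism_compact[OF compact_cball g(1) refl g(2)] by blast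
  then have h: "homeomorphism (ball 0 2) (g ` ball 0 2) g h"
   by (rule homeomorphism_of_subsets) (auto intro: ball_subset_cball subsetD)
  have "subtopology (top_of_set M) (g ` ball 0 2) = top_of_set (g ` ball 0 2)"
   using g(3) ball_subset_cball[of "0::real^3" 2]
   by (metis (no_types, lifting) image_mono inf.absorb_iff2 subtopology_subtopology subset_trans)
  moreover have "homeomorphic_maps (top_of_set (ball 0 2)) (top_of_set (g ` ball 0 2)) g h"
   using h unfolding homeomorphism_def homeomorphic_maps_def
   by (auto simp: continuous_map_in_subtopology)
  ultimately have "embedding_map (top_of_set (ball 0 2)) (top_of_set M) g"
   unfolding embedding_map_def homeomorphic_map_maps by auto
  moreover have "openin (top_of_set (g ` ball 0 2)) (g ` ball 0 1)"
   by (rule homeomorphism_imp_open_map[OF h]) (auto intro!: open_subset)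
  then have "openin (top_of_set M) (g ` ball 0 1)" using g(4) openin_trans by blast
  ultimately show ?thesis unfolding ball_chart_def using g(4) by auto
 qed
 have ce: "ball_chart (top_of_set Y) e" "openin (top_of_set Y) (e ` ball 0 1)" using chart e by auto
 have cf: "ball_chart (top_of_set Z) f" "openin (top_of_set Z) (f ` ball 0 1)" using chart f by auto
 have sY: "subtopology (top_of_set Y) (- e ` ball 0 1) = top_of_set (Y - e ` ball 0 1)"
  and sZ: "subtopology (top_of_set Z) (- f ` ball 0 1) = top_of_set (Z - f ` ball 0 1)"
  by (simp_all add: subtopology_subtopology Diff_eq)
 have cl: "compact (Y - e ` ball 0 1)" "compact (Z - f ` ball 0 1)"
  using closedin_compact[OF Y closedin_diff[OF _ ce(2)]] closedin_compact[OF Z closedin_diff[OF _ cf(2)]]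
  by simp_all
 define W where "W = sum_topology (%b. if b then top_of_set (Y - e ` ball 0 1) else top_of_set (Z - f ` ball 0 1)) UNIV"
 define p where "p = (%(b, v). if b then pY v else pZ v)"
 have tW: "topspace W = (Pair True ` (Y - e ` ball 0 1)) \<union> (Pair False ` (Z - f ` ball 0 1))"
  by (auto simp: W_def split: if_splits)
 have "quotient_map W X p"
 proof (rule T1_Spaces.continuous_imp_quotient_map[OF _ _ X])
  show "continuous_map W X p" unfolding W_def
   by (rule continuous_map_sum_topology) (auto simp: p_def pY pZ)
  then have "p ` topspace W \<subseteq> topspace X" by (simp add: continuous_map_image_subset_topspace)
  moreover have "topspace X \<subseteq> p ` topspace W" using cov unfolding tW image_Un image_image p_def by auto
  ultimately show "p ` topspace W = topspace X" by blast
  show "compact_space W" unfolding W_def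
   by (rule compact_space_sum_topology) (use cl in \<open>auto simp: compact_space_subtopology\<close>)
 qed
 moreover have "\<forall>u \<in> topspace W. \<forall>v \<in> topspace W.
      p u = p v \<longleftrightarrow> u = v | (\<exists>x \<in> sphere 0 1. {u, v} = {(True, e x), (False, f x)})"
 proof (intro ballI)
  fix u v assume "u \<in> topspace W" "v \<in> topspace W"
  moreover obtain b y where u: "u = (b, y)" by (cases u)
  moreover obtain c z where v: "v = (c, z)" by (cases v)
  ultimately have yz: "y \<in> (if b then Y - e ` ball 0 1 else Z - f ` ball 0 1)"
    "z \<in> (if c then Y - e ` ball 0 1 else Z - f ` ball 0 1)" unfolding tW by auto
  show "p u = p v \<longleftrightarrow> u = v | (\<exists>x \<in> sphere 0 1. {u, v} = {(True, e x), (False, f x)})"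
  proof (cases b; cases c)
   assume "b" "c"
   then show ?thesis using yz u v inj_onD[OF pY(2), of y z] by (auto simp: p_def doubleton_eq_iff)
  next
   assume "b" "~ c"
   then show ?thesis using yz u v glue[of y z] by (auto simp: p_def doubleton_eq_iff)
  next
   assume "~ b" "c"
   then show ?thesis using yz u v glue[of z y] by (auto simp: p_def doubleton_eq_iff eq_commute[of "pZ y"])
  next
   assume "~ b" "~ c"
   then show ?thesis using yz u v inj_onD[OF pZ(2), of y z] by (auto simp: p_def doubleton_eq_iff)
  qed
 qed
 moreover have "W = sum_topology (%b. if b then subtopology (top_of_set Y) (- e ` ball 0 1)
                  else subtopology (top_of_set Z) (- f ` ball 0 1)) UNIV"
  by (simp only: W_def sY sZ)
 ultimately show ?thesis
  unfolding is_connected_sum_def Let_def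
  by (intro exI[of _ e] exI[of _ f] exI[of _ p] conjI ce(1) cf(1)) simp_all
qed

text \<open>Cutting a chain at \<open>c\<close>, keeping the part \<open>H <= c\<close> and closing it with a round cap.\<close>

definition cap_gam :: "real => (real => real) => real => real" where
 "cap_gam c gm H = (if H <= c then gm H else gm c - (H - c)^2)"

definition cap_q :: "real => (real => real) => real => real" where
 "cap_q c q H = (if H <= c then q H else q c)"

definition Cap :: "real => real => (real => real) => (real => real) => (real \<times> real \<times> complex) set" where
 "Cap a c gm q = Chain a (c + sqrt (gm c)) (cap_gam c gm) (cap_q c q)"

lemma compact_Chain:
 assumes "chain_data a b gm q"
 shows "compact (Chain a b gm q)"
proof -
 have c: "continuous_on {a..b} gm" "continuous_on {a..b} q" using assms by (auto simp: chain_data_def)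
 obtain B where B: "!!H. H \<in> {a..b} ==> \<bar>gm H\<bar> <= B"
 proof -
  obtain B where "\<forall>y\<in>gm ` {a..b}. norm y <= B"
   using compact_imp_bounded[OF compact_continuous_image[OF c(1) compact_Icc]] bounded_iff by metis
  then show ?thesis by (intro that[of B]) simp
 qed
 let ?S = "{a..b} \<times> (UNIV :: (real \<times> complex) set)"
 have cf: "continuous_on ?S (%p. gm (fst p))" "continuous_on ?S (%p. q (fst p))"
  by (auto intro!: continuous_on_compose2[OF c(1)] continuous_on_compose2[OF c(2)] continuous_intros)
 have S: "closed ?S" by (intro closed_Times closed_atLeastAtMost closed_UNIV)
 have eq: "Chain a b gm q = {p \<in> ?S. (fst (snd p))^2 <= gm (fst p)} \<inter> {p \<in> ?S. 0 <= (fst (snd p))^2 + q (fst p)} \<inter>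
  {p \<in> ?S. (norm (snd (snd p)))^2 <= (gm (fst p) - (fst (snd p))^2)*min 1 ((fst (snd p))^2 + q (fst p))} \<inter>
  {p \<in> ?S. (gm (fst p) - (fst (snd p))^2)*min 1 ((fst (snd p))^2 + q (fst p)) <= (norm (snd (snd p)))^2}"
  by (auto simp: Chain_def)
 have "closed (Chain a b gm q)" unfolding eq
  by (intro closed_Int continuous_on_closed_Collect_le continuous_intros cf S)
 moreover have "Chain a b gm q \<subseteq> {a..b} \<times> cball 0 (sqrt (\<bar>B\<bar> + \<bar>B\<bar>))"
 proof
  fix y assume "y \<in> Chain a b gm q"
  then obtain H s u where y: "y = (H,s,u)" "a <= H" "H <= b" "s^2 <= gm H" "0 <= s^2 + q H"
    "(cmod u)^2 = (gm H - s^2)*min 1 (s^2 + q H)" by (auto simp: Chain_def)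
  have "(cmod u)^2 <= gm H - s^2" unfolding y(6) using y by (intro mult_left_le) auto
  then have "s^2 + (cmod u)^2 <= \<bar>B\<bar> + \<bar>B\<bar>" using B[of H] y by auto
  then show "y \<in> {a..b} \<times> cball 0 (sqrt (\<bar>B\<bar> + \<bar>B\<bar>))"
   using y by (simp add: norm_Pair)
 qed
 then have "bounded (Chain a b gm q)"
  using bounded_subset bounded_Times bounded_closed_interval bounded_cball by (metis bounded_cbox cbox_interval)
 ultimately show ?thesis by (simp add: compact_eq_bounded_closed)
qed

lemma chain_data_cap:
 assumes d: "chain_data a b gm q" and c: "a < c" "c < b" and qc: "0 < q c"
 shows "chain_data a (c + sqrt (gm c)) (cap_gam c gm) (cap_q c q)"
proof -
 have g0: "0 < gm c" using d c by (auto simp: chain_data_def)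
 have c1: "continuous_on {a..c} gm" "continuous_on {a..c} q"
  using d c by (auto simp: chain_data_def intro: continuous_on_subset)
 have un: "{a..c + sqrt (gm c)} = {a..c} \<union> {c..c + sqrt (gm c)}"
  using c g0 by (intro ivl_disj_un_two_touch(4)[symmetric]) auto
 have "continuous_on {a..c + sqrt (gm c)} (cap_gam c gm)" "continuous_on {a..c + sqrt (gm c)} (cap_q c q)"
  unfolding un cap_gam_def cap_q_def
  by (intro continuous_on_cases; use c1 in \<open>auto intro!: continuous_intros\<close>)+
 moreover have pos: "0 < cap_gam c gm H" if "a < H" "H < c + sqrt (gm c)" for H
 proof (cases "H <= c")
  case True then show ?thesis using that d c by (auto simp: cap_gam_def chain_data_def)
 next
  case False
  then have "(H - c)^2 < (sqrt (gm c))^2" using that by (intro power_strict_mono) auto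
  then show ?thesis using False g0 by (auto simp: cap_gam_def)
 qed
 moreover have end0: "cap_gam c gm (c + sqrt (gm c)) = 0" "cap_gam c gm a = 0"
  using g0 c d by (auto simp: cap_gam_def chain_data_def)
 moreover have "0 < cap_gam c gm H + cap_q c q H" if "H \<in> {a..c + sqrt (gm c)}" for H
 proof (cases "H <= c")
  case True then show ?thesis using that d c by (auto simp: cap_gam_def cap_q_def chain_data_def)
 next
  case False
  then have "0 <= cap_gam c gm H" using that pos[of H] end0 c by (cases "H = c + sqrt (gm c)") force+
  then show ?thesis using False qc by (simp add: cap_q_def)
 qed
 moreover have "a < c + sqrt (gm c)" using c real_sqrt_gt_zero[OF g0] by linarith
 ultimately show ?thesis by (auto simp: chain_data_def)
qed

text \<open>The coordinates of \<open>real^3\<close> as a real and a complex number.\<close>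
definition R3 :: "real^3 => real \<times> complex" where "R3 x = (x$1, Complex (x$2) (x$3))"

lemma R3_props: "R3 (c *\<^sub>R x) = c *\<^sub>R R3 x" "R3 x = R3 y \<longleftrightarrow> x = y" "EX x. R3 x = (s, u)"
 "(fst (R3 x))^2 + (norm (snd (R3 x)))^2 = (norm x)^2" "continuous_on S R3"
proof -
 show "R3 (c *\<^sub>R x) = c *\<^sub>R R3 x" by (simp add: R3_def complex_eq_iff)
 show "R3 x = R3 y \<longleftrightarrow> x = y" by (auto simp: R3_def vec_eq_iff forall_3)
 have "R3 (vector [s, Re u, Im u]) = (s, u)" by (simp add: R3_def)
 then show "EX x. R3 x = (s, u)" by blast
 show "(fst (R3 x))^2 + (norm (snd (R3 x)))^2 = (norm x)^2"
  by (simp add: R3_def cmod_power2 norm_vec_def L2_set_def sum_3)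
 show "continuous_on S R3" unfolding R3_def by (intro continuous_intros)
qed

text \<open>A ball in the closed up chain: the unit ball is the cap, and the unit sphere is the cut \<open>H = c\<close>.\<close>
lemma cap_chart:
 assumes d: "chain_data a b gm q" and c: "a < c - \<delta>" "0 < \<delta>" "c < b"
  and q1: "!!H. c - \<delta> <= H ==> H <= c ==> 1 <= q H"
 shows "EX e. continuous_on (cball 0 2) e & inj_on e (cball 0 2) & e ` cball 0 2 \<subseteq> Cap a c gm q &
  e ` ball 0 2 = {p \<in> Cap a c gm q. c - \<delta> < fst p} & e ` ball 0 1 = {p \<in> Cap a c gm q. c < fst p} &
  (\<forall>x\<in>sphere 0 1. e x = (c, sqrt (gm c) *\<^sub>R R3 x))"
proof -
 define ro where "ro = sqrt (gm c)"
 have g0: "0 < gm H" if "c - \<delta> <= H" "H <= c" for H using d c that by (auto simp: chain_data_def)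
 have r0: "0 < ro" "ro^2 = gm c" using g0[of c] c by (auto simp: ro_def)
 (* The unit ball goes to the cap H \<ge> c, a hemisphere; the shell 1 <= |x| <= 2 goes linearly in
  |x| to the collar c - \<delta> <= H <= c. *)
 define K where "K x = c - \<delta>*(norm x - 1)" for x :: "real^3"
 define e1 where "e1 x = (c + ro * sqrt (1 - (norm x)^2), ro *\<^sub>R R3 x)" for x
 define e2 where "e2 x = (K x, sqrt (gm (K x)) *\<^sub>R R3 (sgn x))" for x
 define e where "e x = (if norm x <= 1 then e1 x else e2 x)" for x
 have Kb: "c - \<delta> <= K x" "K x <= c" if "1 <= norm x" "norm x <= 2" for x
  using that c mult_left_mono[of "norm x - 1" 1 \<delta>] by (auto simp: K_def)
 have ce: "continuous_on (cball 0 2) e"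
 proof -
  have "continuous_on (cball 0 1 \<union> {x \<in> cball 0 2. 1 <= norm x}) (%x. if norm x <= 1 then e1 x else e2 x)"
  proof (rule continuous_on_cases)
   have "{x \<in> cball 0 2. 1 <= norm x} = cball 0 2 \<inter> {x::real^3. 1 <= norm x}" by auto
   then show "closed {x::real^3 \<in> cball 0 2. 1 <= norm x}"
    by (simp add: closed_Int closed_Collect_le continuous_on_norm_id)
   show "continuous_on (cball 0 1) e1" unfolding e1_def
    by (intro continuous_intros R3_props(5))
   have cg: "continuous_on {c - \<delta>..c} gm"
    using d c by (auto simp: chain_data_def intro: continuous_on_subset)
   have cs: "continuous_on {x. x \<in> cball 0 2 & 1 <= norm x} (%x::real^3. R3 (sgn x))"
    by (intro continuous_on_compose2[OF R3_props(5)[of UNIV]] continuous_intros) auto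
   show "continuous_on {x. x \<in> cball 0 2 & 1 <= norm x} e2" unfolding e2_def K_def
    by (intro continuous_intros cs continuous_on_compose2[OF cg])
     (use Kb in \<open>auto simp: K_def\<close>)
   show "ALL x. x \<in> cball 0 1 & ~ norm x <= 1 | x \<in> {x \<in> cball 0 2. 1 <= norm x} & norm x <= 1 --> e1 x = e2 x"
    by (auto simp: e1_def e2_def K_def ro_def sgn_div_norm)
  qed auto
  moreover have "cball 0 1 \<union> {x \<in> cball 0 2. 1 <= norm x} = cball (0::real^3) 2" by auto
  ultimately show ?thesis unfolding e_def by simp
 qed
 have fst1: "c <= fst (e1 x)" "fst (e1 x) = c \<longleftrightarrow> norm x = 1" if "norm x <= 1" for x
  using that r0 abs_square_eq_1[of "norm x"] by (auto simp: e1_def abs_square_le_1)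
 have fst2: "fst (e2 x) < c" if "1 < norm x" for x using that c by (simp add: e2_def K_def)
 have inj: "inj_on e (cball 0 2)"
 proof (rule inj_onI)
  fix x y :: "real^3" assume xy: "x \<in> cball 0 2" "y \<in> cball 0 2" "e x = e y"
  show "x = y"
  proof (cases "norm x <= 1"; cases "norm y <= 1")
   assume "norm x <= 1" "norm y <= 1"
   then show ?thesis using xy r0 by (auto simp: e_def e1_def R3_props)
  next
   assume "norm x <= 1" "~ norm y <= 1"
   then show ?thesis using xy fst1(1)[of x] fst2[of y] by (auto simp: e_def)
  next
   assume "~ norm x <= 1" "norm y <= 1"
   then show ?thesis using xy fst1(1)[of y] fst2[of x] by (auto simp: e_def)
  next
   assume n: "~ norm x <= 1" "~ norm y <= 1"
   then have eq: "e2 x = e2 y" using xy by (auto simp: e_def)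
   then have nn: "norm x = norm y" using c by (auto simp: e2_def K_def)
   have "0 < gm (K x)" using g0 Kb[of x] n xy by auto
   moreover have "K y = K x" using nn by (simp add: K_def)
   ultimately have "sgn x = sgn y" using eq by (auto simp: e2_def R3_props)
   moreover have "x ~= 0" "y ~= 0" using n by auto
   then have "norm x *\<^sub>R sgn x = x" "norm y *\<^sub>R sgn y = y" by (simp_all add: sgn_div_norm)
   ultimately show ?thesis using nn by metis
  qed
 qed
 have mem1: "e1 x \<in> Cap a c gm q" if "norm x <= 1" for x
 proof -
  have n2: "(norm x)^2 <= 1" using that by (simp add: abs_square_le_1)
  then have H: "c <= fst (e1 x)" "(fst (e1 x) - c)^2 = ro^2*(1 - (norm x)^2)" "fst (e1 x) <= c + ro"
   using r0 by (auto simp: e1_def power_mult_distrib mult_left_le)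
  have g: "cap_gam c gm (fst (e1 x)) = ro^2*(norm x)^2" "cap_q c q (fst (e1 x)) = q c"
   using H r0 by (auto simp: cap_gam_def cap_q_def algebra_simps)
  have "1 <= q c" using q1[of c] c by auto
  moreover have "(fst (snd (e1 x)))^2 + (norm (snd (snd (e1 x))))^2 = ro^2*(norm x)^2"
   using R3_props(4)[of x] by (simp add: e1_def power_mult_distrib flip: distrib_left)
  ultimately show ?thesis
   using g H c unfolding Cap_def Chain_def ro_def[symmetric]
   by (auto simp: case_prod_unfold min_def)
    (smt (verit) zero_le_power2)+
 qed
 have mem2: "e2 x \<in> Cap a c gm q" if n: "1 < norm x" "norm x <= 2" for x
 proof -
  have K: "c - \<delta> <= K x" "K x <= c" using Kb[of x] n by auto
  have q: "1 <= q (K x)" using q1 K by auto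
  have "norm (sgn x) = 1" using n by (auto simp: norm_sgn)
  then have "(fst (snd (e2 x)))^2 + (norm (snd (snd (e2 x))))^2 = gm (K x)"
   using R3_props(4)[of "sgn x"] g0[OF K] by (simp add: e2_def power_mult_distrib flip: distrib_left)
  then show ?thesis using K q c r0 unfolding Cap_def Chain_def ro_def[symmetric]
   by (auto simp: case_prod_unfold min_def e2_def cap_gam_def cap_q_def)
    (smt (verit) zero_le_power2)+
 qed
 have im: "e ` cball 0 2 \<subseteq> Cap a c gm q" using mem1 mem2 by (auto simp: e_def)
 have sur1: "EX x. norm x < 1 & e1 x = p" if p: "p \<in> Cap a c gm q" "c < fst p" for p
 proof -
  obtain H s u where pp: "p = (H,s,u)" by (metis surj_pair)
  obtain x0 where x0: "R3 x0 = (s,u)" using R3_props(3) by blast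
  have "1 <= q c" using q1[of c] c by auto
  then have e: "s^2 + (cmod u)^2 = ro^2 - (H - c)^2" "c < H"
   using p r0 unfolding Cap_def Chain_def pp by (auto simp: cap_gam_def cap_q_def min_def) (smt (verit) zero_le_power2)
  then have n0: "(norm x0)^2 = ro^2 - (H - c)^2" using R3_props(4)[of x0] x0 by simp
  define x where "x = (1/ro) *\<^sub>R x0"
  have nx: "(norm x)^2 = 1 - ((H - c)/ro)^2"
  proof -
   have "(norm x)^2 = (norm x0)^2/ro^2" using r0 by (simp add: x_def power_divide)
   then show ?thesis
    unfolding n0 power_divide diff_divide_distrib[of "ro^2"] using r0(1) by simp
  qed
  have "0 < (H - c)/ro" using e r0 by auto
  then have "(norm x)^2 < 1" "sqrt (1 - (norm x)^2) = (H - c)/ro"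
   unfolding nx using e r0 by auto
  then have "norm x < 1" "e1 x = p" using r0 x0 pp
   by (auto simp: abs_square_less_1 e1_def x_def R3_props)
  then show ?thesis by blast
 qed
 have sur2: "EX x. 1 <= norm x & norm x < 2 & e x = p" if p: "p \<in> Cap a c gm q" "c - \<delta> < fst p" "fst p <= c" for p
 proof -
  obtain H s u where pp: "p = (H,s,u)" by (metis surj_pair)
  obtain x0 where x0: "R3 x0 = (s,u)" using R3_props(3) by blast
  have Hb: "c - \<delta> < H" "H <= c" using p pp by auto
  have gH: "0 < gm H" "1 <= q H" using g0[of H] q1[of H] Hb by auto
  then have e: "s^2 + (cmod u)^2 = gm H"
   using p Hb unfolding Cap_def Chain_def pp by (auto simp: cap_gam_def cap_q_def min_def) (smt (verit) zero_le_power2)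
  then have n0: "(norm x0)^2 = gm H" using R3_props(4)[of x0] x0 by simp
  then have n0': "norm x0 = sqrt (gm H)" by (metis norm_ge_zero real_sqrt_unique)
  define r where "r = 1 + (c - H)/\<delta>"
  have r: "1 <= r" "r < 2" using Hb c by (auto simp: r_def field_simps)
  define x where "x = (r/sqrt (gm H)) *\<^sub>R x0"
  have nx: "norm x = r" using gH r n0' by (simp add: x_def)
  have Kx: "K x = H" using c by (simp add: K_def nx r_def)
  have sx: "sgn x = (1/sqrt (gm H)) *\<^sub>R x0" using r gH by (simp add: sgn_div_norm nx, simp add: x_def)
  have e2: "e2 x = p" unfolding e2_def Kx sx using gH x0 pp by (simp add: R3_props)
  have "e x = p"
  proof (cases "r = 1")
   case True
   then have "H = c" using c by (simp add: r_def)
   then have "e1 x = e2 x" using nx True by (simp add: e1_def e2_def K_def ro_def sgn_div_norm)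
   then show ?thesis using e2 by (simp add: e_def)
  qed (use e2 r nx in \<open>auto simp: e_def\<close>)
  then show ?thesis using nx r by blast
 qed
 have i1: "e ` ball 0 1 = {p \<in> Cap a c gm q. c < fst p}"
 proof (intro equalityI subsetI)
  fix p assume "p \<in> e ` ball 0 1"
  then show "p \<in> {p \<in> Cap a c gm q. c < fst p}"
   using mem1 fst1 by (auto simp: e_def) (metis order_le_less less_irrefl)
 next
  fix p assume "p \<in> {p \<in> Cap a c gm q. c < fst p}"
  then obtain x where "norm x < 1" "e1 x = p" using sur1 by blast
  then show "p \<in> e ` ball 0 1" by (intro image_eqI[of _ _ x]) (auto simp: e_def)
 qed
 have i2: "e ` ball 0 2 = {p \<in> Cap a c gm q. c - \<delta> < fst p}"
 proof (intro equalityI subsetI)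
  fix p assume "p \<in> e ` ball 0 2"
  then obtain x where x: "norm x < 2" "p = e x" by auto
  then have "p \<in> Cap a c gm q" using im by auto
  moreover have "c - \<delta> < fst p"
  proof (cases "norm x <= 1")
   case True then show ?thesis using fst1(1)[of x] x c by (auto simp: e_def)
  next
   case False
   then have "\<delta>*(norm x - 1) < \<delta>*1" using x c by (intro mult_strict_left_mono) auto
   then show ?thesis using False x by (auto simp: e_def e2_def K_def)
  qed
  ultimately show "p \<in> {p \<in> Cap a c gm q. c - \<delta> < fst p}" by simp
 next
  fix p assume p: "p \<in> {p \<in> Cap a c gm q. c - \<delta> < fst p}"
  show "p \<in> e ` ball 0 2"
  proof (cases "fst p <= c")
   case True
   then obtain x where "norm x < 2" "e x = p" using sur2[of p] p by auto
   then show ?thesis by (intro image_eqI[of _ _ x]) auto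
  next
   case False
   then obtain x where "norm x < 1" "e1 x = p" using sur1[of p] p by auto
   then show ?thesis by (intro image_eqI[of _ _ x]) (auto simp: e_def)
  qed
 qed
 have "\<forall>x\<in>sphere 0 1. e x = (c, sqrt (gm c) *\<^sub>R R3 x)" by (auto simp: e_def e1_def ro_def)
 then show ?thesis using ce inj im i1 i2 by blast
qed

lemma chain_data_reflect:
 "chain_data a b gm q ==> chain_data (- b) (- a) (%H. gm (- H)) (%H. q (- H))"
proof -
 assume d: "chain_data a b gm q"
 have "continuous_on {- b..- a} (%H. gm (- H))" "continuous_on {- b..- a} (%H. q (- H))"
  using d by (auto simp: chain_data_def intro!: continuous_on_compose2[of _ _ _ uminus] continuous_intros)
 then show ?thesis using d by (auto simp: chain_data_def)
qed

text \<open>A linear embedding into the phase space, with left inverse \<open>J'\<close>; it puts the summands of a connected sum on one type.\<close>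

definition J :: "real \<times> real \<times> complex => phase" where
 "J = (%(H, s, u). (H *\<^sub>R axis 1 1 + s *\<^sub>R axis 2 1 + Re u *\<^sub>R axis 3 1, Im u *\<^sub>R axis 1 1))"

definition J' :: "phase => real \<times> real \<times> complex" where
 "J' = (%(M, al). (M$1, M$2, Complex (M$3) (al$1)))"

lemma J'_J [simp]: "J' (J p) = p"
 by (cases p) (simp add: J_def J'_def axis_def complex_eq_iff)

lemma continuous_on_J: "continuous_on S J" "continuous_on S' J'"
 unfolding J_def J'_def case_prod_unfold by (intro continuous_intros)+

lemma J_eq_iff [simp]: "J p = J p' \<longleftrightarrow> p = p'"
 by (metis J'_J)

lemma homeomorphic_J: "J ` S homeomorphic S"
 unfolding homeomorphic_def homeomorphism_def
 by (intro exI[of _ J'] exI[of _ J]) (auto simp: image_comp comp_def continuous_on_J)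

text \<open>Reversing \<open>H\<close>, to treat the part of a chain above a cut like the part below.\<close>
definition flip :: "real \<times> real \<times> complex => real \<times> real \<times> complex" where
 "flip = (%(H, s, u). (- H, s, u))"

lemma flip_flip [simp]: "flip (flip p) = p" and fst_flip [simp]: "fst (flip p) = - fst p"
 and flip_eq_iff [simp]: "flip p = flip p' \<longleftrightarrow> p = p'"
 by (cases p; cases p'; auto simp: flip_def)+

text \<open>Where \<open>q \<ge> 1\<close>, the section of a chain by \<open>H = c\<close> is a sphere with a collar; cutting along it splits off
 summands.\<close>
lemma chain_connected_sum:
 fixes T :: "'b topology"
 assumes d: "chain_data a b gm q" and c: "a < c - \<delta>" "c + \<delta> < b" "0 < \<delta>"
  and q1: "!!H. c - \<delta> <= H ==> H <= c + \<delta> ==> 1 <= q H"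
  and T: "T homeomorphic_space top_of_set (Chain a b gm q)"
 shows "is_connected_sum (top_of_set (J ` Cap a c gm q))
  (top_of_set (J ` Cap (- b) (- c) (%H. gm (- H)) (%H. q (- H)))) T"
proof -
 let ?C = "Chain a b gm q" and ?Y = "Cap a c gm q" and ?Z = "Cap (- b) (- c) (%H. gm (- H)) (%H. q (- H))"
 have g0: "0 < gm c" using d c by (auto simp: chain_data_def)
 obtain \<phi> where \<phi>: "homeomorphic_map (top_of_set ?C) T \<phi>"
  using T homeomorphic_space_sym homeomorphic_space by blast
 have hT: "Hausdorff_space T"
  using T by (simp add: homeomorphic_Hausdorff_space[OF T] Hausdorff_space_subtopology)
 have \<phi>c: "continuous_map (top_of_set ?C) T \<phi>" "\<phi> ` ?C = topspace T" "inj_on \<phi> ?C"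
  using homeomorphic_imp_continuous_map[OF \<phi>] homeomorphic_imp_surjective_map[OF \<phi>]
   homeomorphic_imp_injective_map[OF \<phi>] by simp_all
 have cb: "c < b" and q1': "!!H. c - \<delta> <= H ==> H <= c ==> 1 <= q H" using c q1 by auto
 obtain e where e0: "continuous_on (cball 0 2) e & inj_on e (cball 0 2) & e ` cball 0 2 \<subseteq> ?Y &
  e ` ball 0 2 = {p \<in> ?Y. c - \<delta> < fst p} & e ` ball 0 1 = {p \<in> ?Y. c < fst p} &
  (\<forall>x\<in>sphere 0 1. e x = (c, sqrt (gm c) *\<^sub>R R3 x))"
  using cap_chart[OF d c(1,3) cb q1'] by (rule exE)
 note e = e0[THEN conjunct1] e0[THEN conjunct2, THEN conjunct1] e0[THEN conjunct2, THEN conjunct2, THEN conjunct1] e0[THEN conjunct2, THEN conjunct2, THEN conjunct2, THEN conjunct1] e0[THEN conjunct2, THEN conjunct2, THEN conjunct2, THEN conjunct2, THEN conjunct1]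
  e0[THEN conjunct2, THEN conjunct2, THEN conjunct2, THEN conjunct2, THEN conjunct2]
 have c': "- b < - c - \<delta>" "0 < \<delta>" "- c < - a" and q1'': "!!H. - c - \<delta> <= H ==> H <= - c ==> 1 <= q (- H)"
  using c q1 by auto
 obtain f where f0: "continuous_on (cball 0 2) f & inj_on f (cball 0 2) & f ` cball 0 2 \<subseteq> ?Z &
  f ` ball 0 2 = {p \<in> ?Z. - c - \<delta> < fst p} & f ` ball 0 1 = {p \<in> ?Z. - c < fst p} &
  (\<forall>x\<in>sphere 0 1. f x = (- c, sqrt (gm (- (- c))) *\<^sub>R R3 x))"
  using cap_chart[OF chain_data_reflect[OF d] c' q1''] by (rule exE)
 note f = f0[THEN conjunct1] f0[THEN conjunct2, THEN conjunct1] f0[THEN conjunct2, THEN conjunct2, THEN conjunct1] f0[THEN conjunct2, THEN conjunct2, THEN conjunct2, THEN conjunct1] f0[THEN conjunct2, THEN conjunct2, THEN conjunct2, THEN conjunct2, THEN conjunct1]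
  f0[THEN conjunct2, THEN conjunct2, THEN conjunct2, THEN conjunct2, THEN conjunct2]
 have part: "{p \<in> Cap a c gm q. fst p <= c} = {p \<in> Chain a b gm q. fst p <= c}"
  if "0 < gm c" "c < b" for a b c :: real and gm q
  using that real_sqrt_gt_zero[OF that(1)]
  by (auto simp: Cap_def Chain_def cap_gam_def cap_q_def simp del: real_sqrt_gt_0_iff)
 have partY: "{p \<in> ?Y. fst p <= c} = {p \<in> ?C. fst p <= c}" using part g0 c by auto
 have partZ: "{p \<in> ?Z. fst p <= - c} = {p. flip p \<in> ?C & fst p <= - c}"
  using part[of "%H. gm (- H)" "- c" "- a"] g0 c by (auto simp: Chain_def flip_def)
 have diff: "J ` S - (J \<circ> g) ` ball 0 1 = J ` {p \<in> S. fst p <= t}" if "g ` ball 0 1 = {p \<in> S. t < fst p}"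
  for S t and g :: "real^3 => _"
 proof -
  have "(J \<circ> g) ` ball 0 1 = J ` {p \<in> S. t < fst p}" using that by (metis image_comp)
  moreover have "J ` S - J ` {p \<in> S. t < fst p} = J ` (S - {p \<in> S. t < fst p})"
   by (rule image_set_diff[symmetric]) (simp add: inj_def)
  moreover have "S - {p \<in> S. t < fst p} = {p \<in> S. fst p <= t}" by auto
  ultimately show ?thesis by simp
 qed
 have cont: "continuous_map (top_of_set (J ` {p \<in> S. fst p <= t})) T (\<phi> \<circ> h \<circ> J')"
  if h: "continuous_on UNIV h" "!!p. p \<in> S ==> fst p <= t ==> h p \<in> ?C" for S t h
 proof -
  have "continuous_on (J ` {p \<in> S. fst p <= t}) (h \<circ> J')"
   by (intro continuous_on_compose continuous_on_J continuous_on_subset[OF h(1)]) auto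
  then have "continuous_map (top_of_set (J ` {p \<in> S. fst p <= t})) (top_of_set ?C) (h \<circ> J')"
   using h(2) by (auto simp: continuous_map_in_subtopology)
  from continuous_map_compose[OF this \<phi>c(1)] show ?thesis by (simp only: comp_assoc)
 qed
 have opn: "openin (top_of_set (J ` S)) (J ` {p \<in> S. t < fst p})" for S t
 proof -
  have "open {p :: real \<times> real \<times> complex. t < fst p}" by (intro open_Collect_less continuous_intros)
  then have "open (J' -` {p. t < fst p})" by (rule open_vimage[OF _ continuous_on_J(2)])
  moreover have "J ` {p \<in> S. t < fst p} = J ` S \<inter> J' -` {p. t < fst p}" by auto
  ultimately show ?thesis by (simp only: openin_open_Int)
 qed
 have flipc: "continuous_on UNIV flip" unfolding flip_def case_prod_unfold by (intro continuous_intros)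
 have cpt: "compact (J ` Cap a c gm q)" if "chain_data a b gm q" "a < c" "c < b" "0 < q c" for a b c gm q
  unfolding Cap_def
  by (rule compact_continuous_image[OF continuous_on_J(1) compact_Chain[OF chain_data_cap[OF that]]])
 show ?thesis
 proof (rule is_connected_sumI[where e = "J \<circ> e" and f = "J \<circ> f" and pY = "\<phi> \<circ> id \<circ> J'" and pZ = "\<phi> \<circ> flip \<circ> J'"])
  show "compact (J ` ?Y)" using cpt[OF d] c q1[of c] by auto
  show "compact (J ` ?Z)" using cpt[OF chain_data_reflect[OF d]] c q1[of c] by auto
  show "continuous_on (cball 0 2) (J \<circ> e)" "continuous_on (cball 0 2) (J \<circ> f)"
   by (intro continuous_on_compose e f continuous_on_J)+
  show "inj_on (J \<circ> e) (cball 0 2)" "inj_on (J \<circ> f) (cball 0 2)"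
   using e(2) f(2) by (auto simp: inj_on_def)
  show "(J \<circ> e) ` cball 0 2 \<subseteq> J ` ?Y" "(J \<circ> f) ` cball 0 2 \<subseteq> J ` ?Z" using e(3) f(3) by auto
  show "openin (top_of_set (J ` ?Y)) ((J \<circ> e) ` ball 0 2)" "openin (top_of_set (J ` ?Z)) ((J \<circ> f) ` ball 0 2)"
   unfolding image_comp[symmetric] e(4) f(4) by (rule opn)+
  show "continuous_map (top_of_set (J ` ?Y - (J \<circ> e) ` ball 0 1)) T (\<phi> \<circ> id \<circ> J')"
   unfolding diff[OF e(5)] by (rule cont) (use partY in \<open>auto\<close>)
  show "continuous_map (top_of_set (J ` ?Z - (J \<circ> f) ` ball 0 1)) T (\<phi> \<circ> flip \<circ> J')"
   unfolding diff[OF f(5)] by (rule cont) (use partZ flipc in \<open>auto\<close>)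
  show "inj_on (\<phi> \<circ> id \<circ> J') (J ` ?Y - (J \<circ> e) ` ball 0 1)"
   unfolding diff[OF e(5)] partY using \<phi>c(3) by (auto simp: inj_on_def)
  show "inj_on (\<phi> \<circ> flip \<circ> J') (J ` ?Z - (J \<circ> f) ` ball 0 1)"
   unfolding diff[OF f(5)] partZ
  proof (rule inj_onI)
   fix y z assume "y \<in> J ` {p. flip p \<in> ?C & fst p <= - c}" "z \<in> J ` {p. flip p \<in> ?C & fst p <= - c}"
    and eq: "(\<phi> \<circ> flip \<circ> J') y = (\<phi> \<circ> flip \<circ> J') z"
   then obtain p p' where p: "y = J p" "flip p \<in> ?C" "z = J p'" "flip p' \<in> ?C" by blast
   then have "flip p = flip p'" using eq by (intro inj_onD[OF \<phi>c(3)]) simp_all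
   then show "y = z" using p by simp
  qed
  show "topspace T \<subseteq> (\<phi> \<circ> id \<circ> J') ` (J ` ?Y - (J \<circ> e) ` ball 0 1) \<union> (\<phi> \<circ> flip \<circ> J') ` (J ` ?Z - (J \<circ> f) ` ball 0 1)"
   unfolding diff[OF e(5)] diff[OF f(5)] partY partZ
  proof
   fix t assume "t \<in> topspace T"
   then obtain p where p: "p \<in> ?C" "t = \<phi> p" using \<phi>c(2) by blast
   show "t \<in> (\<phi> \<circ> id \<circ> J') ` J ` {p \<in> ?C. fst p <= c} \<union> (\<phi> \<circ> flip \<circ> J') ` J ` {p. flip p \<in> ?C & fst p <= - c}"
   proof (cases "fst p <= c")
    case True then show ?thesis using p by (intro UnI1 image_eqI[of _ _ "J p"]) auto
   next
    case False then show ?thesis using p by (intro UnI2 image_eqI[of _ _ "J (flip p)"]) auto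
   qed
  qed
  fix y z assume "y \<in> J ` ?Y - (J \<circ> e) ` ball 0 1" "z \<in> J ` ?Z - (J \<circ> f) ` ball 0 1"
  then obtain p p' where p: "y = J p" "p \<in> ?C" "fst p <= c" and p': "z = J p'" "flip p' \<in> ?C" "fst p' <= - c"
   unfolding diff[OF e(5)] diff[OF f(5)] partY partZ by blast
  have "(\<phi> \<circ> id \<circ> J') y = (\<phi> \<circ> flip \<circ> J') z \<longleftrightarrow> p = flip p'"
   using p p' inj_onD[OF \<phi>c(3), of p "flip p'"] by auto
  also have "... \<longleftrightarrow> (\<exists>x\<in>sphere 0 1. p = e x & p' = f x)"
  proof
   assume pp: "p = flip p'"
   then have fc: "fst p = c" using p p' by auto
   obtain s u where su: "p = (c, s, u)" using fc by (cases p) auto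
   have su2: "s^2 + (cmod u)^2 = gm c"
    using p(2) q1[of c] c unfolding su Chain_def by (auto simp: min_def) (smt (verit) zero_le_power2)
   obtain x0 where x0: "R3 x0 = (s,u)" using R3_props(3) by blast
   have n0: "(norm x0)^2 = gm c" using R3_props(4)[of x0] x0 su2 by simp
   then have n0': "norm x0 = sqrt (gm c)" by (metis norm_ge_zero real_sqrt_unique)
   define x where "x = (1/sqrt (gm c)) *\<^sub>R x0"
   have "x \<in> sphere 0 1" using n0' g0 by (simp add: x_def)
   moreover have "sqrt (gm c) *\<^sub>R R3 x = (s,u)" using g0 x0 by (simp add: x_def R3_props)
   ultimately show "\<exists>x\<in>sphere 0 1. p = e x & p' = f x"
    using e(6) f(6) su pp
    by (intro bexI[of _ x]) (simp_all add: flip_def split: prod.splits)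
  next
   assume "\<exists>x\<in>sphere 0 1. p = e x & p' = f x"
   then show "p = flip p'" using e(6) f(6) by (auto simp: flip_def split: prod.splits)
  qed
  also have "... \<longleftrightarrow> (\<exists>x\<in>sphere 0 1. y = (J \<circ> e) x & z = (J \<circ> f) x)" using p p' by auto
  finally show "(\<phi> \<circ> id \<circ> J') y = (\<phi> \<circ> flip \<circ> J') z \<longleftrightarrow> (\<exists>x\<in>sphere 0 1. y = (J \<circ> e) x & z = (J \<circ> f) x)" .
 qed (rule hT)
qed

text \<open>\<open>pat s p [x\<^sub>0, ..., x\<^sub>n]\<close>: the function \<open>p\<close> vanishes at \<open>x\<^sub>1, ..., x\<^sub>n\<^sub>-\<^sub>1\<close>, it has sign \<open>s\<close> between \<open>x\<^sub>0\<close> and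
 \<open>x\<^sub>1\<close>, alternates between successive intervals, and at \<open>x\<^sub>n\<close> it has the sign of the last interval.\<close>

fun pat :: "real => (real => real) => real list => bool" where
 "pat s p [x, y] \<longleftrightarrow> x < y & (ALL t. x < t --> t < y --> sgn (p t) = s) & sgn (p y) = s"
| "pat s p (x # y # z # zs) \<longleftrightarrow> x < y & (ALL t. x < t --> t < y --> sgn (p t) = s) & p y = 0 & pat (- s) p (y # z # zs)"
| "pat s p [] = False"
| "pat s p [x] = False"

lemma pat_less: "pat s p (x # xs) ==> x < last (x # xs)"
 by (induction s p "x # xs" arbitrary: x xs rule: pat.induct) force+

lemma pat_sim:
 "pat s p xs ==> pat s P ys ==> length xs = length ys ==> sgn (p (hd xs)) = sgn (P (hd ys)) ==>
 sim p (hd xs) (last xs) P (hd ys) (last ys)"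
proof (induction s p xs arbitrary: ys rule: pat.induct)
 case (1 s p x y)
 then have "length ys = Suc (Suc 0)" by simp
 then obtain x' y' where ys: "ys = [x',y']" by (auto simp: length_Suc_conv)
 show ?case using 1 unfolding ys by (auto intro!: sim_const)
next
 case (2 s p x y z zs)
 then have "length ys = Suc (Suc (Suc (length zs)))" by simp
 then obtain x' y' z' zs' where ys: "ys = x' # y' # z' # zs'" by (auto simp: length_Suc_conv)
 have "sim p y (last (y # z # zs)) P y' (last (y' # z' # zs'))"
  using 2(1)[of "y' # z' # zs'"] 2(2-) unfolding ys by auto
 moreover have "sim p x y P x' y'" using 2(2-) unfolding ys by (auto intro!: sim_const)
 ultimately show ?case
  using sim_glue[of x y "last (y # z # zs)"] 2(2) pat_less[of "- s" p y "z # zs"] unfolding ys by auto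
qed auto

lemma Mod_sim:
 assumes "sim P (-1) 1 P' (-1) 1" "continuous_on {-1..1} P" "continuous_on {-1..1} P'"
 shows "Mod P homeomorphic Mod P'"
 unfolding Mod_def[of P]
proof (rule lens_homeomorphic_Mod[where a = "-1" and b = 1 and \<beta> = "%x. sqrt (1 - x^2)" and p = P])
 have iff: "\<bar>h\<bar> <= sqrt (1 - x^2) \<longleftrightarrow> x^2 + h^2 <= 1" if "\<bar>x\<bar> <= 1" for x h :: real
  using real_sqrt_le_iff[of "h^2" "1 - x^2"] by (simp add: algebra_simps)
 show "disc = {(x, h). - 1 <= x & x <= 1 & \<bar>h\<bar> <= sqrt (1 - x^2)}"
 proof (intro set_eqI, clarify, intro iffI)
  fix x h assume "(x, h) \<in> disc"
  then show "(x, h) \<in> {(x, h). - 1 <= x & x <= 1 & \<bar>h\<bar> <= sqrt (1 - x^2)}" using disc_abs[of x h] by auto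
 next
  fix x h :: real assume "(x, h) \<in> {(x, h). - 1 <= x & x <= 1 & \<bar>h\<bar> <= sqrt (1 - x^2)}"
  then show "(x, h) \<in> disc" using iff[of x h] by (auto simp: disc_def)
 qed
 show "0 < sqrt (1 - x^2)" if "- 1 < x" "x < 1" for x :: real using that by (auto simp: abs_square_less_1)
 show "0 <= (case v of (x, h) => 1 - x^2 - h^2 + max 0 (- P x))"
  "0 <= (case v of (x, h) => 1 - x^2 - h^2 + max 0 (P x))" if "v \<in> disc" for v
  using disc_Mod_nonneg[OF that, of P] disc_Mod_nonneg[OF that, of "%x. - P x"] by auto
 fix x h assume d: "(x, h) \<in> disc"
 have "\<bar>h\<bar> = sqrt (1 - x^2) \<longleftrightarrow> x^2 + h^2 = 1"
  using real_sqrt_eq_iff[of "h^2" "1 - x^2"] by auto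
 then show "((case (x, h) of (x, h) => 1 - x^2 - h^2 + max 0 (- P x)) = 0) = (\<bar>h\<bar> = sqrt (1 - x^2) & 0 <= P x)"
  "((case (x, h) of (x, h) => 1 - x^2 - h^2 + max 0 (P x)) = 0) = (\<bar>h\<bar> = sqrt (1 - x^2) & P x <= 0)"
  using d by (auto simp: disc_def max_def)
qed (use assms continuous_on_disc_Mod in \<open>auto intro!: continuous_intros\<close>)

lemma chain_data_ends:
 assumes "chain_data a b gm q" shows "0 < q a" "0 < q b"
proof -
 have "a \<in> {a..b}" "b \<in> {a..b}" using assms by (auto simp: chain_data_def)
 then have "0 < gm a + q a" "0 < gm b + q b" "gm a = 0" "gm b = 0" using assms unfolding chain_data_def by blast+
 then show "0 < q a" "0 < q b" by simp_all
qed

text \<open>The function \<open>q\<close> is compared with \<open>t^2 - 1/4\<close> on \<open>{-1..1}\<close>, whose hole ends at \<open>\<plusminus>1/2\<close>, the abscissa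
 \<open>\<surd>(3/4)\<close> on the unit circle.\<close>
lemma chain_one_hole:
 assumes d: "chain_data a b gm q" and p: "pat 1 q [a, c, c', b]"
 shows "top_of_set (Chain a b gm q) homeomorphic_space S2xS1"
proof -
 define Q where "Q t = t^2 - 1/4" for t :: real
 define P where "P X = X*(sqrt (3/4) - X)" for X
 have q2: "t^2 < 1/4 \<longleftrightarrow> \<bar>t\<bar> < 1/2" "1/4 < t^2 \<longleftrightarrow> 1/2 < \<bar>t\<bar>" for t :: real
  using abs_le_square_iff[of "1/2" t] abs_le_square_iff[of t "1/2"] by (auto simp: power2_eq_square not_le[symmetric])
 have "sgn (Q t) = 1" if "1/2 < \<bar>t\<bar>" for t
  using q2(2)[of t] that by (simp add: Q_def del: less_divide_eq_numeral1)
 moreover have "sgn (Q t) = -1" if "\<bar>t\<bar> < 1/2" for t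
  using q2(1)[of t] that by (simp add: Q_def del: less_divide_eq_numeral1)
 moreover have "\<bar>t\<bar> < 1/2" if "-1/2 < t" "t < 1/2" for t :: real using that by arith
 ultimately have "pat 1 Q [-1, -1/2, 1/2, 1]" unfolding pat.simps by (auto simp: Q_def power2_eq_square)
 moreover have "0 < q a" using d by (rule chain_data_ends)
 ultimately have "sim q a b Q (-1) 1" using pat_sim[OF p, of Q "[-1, -1/2, 1/2, 1]"] by (auto simp: Q_def)
 then obtain \<theta> where th: "continuous_on {a..b} \<theta>" "strict_mono_on {a..b} \<theta>" "\<theta> a = -1" "\<theta> b = 1"
  "!!x. x\<in>{a..b} ==> sgn (q x) = sgn (Q (\<theta> x))" unfolding sim_def by blast
 have cP: "continuous_on {-1..1} P" unfolding P_def by (intro continuous_intros)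
 have r: "0 < sqrt (3/4)" "sqrt (3/4) < 1" "(sqrt (3/4))^2 = 3/4" by auto
 have "Chain a b gm q homeomorphic Mod P"
 proof (rule Chain_homeomorphic_Mod[OF d th(1-4) _ cP])
  fix H assume H: "a < H" "H < b"
  have "-1 < \<theta> H" "\<theta> H < 1"
   using strict_mono_onD[OF th(2), of a H] strict_mono_onD[OF th(2), of H b] H th by auto
  then have R: "0 < sqrt (1 - (\<theta> H)^2)" by (auto simp: abs_square_less_1)
  have "sgn (Q (\<theta> H)) = sgn (sqrt (3/4) - sqrt (1 - (\<theta> H)^2))"
   by (auto simp: Q_def sgn_if)
  then show "sgn (q H) = sgn (P (sqrt (1 - (\<theta> H)^2)))"
   using th(5)[of H] H R unfolding P_def sgn_mult by simp
 next
  show "P x < 0" if "- 1 <= x" "x < 0" for x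
   using that r unfolding P_def by (intro mult_neg_pos) linarith+
  show "P 0 = 0" by (simp add: P_def)
 qed
 moreover have "Mod P homeomorphic Mod (%x. 1/2 - x^2)"
 proof (rule Mod_sim[OF _ cP])
  have "pat (-1) (%X. X*(r - X)) [-1, 0, r, 1]" if "0 < r" "r < 1" for r :: real
   using that by (auto simp: sgn_mult sgn_pos sgn_neg)
  from this[OF r(1,2)] have p1: "pat (-1) P [-1, 0, sqrt (3/4), 1]" by (simp only: P_def[abs_def])
  have "pat (-1) (%x. (r - x)*(r + x)) [-1, - r, r, 1]" if "0 < r" "r < 1" for r :: real
   using that by (auto simp: sgn_mult sgn_pos sgn_neg)
  from this[of "sqrt (1/2)"] have "pat (-1) (%x. (sqrt (1/2) - x)*(sqrt (1/2) + x)) [-1, - sqrt (1/2), sqrt (1/2), 1]"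
   by simp
  moreover have "(%x. (sqrt (1/2) - x)*(sqrt (1/2) + x)) = (%x. 1/2 - x^2)"
   by (rule ext) (simp add: algebra_simps power2_eq_square del: real_sqrt_divide)
  ultimately have "pat (-1) (%x. 1/2 - x^2) [-1, - sqrt (1/2), sqrt (1/2), 1]" by simp
  with p1 show "sim P (-1) 1 (%x. 1/2 - x^2) (-1) 1"
   using pat_sim[of "-1" P "[-1, 0, sqrt (3/4), 1]" "%x. 1/2 - x^2" "[-1, - sqrt (1/2), sqrt (1/2), 1]"] r
   by (simp add: P_def sgn_mult sgn_if del: real_sqrt_divide)
 qed (intro continuous_intros)
 ultimately have "Chain a b gm q homeomorphic Mod (%x. 1/2 - x^2)" by (rule homeomorphic_trans)
 then show ?thesis using Mod_S2xS1 homeomorphic_space_top_of_set homeomorphic_space_trans by blast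
qed

lemma top_of_set_J: "top_of_set (J ` S) homeomorphic_space top_of_set S"
 by (rule homeomorphic_space_top_of_set[OF homeomorphic_J])

lemma sgn_sqrt_diff:
 assumes "\<bar>t\<bar> <= 1" "0 <= r" "r <= 1"
 shows "sgn (\<bar>t\<bar> - r) = sgn (sqrt (1 - r^2) - sqrt (1 - t^2))"
 using assms abs_le_square_iff[of t r] abs_le_square_iff[of r t] by (auto simp: sgn_if)

text \<open>Cutting a chain between its two holes.\<close>

text \<open>A function with signs -+-+ on \<open>{-1..1}\<close>. Its positive zeros are the abscissas of the points of the unit
 circle at heights \<open>1/3\<close> and \<open>2/3\<close>, the ends of the holes of a symmetric chain.\<close>
definition P2 :: "real => real" where "P2 X = X*(sqrt (1 - (1/3)^2) - X)*(sqrt (1 - (2/3)^2) - X)"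

lemma chain_two_holes:
 assumes d: "chain_data a b gm q" and p: "pat 1 q [a, x1, x2, y1, y2, b]"
  and c: "x2 < c - \<delta>" "c + \<delta> < y1" "0 < \<delta>" and q1: "!!H. c - \<delta> <= H ==> H <= c + \<delta> ==> 1 <= q H"
  and T: "T homeomorphic_space top_of_set (Chain a b gm q)"
 shows "is_N3 2 (T :: phase topology)"
proof -
 have o: "a < x1" "x1 < x2" "x2 < y1" "y1 < y2" "y2 < b" using p by auto
 have g0: "0 < sqrt (gm c)" "0 < sqrt (gm (- (- c)))" using d c o by (auto simp: chain_data_def)
 have qc: "0 < q c" using q1[of c] c by auto
 have qpos: "0 < q H" if "x2 < H" "H < y1" for H using p that by (auto simp: sgn_1_pos)
 let ?g = "%H. gm (- H)" and ?q = "%H. q (- H)"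
 have "is_connected_sum (top_of_set (J ` Cap a c gm q)) (top_of_set (J ` Cap (- b) (- c) ?g ?q)) T"
  by (rule chain_connected_sum[OF d _ _ c(3) q1 T]) (use o c in auto)
 moreover have A: "top_of_set (Cap a c gm q) homeomorphic_space S2xS1"
  unfolding Cap_def
 proof (rule chain_one_hole[OF chain_data_cap[OF d _ _ qc]])
  have "pat 1 (cap_q c q) [a, x1, x2, c + r]" if "0 < r" for r
   using p o c that qc qpos by (auto simp: cap_q_def sgn_1_pos sgn_1_neg)
  then show "pat 1 (cap_q c q) [a, x1, x2, c + sqrt (gm c)]" using g0(1) by blast
 qed (use o c in auto)
 moreover have B: "top_of_set (Cap (- b) (- c) ?g ?q) homeomorphic_space S2xS1"
  unfolding Cap_def
 proof (rule chain_one_hole[OF chain_data_cap[OF chain_data_reflect[OF d]]])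
  have qb: "0 < q b" using d by (rule chain_data_ends)
  have "pat 1 (cap_q (- c) ?q) [- b, - y2, - y1, - c + r]" if "0 < r" for r
   using p o c that qc qpos qb by (auto simp: cap_q_def sgn_1_pos sgn_1_neg)
  then show "pat 1 (cap_q (- c) ?q) [- b, - y2, - y1, - c + sqrt (?g (- c))]" using g0(2) by blast
 qed (use o c qc in auto)
 ultimately show ?thesis
  using is_N3.add[OF is_N3.one[OF homeomorphic_space_trans[OF top_of_set_J A]]
    homeomorphic_space_trans[OF top_of_set_J B]] by (simp add: numeral_2_eq_2)
qed

text \<open>Signs -+-+- on \<open>{-1..1}\<close>; the holes of the chain are \<open>|H| < 1/5\<close> and \<open>4/5 < |H| < 9/10\<close>.\<close>
definition P3 :: "real => real" where
 "P3 X = X*(sqrt (1 - (1/5)^2) - X)*(sqrt (1 - (4/5)^2) - X)*(sqrt (1 - (9/10)^2) - X)"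

lemma P23_props: "continuous_on {-1..1} P2" "continuous_on {-1..1} P3"
 "pat (-1) P2 [-1, 0, sqrt (1 - (2/3)^2), sqrt (1 - (1/3)^2), 1]"
 "pat (-1) P3 [-1, 0, sqrt (1 - (9/10)^2), sqrt (1 - (4/5)^2), sqrt (1 - (1/5)^2), 1]"
 "-1 <= x ==> x < 0 ==> P2 x < 0" "-1 <= x ==> x < 0 ==> P3 x < 0"
proof -
 have o2: "0 < sqrt (1 - (2/3)^2)" "sqrt (1 - (2/3)^2) < sqrt (1 - (1/3)^2)" "sqrt (1 - (1/3)^2) < 1"
  by (simp_all add: power2_eq_square del: real_sqrt_divide)
 have o3: "0 < sqrt (1 - (9/10)^2)" "sqrt (1 - (9/10)^2) < sqrt (1 - (4/5)^2)" "sqrt (1 - (4/5)^2) < sqrt (1 - (1/5)^2)"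
  "sqrt (1 - (1/5)^2) < 1"
  by (simp_all add: power2_eq_square del: real_sqrt_divide)
 show "continuous_on {-1..1} P2" "continuous_on {-1..1} P3"
  unfolding P2_def P3_def by (intro continuous_intros)+
 have P2: "P2 = (%X. X*(r1 - X)*(r2 - X))" if "r1 = sqrt (1 - (1/3)^2)" "r2 = sqrt (1 - (2/3)^2)" for r1 r2
  unfolding that by (rule ext) (simp only: P2_def)
 have P3: "P3 = (%X. X*(r1 - X)*(r2 - X)*(r3 - X))"
  if "r1 = sqrt (1 - (1/5)^2)" "r2 = sqrt (1 - (4/5)^2)" "r3 = sqrt (1 - (9/10)^2)" for r1 r2 r3
  unfolding that by (rule ext) (simp only: P3_def)
 note sgns = sgn_mult sgn_pos sgn_neg
 have g2: "pat (-1) (%X. X*(r1 - X)*(r2 - X)) [-1, 0, r2, r1, 1]" if "0 < r2" "r2 < r1" "r1 < 1" for r1 r2 :: real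
  using that by (auto simp: sgns)
 have g3: "pat (-1) (%X. X*(r1 - X)*(r2 - X)*(r3 - X)) [-1, 0, r3, r2, r1, 1]"
  if "0 < r3" "r3 < r2" "r2 < r1" "r1 < 1" for r1 r2 r3 :: real
  using that by (auto simp: sgns)
 show "pat (-1) P2 [-1, 0, sqrt (1 - (2/3)^2), sqrt (1 - (1/3)^2), 1]"
  by (subst P2[OF refl refl]) (rule g2[OF o2])
 show "pat (-1) P3 [-1, 0, sqrt (1 - (9/10)^2), sqrt (1 - (4/5)^2), sqrt (1 - (1/5)^2), 1]"
  by (subst P3[OF refl refl refl]) (rule g3[OF o3])
 show "P2 x < 0" "P3 x < 0" if "-1 <= x" "x < 0"
 proof -
  show "P2 x < 0" unfolding P2_def using that o2 by (intro mult_neg_pos) linarith+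
  show "P3 x < 0" unfolding P3_def using that o3 by (intro mult_neg_pos) linarith+
 qed
qed

lemma Mod_N3_2:
 assumes T: "T homeomorphic_space top_of_set (Mod P2)"
 shows "is_N3 2 (T :: phase topology)"
proof -
 (* The factors 9 and 18 ensure gm + q > 0 and q \<ge> 1 near the cut H = 0. *)
 define gm where "gm t = 9*(1 - t^2)" for t :: real
 define q where "q t = 18*(\<bar>t\<bar> - 1/3)*(\<bar>t\<bar> - 2/3)" for t :: real
 have d: "chain_data (-1) 1 gm q"
  unfolding chain_data_def
 proof (intro conjI ballI allI impI)
  show "continuous_on {-1..1} gm" "continuous_on {-1..1} q" unfolding gm_def q_def by (intro continuous_intros)+
  show "0 < gm H" if "-1 < H" "H < 1" for H using that by (auto simp: gm_def abs_square_less_1)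
  fix H :: real assume "H \<in> {-1..1}"
  then have "\<bar>H\<bar> <= 1" by auto
  moreover have "gm H + q H = 9*\<bar>H\<bar>*\<bar>H\<bar> - 18*\<bar>H\<bar> + 13"
   by (simp add: gm_def q_def algebra_simps power2_eq_square)
  moreover have "0 < 9*\<bar>H\<bar>*\<bar>H\<bar> - 18*\<bar>H\<bar> + 13"
   using zero_le_power2[of "\<bar>H\<bar> - 1"] unfolding power2_eq_square by (simp add: algebra_simps)
  ultimately show "0 < gm H + q H" by simp
 qed (auto simp: gm_def)
 have "Chain (-1) 1 gm q homeomorphic Mod P2"
 proof (rule Chain_homeomorphic_Mod[OF d, where \<theta> = id])
  fix H :: real assume H: "-1 < H" "H < 1"
  then have R: "0 < sqrt (1 - H^2)" by (auto simp: abs_square_less_1)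
  have "sgn (\<bar>H\<bar> - 1/3) = sgn (sqrt (1 - (1/3)^2) - sqrt (1 - H^2))"
   "sgn (\<bar>H\<bar> - 2/3) = sgn (sqrt (1 - (2/3)^2) - sqrt (1 - H^2))"
   by (rule sgn_sqrt_diff; use H in simp)+
  then show "sgn (q H) = sgn (P2 (sqrt (1 - (id H)^2)))"
   using R unfolding q_def P2_def sgn_mult id_apply by (simp add: sgn_pos)
 qed (use P23_props in \<open>auto intro: strict_mono_onI simp: P2_def\<close>)
 then have T': "T homeomorphic_space top_of_set (Chain (-1) 1 gm q)"
  using T homeomorphic_space_top_of_set homeomorphic_space_sym homeomorphic_space_trans by blast
 show ?thesis
 proof (rule chain_two_holes[OF d _ _ _ _ _ T', where c = 0 and \<delta> = "1/10"])
  show "pat 1 q [-1, -2/3, -1/3, 1/3, 2/3, 1]"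
  proof -
   have "sgn (q t) = 1" if "\<bar>t\<bar> < 1/3 | 2/3 < \<bar>t\<bar>" for t
    using that by (auto simp: q_def sgn_mult sgn_pos sgn_neg)
   moreover have "sgn (q t) = -1" if "1/3 < \<bar>t\<bar>" "\<bar>t\<bar> < 2/3" for t
    using that by (auto simp: q_def sgn_mult sgn_pos sgn_neg)
   moreover have "q (1/3) = 0" "q (- (1/3)) = 0" "q (2/3) = 0" "q (- (2/3)) = 0" by (simp_all add: q_def)
   moreover have "\<bar>t\<bar> < 1/3" if "- (1/3) < t" "t < 1/3" for t :: real using that by arith
   ultimately show ?thesis by auto
  qed
  show "1 <= q H" if "0 - 1/10 <= H" "H <= 0 + 1/10" for H
  proof -
   have "(7/30)*(17/30) <= (1/3 - \<bar>H\<bar>)*(2/3 - \<bar>H\<bar>)" using that by (intro mult_mono) auto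
   then show ?thesis by (simp add: q_def algebra_simps)
  qed
 qed auto
qed

text \<open>Cutting off the last hole of the chain with three holes at \<open>H = 1/2\<close>.\<close>

lemma Mod_N3_3:
 assumes T: "T homeomorphic_space top_of_set (Mod P3)"
 shows "is_N3 3 (T :: phase topology)"
proof -
 (* The factors 60 and 100 ensure gm + q > 0 and q \<ge> 1 near the cuts H = \<plusminus>1/2. *)
 define gm where "gm t = 60*(1 - t^2)" for t :: real
 define q where "q t = 100*(\<bar>t\<bar> - 1/5)*(\<bar>t\<bar> - 4/5)*(\<bar>t\<bar> - 9/10)" for t :: real
 have cq: "continuous_on S gm" "continuous_on S q" for S
  unfolding gm_def q_def by (intro continuous_intros)+
 have d: "chain_data (-1) 1 gm q"
  unfolding chain_data_def
 proof (intro conjI ballI allI impI cq)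
  show g0: "0 < gm H" if "-1 < H" "H < 1" for H using that by (auto simp: gm_def abs_square_less_1)
  fix H :: real assume H: "H \<in> {-1..1}"
  define t where "t = \<bar>H\<bar>"
  have t: "0 <= t" "t <= 1" using H by (auto simp: t_def)
  have e: "gm H = 60*(1 - t)*(1 + t)" "q H = 100*(t - 1/5)*((t - 4/5)*(t - 9/10))"
   by (simp_all add: gm_def q_def t_def power2_eq_square algebra_simps)
  show "0 < gm H + q H"
  proof (cases "t <= 9/10")
   case False
   then have "0 < q H" unfolding e using t by simp
   moreover have "0 <= gm H" unfolding e using t by simp
   ultimately show ?thesis by simp
  next
   case True
   show ?thesis
   proof (cases "t <= 1/5")
    case True
    have "(4/5 - t)*(9/10 - t) <= (4/5)*(9/10)" using True t by (intro mult_mono) auto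
    then have "(1/5 - t)*((4/5 - t)*(9/10 - t)) <= (1/5)*((4/5)*(9/10))"
     using True t by (intro mult_mono) auto
    moreover have "q H = - 100*((1/5 - t)*((4/5 - t)*(9/10 - t)))" unfolding e by (simp add: field_simps)
    ultimately have "- 15 <= q H" by simp
    moreover have "60*(4/5*1) <= gm H" unfolding e mult.assoc using True t
     by (intro mult_left_mono mult_mono) auto
    ultimately show ?thesis by simp
   next
    case f: False
    have "60*(1/10*1) <= gm H" unfolding e mult.assoc using True t
     by (intro mult_left_mono mult_mono) auto
    moreover have "- 1/400 <= (t - 4/5)*(t - 9/10)"
     using zero_le_power2[of "t - 17/20"] by (simp add: power2_eq_square field_simps)
    then have "(t - 1/5)*(- 1/400) <= (t - 1/5)*((t - 4/5)*(t - 9/10))"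
     using f by (intro mult_left_mono) auto
    then have "100*((t - 1/5)*(- 1/400)) <= q H" unfolding e by (simp only: mult.assoc mult_left_mono)
    then have "- (t/4) + 1/20 <= q H" by (simp add: field_simps)
    then have "- 1/4 <= q H" using True t by linarith
    ultimately show ?thesis by simp
   qed
  qed
 qed (auto simp: gm_def)
 have "Chain (-1) 1 gm q homeomorphic Mod P3"
 proof (rule Chain_homeomorphic_Mod[OF d, where \<theta> = id])
  fix H :: real assume H: "-1 < H" "H < 1"
  then have R: "0 < sqrt (1 - H^2)" by (auto simp: abs_square_less_1)
  have "sgn (\<bar>H\<bar> - 1/5) = sgn (sqrt (1 - (1/5)^2) - sqrt (1 - H^2))"
   "sgn (\<bar>H\<bar> - 4/5) = sgn (sqrt (1 - (4/5)^2) - sqrt (1 - H^2))"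
   "sgn (\<bar>H\<bar> - 9/10) = sgn (sqrt (1 - (9/10)^2) - sqrt (1 - H^2))"
   by (rule sgn_sqrt_diff; use H in simp)+
  then show "sgn (q H) = sgn (P3 (sqrt (1 - (id H)^2)))"
   using R unfolding q_def P3_def sgn_mult id_apply by (simp add: sgn_pos)
 qed (use P23_props in \<open>auto intro: strict_mono_onI simp: P3_def\<close>)
 then have T': "T homeomorphic_space top_of_set (Chain (-1) 1 gm q)"
  using T homeomorphic_space_top_of_set homeomorphic_space_sym homeomorphic_space_trans by blast
 have q1: "1 <= q H" if "2/5 <= \<bar>H\<bar>" "\<bar>H\<bar> <= 3/5" for H
 proof -
  have "(1/5)*(3/10) <= (4/5 - \<bar>H\<bar>)*(9/10 - \<bar>H\<bar>)" using that by (intro mult_mono) auto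
  then have "(1/5)*((1/5)*(3/10)) <= (\<bar>H\<bar> - 1/5)*((4/5 - \<bar>H\<bar>)*(9/10 - \<bar>H\<bar>))"
   using that by (intro mult_mono) auto
  moreover have "q H = 100*((\<bar>H\<bar> - 1/5)*((4/5 - \<bar>H\<bar>)*(9/10 - \<bar>H\<bar>)))"
   by (simp add: q_def field_simps)
  ultimately show ?thesis by simp
 qed
 have qp: "sgn (q t) = 1" if "9/10 < \<bar>t\<bar> | 1/5 < \<bar>t\<bar> & \<bar>t\<bar> < 4/5" for t
  using that by (auto simp: q_def sgn_mult sgn_pos sgn_neg)
 have qn: "sgn (q t) = -1" if "\<bar>t\<bar> < 1/5 | 4/5 < \<bar>t\<bar> & \<bar>t\<bar> < 9/10" for t
  using that by (auto simp: q_def sgn_mult sgn_pos sgn_neg)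
 have q0: "q t = 0" if "\<bar>t\<bar> = 1/5 | \<bar>t\<bar> = 4/5 | \<bar>t\<bar> = 9/10" for t
  using that by (auto simp: q_def)
 have m: "\<bar>t\<bar> < 1/5" if "- (1/5) < t" "t < 1/5" for t :: real using that by arith
 have g0: "0 < sqrt (gm (1/2))" "0 < sqrt (gm (- (- (1/2))))" by (auto simp: gm_def power2_eq_square)
 have qh: "0 < q (1/2)" using q1[of "1/2"] by simp
 let ?L = "Cap (-1) (1/2) gm q" and ?R = "Cap (-1) (-(1/2)) (%H. gm (- H)) (%H. q (- H))"
 have S: "is_connected_sum (top_of_set (J ` ?L)) (top_of_set (J ` ?R)) T"
  by (rule chain_connected_sum[OF d _ _ _ q1 T', where \<delta> = "1/10"]) auto
 have dL: "chain_data (-1) (1/2 + sqrt (gm (1/2))) (cap_gam (1/2) gm) (cap_q (1/2) q)"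
  by (rule chain_data_cap[OF d _ _ qh]) auto
 have L: "is_N3 2 (top_of_set (J ` ?L))"
 proof (rule chain_two_holes[OF dL, where c = "-1/2" and \<delta> = "1/10"])
  show "top_of_set (J ` ?L) homeomorphic_space top_of_set (Chain (-1) (1/2 + sqrt (gm (1/2))) (cap_gam (1/2) gm) (cap_q (1/2) q))"
   unfolding Cap_def by (rule top_of_set_J)
  have "pat 1 (cap_q (1/2) q) [-1, -9/10, -4/5, -1/5, 1/5, 1/2 + r]" if "0 < r" for r
   using that qp qn q0 qh m by (auto simp: cap_q_def)
  then show "pat 1 (cap_q (1/2) q) [-1, -9/10, -4/5, -1/5, 1/5, 1/2 + sqrt (gm (1/2))]" using g0(1) by blast
  show "1 <= cap_q (1/2) q H" if "-1/2 - 1/10 <= H" "H <= -1/2 + 1/10" for H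
   using that q1[of H] by (auto simp: cap_q_def)
 qed auto
 have R: "top_of_set ?R homeomorphic_space S2xS1"
  unfolding Cap_def
 proof (rule chain_one_hole[OF chain_data_cap])
  show "chain_data (-1) 1 (%H. gm (- H)) (%H. q (- H))" using chain_data_reflect[OF d] by simp
  have "pat 1 (cap_q (-(1/2)) (%H. q (- H))) [-1, -9/10, -4/5, -(1/2) + r]" if "0 < r" for r
   using that qp qn q0 qh by (auto simp: cap_q_def)
  then show "pat 1 (cap_q (-(1/2)) (%H. q (- H))) [-1, -9/10, -4/5, -(1/2) + sqrt (gm (- (- (1/2))))]"
   using g0(2) by blast
 qed (use qh in auto)
 show ?thesis
  using is_N3.add[OF L homeomorphic_space_trans[OF top_of_set_J R] S] by (simp add: numeral_3_eq_3 numeral_2_eq_2)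
qed

section \<open>Isoenergetic manifolds as circle bundles\<close>

lemma Q3_iff:
 "(M, al) \<in> Q3 a e0 e1 l h \<longleftrightarrow>
  ((M$1)^2 + (M$2)^2 + 2*(M$3)^2)/4 + e1*(al$3*M$2 - al$2*M$3) - e0*al$1 = h &
  (al$1)^2 + (al$2)^2 + (al$3)^2 = a^2 & M$1*al$1 + M$2*al$2 + M$3*al$3 = 2*l"
 by (auto simp: Q3_def P4_def P5_def ksH_def ksL_def alpha_sq_def inner_vec_def sum_3 power2_eq_square)

text \<open>Scaling the second component reduces everything to \<open>a = 1\<close>.\<close>

lemma Q3_scale:
 assumes a: "0 < a"
 shows "Q3 a e0 e1 l h homeomorphic Q3 1 (a*e0) (a*e1) (l/a) h"
proof -
 let ?f = "%(M, al). (M, (1/a) *\<^sub>R al) :: phase" and ?g = "%(M, al). (M, a *\<^sub>R al) :: phase"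
 have eq: "(M, a *\<^sub>R al) \<in> Q3 a e0 e1 l h \<longleftrightarrow> (M, al) \<in> Q3 1 (a*e0) (a*e1) (l/a) h" for M al
 proof -
  have "(a*al$1)^2 + (a*al$2)^2 + (a*al$3)^2 = a^2 \<longleftrightarrow> a^2*((al$1)^2 + (al$2)^2 + (al$3)^2) = a^2*1"
   by (simp add: power_mult_distrib distrib_left)
  also have "... \<longleftrightarrow> (al$1)^2 + (al$2)^2 + (al$3)^2 = 1" using a by (subst mult_cancel_left) auto
  finally show ?thesis using a unfolding Q3_iff by (simp add: field_simps)
 qed
 have "homeomorphism (Q3 a e0 e1 l h) (Q3 1 (a*e0) (a*e1) (l/a) h) ?f ?g"
 proof (rule homeomorphismI)
  show "continuous_on S ?f" "continuous_on S ?g" for S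
   unfolding case_prod_unfold by (intro continuous_intros)+
  show "?g ` Q3 1 (a*e0) (a*e1) (l/a) h \<subseteq> Q3 a e0 e1 l h" using eq by auto
  show "?f ` Q3 a e0 e1 l h \<subseteq> Q3 1 (a*e0) (a*e1) (l/a) h"
  proof clarify
   fix M al assume "(M, al) \<in> Q3 a e0 e1 l h"
   then show "(M, (1/a) *\<^sub>R al) \<in> Q3 1 (a*e0) (a*e1) (l/a) h"
    using eq[of M "(1/a) *\<^sub>R al"] a by simp
  qed
 qed (use a in auto)
 then show ?thesis using homeomorphic_def by blast
qed

text \<open>For \<open>a = 1\<close>, \<open>gf\<close> is the energy minus the effective potential on the great circle
 \<open>n y + l z = 0\<close> of the sphere of directions \<open>(x, y, z)\<close>, and \<open>psi\<close> is the energy minus the effective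
 potential (the minimum of the Hamiltonian over \<open>M\<close>) everywhere.\<close>

definition gf :: "real => real => real => real => real" where
 "gf e n k x = k + e*x + n^2*(1 - x^2)"

definition psi :: "real => real => real => real => real^3 => real" where
 "psi e n l h al = gf e n (h - l^2) (al$1) - (n*al$2 + l*al$3)^2/(2 - (al$3)^2)"

text \<open>The covector whose kernel is the plane of displacements of \<open>M\<close> that preserve \<open>L\<close>, after the third
 coordinate of \<open>M\<close> is rescaled to make the kinetic energy \<open>|M|^2 / 4\<close>.\<close>
definition bet :: "real^3 => real^3" where
 "bet al = (\<chi> j. if j = 3 then al$3/sqrt 2 else al$j)"

text \<open>The point over \<open>al\<close> at displacement \<open>w\<close> (rescaled in the third coordinate) from the minimiser.\<close>

definition fib :: "real => real => real^3 => real^3 => phase" where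
 "fib n l al w = (let c = (2*l + n*al$2*al$3)/(2 - (al$3)^2) in
  (\<chi> j. if j = 1 then 2*c*al$1 + w$1 else if j = 2 then 2*(c*al$2 - n*al$3) + w$2
     else c*al$3 + n*al$2 + w$3/sqrt 2, al))"

lemma sphere_z: "al \<in> sphere (0::real^3) 1 ==> (al$1)^2 <= 1 & (al$3)^2 <= 1 & 0 < 2 - (al$3)^2"
 unfolding sphere3 using zero_le_power2[of "al$1"] zero_le_power2[of "al$2"] zero_le_power2[of "al$3"] by linarith

lemma fib_in_Q3:
 assumes al: "al \<in> sphere 0 1" and w: "w \<bullet> bet al = 0"
 shows "fib n l al w \<in> Q3 1 e n l h \<longleftrightarrow> (norm w)^2 = 4*psi e n l h al"
proof -
 define x y z W c where "x = al$1" and "y = al$2" and "z = al$3" and "W = 2 - z^2" and "c = (2*l + n*y*z)/W"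
 define a b d where "a = w$1" and "b = w$2" and "d = w$3/sqrt 2"
 have W: "0 < W" using sphere_z[OF al] by (simp add: W_def z_def)
 then have cW: "c*W = 2*l + n*y*z" by (simp add: c_def)
 have x2: "x^2 = 1 - y^2 - z^2" using al unfolding sphere3 x_def y_def z_def by simp
 have wd: "(w$3)^2 = 2*d^2" by (simp add: d_def power_divide)
 have orth: "a*x + b*y + d*z = 0"
  using w by (simp add: inner_vec_def sum_3 bet_def a_def b_def d_def x_def y_def z_def)
 have nw: "(norm w)^2 = a^2 + b^2 + 2*d^2"
  by (simp add: norm_vec_def L2_set_def sum_3 wd a_def b_def)
 have L: "(2*c*x + a)*x + (2*(c*y - n*z) + b)*y + (c*z + n*y + d)*z = 2*l"
 proof -
  have "(2*c*x + a)*x + (2*(c*y - n*z) + b)*y + (c*z + n*y + d)*z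
   = c*(2*x^2 + 2*y^2 + z^2) - n*y*z + (a*x + b*y + d*z)"
   by (simp add: algebra_simps power2_eq_square)
  also have "2*x^2 + 2*y^2 + z^2 = W" by (simp add: x2 W_def)
  finally show ?thesis using cW orth by simp
 qed
 have E1: "((2*c*x + a)^2 + (2*(c*y - n*z) + b)^2 + 2*(c*z + n*y + d)^2)/4
  + n*(z*(2*(c*y - n*z) + b) - y*(c*z + n*y + d)) - e*x
  = c^2*(2*x^2 + 2*y^2 + z^2)/2 - n^2*z^2 - n^2*y^2/2 - e*x + c*(a*x + b*y + d*z)
   + (a^2 + b^2 + 2*d^2)/4"
  by (simp add: power2_eq_square field_simps)
 have "c^2*W = (2*l + n*y*z)^2/W"
  using W by (simp add: c_def power_divide power2_eq_square)
 then have E2: "c^2*W/2 - n^2*z^2 - n^2*y^2/2 = l^2 - n^2*(1 - x^2) + (n*y + l*z)^2/W"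
 proof -
  have z2: "z^2 = 2 - W" by (simp add: W_def)
  have "(2*l + n*y*z)^2 - n^2*(2*z^2 + y^2)*W = 2*l^2*W - 2*n^2*(y^2 + z^2)*W + 2*(n*y + l*z)^2"
   unfolding W_def by (simp add: power2_eq_square algebra_simps)
  then have "(2*l + n*y*z)^2/W = n^2*(2*z^2 + y^2) + 2*l^2 - 2*n^2*(y^2 + z^2) + 2*((n*y + l*z)^2/W)"
   using W by (simp add: field_simps)
  moreover have e: "n^2*(2*z^2 + y^2) = 2*(n^2*z^2) + n^2*y^2"
   "2*n^2*(y^2 + z^2) = 2*(n^2*y^2) + 2*(n^2*z^2)" "n^2*(1 - x^2) = n^2*y^2 + n^2*z^2"
   unfolding x2 by (simp_all add: algebra_simps)
  ultimately have cw: "c^2*W = 2*(n^2*z^2) + n^2*y^2 + 2*l^2 - (2*(n^2*y^2) + 2*(n^2*z^2)) + 2*((n*y + l*z)^2/W)"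
   using \<open>c^2 * W = _\<close> by (simp only:)
  have lin: "A/2 - q - p/2 = L - (p + q) + B" if "A = 2*q + p + 2*L - (2*p + 2*q) + 2*B" for A B p q L :: real
   unfolding that by (simp add: field_simps)
  show ?thesis unfolding e by (rule lin[OF cw])
 qed
 have "fib n l al w \<in> Q3 1 e n l h \<longleftrightarrow>
  ((2*c*x + a)^2 + (2*(c*y - n*z) + b)^2 + 2*(c*z + n*y + d)^2)/4
  + n*(z*(2*(c*y - n*z) + b) - y*(c*z + n*y + d)) - e*x = h"
  using L x2 unfolding fib_def Let_def Q3_iff x_def[symmetric] y_def[symmetric] z_def[symmetric] W_def[symmetric] c_def[symmetric]
  by (simp add: a_def[symmetric] b_def[symmetric] d_def[symmetric])
 also have "... \<longleftrightarrow> c^2*W/2 - n^2*z^2 - n^2*y^2/2 - e*x + (a^2 + b^2 + 2*d^2)/4 = h"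
  unfolding E1 orth by (simp add: x2 W_def)
 also have "... \<longleftrightarrow> (norm w)^2 = 4*psi e n l h al"
 proof -
  have "L - A + B - X + N/4 = h \<longleftrightarrow> N = 4*(h - L + X + A - B)" for L A B X N h :: real
   by (auto simp: field_simps)
  then show ?thesis
   unfolding E2 nw psi_def gf_def x_def[symmetric] y_def[symmetric] z_def[symmetric] W_def[symmetric] .
 qed
 finally show ?thesis .
qed

lemma Q3_fib:
 assumes Q: "(M, al) \<in> Q3 1 e n l h"
 shows "EX w. w \<bullet> bet al = 0 & fib n l al w = (M, al) & al \<in> sphere 0 1"
proof -
 have al: "al \<in> sphere 0 1" using Q unfolding sphere3 Q3_iff by simp
 define c where "c = (2*l + n*al$2*al$3)/(2 - (al$3)^2)"
 have W: "0 < 2 - (al$3)^2" using sphere_z[OF al] by simp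
 then have cW: "c*(2 - (al$3)^2) = 2*l + n*al$2*al$3" by (simp add: c_def)
 define w :: "real^3" where "w = (\<chi> j. if j = 1 then M$1 - 2*c*al$1 else if j = 2 then M$2 - 2*(c*al$2 - n*al$3)
  else sqrt 2*(M$3 - c*al$3 - n*al$2))"
 have "w \<bullet> bet al = (M$1*al$1 + M$2*al$2 + M$3*al$3) - c*(2*(al$1)^2 + 2*(al$2)^2 + (al$3)^2) + n*al$2*al$3"
  by (simp add: inner_vec_def sum_3 bet_def w_def power2_eq_square algebra_simps)
 also have "2*(al$1)^2 + 2*(al$2)^2 + (al$3)^2 = 2 - (al$3)^2" using al unfolding sphere3 by simp
 finally have "w \<bullet> bet al = 0" using Q cW unfolding Q3_iff by simp
 moreover have "fib n l al w = (M, al)"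
  unfolding fib_def Let_def c_def[symmetric] by (simp add: w_def vec_eq_iff forall_3)
 ultimately show ?thesis using al by blast
qed

lemma continuous_on_vec3:
 fixes A B C :: "'a::topological_space => real"
 assumes "continuous_on S A" "continuous_on S B" "continuous_on S C"
 shows "continuous_on S (%s. (\<chi> j. if j = 1 then A s else if j = 2 then B s else C s) :: real^3)"
proof (rule continuous_on_vec_lambda)
 show "continuous_on S (%s. if j = 1 then A s else if j = 2 then B s else C s)" for j :: 3
  using assms by (cases "j = 1"; cases "j = 2"; simp)
qed

lemma continuous_on_fib:
 assumes f: "continuous_on S f" and g: "continuous_on S g" and s: "!!s. s \<in> S ==> f s \<in> sphere 0 1"
 shows "continuous_on S (%s. fib n l (f s) (g s))"
proof -
 define c where "c s = (2*l + n*f s$2*f s$3)/(2 - (f s$3)^2)" for s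
 have W: "2 - (f s $ 3)^2 ~= 0" if "s \<in> S" for s using sphere_z[OF s[OF that]] by linarith
 have fi: "continuous_on S (%s. f s $ j)" and gi: "continuous_on S (%s. g s $ j)" for j
  using bounded_linear.continuous_on[OF bounded_linear_vec_nth f] bounded_linear.continuous_on[OF bounded_linear_vec_nth g]
  by blast+
 have c: "continuous_on S c" unfolding c_def
  by (rule continuous_on_divide) (use W in \<open>auto intro!: continuous_intros fi\<close>)
 show ?thesis
  unfolding fib_def Let_def c_def[symmetric]
  by (rule continuous_on_Pair[OF continuous_on_vec3 f]) (auto intro!: continuous_intros c fi gi)
qed

lemma continuous_on_psi: "continuous_on (sphere 0 1) (psi e n l h)"
proof -
 have W: "2 - (s $ 3)^2 ~= 0" if "s \<in> sphere 0 1" for s :: "real^3" using sphere_z[OF that] by linarith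
 have "continuous_on (sphere 0 1) (%s::real^3. (n * s$2 + l * s$3)^2/(2 - (s$3)^2))"
  by (rule continuous_on_divide) (use W in \<open>auto intro!: continuous_intros\<close>)
 then show ?thesis unfolding psi_def gf_def by (intro continuous_on_diff) (intro continuous_intros)
qed

lemma bet_nz: "al \<in> sphere 0 1 ==> bet al ~= 0"
 unfolding sphere3 by (auto simp: bet_def vec_eq_iff forall_3)

lemma continuous_on_bet: "continuous_on S bet"
proof -
 have "bet al = al$1 *\<^sub>R axis 1 1 + al$2 *\<^sub>R axis 2 1 + (al$3/sqrt 2) *\<^sub>R axis 3 1" for al
  by (simp add: bet_def vec_eq_iff forall_3 axis_def)
 then have b: "bet = (%al. al$1 *\<^sub>R axis 1 1 + al$2 *\<^sub>R axis 2 1 + (al$3/sqrt 2) *\<^sub>R axis 3 1)" by (rule ext)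
 show ?thesis unfolding b by (intro continuous_intros; simp)
qed

text \<open>\<open>roll m d\<close> takes the orthogonal complement of \<open>d\<close> isometrically to that of \<open>m\<close>: it is the rotation
 along the great circle from \<open>d\<close> to \<open>m\<close>.\<close>

definition roll :: "'a::real_inner => 'a => 'a => 'a" where
 "roll m d t = t - ((t \<bullet> m)/(1 + m \<bullet> d)) *\<^sub>R (m + d)"

lemma roll_props:
 assumes "norm m = 1" "norm d = 1" "1 + m \<bullet> d ~= 0" "t \<bullet> d = 0"
 shows "roll m d t \<bullet> m = 0" "(norm (roll m d t))^2 = (norm t)^2" "roll d m (roll m d t) = t"
proof -
 have mm: "m \<bullet> m = 1" "d \<bullet> d = 1" using assms by (simp_all add: dot_square_norm)
 have md: "d \<bullet> m = m \<bullet> d" "d \<bullet> t = 0" "m \<bullet> t = t \<bullet> m" using assms(4) by (simp_all add: inner_commute)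
 define c where "c = (t \<bullet> m)/(1 + m \<bullet> d)"
 have c: "c*(1 + m \<bullet> d) = t \<bullet> m" using assms by (simp add: c_def)
 have r: "roll m d t = t - c *\<^sub>R (m + d)" by (simp add: roll_def c_def)
 show "roll m d t \<bullet> m = 0" unfolding r using c by (simp add: inner_diff_left inner_add_left mm md)
 have rd: "roll m d t \<bullet> d = - (t \<bullet> m)"
  unfolding r using c assms(4) by (simp add: inner_diff_left inner_add_left mm md add.commute)
 have "(norm (roll m d t))^2 = (norm t)^2 - 2*c*(t \<bullet> m) + 2*c*(c*(1 + m \<bullet> d))"
  unfolding r power2_norm_eq_inner using assms(4)
  by (simp add: inner_diff_left inner_diff_right inner_add_left inner_add_right mm md algebra_simps)
 then show "(norm (roll m d t))^2 = (norm t)^2" unfolding c by simp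
 have "roll d m (roll m d t) = roll m d t + c *\<^sub>R (d + m)"
  unfolding roll_def[of d m] rd by (simp add: c_def md)
 then show "roll d m (roll m d t) = t" unfolding r by (simp add: algebra_simps)
qed

text \<open>Away from one direction the tangent planes of the sphere are identified with a fixed plane by
 \<open>roll\<close>; the exceptional direction is chosen at a point where \<open>psi\<close> is negative.\<close>
lemma Q3_homeomorphic_circ:
 assumes al0: "al0 \<in> sphere 0 1" "psi e n l h al0 < 0"
 shows "(circ {al \<in> sphere 0 1. 0 <= psi e n l h al} (%al. 2 * sqrt (psi e n l h al)) :: ((real^3) \<times> complex) set)
  homeomorphic Q3 1 e n l h"
proof -
 let ?U = "{al \<in> sphere 0 1. 0 <= psi e n l h al}" and ?ro = "%al. 2 * sqrt (psi e n l h al)"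
 (* d is antipodal to the excluded direction, t an isometry of the plane to the complement of d. *)
 define d where "d = - sgn (bet al0)"
 have d1: "norm d = 1" using bet_nz[OF al0(1)] by (simp add: d_def norm_sgn)
 have "norm (axis 1 1 :: real^3) = norm d" using d1 by (simp add: norm_axis_1)
 then obtain R :: "real^3 => real^3" where R: "orthogonal_transformation R" "R (axis 1 1) = d"
  by (rule orthogonal_transformation_exists)
 have lR: "linear R" using R orthogonal_transformation_linear by blast
 define m where "m al = sgn (bet al)" for al
 define t where "t u = R (vector [0, Re u, Im u])" for u
 have vd: "vector [0, Re u, Im u] = Re u *\<^sub>R axis 2 1 + Im u *\<^sub>R (axis 3 1 :: real^3)" for u
  by (simp add: vec_eq_iff forall_3 axis_def)
 have td: "t u \<bullet> d = 0" for u
  unfolding t_def R(2)[symmetric] using R(1)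
  by (simp add: orthogonal_transformation_def inner_vec_def sum_3 axis_def)
 have tn: "norm (t u) = norm u" for u
  unfolding t_def orthogonal_transformation_norm[OF R(1)]
  by (simp add: norm_vec_def L2_set_def sum_3 cmod_def)
 have tsur: "EX u. t u = v" if "v \<bullet> d = 0" for v
 proof -
  obtain w where w: "R w = v" using orthogonal_transformation_surj[OF R(1)] by (metis surjD)
  have "w \<bullet> axis 1 1 = 0" using R that w by (metis orthogonal_transformation_def)
  then have "w$1 = 0" by (simp add: inner_axis)
  then have "vector [0, Re (Complex (w$2) (w$3)), Im (Complex (w$2) (w$3))] = w"
   by (simp add: vec_eq_iff forall_3)
  then show ?thesis unfolding t_def using w by metis
 qed
 have tinj: "u = u'" if "t u = t u'" for u u'
 proof -
  have "vector [0, Re u, Im u] = (vector [0, Re u', Im u'] :: real^3)"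
   using that orthogonal_transformation_inj[OF R(1)] by (simp add: t_def inj_eq)
  then show ?thesis by (simp add: vec_eq_iff forall_3 complex_eq_iff)
 qed
 have m1: "norm (m al) = 1" if "al \<in> sphere 0 1" for al using bet_nz[OF that] by (simp add: m_def norm_sgn)
 have nd: "1 + m al \<bullet> d ~= 0" if "al \<in> ?U" for al
 proof
  assume "1 + m al \<bullet> d = 0"
  then have "m al \<bullet> sgn (bet al0) = 1" by (simp add: d_def)
  moreover have s: "al \<in> sphere 0 1" using that by auto
  ultimately have "m al = sgn (bet al0)"
   using norm_cauchy_schwarz_eq[of "m al" "sgn (bet al0)"] m1[OF s] bet_nz[OF al0(1)] by (simp add: norm_sgn)
  then have e: "bet al = (norm (bet al)/norm (bet al0)) *\<^sub>R bet al0"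
   using bet_nz[OF s] bet_nz[OF al0(1)] unfolding m_def
   by (metis (no_types, lifting) divide_inverse norm_eq_zero scaleR_one scaleR_scaleR sgn_div_norm right_inverse)
  define r where "r = norm (bet al)/norm (bet al0)"
  have "0 <= r" by (simp add: r_def)
  have "al = r *\<^sub>R al0"
   using e unfolding r_def[symmetric] by (simp add: bet_def vec_eq_iff forall_3)
  moreover from this have "r = 1" using s al0(1) \<open>0 <= r\<close> by auto
  ultimately show False using that al0 by auto
 qed
 let ?G = "%p::(real^3) \<times> complex. fib n l (fst p) (roll (m (fst p)) d (t (snd p)))"
 have cpsi: "continuous_on ?U (psi e n l h)" by (rule continuous_on_subset[OF continuous_on_psi]) auto
 have "closed (sphere 0 1 \<inter> psi e n l h -` {0..})"
  by (intro continuous_closed_preimage[OF continuous_on_psi] closed_sphere closed_atLeast)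
 moreover have "sphere 0 1 \<inter> psi e n l h -` {0..} = ?U" by auto
 ultimately have "compact ?U"
  using compact_sphere[of "0::real^3" 1] by (metis compact_Int_closed inf.left_idem)
 then have c1: "compact (circ ?U ?ro :: ((real^3) \<times> complex) set)"
  by (rule compact_circ) (use cpsi in \<open>auto intro!: continuous_intros\<close>)
 have cm: "continuous_on (sphere 0 1) m" unfolding m_def
  by (rule continuous_on_sgn[OF continuous_on_bet]) (use bet_nz in auto)
 have ct: "continuous_on S t" for S
 proof -
  have "continuous_on UNIV R" using lR by (simp add: linear_continuous_on linear_conv_bounded_linear)
  then show ?thesis unfolding t_def vd
   by (rule continuous_on_compose2) (auto intro!: continuous_intros)
 qed
 have cms: "continuous_on (circ ?U ?ro :: ((real^3) \<times> complex) set) (%p. m (fst p))"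
  by (rule continuous_on_compose2[OF cm]) (auto simp: circ_def intro!: continuous_intros)
 have cts: "continuous_on (circ ?U ?ro :: ((real^3) \<times> complex) set) (%p. t (snd p))"
  by (rule continuous_on_compose2[OF ct[of UNIV]]) (auto intro!: continuous_intros)
 have c2: "continuous_on (circ ?U ?ro) ?G"
 proof (rule continuous_on_fib)
  have "continuous_on (circ ?U ?ro :: ((real^3) \<times> complex) set) (%p. (t (snd p) \<bullet> m (fst p))/(1 + m (fst p) \<bullet> d))"
  proof (rule continuous_on_divide)
   show "\<forall>p\<in>circ ?U ?ro :: ((real^3) \<times> complex) set. 1 + m (fst p) \<bullet> d ~= 0"
    using nd by (auto simp: circ_def)
  qed (intro continuous_on_inner continuous_on_add continuous_on_const cms cts)+
  then show "continuous_on (circ ?U ?ro :: ((real^3) \<times> complex) set) (%p. roll (m (fst p)) d (t (snd p)))"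
   unfolding roll_def
   by (intro continuous_on_diff continuous_on_scaleR continuous_on_add continuous_on_const cms cts)
 qed (auto simp: circ_def intro!: continuous_intros)
 have mb: "w \<bullet> m al = 0 \<longleftrightarrow> w \<bullet> bet al = 0" for w al
  by (auto simp: m_def sgn_div_norm)
 have wn: "(norm w)^2 = 4*q \<longleftrightarrow> norm w = 2 * sqrt q" if "0 <= q" for q and w :: "real^3"
 proof -
  have "4*q = (2 * sqrt q)^2" using that by (simp add: power_mult_distrib)
  then show ?thesis using that by (metis norm_ge_zero power2_eq_iff_nonneg real_sqrt_ge_zero mult_nonneg_nonneg zero_le_numeral)
 qed
 have c3: "?G ` circ ?U ?ro = Q3 1 e n l h"
 proof (intro equalityI subsetI)
  fix p assume "p \<in> ?G ` circ ?U ?ro"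
  then obtain al u where p: "al \<in> ?U" "norm u = ?ro al" "p = fib n l al (roll (m al) d (t u))" by (auto simp: circ_def)
  have s: "al \<in> sphere 0 1" using p by auto
  note r = roll_props[OF m1[OF s] d1 nd[OF p(1)] td[of u]]
  have "(norm (roll (m al) d (t u)))^2 = 4*psi e n l h al"
   unfolding r(2) tn p(2) using p(1) by (simp add: power_mult_distrib)
  then show "p \<in> Q3 1 e n l h" unfolding p(3) using fib_in_Q3[OF s] r(1) mb by blast
 next
  fix p assume "p \<in> Q3 1 e n l h"
  moreover obtain M al where p: "p = (M, al)" by (cases p)
  ultimately obtain w where w: "w \<bullet> bet al = 0" "fib n l al w = p" "al \<in> sphere 0 1" using Q3_fib by blast
  then have nw: "(norm w)^2 = 4*psi e n l h al" using fib_in_Q3 \<open>p \<in> _\<close> by metis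
  then have U: "al \<in> ?U" using w zero_le_power2[of "norm w"] by auto
  have wm: "w \<bullet> m al = 0" using w mb by blast
  have "1 + d \<bullet> m al ~= 0" using nd[OF U] by (simp add: inner_commute)
  note r = roll_props[OF d1 m1[OF w(3)] this wm]
  obtain u where u: "t u = roll d (m al) w" using tsur r(1) by blast
  have "(norm u)^2 = 4*psi e n l h al" using r(2) nw tn[of u] u by simp
  then have "norm u = ?ro al" using wn[of "psi e n l h al" "t u"] U tn by auto
  then have "(al, u) \<in> circ ?U ?ro" using U by (simp add: circ_def)
  moreover have "?G (al, u) = p" using u r(3) w by simp
  ultimately show "p \<in> ?G ` circ ?U ?ro" by blast
 qed
 have c4: "inj_on ?G (circ ?U ?ro)"
 proof (rule inj_onI)
  fix p p' :: "(real^3) \<times> complex" assume p: "p \<in> circ ?U ?ro" "p' \<in> circ ?U ?ro" "?G p = ?G p'"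
  obtain al u al' u' where pp: "p = (al,u)" "p' = (al',u')" by (metis surj_pair)
  have f: "al = al' & w = w'" if "fib n l al w = fib n l al' w'" for al al' w w'
   using that by (auto simp: fib_def Let_def vec_eq_iff forall_3)
  have e: "al' = al" "roll (m al) d (t u) = roll (m al) d (t u')" using f[of al _ al'] p(3) pp by auto
  have U: "al \<in> ?U" "al \<in> sphere 0 1" using p pp by (auto simp: circ_def)
  have "t u = t u'"
   using roll_props(3)[OF m1[OF U(2)] d1 nd[OF U(1)] td] e by metis
  then show "p = p'" using tinj e pp by auto
 qed
 show ?thesis by (rule homeomorphic_compact[OF c1 c2 c3 c4])
qed

text \<open>The spinor map. For unit vectors \<open>(Z, W)\<close>, the null vectors \<open>(Z^2 - W^2, \<i> (Z^2 + W^2), - 2 Z W)\<close> of \<open>\<complex>\<^sup>3\<close>, split into real and imaginary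
 part, are the orthonormal pairs, and \<open>(Z, W)\<close> is determined up to sign.\<close>

definition spin :: "real^4 => (real^3) \<times> (real^3)" where
 "spin v = (let Z = Complex (v$1) (v$2); W = Complex (v$3) (v$4) in
  (vector [Re (Z^2 - W^2), - Im (Z^2 + W^2), - 2*Re (Z*W)],
   vector [Im (Z^2 - W^2), Re (Z^2 + W^2), - 2*Im (Z*W)]))"

lemma spin_eq_iff: "spin v = spin w \<longleftrightarrow> v = w | v = - w"
proof
 define Z W Z' W' where "Z = Complex (v$1) (v$2)" and "W = Complex (v$3) (v$4)"
  and "Z' = Complex (w$1) (w$2)" and "W' = Complex (w$3) (w$4)"
 assume "spin v = spin w"
 then have "ALL j. fst (spin v) $ j = fst (spin w) $ j & snd (spin v) $ j = snd (spin w) $ j" by simp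
 then have e: "Re (Z^2 - W^2) = Re (Z'^2 - W'^2)" "- Im (Z^2 + W^2) = - Im (Z'^2 + W'^2)"
  "- 2*Re (Z*W) = - 2*Re (Z'*W')" "Im (Z^2 - W^2) = Im (Z'^2 - W'^2)"
  "Re (Z^2 + W^2) = Re (Z'^2 + W'^2)" "- 2*Im (Z*W) = - 2*Im (Z'*W')"
  unfolding spin_def Let_def Z_def[symmetric] W_def[symmetric] Z'_def[symmetric] W'_def[symmetric]
   fst_conv snd_conv forall_3 vector_3 by blast+
 have 1: "Z^2 - W^2 = Z'^2 - W'^2" "Z^2 + W^2 = Z'^2 + W'^2"
  using e(1,2,4,5) by (intro complex_eqI; simp)+
 have zw: "Z*W = Z'*W'" using e(3,6) by (intro complex_eqI) (simp_all only: mult_cancel_left, simp_all)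
 have "(Z^2 - W^2) + (Z^2 + W^2) = (Z'^2 - W'^2) + (Z'^2 + W'^2)" by (simp only: 1)
 then have z: "Z^2 = Z'^2" by simp
 then have w: "W^2 = W'^2" using 1 by simp
 have "(Z = Z' & W = W') | (Z = - Z' & W = - W')"
 proof (cases "Z' = 0")
  case True
  then show ?thesis using z w by (simp add: power2_eq_iff)
 next
  case False
  have "Z = Z' | Z = - Z'" using z by (simp add: power2_eq_iff)
  then show ?thesis
  proof
   assume "Z = Z'" then show ?thesis using zw False by simp
  next
   assume "Z = - Z'"
   then have "Z'*W = Z'*(- W')" using zw by (simp add: minus_equation_iff eq_commute)
   then show ?thesis using \<open>Z = - Z'\<close> False by (simp only: mult_cancel_left) simp
  qed
 qed
 then show "v = w | v = - w"
  by (auto simp: Z_def W_def Z'_def W'_def complex_eq_iff vec_eq_iff forall_4)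
qed (auto simp: spin_def Let_def vec_eq_iff forall_3 power2_eq_square)

lemma complex_square_root: "EX z::complex. z^2 = a"
 by (metis power2_csqrt)

lemma spin_image: "spin ` sphere 0 1 = {(m, v). norm m = 1 & norm v = 1 & m \<bullet> v = 0}"
proof -
 have props: "(norm (fst (spin q)))^2 = ((norm q)^2)^2 & (norm (snd (spin q)))^2 = ((norm q)^2)^2 & fst (spin q) \<bullet> snd (spin q) = 0" for q
 proof -
  define a b c d where "a = q$1" and "b = q$2" and "c = q$3" and "d = q$4"
  have n: "(norm q)^2 = a^2 + b^2 + c^2 + d^2" "(norm m)^2 = (m$1)^2 + (m$2)^2 + (m$3)^2" for m :: "real^3"
   by (simp_all add: norm_vec_def L2_set_def sum_3 sum_4 a_def b_def c_def d_def)
  have s: "spin q = (vector [a^2 - b^2 - c^2 + d^2, - (2*a*b + 2*c*d), - 2*(a*c - b*d)],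
   vector [2*a*b - 2*c*d, a^2 - b^2 + c^2 - d^2, - 2*(a*d + b*c)])"
   by (simp add: spin_def Let_def a_def b_def c_def d_def vec_eq_iff forall_3 power2_eq_square)
  show ?thesis
   unfolding n s fst_conv snd_conv inner_vec_def sum_3 vector_3
   by (simp add: power2_eq_square algebra_simps)
 qed
 show ?thesis
 proof (intro equalityI subsetI)
  fix p assume "p \<in> spin ` sphere 0 1"
  then obtain q where q: "norm q = 1" "p = spin q" by auto
  then have "(norm (fst p))^2 = 1" "(norm (snd p))^2 = 1" "fst p \<bullet> snd p = 0" using props[of q] by auto
  then show "p \<in> {(m, v). norm m = 1 & norm v = 1 & m \<bullet> v = 0}"
   by (auto simp: abs_square_eq_1 split: prod.splits)
 next
  fix p :: "(real^3) \<times> (real^3)" assume "p \<in> {(m, v). norm m = 1 & norm v = 1 & m \<bullet> v = 0}"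
  then obtain m v where p: "p = (m,v)" "norm m = 1" "norm v = 1" "m \<bullet> v = 0" by auto
  define N where "N j = Complex (m$j) (v$j)" for j
  have m2: "(m$1)^2 + (m$2)^2 + (m$3)^2 = 1" "(v$1)^2 + (v$2)^2 + (v$3)^2 = 1"
   using p sphere3[of m] sphere3[of v] by auto
  have mv: "m$1 * v$1 + m$2 * v$2 + m$3 * v$3 = 0" using p(4) by (simp add: inner_vec_def sum_3)
  have null: "(N 1)^2 + (N 2)^2 + (N 3)^2 = 0"
  proof (rule complex_eqI)
   show "Re ((N 1)^2 + (N 2)^2 + (N 3)^2) = Re 0"
    using m2 by (simp add: N_def power2_eq_square)
   show "Im ((N 1)^2 + (N 2)^2 + (N 3)^2) = Im 0"
    using mv by (simp add: N_def power2_eq_square mult.commute)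
  qed
  define A B C where "A = (N 1 - \<i>*N 2)/2" and "B = - (N 1 + \<i>*N 2)/2" and "C = - N 3/2"
  have AB: "A*B = C^2"
  proof -
   have "4*(A*B) = - ((N 1)^2 + (N 2)^2)"
    by (simp add: A_def B_def power2_eq_square field_simps)
   also have "... = (N 3)^2" using null by (simp add: add_eq_0_iff)
   also have "... = 4*C^2" by (simp add: C_def power2_eq_square)
   finally show ?thesis by simp
  qed
  have "EX Z W. Z^2 = A & W^2 = B & Z*W = C"
  proof (cases "A = 0")
   case True
   then have "C = 0" using AB by simp
   moreover obtain W where "W^2 = B" using complex_square_root by blast
   ultimately show ?thesis using True by (intro exI[of _ 0] exI[of _ W]) simp
  next
   case False
   obtain Z where Z: "Z^2 = A" using complex_square_root by blast
   then have "Z ~= 0" using False by auto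
   moreover have "(C/Z)^2 = B" unfolding power_divide Z AB[symmetric] using False by simp
   ultimately show ?thesis using Z by (intro exI[of _ Z] exI[of _ "C/Z"]) simp
  qed
  then obtain Z W where ZW: "Z^2 = A" "W^2 = B" "Z*W = C" by blast
  obtain q where q: "R4 q = ((Re Z, Im Z), (Re W, Im W))" using R4_surj by blast
  then have ZW': "Complex (q$1) (q$2) = Z" "Complex (q$3) (q$4) = W" by (auto simp: R4_def complex_eq_iff)
  have sp: "spin q = p"
  proof -
   have 1: "Z^2 - W^2 = N 1" "Z*W = - N 3/2" unfolding ZW by (simp_all add: A_def B_def C_def field_simps)
   have "Z^2 + W^2 = - (\<i>*N 2)" unfolding ZW by (simp add: A_def B_def field_simps)
   then have 2: "Re (Z^2 + W^2) = v$2" "Im (Z^2 + W^2) = - m$2" by (simp_all add: N_def)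
   show ?thesis unfolding spin_def Let_def ZW' 1 2 p(1)
    by (simp add: N_def vec_eq_iff forall_3)
  qed
  have "((norm q)^2)^2 = 1" using props[of q] sp p by simp
  then have "(norm q)^2 = 1" by (metis abs_square_eq_1 abs_power2)
  then have "q \<in> sphere 0 1" by (simp add: abs_square_eq_1)
  then show "p \<in> spin ` sphere 0 1" using sp by blast
 qed
qed

lemma continuous_on_vector3:
 fixes A B C :: "'a::topological_space => real"
 assumes "continuous_on S A" "continuous_on S B" "continuous_on S C"
 shows "continuous_on S (%s. vector [A s, B s, C s] :: real^3)"
proof -
 have v: "vector [A s, B s, C s] = (\<chi> j. if j = 1 then A s else if j = 2 then B s else C s :: real^3)" for s
  by (simp add: vec_eq_iff forall_3)
 show ?thesis unfolding v by (rule continuous_on_vec3[OF assms])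
qed

lemma continuous_on_spin: "continuous_on S spin"
proof -
 have s: "spin = (%q. (vector [(q$1)^2 - (q$2)^2 - (q$3)^2 + (q$4)^2, - (2*q$1*q$2 + 2*q$3*q$4), - 2*(q$1*q$3 - q$2*q$4)],
   vector [2*q$1*q$2 - 2*q$3*q$4, (q$1)^2 - (q$2)^2 + (q$3)^2 - (q$4)^2, - 2*(q$1*q$4 + q$2*q$3)]))"
  by (rule ext) (simp add: spin_def Let_def vec_eq_iff forall_3 power2_eq_square)
 show ?thesis unfolding s by (rule continuous_on_Pair) (rule continuous_on_vector3; intro continuous_intros)+
qed

text \<open>If the fibres are circles everywhere, \<open>Q3\<close> is the space of orthonormal pairs \<open>(m, v)\<close>: \<open>m\<close> is the
 direction of \<open>bet\<close>, \<open>v\<close> that of the displacement.\<close>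
lemma Q3_RP3:
 assumes pos: "!!al. al \<in> sphere 0 1 ==> 0 < psi e n l h al"
 shows "is_RP3 (top_of_set (Q3 1 e n l h))"
proof -
 define un where "un m = sgn (\<chi> j. if j = 3 then m$3 * sqrt 2 else m$j)" for m :: "real^3"
 have nz: "(\<chi> j. if j = 3 then m$3 * sqrt 2 else m$j) ~= 0" if "norm m = 1" for m :: "real^3"
 proof
  assume "(\<chi> j. if j = 3 then m$3 * sqrt 2 else m$j) = 0"
  then have "m = 0" by (simp add: vec_eq_iff forall_3)
  then show False using that by simp
 qed
 have un1: "un m \<in> sphere 0 1" if "norm m = 1" for m using nz[OF that] by (simp add: un_def norm_sgn)
 have bun: "EX r>0. bet (un m) = r *\<^sub>R m" if m: "norm m = 1" for m
 proof -
  let ?v = "(\<chi> j. if j = 3 then m$3 * sqrt 2 else m$j) :: real^3"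
  have "bet (un m) = inverse (norm ?v) *\<^sub>R m"
   by (simp add: bet_def un_def sgn_div_norm vec_eq_iff forall_3)
  then show ?thesis using nz[OF m] by (intro exI[of _ "inverse (norm ?v)"]) simp
 qed
 have bun': "sgn (bet (un m)) = m" if m: "norm m = 1" for m
 proof -
  obtain r where "0 < r" "bet (un m) = r *\<^sub>R m" using bun[OF m] by blast
  then show ?thesis using m by (simp add: sgn_div_norm)
 qed
 have unb: "un (sgn (bet al)) = al" if "al \<in> sphere 0 1" for al
 proof -
  have "(\<chi> j. if j = 3 then sgn (bet al)$3 * sqrt 2 else sgn (bet al)$j) = inverse (norm (bet al)) *\<^sub>R al"
   by (simp add: sgn_div_norm bet_def vec_eq_iff forall_3)
  then have "un (sgn (bet al)) = sgn (inverse (norm (bet al)) *\<^sub>R al)" by (simp add: un_def)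
  also have "... = al" using bet_nz[OF that] that by (simp add: sgn_div_norm)
  finally show ?thesis .
 qed
 let ?G = "%p::(real^3) \<times> (real^3). fib n l (un (fst p)) ((2 * sqrt (psi e n l h (un (fst p)))) *\<^sub>R snd p)"
 let ?T = "{(m, v). norm m = 1 & norm v = 1 & m \<bullet> v = 0} :: ((real^3) \<times> (real^3)) set"
 have cun: "continuous_on ?T (%p. un (fst p))"
 proof -
  have "un = (%m. sgn (\<chi> j. if j = 1 then m$1 else if j = 2 then m$2 else m$3 * sqrt 2))"
   unfolding un_def by (rule ext, rule arg_cong[where f = sgn]) (simp add: vec_eq_iff forall_3)
  moreover have "continuous_on (sphere 0 1) (%m::real^3. sgn ((\<chi> j. if j = 1 then m$1 else if j = 2 then m$2 else m$3 * sqrt 2) :: real^3))"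
  proof (rule continuous_on_sgn)
   show "continuous_on (sphere 0 1) (%m::real^3. (\<chi> j. if j = 1 then m$1 else if j = 2 then m$2 else m$3 * sqrt 2) :: real^3)"
    by (rule continuous_on_vec3) (intro continuous_intros)+
   show "\<forall>m\<in>sphere (0::real^3) 1. (\<chi> j. if j = 1 then m$1 else if j = 2 then m$2 else m$3 * sqrt 2) ~= (0 :: real^3)"
    using nz by (auto simp: vec_eq_iff forall_3)
  qed
  ultimately have "continuous_on (sphere 0 1) un" by simp
  moreover have "continuous_on ?T (%p. fst p)" by (intro continuous_intros)
  moreover have "(%p. fst p) ` ?T \<subseteq> sphere 0 1" by auto
  ultimately show ?thesis by (rule continuous_on_compose2)
 qed
 have cpsi: "continuous_on ?T (%p. psi e n l h (un (fst p)))"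
 proof (rule continuous_on_compose2[OF continuous_on_psi cun])
  show "(%p. un (fst p)) ` ?T \<subseteq> sphere 0 1"
  proof
   fix y assume "y \<in> (%p. un (fst p)) ` ?T"
   then obtain p where "p \<in> ?T" "y = un (fst p)" by blast
   then show "y \<in> sphere 0 1" using un1[of "fst p"] by auto
  qed
 qed
 have cG: "continuous_on ?T ?G"
 proof (rule continuous_on_fib[OF cun])
  show "continuous_on ?T (%p. (2 * sqrt (psi e n l h (un (fst p)))) *\<^sub>R snd p)"
   by (intro continuous_on_scaleR continuous_on_mult continuous_on_const continuous_on_real_sqrt cpsi
     continuous_on_snd continuous_on_id)
  show "un (fst p) \<in> sphere 0 1" if "p \<in> ?T" for p using that by (intro un1) auto
 qed
 have mb: "v \<bullet> bet (un m) = 0 \<longleftrightarrow> m \<bullet> v = 0" if "norm m = 1" for m v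
  using bun[OF that] by (auto simp: inner_commute)
 have G: "?G ` ?T = Q3 1 e n l h"
 proof (intro equalityI subsetI)
  fix p assume "p \<in> ?G ` ?T"
  then obtain m v where p: "norm m = 1" "norm v = 1" "m \<bullet> v = 0" "p = ?G (m,v)" by auto
  let ?w = "(2 * sqrt (psi e n l h (un m))) *\<^sub>R v"
  have "?w \<bullet> bet (un m) = 0" using mb[OF p(1)] p(3) by simp
  moreover have "(norm ?w)^2 = 4*psi e n l h (un m)"
   using pos[OF un1[OF p(1)]] p(2) by (simp add: power_mult_distrib)
  ultimately show "p \<in> Q3 1 e n l h" using fib_in_Q3[OF un1[OF p(1)]] p(4) by simp
 next
  fix p assume pQ: "p \<in> Q3 1 e n l h"
  obtain M al where p: "p = (M, al)" by (cases p)
  obtain w where w0: "w \<bullet> bet al = 0 & fib n l al w = (M, al) & al \<in> sphere 0 1"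
   using Q3_fib[OF pQ[unfolded p]] by (rule exE)
  then have w: "w \<bullet> bet al = 0" "fib n l al w = p" "al \<in> sphere 0 1" by (simp_all only: p)
  have nw: "(norm w)^2 = 4*psi e n l h al"
   using fib_in_Q3[OF w(3,1), of n l e h] pQ unfolding w(2) by (simp only:)
  define m where "m = sgn (bet al)"
  have m: "norm m = 1" "un m = al" using bet_nz[OF w(3)] unb[OF w(3)] by (simp_all add: m_def norm_sgn)
  have wn: "norm w = 2 * sqrt (psi e n l h al)"
  proof -
   have "(2 * sqrt (psi e n l h al))^2 = (norm w)^2" using pos[OF w(3)] nw by (simp add: power_mult_distrib)
   then have "2 * sqrt (psi e n l h al) = norm w"
    by (rule power2_eq_imp_eq) (use pos[OF w(3)] in auto)
   then show ?thesis by simp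
  qed
  have p0: "0 < norm w" using wn pos[OF w(3)] by simp
  have "w \<bullet> bet (un m) = 0" using w(1) m(2) by simp
  then have "m \<bullet> w = 0" using mb[OF m(1)] by blast
  then have "m \<bullet> sgn w = 0" by (simp add: sgn_div_norm)
  moreover have "norm (sgn w) = 1" using p0 by (simp add: norm_sgn)
  ultimately have T: "(m, sgn w) \<in> ?T" using m(1) by blast
  have "(2 * sqrt (psi e n l h (un m))) *\<^sub>R sgn w = w"
   unfolding m(2) wn[symmetric] using p0 by (simp add: sgn_div_norm)
  then have "?G (m, sgn w) = p" unfolding fst_conv snd_conv m(2) using w(2) by (simp only:)
  then have "p = ?G (m, sgn w)" by (rule sym)
  then show "p \<in> ?G ` ?T" using T by (rule image_eqI)

 qed
 have inj: "x = y" if "x \<in> ?T" "y \<in> ?T" "?G x = ?G y" for x y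
 proof -
  obtain m v m' v' where xy: "x = (m,v)" "y = (m',v')" by (metis surj_pair)
  have f: "al = al' & w = w'" if "fib n l al w = fib n l al' w'" for al al' w w'
   using that by (auto simp: fib_def Let_def vec_eq_iff forall_3)
  have n: "norm m = 1" "norm m' = 1" using that xy by auto
  note fe = f[OF that(3)[unfolded xy fst_conv snd_conv]]
  have e: "un m = un m'" by (rule fe[THEN conjunct1])
  have e2: "(2 * sqrt (psi e n l h (un m))) *\<^sub>R v = (2 * sqrt (psi e n l h (un m'))) *\<^sub>R v'"
   by (rule fe[THEN conjunct2])
  have "m = m'" using arg_cong[OF e, of "%x. sgn (bet x)"] unfolding bun'[OF n(1)] bun'[OF n(2)] .
  moreover have "2 * sqrt (psi e n l h (un m')) ~= 0" using pos[OF un1[OF n(2)]] by simp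
  then have "v = v'" using e2 unfolding e scaleR_cancel_left by blast
  ultimately show ?thesis using xy by simp
 qed
 define G where "G = ?G"
 define p where "p q = G (spin q)" for q
 have c: "continuous_on (sphere 0 1) p" unfolding p_def
  by (rule continuous_on_compose2[OF cG[folded G_def] continuous_on_spin]) (simp only: spin_image order_refl)
 have "p ` sphere 0 1 = G ` (spin ` sphere 0 1)" unfolding p_def[abs_def] by (simp only: image_image)
 then have im: "p ` sphere 0 1 = Q3 1 e n l h" by (simp only: spin_image G[folded G_def])
 have quot: "quotient_map S3 (top_of_set (Q3 1 e n l h)) p"
 proof (rule T1_Spaces.continuous_imp_quotient_map)
  show "continuous_map S3 (top_of_set (Q3 1 e n l h)) p"
   using c im by (auto simp: continuous_map_in_subtopology)
  show "p ` topspace S3 = topspace (top_of_set (Q3 1 e n l h))"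
   unfolding topspace_euclidean_subtopology by (rule im)
 qed (auto simp: compact_space_subtopology Hausdorff_space_subtopology)
 have fibres: "p x = p y \<longleftrightarrow> x = y | x = - y" if "x \<in> sphere 0 1" "y \<in> sphere 0 1" for x y
 proof -
  have "spin x \<in> ?T" "spin y \<in> ?T" unfolding spin_image[symmetric] using that by simp_all
  from inj[OF this] have "G (spin x) = G (spin y) ==> spin x = spin y" unfolding G_def .
  then have "p x = p y \<longleftrightarrow> spin x = spin y" unfolding p_def by metis
  then show ?thesis by (simp only: spin_eq_iff)
 qed
 show ?thesis unfolding is_RP3_def
  by (intro exI[of _ p] conjI ballI quot fibres)
qed

text \<open>\<open>pf\<close> is positive at \<open>x\<close> exactly if the effective potential is below the energy on the whole circle
 of directions with first coordinate \<open>x\<close>.\<close>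

definition pf :: "real => real => real => real => real => real" where
 "pf e n l k x = gf e n k x*(2 + 2*x^2) - 2*(1 - x^2)*l^2 - n^2*(1 - x^2)*(1 + x^2)"

lemma psi_identity:
 fixes n l g :: real
 assumes "x^2 + y^2 + z^2 = 1"
 shows "(1 - x^2)*(2*l^2 + n^2*(1 + x^2))*((2 - z^2)*g - (n*y + l*z)^2) =
  g*(n*(1 + x^2)*z - 2*l*y)^2
   + (g*(2 + 2*x^2) - 2*(1 - x^2)*l^2 - n^2*(1 - x^2)*(1 + x^2))*(n*y + l*z)^2"
proof -
 have x2: "x^2 = 1 - y^2 - z^2" using assms by simp
 show ?thesis unfolding x2 by (simp add: power2_eq_square algebra_simps)
qed

lemma pf_neg:
 assumes "0 < n" "x^2 < 1" "gf e n k x <= 0"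
 shows "pf e n l k x < 0"
proof -
 have "gf e n k x*(2 + 2*x^2) <= 0" using assms by (intro mult_nonpos_nonneg) auto
 moreover have "0 <= 2*(1 - x^2)*l^2" using assms by simp
 moreover have "0 < n^2*(1 - x^2)*(1 + x^2)" using assms by (intro mult_pos_pos) (auto simp: add_pos_nonneg)
 ultimately show ?thesis unfolding pf_def by linarith
qed

lemma pf_pole: "pf e n l k 1 = 4*gf e n k 1" "pf e n l k (-1) = 4*gf e n k (-1)"
 by (simp_all add: pf_def)

text \<open>In the coordinates \<open>\<eta> = n y + l z\<close>, \<open>\<zeta> = n (1 + x^2) z - 2 l y\<close> the region of possible motion over a
 circle \<open>x = const\<close> is \<open>g \<zeta>^2 + p \<eta>^2 \<ge> 0\<close>. After normalising \<open>(\<eta>, \<zeta>)\<close> it becomes the double of a lens.\<close>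

lemma Q3_homeomorphic_Mod:
 fixes e n l h :: real
 defines "g == gf e n (h - l^2)" and "p == pf e n l (h - l^2)"
 assumes n: "0 < n" and ab: "-1 <= a" "a < b" "b <= 1"
  and gpos: "!!x. a < x ==> x < b ==> 0 < g x"
  and ga: "a = -1 & 0 < g a | g a = 0 & -1 < a" and gb: "b = 1 & 0 < g b | g b = 0 & b < 1"
  and gneg: "!!x. -1 <= x ==> x <= 1 ==> x < a | b < x ==> g x < 0"
  and sim: "sim p a b P (-1) 1" and P: "continuous_on {-1..1} P"
  and neg: "al0 \<in> sphere 0 1" "psi e n l h al0 < 0"
 shows "Q3 1 e n l h homeomorphic Mod P"
proof -
 let ?U = "{al \<in> sphere (0::real^3) 1. 0 <= psi e n l h al}"
 (* With (\<eta>, \<zeta>) normalised to (u, v), u^2 + v^2 = 1, the lens coordinate is t = r \<surd>G u and the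
  doubling coordinate is s = r v, r = \<surd>(1 - x^2). Then \<beta>^2 - t^2 = r^2 (g v^2 - max 0 (-p) u^2). *)
 define G where "G x = g x + max 0 (- p x)" for x
 define \<beta> where "\<beta> x = sqrt ((1 - x^2)*g x)" for x
 define V where "V = {(x, t). a <= x & x <= b & \<bar>t\<bar> <= \<beta> x}"
 define i where "i = (%(x, t). sqrt ((1 - x^2) - t^2/G x))"
 define ro where "ro = (%(x, t). \<beta> x - \<bar>t\<bar> + max 0 (p x))"
 define et where "et al = n*al$2 + l*al$3" for al :: "real^3"
 define ze where "ze al = n*(1 + (al$1)^2)*al$3 - 2*l*al$2" for al :: "real^3"
 define D where "D al = sqrt ((et al)^2 + (ze al)^2)" for al
 define r where "r x = sqrt (1 - x^2)" for x :: real
 define \<Phi> where "\<Phi> al = ((al$1, (r (al$1) * sqrt (G (al$1)))*(et al/D al)), r (al$1)*(ze al/D al))" for al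
 define w where "w x = 2*l^2 + n^2*(1 + x^2)" for x :: real
 have wpos: "0 < w x" for x
 proof -
  have "0 < n^2*(1 + x^2)" using n by (intro mult_pos_pos) (auto simp: add_pos_nonneg)
  then show ?thesis unfolding w_def using zero_le_power2[of l] by linarith
 qed
 have cg: "continuous_on S g" "continuous_on S p" for S
  unfolding g_def p_def pf_def gf_def by (intro continuous_intros)+
 have cG: "continuous_on S G" "continuous_on S \<beta>" for S
  unfolding G_def \<beta>_def by (intro continuous_intros cg)+
 have x1: "x^2 <= 1" if "a <= x" "x <= b" for x using that ab by (auto simp: abs_square_le_1)
 have g0: "0 <= g x" if "a <= x" "x <= b" for x
  using that gpos[of x] ga gb by (cases "x = a"; cases "x = b") force+
 have pn: "p x < 0" if "x^2 < 1" "g x <= 0" for x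
  using pf_neg[OF n that(1)] that(2) unfolding g_def p_def by blast
 have pole: "x = 1 & b = 1 | x = -1 & a = -1" if "a <= x" "x <= b" "~ x^2 < 1" for x
 proof -
  have "\<bar>x\<bar> = 1" using that x1[of x] abs_square_eq_1[of x] by linarith
  then show ?thesis using that ab by (auto simp: abs_if split: if_splits)
 qed
 have gpole: "0 < g x" "p x = 4*g x" if "a <= x" "x <= b" "~ x^2 < 1" for x
  using pole[OF that] ga gb ab pf_pole unfolding g_def p_def by auto
 have Gpos: "0 < G x" if "a <= x" "x <= b" for x
 proof (cases "x^2 < 1 & g x = 0")
  case True then show ?thesis using pn[of x] by (auto simp: G_def)
 next
  case False
  then have "0 < g x" using g0[OF that] gpole[OF that] by force
  then show ?thesis by (simp add: G_def)
 qed
 have cV: "continuous_on V (%v. f (fst v))" if "continuous_on {a..b} f" for f :: "real => real"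
  by (rule continuous_on_compose2[OF that]) (auto simp: V_def intro!: continuous_intros)
 have ci: "continuous_on V i"
  unfolding i_def case_prod_unfold
  by (intro continuous_intros cV cG ballI) (use Gpos in \<open>force simp: V_def\<close>)
 have cro: "continuous_on V ro"
  unfolding ro_def case_prod_unfold by (intro continuous_intros cV cG cg)
 have \<beta>2: "(\<beta> x)^2 = (1 - x^2)*g x" "0 <= \<beta> x" if "a <= x" "x <= b" for x
  using g0[OF that] x1[OF that] by (auto simp: \<beta>_def)
 have tb: "t^2 <= (1 - x^2)*g x" if "(x,t) \<in> V" for x t
 proof -
  have x: "a <= x" "x <= b" "\<bar>t\<bar> <= \<beta> x" using that by (auto simp: V_def)
  then have "\<bar>t\<bar>^2 <= (\<beta> x)^2" by (intro power_mono) auto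
  then show ?thesis using \<beta>2[OF x(1,2)] by simp
 qed
 have tG: "t^2/G x <= 1 - x^2" if "(x,t) \<in> V" for x t
 proof -
  have x: "a <= x" "x <= b" using that by (auto simp: V_def)
  have "t^2 <= (1 - x^2)*G x"
   using tb[OF that] x1[OF x] mult_left_mono[of "g x" "G x" "1 - x^2"] by (simp add: G_def)
  then show ?thesis using Gpos[OF x] by (simp add: pos_divide_le_eq)
 qed
 have pos: "0 <= i v" "0 <= ro v" if "v \<in> V" for v
 proof -
  obtain x t where v: "v = (x,t)" by (cases v)
  show "0 <= i v" using tG[of x t] that unfolding v i_def by simp
  show "0 <= ro v" using that unfolding v ro_def V_def by auto
 qed
 have sph: "(al$1)^2 + (al$2)^2 + (al$3)^2 = 1" "(al$1)^2 <= 1" "0 < 2 - (al$3)^2" "0 <= (r (al$1))^2" "(r (al$1))^2 = 1 - (al$1)^2"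
  if "al \<in> sphere 0 1" for al :: "real^3"
  using that sphere_z[OF that] unfolding sphere3 r_def by auto
 have psiW: "(2 - (al$3)^2)*psi e n l h al = (2 - (al$3)^2)*g (al$1) - (et al)^2" if "al \<in> sphere 0 1" for al
  using sph(3)[OF that] by (simp add: psi_def g_def et_def right_diff_distrib)
 have ident: "(1 - (al$1)^2)*w (al$1)*((2 - (al$3)^2)*psi e n l h al) = g (al$1)*(ze al)^2 + p (al$1)*(et al)^2"
  if "al \<in> sphere 0 1" for al
  unfolding psiW[OF that] using psi_identity[OF sph(1)[OF that], of l n "g (al$1)"]
  by (simp add: w_def et_def ze_def p_def pf_def g_def)
 have sgnpsi: "0 <= psi e n l h al \<longleftrightarrow> 0 <= g (al$1)*(ze al)^2 + p (al$1)*(et al)^2"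
   "psi e n l h al = 0 \<longleftrightarrow> g (al$1)*(ze al)^2 + p (al$1)*(et al)^2 = 0"
  if "al \<in> sphere 0 1" "(al$1)^2 < 1" for al
 proof -
  have c: "0 < (1 - (al$1)^2)*w (al$1)*(2 - (al$3)^2)"
   using that sph(3)[OF that(1)] wpos by (intro mult_pos_pos) auto
  have "((1 - (al$1)^2)*w (al$1)*(2 - (al$3)^2))*psi e n l h al = g (al$1)*(ze al)^2 + p (al$1)*(et al)^2"
   using ident[OF that(1)] by (simp only: mult.assoc)
  then show "0 <= psi e n l h al \<longleftrightarrow> 0 <= g (al$1)*(ze al)^2 + p (al$1)*(et al)^2"
   "psi e n l h al = 0 \<longleftrightarrow> g (al$1)*(ze al)^2 + p (al$1)*(et al)^2 = 0"
   using c by (metis zero_le_mult_iff less_le not_less, metis mult_eq_0_iff less_irrefl)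
 qed
 have Uab: "a <= al$1" "al$1 <= b" if "al \<in> ?U" for al
 proof -
  have s: "al \<in> sphere 0 1" using that by auto
  have "0 <= (2 - (al$3)^2)*psi e n l h al" using that sph(3)[OF s] by auto
  then have "0 <= (2 - (al$3)^2)*g (al$1)" using psiW[OF s] zero_le_power2[of "et al"] by linarith
  then have "0 <= g (al$1)" using sph(3)[OF s] by (simp add: zero_le_mult_iff)
  moreover have "\<bar>al$1\<bar> <= 1" using sph(2)[OF s] by (simp add: abs_square_le_1)
  ultimately show "a <= al$1" "al$1 <= b" using gneg[of "al$1"] by force+
 qed
 have solve: "w x*y = n*(1 + x^2)*(n*y + l*z) - l*(n*(1 + x^2)*z - 2*l*y)"
   "w x*z = 2*l*(n*y + l*z) + n*(n*(1 + x^2)*z - 2*l*y)" for x y z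
  by (simp_all add: w_def power2_eq_square algebra_simps)
 have solveE: "w (al$1)*al$2 = n*(1 + (al$1)^2)*et al - l*ze al" "w (al$1)*al$3 = 2*l*et al + n*ze al" for al
  unfolding et_def ze_def by (rule solve)+
 have Dpos: "0 < D al" if "al \<in> sphere 0 1" "(al$1)^2 < 1" for al
 proof (rule ccontr)
  assume "~ 0 < D al"
  then have "(et al)^2 + (ze al)^2 <= 0" by (simp add: D_def)
  then have z: "et al = 0" "ze al = 0" by (simp_all add: sum_power2_le_zero_iff)
  have "w (al$1)*al$2 = 0" "w (al$1)*al$3 = 0"
   unfolding solveE z by simp_all
  then have "al$2 = 0" "al$3 = 0" using wpos[of "al$1"] by auto
  then show False using sph(1)[OF that(1)] that(2) by simp
 qed
 have D2: "(D al)^2 = (et al)^2 + (ze al)^2" for al by (simp add: D_def)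
 have Dle: "\<bar>et al/D al\<bar> <= 1" "\<bar>ze al/D al\<bar> <= 1" for al
 proof -
  have "\<bar>et al\<bar> <= D al" "\<bar>ze al\<bar> <= D al" unfolding D_def by (auto intro!: real_le_rsqrt)
  then show "\<bar>et al/D al\<bar> <= 1" "\<bar>ze al/D al\<bar> <= 1" by (auto simp: divide_simps)
 qed
 have crd: "continuous_on S (%al::real^3. f (al$1))" if "!!T. continuous_on T f" for S and f :: "real => real"
  by (rule continuous_on_compose2[OF that[of UNIV]]) (auto intro!: continuous_intros)
 have cet: "continuous_on S et" "continuous_on S ze" for S
  unfolding et_def ze_def by (intro continuous_intros)+
 have cD: "continuous_on S D" for S unfolding D_def by (intro continuous_intros cet)
 have cr: "continuous_on S (%al::real^3. r (al$1))" for S unfolding r_def by (intro continuous_intros)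
 have c\<Phi>: "continuous_on ?U \<Phi>"
 proof -
  have quot: "continuous_on {al \<in> ?U. f al ~= 0} (%al. q al/D al)"
   if "!!al. f al ~= 0 ==> r (al$1) ~= 0" "continuous_on {al \<in> ?U. f al ~= 0} q" for f q
  proof (rule continuous_on_divide[OF that(2) cD])
   show "\<forall>al\<in>{al \<in> ?U. f al ~= 0}. D al ~= 0"
   proof
    fix al assume "al \<in> {al \<in> ?U. f al ~= 0}"
    then have "al \<in> sphere 0 1" "r (al$1) ~= 0" using that(1) by auto
    then show "D al ~= 0" using Dpos[of al] sph(2)[of al] by (auto simp: r_def)
   qed
  qed
  have rG: "continuous_on ?U (%al. r (al$1) * sqrt (G (al$1)))"
   by (intro continuous_on_mult cr continuous_on_real_sqrt crd cG)
  have 1: "continuous_on ?U (%al. (r (al$1) * sqrt (G (al$1)))*(et al/D al))"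
   by (rule continuous_on_mult_bounded[OF rG quot[OF _ cet(1)] Dle(1)]) simp
  have 2: "continuous_on ?U (%al. r (al$1)*(ze al/D al))"
   by (rule continuous_on_mult_bounded[OF cr quot[OF _ cet(2)] Dle(2)])
  show ?thesis unfolding \<Phi>_def
   by (intro continuous_on_Pair 1 2 continuous_intros)
 qed
 have key: "((al$1, t), s) \<in> circ V i & (ro (al$1, t) = 0 \<longleftrightarrow> psi e n l h al = 0)"
  if al: "al \<in> ?U" "\<Phi> al = ((al$1, t), s)" for al t s
 proof -
  note x = Uab[OF al(1)]
  have s1: "al \<in> sphere 0 1" using al by auto
  have ts: "t = r (al$1) * sqrt (G (al$1))*(et al/D al)" "s = r (al$1)*(ze al/D al)"
   using al(2) by (auto simp: \<Phi>_def)
  show ?thesis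
  proof (cases "(al$1)^2 < 1")
   case False
   then have r0: "r (al$1) = 0" "(al$1)^2 = 1" using sph(2)[OF s1] by (auto simp: r_def)
   then have b0: "\<beta> (al$1) = 0" "t = 0" "s = 0" using ts by (auto simp: \<beta>_def)
   have "0 < (2 - (al$3)^2)*psi e n l h al"
   proof -
    have "al$2 = 0" "al$3 = 0" using sph(1)[OF s1] r0 by (simp_all add: sum_power2_eq_zero_iff)
    then show ?thesis using psiW[OF s1] gpole[OF x False] by (simp add: et_def)
   qed
   then have "psi e n l h al ~= 0" by auto
   moreover have "0 < p (al$1)" using gpole[OF x False] by auto
   ultimately show ?thesis using b0 x r0 by (auto simp: circ_def V_def i_def ro_def)
  next
   case True
   have Dp: "0 < D al" by (rule Dpos[OF s1 True])
   have Gp: "0 < G (al$1)" by (rule Gpos[OF x])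
   have rp: "0 < r (al$1)" "(r (al$1))^2 = 1 - (al$1)^2" using True by (auto simp: r_def)
   define u v where "u = et al/D al" and "v = ze al/D al"
   have "u^2 + v^2 = ((et al)^2 + (ze al)^2)/(D al)^2"
    by (simp only: u_def v_def power_divide add_divide_distrib)
   then have uv: "u^2 + v^2 = 1" unfolding D2[symmetric] using Dp by simp
   have t2: "t^2 = (1 - (al$1)^2)*(G (al$1)*u^2)"
    unfolding ts(1) u_def[symmetric] power_mult_distrib rp(2) using Gp by simp
   have s2: "s^2 = (1 - (al$1)^2) * v^2" unfolding ts(2) v_def[symmetric] power_mult_distrib rp(2) by simp
   have ev: "et al = D al*u" "ze al = D al * v" using Dp by (simp_all add: u_def v_def)
   have F: "g (al$1)*(ze al)^2 + p (al$1)*(et al)^2 = (D al)^2*(g (al$1) * v^2 + p (al$1)*u^2)"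
    unfolding ev by (simp add: power_mult_distrib algebra_simps)
   have D2p: "0 < (D al)^2" using Dp by simp
   have F0: "0 <= g (al$1) * v^2 + p (al$1)*u^2"
    using al(1) sgnpsi(1)[OF s1 True] D2p unfolding F by (simp add: zero_le_mult_iff)
   have Fz: "psi e n l h al = 0 \<longleftrightarrow> g (al$1) * v^2 + p (al$1)*u^2 = 0"
    unfolding sgnpsi(2)[OF s1 True] F using D2p by simp
   have gG: "g (al$1) - G (al$1)*u^2 = g (al$1) * v^2 - max 0 (- p (al$1))*u^2"
   proof -
    have v2: "v^2 = 1 - u^2" using uv by simp
    show ?thesis unfolding v2 G_def by (simp add: algebra_simps)
   qed
   have ge: "0 <= g (al$1) - G (al$1)*u^2"
    unfolding gG using F0 g0[OF x] by (cases "0 <= p (al$1)") auto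
   have gz: "g (al$1) - G (al$1)*u^2 = 0 & p (al$1) <= 0 \<longleftrightarrow> g (al$1) * v^2 + p (al$1)*u^2 = 0"
   proof (cases "p (al$1) <= 0")
    case True then show ?thesis unfolding gG by auto
   next
    case False
    then have "0 < g (al$1)" using pn[OF True] by force
    then have "0 < g (al$1) * v^2 + p (al$1)*u^2"
     using False uv by (cases "u = 0") (auto intro!: add_nonneg_pos)
    then show ?thesis using False by auto
   qed
   have b2: "(\<beta> (al$1))^2 - t^2 = (1 - (al$1)^2)*(g (al$1) - G (al$1)*u^2)"
    unfolding \<beta>2(1)[OF x] t2 by (simp add: algebra_simps)
   have tl: "\<bar>t\<bar> <= \<beta> (al$1)"
   proof -
    have "0 <= (\<beta> (al$1))^2 - t^2" unfolding b2 using True ge by simp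
    then have "\<bar>t\<bar>^2 <= (\<beta> (al$1))^2" unfolding power2_abs by linarith
    then show ?thesis by (rule power2_le_imp_le) (rule \<beta>2(2)[OF x])
   qed
   have te: "\<bar>t\<bar> = \<beta> (al$1) \<longleftrightarrow> g (al$1) - G (al$1)*u^2 = 0"
   proof -
    have "\<bar>t\<bar> = \<beta> (al$1) \<longleftrightarrow> \<bar>t\<bar>^2 = (\<beta> (al$1))^2"
     using \<beta>2(2)[OF x] by (simp only: power2_eq_iff_nonneg abs_ge_zero)
    then have "\<bar>t\<bar> = \<beta> (al$1) \<longleftrightarrow> (\<beta> (al$1))^2 - t^2 = 0" unfolding power2_abs by linarith
    then show ?thesis unfolding b2 using True by simp
   qed
   have "t^2/G (al$1) = (1 - (al$1)^2)*u^2" unfolding t2 using Gp by simp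
   then have "(1 - (al$1)^2) - t^2/G (al$1) = s^2"
   proof -
    have v2: "v^2 = 1 - u^2" using uv by simp
    show ?thesis unfolding s2 v2 \<open>t^2 / G (al$1) = _\<close> by (simp add: algebra_simps)
   qed
   then have "\<bar>s\<bar> = i (al$1, t)" by (simp add: i_def)
   moreover have "ro (al$1, t) = 0 \<longleftrightarrow> \<bar>t\<bar> = \<beta> (al$1) & p (al$1) <= 0"
    unfolding ro_def using tl by (auto simp: max_def)
   ultimately show ?thesis using x tl te gz Fz by (auto simp: circ_def V_def)
  qed
 qed
 have inj: "inj_on \<Phi> ?U"
 proof (rule inj_onI)
  fix al al' assume al: "al \<in> ?U" "al' \<in> ?U" "\<Phi> al = \<Phi> al'"
  have x: "al'$1 = al$1" using al(3) by (auto simp: \<Phi>_def)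
  have s: "al \<in> sphere 0 1" "al' \<in> sphere 0 1" using al by auto
  show "al = al'"
  proof (cases "(al$1)^2 < 1")
   case False
   then have "(al$1)^2 = 1" using sph(2)[OF s(1)] by auto
   then have "al$2 = 0" "al$3 = 0" "al'$2 = 0" "al'$3 = 0"
    using sph(1)[OF s(1)] sph(1)[OF s(2)] x by (simp_all add: sum_power2_eq_zero_iff)
   then show ?thesis using x by (simp add: vec_eq_iff forall_3)
  next
   case True
   have Dp: "0 < D al" "0 < D al'" using Dpos[OF s(1)] Dpos[OF s(2)] True x by auto
   have "r (al$1) * sqrt (G (al$1)) ~= 0" "r (al$1) ~= 0" using True Gpos[OF Uab[OF al(1)]] by (auto simp: r_def)
   moreover have "(r (al$1) * sqrt (G (al$1)))*(et al/D al) = (r (al$1) * sqrt (G (al$1)))*(et al'/D al')"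
    "r (al$1)*(ze al/D al) = r (al$1)*(ze al'/D al')"
    using al(3) unfolding \<Phi>_def prod.inject x by blast+
   ultimately have q: "et al/D al = et al'/D al'" "ze al/D al = ze al'/D al'"
    by (metis mult_left_cancel)+
   define c where "c = D al/D al'"
   have c: "0 < c" "et al = c*et al'" "ze al = c*ze al'" using Dp q by (auto simp: c_def field_simps)
   have "w (al$1)*al$2 = w (al$1)*(c*al'$2)" "w (al$1)*al$3 = w (al$1)*(c*al'$3)"
   proof -
    note 1 = solveE[of al] and 2 = solveE[of al', unfolded x]
    have "w (al$1)*(c*al'$2) = c*(w (al$1)*al'$2)" "w (al$1)*(c*al'$3) = c*(w (al$1)*al'$3)"
     by (simp_all add: ac_simps)
    then show "w (al$1)*al$2 = w (al$1)*(c*al'$2)" "w (al$1)*al$3 = w (al$1)*(c*al'$3)"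
     unfolding 1 2 c(2,3) by (simp_all only: algebra_simps)
   qed
   then have yz: "al$2 = c*al'$2" "al$3 = c*al'$3" using wpos[of "al$1"] by auto
   have "c^2*((al'$2)^2 + (al'$3)^2) = 1*((al'$2)^2 + (al'$3)^2)"
    using sph(1)[OF s(1)] sph(1)[OF s(2)] unfolding yz x by (simp add: power_mult_distrib algebra_simps)
   moreover have "(al'$2)^2 + (al'$3)^2 ~= 0" using sph(1)[OF s(2)] True x by auto
   ultimately have "c^2 = 1" by (simp only: mult_cancel_right) simp
   then have "c = 1" using c(1) by (simp add: abs_square_eq_1 power2_eq_1_iff)
   then show ?thesis using x yz by (simp add: vec_eq_iff forall_3)
  qed
 qed
 have im: "\<Phi> ` ?U = circ V i"
 proof (intro equalityI subsetI)
  fix q assume "q \<in> \<Phi> ` ?U"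
  then obtain al where "al \<in> ?U" "q = \<Phi> al" by blast
  then show "q \<in> circ V i" using key[of al] unfolding \<Phi>_def by blast
 next
  fix q :: "(real \<times> real) \<times> real" assume q: "q \<in> circ V i"
  obtain x t s where qq: "q = ((x,t),s)" by (metis surj_pair)
  have V: "(x,t) \<in> V" and s: "\<bar>s\<bar> = i (x,t)" using q qq by (auto simp: circ_def)
  then have x: "a <= x" "x <= b" "\<bar>t\<bar> <= \<beta> x" by (auto simp: V_def)
  have s2: "s^2 = (1 - x^2) - t^2/G x"
  proof -
   have "s^2 = \<bar>s\<bar>^2" by simp
   then show ?thesis unfolding s using tG[OF V] by (simp add: i_def)
  qed
  have Gp: "0 < G x" by (rule Gpos[OF x(1,2)])
  show "q \<in> \<Phi> ` ?U"
  proof (cases "x^2 < 1")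
   case False
   then have x2: "x^2 = 1" using x1[OF x(1,2)] by simp
   then have t0: "t = 0" using x by (simp add: \<beta>_def)
   then have s0: "s = 0" using s2 x2 by simp
   define al :: "real^3" where "al = vector [x, 0, 0]"
   have s1: "al \<in> sphere 0 1" unfolding sphere3 using x2 by (simp add: al_def)
   have "psi e n l h al = g x" by (simp add: psi_def al_def g_def)
   then have "al \<in> ?U" using s1 g0[OF x(1,2)] by auto
   moreover have "\<Phi> al = q" using x2 t0 s0 qq by (simp add: \<Phi>_def al_def r_def)
   ultimately show ?thesis by blast
  next
   case True
   have rp: "0 < r x" "(r x)^2 = 1 - x^2" using True by (auto simp: r_def)
   define u v where "u = t/(r x * sqrt (G x))" and "v = s/r x"
   have u2: "u^2 = t^2/((1 - x^2)*G x)" unfolding u_def using Gp by (simp add: power_divide power_mult_distrib rp)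
   have v2: "v^2 = s^2/(1 - x^2)" unfolding v_def by (simp add: power_divide rp)
   have "T/(R*F) + (R - T/F)/R = 1" if "0 < R" "0 < F" for T R F :: real
    using that by (simp add: field_simps)
   then have uv: "u^2 + v^2 = 1" unfolding u2 v2 s2 using True Gp by simp
   define y0 z0 where "y0 = (n*(1 + x^2)*u - l * v)/w x" and "z0 = (2*l*u + n * v)/w x"
   have sol: "n*y0 + l*z0 = u" "n*(1 + x^2)*z0 - 2*l*y0 = v"
   proof -
    have wy: "w x*y0 = n*(1 + x^2)*u - l * v" "w x*z0 = 2*l*u + n * v"
     using wpos[of x] by (simp_all add: y0_def z0_def)
    have "w x*(n*y0 + l*z0) = n*(w x*y0) + l*(w x*z0)" by (simp add: algebra_simps)
    also have "... = w x*u" unfolding wy by (simp add: w_def power2_eq_square algebra_simps)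
    finally show "n*y0 + l*z0 = u" using wpos[of x] by simp
    have "w x*(n*(1 + x^2)*z0 - 2*l*y0) = n*(1 + x^2)*(w x*z0) - 2*l*(w x*y0)"
     by (simp add: algebra_simps)
    also have "... = w x * v" unfolding wy by (simp add: w_def power2_eq_square algebra_simps)
    finally show "n*(1 + x^2)*z0 - 2*l*y0 = v" using wpos[of x] by simp
   qed
   have nz: "y0 ~= 0 | z0 ~= 0" using sol uv by auto
   define m where "m = sqrt (y0^2 + z0^2)"
   have m: "0 < m" "m^2 = y0^2 + z0^2" using nz by (auto simp: m_def sum_power2_gt_zero_iff)
   define c where "c = r x/m"
   have c: "0 < c" "c^2*(y0^2 + z0^2) = 1 - x^2" using rp m by (auto simp: c_def power_divide)
   define al :: "real^3" where "al = vector [x, c*y0, c*z0]"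
   have A: "al$1 = x" "al$2 = c*y0" "al$3 = c*z0" by (simp_all add: al_def)
   have s1: "al \<in> sphere 0 1" unfolding sphere3 A using c(2) by (simp add: power_mult_distrib distrib_left)
   have e: "et al = c*u" "ze al = c * v"
    unfolding et_def ze_def A sol[symmetric] by (simp_all add: algebra_simps)
   have Dc: "D al = c" unfolding D_def e power_mult_distrib distrib_left[symmetric] uv using c(1) by simp
   have "0 <= g x * v^2 + p x*u^2"
   proof -
    have "t^2 <= (1 - x^2)*g x" by (rule tb[OF V])
    moreover have "t^2 = (1 - x^2)*(G x*u^2)" unfolding u2 using True Gp by simp
    ultimately have "G x*u^2 <= g x" using True by simp
    moreover have v2: "v^2 = 1 - u^2" using uv by simp
    moreover have "- p x*u^2 <= max 0 (- p x)*u^2" by (intro mult_right_mono) auto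
    ultimately show ?thesis unfolding v2 G_def by (simp add: algebra_simps)
   qed
   then have "0 <= c^2*(g x * v^2 + p x*u^2)" by simp
   also have "... = g (al$1)*(ze al)^2 + p (al$1)*(et al)^2"
    unfolding e A by (simp add: power_mult_distrib algebra_simps)
   finally have "al \<in> ?U" using s1 sgnpsi(1)[OF s1] True A by simp
   moreover have "\<Phi> al = q"
    unfolding \<Phi>_def A e Dc qq using c(1) rp(1) Gp by (simp add: u_def v_def)
   ultimately show ?thesis by blast
  qed
 qed
 have cU: "compact ?U"
 proof -
  have "closed (sphere 0 1 \<inter> psi e n l h -` {0..})"
   by (intro continuous_closed_preimage[OF continuous_on_psi] closed_sphere closed_atLeast)
  moreover have "sphere 0 1 \<inter> psi e n l h -` {0..} = ?U" by auto
  ultimately show ?thesis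
   using compact_sphere[of "0::real^3" 1] by (metis compact_Int_closed inf.left_idem)
 qed
 have cpsi: "continuous_on ?U (%al. 2 * sqrt (psi e n l h al))"
  by (intro continuous_on_mult continuous_on_const continuous_on_real_sqrt continuous_on_subset[OF continuous_on_psi]) auto
 have H1: "(circ ?U (%al. 2 * sqrt (psi e n l h al)) :: ((real^3) \<times> complex) set) homeomorphic dbl V i ro"
  unfolding dbl_def case_prod_unfold
 proof (rule circ_reparam[OF cU c\<Phi> inj im cpsi])
  show "continuous_on (circ V i) (%q. ro (fst q))"
   by (rule continuous_on_compose2[OF cro]) (auto simp: circ_def intro!: continuous_intros)
  show "0 <= ro (fst q)" if "q \<in> circ V i" for q :: "(real \<times> real) \<times> real"
   using that pos(2)[of "fst q"] by (auto simp: circ_def)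
  show "(2 * sqrt (psi e n l h al) = 0) = (ro (fst (\<Phi> al)) = 0)" if "al \<in> ?U" for al
   using key[OF that] unfolding \<Phi>_def by auto
 qed auto
 have H2: "dbl V i ro homeomorphic Mod P"
 proof (rule lens_homeomorphic_Mod[OF ab(2) cG(2) _ _ _ V_def ci pos(1) cro pos(2) _ _ P sim])
  show "0 < \<beta> x" if "a < x" "x < b" for x
   using that ab gpos[OF that] by (auto simp: \<beta>_def abs_square_less_1)
  show "\<beta> a = 0" "\<beta> b = 0" using ga gb by (auto simp: \<beta>_def)
  fix x t assume V: "(x,t) \<in> V"
  then have x: "a <= x" "x <= b" "\<bar>t\<bar> <= \<beta> x" by (auto simp: V_def)
  show "(ro (x, t) = 0) = (\<bar>t\<bar> = \<beta> x & p x <= 0)"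
   unfolding ro_def using x by (auto simp: max_def)
  have "\<bar>t\<bar> = \<beta> x \<longleftrightarrow> \<bar>t\<bar>^2 = (\<beta> x)^2"
   using \<beta>2(2)[OF x(1,2)] by (simp only: power2_eq_iff_nonneg abs_ge_zero)
  then have e: "\<bar>t\<bar> = \<beta> x \<longleftrightarrow> t^2 = (1 - x^2)*g x" unfolding power2_abs \<beta>2(1)[OF x(1,2)] .
  have "i (x, t) = 0 \<longleftrightarrow> t^2 = (1 - x^2)*G x"
   using Gpos[OF x(1,2)] by (auto simp: i_def field_simps)
  also have "... \<longleftrightarrow> t^2 = (1 - x^2)*g x & 0 <= p x"
  proof (cases "x^2 < 1")
   case False
   then have "x^2 = 1" using x1[OF x(1,2)] by simp
   then show ?thesis using gpole[OF x(1,2) False] by auto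
  next
   case True
   show ?thesis
   proof
    assume t: "t^2 = (1 - x^2)*G x"
    then have "(1 - x^2)*G x <= (1 - x^2)*g x" using tb[OF V] by simp
    then have "max 0 (- p x) <= 0" using True by (simp add: G_def)
    then show "t^2 = (1 - x^2)*g x & 0 <= p x" using t by (auto simp: G_def max_def split: if_splits)
   qed (auto simp: G_def)
  qed
  finally show "(i (x, t) = 0) = (\<bar>t\<bar> = \<beta> x & 0 <= p x)" using e by simp
 qed
 show ?thesis
  using Q3_homeomorphic_circ[OF neg] H1 H2 by (meson homeomorphic_sym homeomorphic_trans)
qed

section \<open>The profile function\<close>

text \<open>The effective potential, reduced by the constant \<open>m = l^2\<close>, is below \<open>k\<close> on the whole circle over \<open>x\<close>
 exactly if \<open>Kf e E m x < k\<close>. All curves of the Smale diagram except \<open>\<delta>\<^sub>4\<close> are values of \<open>Kf\<close> at the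
 end points or at critical points.\<close>

definition Kf :: "real => real => real => real => real" where
 "Kf e E m x = m*(1 - x^2)/(1 + x^2) - E/2*(1 - x^2) - e*x"

text \<open>The derivative of \<open>Kf\<close>.\<close>
definition Kd :: "real => real => real => real => real" where
 "Kd e E m x = E*x - e - 4*m*x/(1 + x^2)^2"

text \<open>\<open>fz\<close> is the derivative at \<open>w\<close> of \<open>w \<mapsto> Kf e E m (- w)\<close> without its positive denominator.\<close>

definition fz :: "real => real => real => real => real" where
 "fz e E m w = (E*w + e)*(1 + w^2)^2 - 4*m*w"

text \<open>The level \<open>k\<close> is a critical value of the profile on \<open>(-1, 1)\<close>.\<close>
definition crit :: "real => real => real => real => bool" where
 "crit e E m k \<longleftrightarrow> (EX x. -1 < x & x < 1 & Kd e E m x = 0 & Kf e E m x = k)"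

text \<open>Within \<open>(-1, 0)\<close> the profile is below \<open>k\<close> at some point and above \<open>k\<close> at a later one.\<close>

definition W :: "real => real => real => real => bool" where
 "W e E m k \<longleftrightarrow> (EX u v. 0 < u & u < v & v < 1 & Kf e E m (- v) < k & k < Kf e E m (- u))"

lemma one_plus_sq: "0 < 1 + (x::real)^2" "1 + (x::real)^2 ~= 0"
 using zero_le_power2[of x] by (linarith, linarith)

lemma pf_Kf: "pf e n l k x = 2*(1 + x^2)*(k - Kf e (n^2) (l^2) x)"
proof -
 define A where "A = l^2*(1 - x^2)/(1 + x^2)"
 have A: "(1 + x^2)*A = l^2*(1 - x^2)" using one_plus_sq[of x] by (simp add: A_def)
 have "2*(1 + x^2)*(k - Kf e (n^2) (l^2) x) =
  2*(1 + x^2)*(k + n^2/2*(1 - x^2) + e*x) - 2*((1 + x^2)*A)"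
  unfolding Kf_def A_def[symmetric] by (simp add: algebra_simps)
 also have "... = pf e n l k x"
  unfolding A pf_def gf_def by (simp add: field_simps)
 finally show ?thesis by simp
qed

lemma Kf_1: "Kf e E m 1 = - e" "Kf e E m (-1) = e" by (simp_all add: Kf_def)

lemma Kf_deriv: "(Kf e E m has_real_derivative Kd e E m x) (at x)"
proof -
 have "((%x. m*(1 - x^2)/(1 + x^2) - E/2*(1 - x^2) - e*x) has_real_derivative
  (m*(- 2*x)*(1 + x^2) - m*(1 - x^2)*(2*x))/((1 + x^2)*(1 + x^2)) - E/2*(- 2*x) - e) (at x)"
  by (auto intro!: derivative_eq_intros simp: one_plus_sq)
 also have "(m*(- 2*x)*(1 + x^2) - m*(1 - x^2)*(2*x)) = - 4*m*x"
  by (simp add: algebra_simps)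
 also have "- 4*m*x/((1 + x^2)*(1 + x^2)) - E/2*(- 2*x) - e = Kd e E m x"
  by (simp add: Kd_def power2_eq_square)
 finally show ?thesis by (simp only: Kf_def[abs_def])
qed

lemma continuous_on_Kf: "continuous_on S (Kf e E m)"
 using Kf_deriv by (metis DERIV_isCont continuous_at_imp_continuous_on)

lemma Kd_minus: "Kd e E m (- w) = - fz e E m w/(1 + w^2)^2"
 using one_plus_sq[of w] by (simp add: Kd_def fz_def field_simps)

lemma Kd_minus_iff: "Kd e E m (- w) = 0 \<longleftrightarrow> fz e E m w = 0" "Kd e E m (- w) < 0 \<longleftrightarrow> 0 < fz e E m w" "0 < Kd e E m (- w) \<longleftrightarrow> fz e E m w < 0"
 using one_plus_sq[of w] unfolding Kd_minus by (auto simp: zero_less_divide_iff divide_less_0_iff)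

lemma Kt_deriv: "((%w. Kf e E m (- w)) has_real_derivative fz e E m w/(1 + w^2)^2) (at w)"
proof -
 have "((%w. Kf e E m (- w)) has_real_derivative Kd e E m (- w)*(- 1)) (at w)"
  by (rule DERIV_chain2[OF Kf_deriv]) (auto intro!: derivative_eq_intros)
 then show ?thesis by (simp add: Kd_minus)
qed

lemma Kf_reflect: "Kf e E m (- w) - Kf e E m w = 2*e*w"
 by (simp add: Kf_def)

lemma Kf_mono_m: "m <= m' ==> x^2 <= 1 ==> Kf e E m x <= Kf e E m' x"
 unfolding Kf_def by (auto intro!: divide_right_mono mult_right_mono)

text \<open>\<open>fz\<close> is strictly convex on the positive axis, so the profile has at most two critical points in \<open>(-1, 0)\<close>.\<close>
lemma fz_chord:
 assumes e: "0 < e" and E: "0 < E" and uvw: "0 <= u" "u < v" "v < w"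
 shows "(fz e E m v - fz e E m u)/(v - u) < (fz e E m w - fz e E m v)/(w - v)"
proof -
 define d where "d w = E*(1 + w^2)^2 + (E*w + e)*(4*w*(1 + w^2)) - 4*m" for w
 have D: "(fz e E m has_real_derivative d w) (at w)" for w
  unfolding fz_def[abs_def] d_def
  by (auto intro!: derivative_eq_intros simp: power2_eq_square algebra_simps)
 have mono: "d x < d y" if "0 <= x" "x < y" for x y
 proof -
  have sq: "x^2 <= y^2" using that by (intro power_mono) auto
  have "E*(1 + x^2)^2 <= E*(1 + y^2)^2" using E sq by (intro mult_left_mono power_mono) auto
  moreover have "4*x*(1 + x^2) < 4*y*(1 + y^2)"
   by (rule mult_less_le_imp_less) (use that sq in \<open>auto simp: add_pos_nonneg\<close>)
  then have "(E*x + e)*(4*x*(1 + x^2)) < (E*y + e)*(4*y*(1 + y^2))"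
   by (rule mult_le_less_imp_less[rotated]) (use that E e in \<open>auto intro!: add_nonneg_pos mult_nonneg_nonneg\<close>)
  ultimately show ?thesis unfolding d_def by linarith
 qed
 obtain x where x: "u < x" "x < v" "fz e E m v - fz e E m u = (v - u)*d x"
  using MVT2[of u v "fz e E m" d] D uvw by auto
 obtain y where y: "v < y" "y < w" "fz e E m w - fz e E m v = (w - v)*d y"
  using MVT2[of v w "fz e E m" d] D uvw by auto
 have "d x < d y" using mono[of x y] x y uvw by auto
 then show ?thesis using x y uvw by simp
qed

lemma fz_zeros:
 assumes e: "0 < e" and E: "0 < E" and uv: "0 <= u" "u < v" and z: "fz e E m u = 0" "fz e E m v <= 0"
 shows "!!w. u < w ==> w < v ==> fz e E m w < 0"
proof -
 fix w assume w: "u < w" "w < v"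
 have c: "(fz e E m w - 0)/(w - u) < (fz e E m v - fz e E m w)/(v - w)"
  using fz_chord[OF e E uv(1) w, of m] z by simp
 show "fz e E m w < 0"
 proof (rule ccontr)
  assume "~ fz e E m w < 0"
  then have "0 <= (fz e E m w - 0)/(w - u)" "(fz e E m v - fz e E m w)/(v - w) <= 0"
   using w z by (auto simp: divide_le_0_iff)
  then show False using c by linarith
 qed
qed

lemma fz_after:
 assumes e: "0 < e" and E: "0 < E" and uv: "0 <= u" "u < v" "v < w" and z: "fz e E m u = 0" "fz e E m v = 0"
 shows "0 < fz e E m w"
proof -
 have "0 < (fz e E m w - 0)/(w - v)" using fz_chord[OF e E uv, of m] z by simp
 then show ?thesis using uv by (simp add: zero_less_divide_iff)
qed

text \<open>On the positive axis \<open>Kd x / x\<close> increases, so the profile has no interior maximum.\<close>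
lemma Kf_quasi:
 assumes e: "0 < e" and m: "0 <= m" and xyz: "0 <= x" "x < y" "y < z"
 shows "Kf e E m y < max (Kf e E m x) (Kf e E m z)"
proof (rule ccontr)
 assume "~ ?thesis"
 then have le: "Kf e E m x <= Kf e E m y" "Kf e E m z <= Kf e E m y" by auto
 obtain s where s: "x < s" "s < y" "Kf e E m y - Kf e E m x = (y - x)*Kd e E m s"
  using MVT2[of x y "Kf e E m" "Kd e E m"] Kf_deriv xyz by auto
 obtain t where t: "y < t" "t < z" "Kf e E m z - Kf e E m y = (z - y)*Kd e E m t"
  using MVT2[of y z "Kf e E m" "Kd e E m"] Kf_deriv xyz by auto
 have "0 <= (y - x)*Kd e E m s" "(z - y)*Kd e E m t <= 0" using le s(3) t(3) by linarith+
 then have 1: "0 <= Kd e E m s" "Kd e E m t <= 0" using xyz by (auto simp: zero_le_mult_iff mult_le_0_iff)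
 have st: "0 < s" "s < t" using s t xyz by auto
 have "Kd e E m s = s*(E - e/s - 4*m/(1 + s^2)^2)" "Kd e E m t = t*(E - e/t - 4*m/(1 + t^2)^2)"
  using st by (simp_all add: Kd_def algebra_simps)
 then have 2: "e/s + 4*m/(1 + s^2)^2 <= E" "E <= e/t + 4*m/(1 + t^2)^2"
  using 1 st by (auto simp: zero_le_mult_iff mult_le_0_iff)
 have "e/t < e/s" using st e by (intro divide_strict_left_mono) auto
 moreover have "(1 + s^2)^2 <= (1 + t^2)^2" using st by (intro power_mono add_left_mono) auto
 then have "4*m/(1 + t^2)^2 <= 4*m/(1 + s^2)^2"
  using m one_plus_sq[of s] by (intro divide_left_mono) (auto intro!: mult_pos_pos zero_less_power simp: one_plus_sq)
 ultimately show False using 2 by linarith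
qed

text \<open>A function with nonzero derivative takes larger and smaller values nearby on either side.\<close>

lemma deriv_pos_nearby:
 fixes f :: "real => real"
 assumes "(f has_real_derivative d) (at x)" "0 < d" "0 < \<epsilon>"
 shows "EX y. x < y & y < x + \<epsilon> & f x < f y" "EX y. x - \<epsilon> < y & y < x & f y < f x"
proof -
 obtain \<delta> where \<delta>: "0 < \<delta>" "ALL h>0. h < \<delta> --> f x < f (x + h)" using DERIV_pos_inc_right[OF assms(1,2)] by auto
 define h where "h = min \<delta> \<epsilon>/2"
 have "0 < h" "h < \<delta>" "h < \<epsilon>" using \<delta>(1) assms(3) by (auto simp: h_def)
 then show "EX y. x < y & y < x + \<epsilon> & f x < f y" using \<delta>(2) by (intro exI[of _ "x + h"]) auto
 obtain \<delta> where \<delta>: "0 < \<delta>" "ALL h>0. h < \<delta> --> f (x - h) < f x" using DERIV_pos_inc_left[OF assms(1,2)] by auto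
 define h where "h = min \<delta> \<epsilon>/2"
 have "0 < h" "h < \<delta>" "h < \<epsilon>" using \<delta>(1) assms(3) by (auto simp: h_def)
 then show "EX y. x - \<epsilon> < y & y < x & f y < f x" using \<delta>(2) by (intro exI[of _ "x - h"]) auto
qed

lemma deriv_neg_nearby:
 fixes f :: "real => real"
 assumes "(f has_real_derivative d) (at x)" "d < 0" "0 < \<epsilon>"
 shows "EX y. x < y & y < x + \<epsilon> & f y < f x" "EX y. x - \<epsilon> < y & y < x & f x < f y"
proof -
 have "((%t. - f t) has_real_derivative - d) (at x)" using assms(1) by (rule DERIV_minus)
 then show "EX y. x < y & y < x + \<epsilon> & f y < f x" "EX y. x - \<epsilon> < y & y < x & f x < f y"
  using deriv_pos_nearby[of "%t. - f t" "- d" x \<epsilon>] assms(2,3) by auto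
qed

text \<open>At a regular level the inequalities of \<open>W\<close> may be relaxed, because \<open>Kf\<close> has nonzero slope wherever it takes
 the value \<open>k\<close>, and a negative slope at 0.\<close>
lemma W_upgrade:
 assumes e: "0 < e" and uv: "0 <= u" "u < v" "v <= 1" and k: "Kf e E m (- v) <= k" "k <= Kf e E m (- u)" "k < e"
  and nc: "~ crit e E m k"
 shows "W e E m k"
proof -
 let ?f = "%w. Kf e E m (- w)"
 have v1: "v < 1" using k uv Kf_1(2)[of e E m] by (cases "v = 1") auto
 have nz: "fz e E m w ~= 0" if "0 < w" "w < 1" "?f w = k" for w
  using nc that Kd_minus_iff(1)[of e E m w] unfolding crit_def by (metis less_trans neg_less_iff_less neg_less_0_iff_less zero_less_one)
 have sg: "0 < fz e E m w/(1 + w^2)^2 \<longleftrightarrow> 0 < fz e E m w" "fz e E m w/(1 + w^2)^2 < 0 \<longleftrightarrow> fz e E m w < 0" for w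
  using one_plus_sq[of w] by (auto simp: zero_less_divide_iff divide_less_0_iff)
 have f0: "0 < fz e E m 0" using e by (simp add: fz_def)
 obtain v' where v': "u < v'" "v' < 1" "?f v' < k"
 proof (cases "?f v < k")
  case True then show ?thesis using that uv v1 by auto
 next
  case False
  then have eq: "?f v = k" using k by simp
  then have "fz e E m v ~= 0" using nz uv v1 by auto
  then consider "0 < fz e E m v" | "fz e E m v < 0" by linarith
  then show ?thesis
  proof cases
   case 1
   then obtain y where "v - (v - u) < y" "y < v" "?f y < ?f v"
    using deriv_pos_nearby(2)[OF Kt_deriv, where x = v and \<epsilon> = "v - u"] sg(1)[of v] uv by force
   then show ?thesis using that[of y] eq v1 by auto
  next
   case 2
   then obtain y where "v < y" "y < v + (1 - v)" "?f y < ?f v"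
    using deriv_neg_nearby(1)[OF Kt_deriv, where x = v and \<epsilon> = "1 - v"] sg(2)[of v] v1 by force
   then show ?thesis using that[of y] eq uv by auto
  qed
 qed
 obtain u' where u': "0 <= u'" "u' < v'" "k < ?f u'"
 proof (cases "k < ?f u")
  case True then show ?thesis using that uv v' by auto
 next
  case False
  then have eq: "?f u = k" using k by simp
  show ?thesis
  proof (cases "0 < fz e E m u")
   case True
   then obtain y where "u < y" "y < u + (v' - u)" "?f u < ?f y"
    using deriv_pos_nearby(1)[OF Kt_deriv, where x = u and \<epsilon> = "v' - u"] sg(1)[of u] v' by force
   then show ?thesis using that[of y] eq uv by auto
  next
   case False
   then have u0: "0 < u" using f0 uv by (cases "u = 0") auto
   then have "fz e E m u < 0" using nz[of u] eq uv v1 False by force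
   then obtain y where "u - u < y" "y < u" "?f u < ?f y"
    using deriv_neg_nearby(2)[OF Kt_deriv, where x = u and \<epsilon> = u] sg(2)[of u] u0 by force
   then show ?thesis using that[of y] eq v' by auto
  qed
 qed
 show ?thesis
 proof (cases "0 < u'")
  case True then show ?thesis unfolding W_def using u' v' by blast
 next
  case False
  then have "u' = 0" using u' by simp
  then obtain y where "u' < y" "y < u' + (v' - u')" "?f u' < ?f y"
   using deriv_pos_nearby(1)[OF Kt_deriv, where x = u' and \<epsilon> = "v' - u'"] sg(1)[of u'] f0 u' by force
  then show ?thesis unfolding W_def using u' v' by (intro exI[of _ y] exI[of _ v']) auto
 qed
qed

text \<open>Under \<open>W\<close> and going left from 0, there are a critical point above the level \<open>k\<close> and then one below.\<close>

lemma W_crit_points: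
 assumes e: "0 < e" and k: "k < e" and W: "W e E m k"
 shows "EX s t. 0 < s & s < t & t < 1 & fz e E m s = 0 & fz e E m t = 0 & k < Kf e E m (- s) & Kf e E m (- t) < k"
proof -
 let ?f = "%w. Kf e E m (- w)"
 have sg: "fz e E m w/(1 + w^2)^2 = 0 \<longleftrightarrow> fz e E m w = 0" for w using one_plus_sq[of w] by auto
 have cf: "continuous_on S ?f" for S using Kt_deriv by (metis DERIV_isCont continuous_at_imp_continuous_on)
 obtain u v where uv: "0 < u" "u < v" "v < 1" "?f v < k" "k < ?f u" using W W_def by auto
 have "\<exists>s\<in>{0..v}. \<forall>y\<in>{0..v}. ?f y <= ?f s"
  by (rule continuous_attains_sup[OF compact_Icc _ cf]) (use uv in auto)
 then obtain s where s: "0 <= s" "s <= v" "!!y. 0 <= y ==> y <= v ==> ?f y <= ?f s" by auto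
 have ks: "k < ?f s" using s(3)[of u] uv by auto
 have sv: "s < v" using ks uv s by (cases "s = v") auto
 have s0: "0 < s"
 proof (rule ccontr)
  assume "~ 0 < s"
  then have "s = 0" using s by simp
  moreover obtain y where "0 < y" "y < 0 + v" "?f 0 < ?f y"
   using deriv_pos_nearby(1)[OF Kt_deriv, where x = 0 and \<epsilon> = v] e uv by (force simp: fz_def)
  ultimately show False using s(3)[of y] by auto
 qed
 have zs: "fz e E m s = 0"
 proof -
  have "fz e E m s/(1 + s^2)^2 = 0"
   by (rule DERIV_local_max[OF Kt_deriv, where d = "min s (v - s)"]) (use s0 sv s(3) in \<open>auto simp: abs_if split: if_splits\<close>)
  then show ?thesis using sg by blast
 qed
 have "\<exists>t\<in>{s..1}. \<forall>y\<in>{s..1}. ?f t <= ?f y"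
  by (rule continuous_attains_inf[OF compact_Icc _ cf]) (use uv sv in auto)
 then obtain t where t: "s <= t" "t <= 1" "!!y. s <= y ==> y <= 1 ==> ?f t <= ?f y" by auto
 have kt: "?f t < k" using t(3)[of v] uv sv by auto
 have "t ~= s" "t ~= 1" using kt ks k Kf_1(2)[of e E m] by auto
 then have st: "s < t" "t < 1" using t by auto
 have "fz e E m t/(1 + t^2)^2 = 0"
  by (rule DERIV_local_min[OF Kt_deriv, where d = "min (t - s) (1 - t)"]) (use st t(3) in \<open>auto simp: abs_if split: if_splits\<close>)
 then have "fz e E m t = 0" using sg by blast
 then show ?thesis using s0 st zs ks kt by blast
qed

section \<open>Sign patterns of the profile\<close>

lemma quartic_factor:
 fixes c0 c1 c2 c3 E :: real
 assumes r: "r1 < r2" "r2 < r3" "r3 < r4"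
  and z: "!!x. x \<in> {r1, r2, r3, r4} ==> c0 + c1*x + c2*x^2 + c3*x^3 - E*x^4 = 0"
 shows "c0 + c1*x + c2*x^2 + c3*x^3 - E*x^4 = E*(x - r1)*(x - r2)*(x - r3)*(r4 - x)"
proof -
 define q :: "real poly" where "q = [:c0, c1, c2, c3, - E:] + smult E ([:-r1, 1:]*[:-r2, 1:]*[:-r3, 1:]*[:-r4, 1:])"
 have pq: "poly q x = c0 + c1*x + c2*x^2 + c3*x^3 - E*x^4 - E*(x - r1)*(x - r2)*(x - r3)*(r4 - x)" for x
  by (simp add: q_def algebra_simps power2_eq_square power3_eq_cube power4_eq_xxxx)
 have "coeff q 4 = 0" by (simp add: q_def eval_nat_numeral)
 moreover have "degree q <= 4" unfolding q_def
  by (rule degree_add_le) (auto intro: order_trans[OF degree_smult_le] simp: degree_mult_eq)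
 ultimately have d: "degree q <= 3 | q = 0"
  by (metis One_nat_def Suc_1 eval_nat_numeral(3) leading_coeff_0_iff le_Suc_eq numeral_3_eq_3 numeral_eq_Suc pred_numeral_simps(2) pred_numeral_simps(3) semiring_norm(26) semiring_norm(27) semiring_norm(28))
 have "q = 0"
 proof (rule ccontr)
  assume "q ~= 0"
  then have "card {x. poly q x = 0} <= 3" using d card_poly_roots_bound[of q] by linarith
  moreover have "{r1, r2, r3, r4} \<subseteq> {x. poly q x = 0}" using z by (auto simp: pq)
  then have "card {r1, r2, r3, r4} <= card {x. poly q x = 0}"
   by (rule card_mono[OF poly_roots_finite[OF \<open>q ~= 0\<close>]])
  ultimately show False using r by simp
 qed
 then show ?thesis using pq[of x] by simp
qed

lemma Kf_poly: "2*(1 + x^2)*(k - Kf e E m x) = (E + 2*k - 2*m) + (2*e)*x + 2*(k + m)*x^2 + (2*e)*x^3 - E*x^4"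
proof -
 define A where "A = m*(1 - x^2)/(1 + x^2)"
 have A: "(1 + x^2)*A = m*(1 - x^2)" using one_plus_sq[of x] by (simp add: A_def)
 have "2*(1 + x^2)*(k - Kf e E m x) = 2*(1 + x^2)*(k + E/2*(1 - x^2) + e*x) - 2*((1 + x^2)*A)"
  unfolding Kf_def A_def[symmetric] by (simp add: algebra_simps)
 also have "... = (E + 2*k - 2*m) + (2*e)*x + 2*(k + m)*x^2 + (2*e)*x^3 - E*x^4"
  unfolding A by (simp add: field_simps power2_eq_square power3_eq_cube power4_eq_xxxx)
 finally show ?thesis .
qed

text \<open>Four roots exhaust the quartic polynomial \<open>2 (1 + x^2) (k - Kf x)\<close> and determine its signs.\<close>
lemma four_roots:
 assumes r: "r1 < r2" "r2 < r3" "r3 < r4" and z: "!!x. x \<in> {r1, r2, r3, r4} ==> Kf e E m x = k"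
 shows "2*(1 + x^2)*(k - Kf e E m x) = E*(x - r1)*(x - r2)*(x - r3)*(r4 - x)"
 unfolding Kf_poly
proof (rule quartic_factor[OF r])
 fix x assume "x \<in> {r1, r2, r3, r4}"
 then have "k - Kf e E m x = 0" using z by auto
 then show "E + 2*k - 2*m + 2*e*x + 2*(k + m)*x^2 + 2*e*x ^ 3 - E*x ^ 4 = 0"
  unfolding Kf_poly[symmetric] by simp
qed

lemma four_roots_sgn:
 assumes E: "0 < E" and r: "r1 < r2" "r2 < r3" "r3 < r4" and z: "!!x. x \<in> {r1, r2, r3, r4} ==> Kf e E m x = k"
 shows "sgn (k - Kf e E m x) = sgn ((x - r1)*(x - r2)*(x - r3)*(r4 - x))"
proof -
 have "sgn (2*(1 + x^2)*(k - Kf e E m x)) = sgn (k - Kf e E m x)"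
  using one_plus_sq(1)[of x] by (simp add: sgn_mult)
 moreover have "sgn (E*(x - r1)*(x - r2)*(x - r3)*(r4 - x)) = sgn ((x - r1)*(x - r2)*(x - r3)*(r4 - x))"
  using E by (simp add: sgn_mult)
 ultimately show ?thesis using four_roots[OF r z] by metis
qed

lemma four_roots_not_crit:
 assumes E: "0 < E" and r: "r1 < r2" "r2 < r3" "r3 < r4" and z: "!!x. x \<in> {r1, r2, r3, r4} ==> Kf e E m x = k"
 shows "~ crit e E m k"
proof
 assume "crit e E m k"
 then obtain s where s: "Kd e E m s = 0" "Kf e E m s = k" by (auto simp: crit_def)
 have "E*(s - r1)*(s - r2)*(s - r3)*(r4 - s) = 0"
  using four_roots[OF r z, where x = s] s by simp
 then have sr: "s \<in> {r1, r2, r3, r4}" using E by auto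
 define g where "g x = (if s = r1 then (x - r2)*(x - r3)*(r4 - x) else if s = r2 then (x - r1)*(x - r3)*(r4 - x)
  else if s = r3 then (x - r1)*(x - r2)*(r4 - x) else - ((x - r1)*(x - r2)*(x - r3)))" for x
 define G where "G x = - E*g x/(2*(1 + x^2))" for x
 have "Kf e E m x - Kf e E m s = G x*(x - s)" for x
 proof -
  have "2*(1 + x^2)*(Kf e E m s - Kf e E m x) = E*(g x*(x - s))"
  proof -
   have "g x*(x - s) = - ((x - r1)*(x - r2)*(x - r3)*(r4 - x)) | g x*(x - s) = (x - r1)*(x - r2)*(x - r3)*(r4 - x)"
    using sr by (auto simp: g_def algebra_simps)
   moreover have "2*(1 + x^2)*(Kf e E m s - Kf e E m x) = E*((x - r1)*(x - r2)*(x - r3)*(r4 - x))"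
    using four_roots[OF r z, where x = x] s(2) by (simp add: mult.assoc)
   moreover have "g x*(x - s) = (x - r1)*(x - r2)*(x - r3)*(r4 - x)"
    using sr by (auto simp: g_def algebra_simps)
   ultimately show ?thesis by simp
  qed
  then have "Kf e E m s - Kf e E m x = E*(g x*(x - s))/(2*(1 + x^2))"
   using one_plus_sq[of x] by (simp add: field_simps)
  then show ?thesis by (simp add: G_def)
 qed
 moreover have "isCont g s" unfolding g_def
  by (cases "s = r1"; cases "s = r2"; cases "s = r3"; simp)
 then have "isCont G s" unfolding G_def using one_plus_sq[of s] by (auto intro!: continuous_intros)
 ultimately have "(Kf e E m has_real_derivative G s) (at s)" unfolding CARAT_DERIV by blast
 then have "G s = 0" using DERIV_unique[OF _ Kf_deriv] s(1) by metis
 then have "g s = 0" using E one_plus_sq[of s] by (simp add: G_def)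
 then show False using sr r by (auto simp: g_def split: if_splits)
qed

lemma Kf_root:
 assumes "a < b" "(Kf e E m a < k & k < Kf e E m b) | (Kf e E m b < k & k < Kf e E m a)"
 shows "EX r. a < r & r < b & Kf e E m r = k"
proof -
 have c: "continuous_on {a..b} (Kf e E m)" by (rule continuous_on_Kf)
 have "EX r. a <= r & r <= b & Kf e E m r = k"
  using assms IVT'[of "Kf e E m" a k b] IVT2'[of "Kf e E m" b k a] c by force
 then show ?thesis using assms by (metis less_irrefl order_le_less)
qed

text \<open>Beyond \<open>\<plusminus>1\<close> the profile grows above every level, which supplies the roots outside \<open>[-1, 1]\<close>.\<close>
lemma Kf_large:
 assumes E: "0 < E" and m: "0 <= m" and e: "0 < e"
 shows "EX t>1. k < Kf e E m t & k < Kf e E m (- t)"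
proof -
 define t where "t = 1 + 2/E*(e + (\<bar>k\<bar> + m + E/2 + 1))"
 have t1: "1 < t" unfolding t_def using E m e by (auto intro!: mult_pos_pos add_pos_nonneg)
 have "E/2*t = E/2 + (e + (\<bar>k\<bar> + m + E/2 + 1))" using E by (simp add: t_def field_simps)
 then have "\<bar>k\<bar> + m + E/2 + 1 <= E/2*t - e" using E by linarith
 moreover have "1*(E/2*t - e) <= t*(E/2*t - e)"
  using t1 calculation E m by (intro mult_right_mono) auto
 ultimately have b: "\<bar>k\<bar> + m + E/2 + 1 <= E/2*t^2 - e*t" by (simp add: power2_eq_square algebra_simps)
 have "- m <= m*(1 - t^2)/(1 + t^2)"
 proof -
  have "- m*(1 + t^2) <= m*(1 - t^2)" using m by (simp add: algebra_simps)
  then show ?thesis using one_plus_sq[of t] by (simp add: pos_le_divide_eq)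
 qed
 moreover have "Kf e E m t = m*(1 - t^2)/(1 + t^2) - E/2 + (E/2*t^2 - e*t)"
  by (simp add: Kf_def algebra_simps)
 ultimately have "k < Kf e E m t" using b by linarith
 moreover have "Kf e E m t < Kf e E m (- t)"
  using Kf_reflect[of e E m t] mult_pos_pos[of "2*e" t] e t1 by linarith
 ultimately show ?thesis using t1 by force
qed

lemma pat_cong:
 assumes "!!t. sgn (p t) = sgn (q t)"
 shows "pat s p xs \<longleftrightarrow> pat s q xs"
proof -
 have z: "p t = 0 \<longleftrightarrow> q t = 0" for t using assms[of t] by (metis sgn_0_0)
 have "pat s p' xs ==> p' = p ==> pat s q xs" for p'
  by (induction s p' xs rule: pat.induct) (auto simp: assms z)
 moreover have "pat s q' xs ==> q' = q ==> pat s p xs" for q'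
  by (induction s q' xs rule: pat.induct) (auto simp: assms z)
 ultimately show ?thesis by blast
qed

lemma pat_four_roots:
 assumes "0 < E" "r1 < r2" "r2 < r3" "r3 < r4" and "!!x. x \<in> {r1, r2, r3, r4} ==> Kf e E m x = k"
 shows "pat s (%x. k - Kf e E m x) xs \<longleftrightarrow> pat s (%x. (x - r1)*(x - r2)*(x - r3)*(r4 - x)) xs"
 by (rule pat_cong) (rule four_roots_sgn[OF assms])

lemma pattern_C:
 assumes "0 < E" "0 < e" "0 <= m" and k: "e < k" "0 < w" "w < 1" "k < Kf e E m (- w)"
 shows "EX y1 y2. -1 < y1 & y2 < 1 & pat 1 (%x. k - Kf e E m x) [-1, y1, y2, 1]" and "~ crit e E m k"
proof -
 obtain t where t: "1 < t" "k < Kf e E m t" "k < Kf e E m (- t)" using Kf_large assms by blast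
 have e1: "Kf e E m (-1) < k" "Kf e E m 1 < k" using Kf_1[of e E m] k assms by auto
 obtain r1 where r1: "- t < r1" "r1 < -1" "Kf e E m r1 = k" using Kf_root[of "-t" "-1" e E m k] t e1 by auto
 obtain r2 where r2: "-1 < r2" "r2 < - w" "Kf e E m r2 = k" using Kf_root[of "-1" "-w" e E m k] k e1 by auto
 obtain r3 where r3: "- w < r3" "r3 < 1" "Kf e E m r3 = k" using Kf_root[of "-w" "1" e E m k] k e1 by auto
 obtain r4 where r4: "1 < r4" "r4 < t" "Kf e E m r4 = k" using Kf_root[of "1" t e E m k] t e1 by auto
 have o: "r1 < r2" "r2 < r3" "r3 < r4" using r1 r2 r3 r4 by auto
 have z: "!!x. x \<in> {r1, r2, r3, r4} ==> Kf e E m x = k" using r1 r2 r3 r4 by auto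
 show "~ crit e E m k" by (rule four_roots_not_crit[OF assms(1) o z])
 have "pat 1 (%x. k - Kf e E m x) [-1, r2, r3, 1]"
  apply (rule pat_four_roots[OF assms(1) o z, THEN iffD2], assumption)
  using r1(1,2) r2(1,2) r3(1,2) r4(1,2) o by (auto simp: sgn_mult sgn_pos sgn_neg)
 then show "EX y1 y2. -1 < y1 & y2 < 1 & pat 1 (%x. k - Kf e E m x) [-1, y1, y2, 1]" using r2 r3 by blast
qed

lemma W_below:
 assumes "0 < e" "W e E m k" shows "EX x. 0 < x & x < 1 & Kf e E m x < k"
proof -
 obtain u v where uv: "0 < u" "u < v" "v < 1" "Kf e E m (- v) < k" using assms W_def by auto
 moreover have "Kf e E m v < Kf e E m (- v)" using Kf_reflect[of e E m v] mult_pos_pos[of "2*e" v] assms uv by linarith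
 ultimately show ?thesis by (intro exI[of _ v]) auto
qed

lemma W_roots:
 assumes E: "0 < E" and e: "0 < e" and m: "0 <= m" and k: "k < e" "W e E m k"
 shows "EX r1 r2 r3 r4. -1 < r1 & r1 < r2 & r2 < r3 & r3 < r4 & r3 < 1 & (\<forall>x\<in>{r1, r2, r3, r4}. Kf e E m x = k)"
proof -
 obtain T where T: "1 < T" "k < Kf e E m T" using Kf_large[OF E m e] by blast
 have e1: "k < Kf e E m (-1)" using Kf_1[of e E m] k by auto
 obtain u v where uv: "0 < u" "u < v" "v < 1" "Kf e E m (- v) < k" "k < Kf e E m (- u)" using k W_def by auto
 obtain s where s: "0 < s" "s < 1" "Kf e E m s < k" using W_below[OF e k(2)] by blast
 obtain r1 where r1: "-1 < r1" "r1 < -v" "Kf e E m r1 = k" using Kf_root[of "-1" "-v" e E m k] uv e1 by auto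
 obtain r2 where r2: "-v < r2" "r2 < - u" "Kf e E m r2 = k" using Kf_root[of "-v" "-u" e E m k] uv by auto
 obtain r3 where r3: "- u < r3" "r3 < s" "Kf e E m r3 = k" using Kf_root[of "-u" s e E m k] uv s by auto
 obtain r4 where r4: "s < r4" "r4 < T" "Kf e E m r4 = k" using Kf_root[of s T e E m k] s T by auto
 show ?thesis
  by (rule exI[of _ r1], rule exI[of _ r2], rule exI[of _ r3], rule exI[of _ r4]) (use r1 r2 r3 r4 s in auto)
qed

lemma W_not_crit:
 assumes "0 < E" "0 < e" "0 <= m" "k < e" "W e E m k"
 shows "~ crit e E m k"
proof -
 from W_roots[OF assms] obtain r1 r2 r3 r4 where r: "r1 < r2" "r2 < r3" "r3 < r4" "\<forall>x\<in>{r1, r2, r3, r4}. Kf e E m x = k"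
  by (elim exE conjE)
 show ?thesis by (rule four_roots_not_crit[OF assms(1) r(1-3)]) (use r(4) in blast)
qed

lemma W_pattern:
 assumes E: "0 < E" and e: "0 < e" and m: "0 <= m" and k: "k < e" "k ~= - e" "W e E m k"
 shows "EX r1 r2 r3 r4. -1 < r1 & r3 < 1 &
  (- e < k --> (ALL x0. -1 <= x0 --> x0 < r1 --> pat (-1) (%x. k - Kf e E m x) [x0, r1, r2, r3, 1])) &
  (k < - e --> r4 < 1 & (ALL x0 x1. x0 < r1 --> r4 < x1 --> pat (-1) (%x. k - Kf e E m x) [x0, r1, r2, r3, r4, x1]))"
proof -
 from W_roots[OF E e m k(1,3)] obtain r1 r2 r3 r4 where r1: "-1 < r1" and o: "r1 < r2" "r2 < r3" "r3 < r4" and r3: "r3 < 1"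
  and z0: "\<forall>x\<in>{r1, r2, r3, r4}. Kf e E m x = k" by (elim exE conjE)
 have z: "!!x. x \<in> {r1, r2, r3, r4} ==> Kf e E m x = k" using z0 by blast
 have "sgn (k + e) = sgn ((1 - r1)*(1 - r2)*(1 - r3)*(r4 - 1))"
  using four_roots_sgn[OF E o z, of 1] by (simp add: Kf_1)
 also have "... = sgn (r4 - 1)" using o r3 by (simp add: sgn_mult)
 finally have r4: "- e < k ==> 1 < r4" "k < - e ==> r4 < 1" by (auto simp: sgn_if split: if_splits)
 have 1: "pat (-1) (%x. k - Kf e E m x) [x0, r1, r2, r3, 1]" if "x0 < r1" "1 < r4" for x0
  by (rule pat_four_roots[OF E o z, THEN iffD2], assumption)
   (use r1 r3 o that in \<open>auto simp: sgn_mult sgn_pos sgn_neg\<close>)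
 have 2: "pat (-1) (%x. k - Kf e E m x) [x0, r1, r2, r3, r4, x1]" if "x0 < r1" "r4 < x1" for x0 x1
  by (rule pat_four_roots[OF E o z, THEN iffD2], assumption)
   (use r1 r3 o that in \<open>auto simp: sgn_mult sgn_pos sgn_neg\<close>)
 show ?thesis
  by (rule exI[of _ r1], rule exI[of _ r2], rule exI[of _ r3], rule exI[of _ r4]) (use r1 r3 r4 1 2 in \<open>simp del: pat.simps\<close>)
qed

lemma pattern_D:
 assumes "0 < E" "0 < e" "0 <= m" and k: "- e < k" "k < e" "W e E m k"
 shows "EX y1 y2 y3. -1 < y1 & y3 < 1 & (ALL x0. -1 <= x0 --> x0 < y1 --> pat (-1) (%x. k - Kf e E m x) [x0, y1, y2, y3, 1])"
 using W_pattern[OF assms(1-3,5) _ k(3)] k by (elim exE conjE meta_impE) (simp, blast)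

lemma pattern_G:
 assumes "0 < E" "0 < e" "0 <= m" and k: "k < - e" "W e E m k"
 shows "EX y1 y2 y3 y4. -1 < y1 & y4 < 1 & (ALL x0 x1. x0 < y1 --> y4 < x1 --> pat (-1) (%x. k - Kf e E m x) [x0, y1, y2, y3, y4, x1])"
proof -
 have "k < e" "k ~= - e" using k assms(2) by auto
 from W_pattern[OF assms(1-3) this k(2)] show ?thesis using k(1) by (elim exE conjE) blast
qed

text \<open>Without \<open>W\<close>, the function crosses the level \<open>k\<close> to the left of a point \<open>c\<close> only downwards.\<close>

lemma crossing_down:
 assumes e: "0 < e" and m: "0 <= m" and k: "k < e" and nW: "~ W e E m k" and nc: "~ crit e E m k"
  and c: "0 < c" "Kf e E m c < k" and x: "-1 <= x1" "x1 < x2" "x2 <= c" "Kf e E m x1 <= k"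
 shows "Kf e E m x2 < k"
proof (rule ccontr)
 assume "~ Kf e E m x2 < k"
 then have x2: "k <= Kf e E m x2" by simp
 have x2c: "x2 < c" using x2 c x by (cases "x2 = c") auto
 have q: "k <= Kf e E m y" if "0 <= y" "y <= x2" for y
 proof (cases "y = x2")
  case False
  then show ?thesis using Kf_quasi[OF e m that(1), of x2 c E] that x2c x2 c by auto
 qed (use x2 in simp)
 have qs: "k < Kf e E m y" if "0 <= y" "y < x2" for y
  using Kf_quasi[OF e m that(1), of x2 c E] that x2c x2 c by auto
 have x10: "x1 < 0"
 proof (rule ccontr)
  assume "~ x1 < 0" then show False using qs[of x1] x by auto
 qed
 have "k <= Kf e E m (min x2 0)" using x2 q[of 0] by (auto simp: min_def)
 then have "W e E m k"
  using W_upgrade[OF e, of "- min x2 0" "- x1" E m k] x x10 k nc by (auto simp: min_def)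
 then show False using nW by simp
qed

lemma pattern_A:
 assumes e: "0 < e" and m: "0 <= m" and k: "- e < k" "k < e" and nW: "~ W e E m k" and nc: "~ crit e E m k"
 shows "EX y. -1 < y & y < 1 & Kf e E m y = k & (ALL x. -1 <= x --> x < y --> k < Kf e E m x) & (ALL x. y < x --> x <= 1 --> Kf e E m x < k)"
proof -
 have e1: "k < Kf e E m (-1)" "Kf e E m 1 < k" using Kf_1[of e E m] k by auto
 obtain y where y: "-1 < y" "y < 1" "Kf e E m y = k" using Kf_root[of "-1" "1" e E m k] e1 by auto
 have d: "Kf e E m x2 < k" if "-1 <= x1" "x1 < x2" "x2 <= 1" "Kf e E m x1 <= k" for x1 x2
  using crossing_down[OF e m k(2) nW nc, of 1] e1 that by auto
 have "k < Kf e E m x" if "-1 <= x" "x < y" for x using d[of x y] that y by force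
 moreover have "Kf e E m x < k" if "y < x" "x <= 1" for x using d[of y x] that y by force
 ultimately show ?thesis using y by blast
qed

lemma pattern_F:
 assumes e: "0 < e" and m: "0 <= m" and k: "k < - e" and nW: "~ W e E m k" and nc: "~ crit e E m k"
  and c: "0 < c" "c < 1" "Kf e E m c < k"
 shows "EX y1 y2. -1 < y1 & y1 < y2 & y2 < 1 & Kf e E m y1 = k & Kf e E m y2 = k & (ALL x. -1 <= x --> x < y1 --> k < Kf e E m x) &
  (ALL x. y1 < x --> x < y2 --> Kf e E m x < k) & (ALL x. y2 < x --> x <= 1 --> k < Kf e E m x)"
proof -
 have e1: "k < Kf e E m (-1)" "k < Kf e E m 1" using Kf_1[of e E m] k e by auto
 obtain y1 where y1: "-1 < y1" "y1 < c" "Kf e E m y1 = k" using Kf_root[of "-1" c e E m k] e1 c by auto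
 obtain y2 where y2: "c < y2" "y2 < 1" "Kf e E m y2 = k" using Kf_root[of c 1 e E m k] e1 c by auto
 have ke: "k < e" using k e by simp
 have d: "Kf e E m x2 < k" if "-1 <= x1" "x1 < x2" "x2 <= c" "Kf e E m x1 <= k" for x1 x2
  using crossing_down[OF e m ke nW nc c(1,3)] that by auto
 have u: "k < Kf e E m x2" if "c <= x1" "x1 < x2" "k <= Kf e E m x1" for x1 x2
 proof -
  have "c < x1" using that c by (cases "x1 = c") auto
  then show ?thesis using Kf_quasi[OF e m, of c x1 x2 E] that c by auto
 qed
 have "k < Kf e E m x" if "-1 <= x" "x < y1" for x using d[of x y1] that y1 by force
 moreover have "k < Kf e E m x" if "y2 < x" "x <= 1" for x using u[of y2 x] that y2 by force
 moreover have "Kf e E m x < k" if "y1 < x" "x < y2" for x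
 proof (cases "x <= c")
  case True then show ?thesis using d[of y1 x] that y1 by force
 next
  case False then show ?thesis using u[of x y2] that y2 by force
 qed
 ultimately show ?thesis using y1 y2 by (intro exI[of _ y1] exI[of _ y2]) auto
qed

lemma pattern_B:
 assumes e: "0 < e" and k: "e < k" and nc: "~ crit e E m k" and le: "!!w. 0 < w ==> w < 1 ==> Kf e E m (- w) <= k"
  and x: "-1 <= x" "x <= 1"
 shows "Kf e E m x < k"
proof -
 have lt: "Kf e E m (- w) < k" if w: "0 < w" "w < 1" for w
 proof (rule ccontr)
  assume "~ Kf e E m (- w) < k"
  then have eq: "Kf e E m (- w) = k" using le[OF w] by simp
  have "fz e E m w/(1 + w^2)^2 = 0"
   by (rule DERIV_local_max[OF Kt_deriv, where d = "min w (1 - w)"]) (use w le eq in \<open>auto simp: abs_if split: if_splits\<close>)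
  then have "Kd e E m (- w) = 0" by (simp add: Kd_minus)
  then have "crit e E m k" unfolding crit_def using eq w by (intro exI[of _ "- w"]) auto
  then show False using nc by simp
 qed
 have "0 < fz e E m 0/(1 + 0^2)^2" using e by (simp add: fz_def)
 then have "EX y. 0 < y & y < 0 + 1 & Kf e E m (- 0) < Kf e E m (- y)"
  by (intro deriv_pos_nearby(1)[OF Kt_deriv]) auto
 then obtain y where "0 < y" "y < 0 + 1" "Kf e E m (- 0) < Kf e E m (- y)" by (elim exE conjE)
 then have K0: "Kf e E m 0 < k" using le[of y] by auto
 consider "x = -1" | "-1 < x" "x < 0" | "x = 0" | "0 < x" "x < 1" | "x = 1" using x by linarith
 then show ?thesis
 proof cases
  case 2 then show ?thesis using lt[of "- x"] by simp
 next
  case 4 then show ?thesis using lt[of x] Kf_reflect[of e E m x] mult_pos_pos[OF e, of x] by simp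
 qed (use K0 Kf_1[of e E m] k e in auto)
qed

lemma pattern_E:
 assumes e: "0 < e" and k: "k < - e" and nc: "~ crit e E m k" and ge: "!!x. 0 < x ==> x < 1 ==> k <= Kf e E m x"
  and x: "-1 <= x" "x <= 1"
 shows "k < Kf e E m x"
proof -
 have gt: "k < Kf e E m x" if w: "0 < x" "x < 1" for x
 proof (rule ccontr)
  assume "~ k < Kf e E m x"
  then have eq: "Kf e E m x = k" using ge[OF w] by simp
  have "Kd e E m x = 0"
   by (rule DERIV_local_min[OF Kf_deriv, where d = "min x (1 - x)"]) (use w ge eq in \<open>auto simp: abs_if split: if_splits\<close>)
  then have "crit e E m k" unfolding crit_def using eq w by (intro exI[of _ x]) auto
  then show False using nc by simp
 qed
 have "Kd e E m 0 < 0" using e by (simp add: Kd_def)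
 then have "EX y. 0 < y & y < 0 + 1 & Kf e E m y < Kf e E m 0"
  by (intro deriv_neg_nearby(1)[OF Kf_deriv]) auto
 then obtain y where "0 < y" "y < 0 + 1" "Kf e E m y < Kf e E m 0" by (elim exE conjE)
 then have K0: "k < Kf e E m 0" using ge[of y] by auto
 consider "x = -1" | "-1 < x" "x < 0" | "x = 0" | "0 < x" "x < 1" | "x = 1" using x by linarith
 then show ?thesis
 proof cases
  case 2 then show ?thesis using gt[of "- x"] Kf_reflect[of e E m "- x"] mult_pos_pos[OF e, of "- x"] by simp
 next
  case 4 then show ?thesis by (rule gt)
 qed (use K0 Kf_1[of e E m] k e in auto)
qed

section \<open>The isoenergetic manifolds of the unit system\<close>

text \<open>\<open>gf\<close> is a concave quadratic polynomial that vanishes neither at \<open>1\<close> nor at \<open>-1\<close>.\<close>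
lemma gf_interval:
 assumes n: "0 < n" and x0: "-1 < x0" "x0 < 1" "0 < gf e n k x0" and ke: "k ~= e" "k ~= - e"
 shows "EX a b. -1 <= a & a < b & b <= 1 & (ALL x. a < x --> x < b --> 0 < gf e n k x) &
  (a = -1 & 0 < gf e n k a | gf e n k a = 0 & -1 < a) & (b = 1 & 0 < gf e n k b | gf e n k b = 0 & b < 1) &
  (ALL x. -1 <= x --> x <= 1 --> x < a | b < x --> gf e n k x < 0)"
proof -
 define D where "D = e^2 + 4*n^2*(k + n^2)"
 have sq: "4*n^2*gf e n k x = D - (2*n^2*x - e)^2" for x
  by (simp add: D_def gf_def power2_eq_square algebra_simps)
 have "0 < 4*n^2*gf e n k x0" using n x0 by simp
 then have D: "0 < D" using sq[of x0] zero_le_power2[of "2*n^2*x0 - e"] by linarith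
 define r s where "r = (e - sqrt D)/(2*n^2)" and "s = (e + sqrt D)/(2*n^2)"
 have g: "gf e n k x = n^2*((x - r)*(s - x))" for x
 proof -
  have "2*n^2*(x - r) = 2*n^2*x - e + sqrt D" "2*n^2*(s - x) = sqrt D - (2*n^2*x - e)"
   using n by (simp_all add: r_def s_def field_simps)
  then have "(2*n^2*(x - r))*(2*n^2*(s - x)) = (sqrt D)^2 - (2*n^2*x - e)^2"
   by (simp add: power2_eq_square algebra_simps)
  also have "... = 4*n^2*gf e n k x" using sq D by simp
  finally have "4*n^2*(n^2*((x - r)*(s - x))) = 4*n^2*gf e n k x" by (simp add: algebra_simps)
  then show ?thesis using n by simp
 qed
 have rs: "r < s" using D n by (simp add: r_def s_def divide_strict_right_mono)
 have gp: "0 < gf e n k x \<longleftrightarrow> r < x & x < s" for x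
  using n rs by (auto simp: g zero_less_mult_iff)
 have gn: "gf e n k x < 0 \<longleftrightarrow> x < r | s < x" for x
  using n rs by (auto simp: g mult_less_0_iff)
 have g1: "gf e n k 1 ~= 0" "gf e n k (-1) ~= 0" using ke by (auto simp: gf_def)
 have r0: "r < x0" "x0 < s" using gp x0 by auto
 have "r ~= -1" "s ~= 1" using g1 g by force+
 moreover have "gf e n k r = 0" "gf e n k s = 0" by (simp_all add: g)
 moreover have "0 < gf e n k (-1)" if "~ -1 < r" unfolding gp using that r0 x0 \<open>r ~= -1\<close> by simp
 moreover have "0 < gf e n k 1" if "~ s < 1" unfolding gp using that r0 x0 \<open>s ~= 1\<close> by simp
 ultimately show ?thesis using r0 x0
  by (intro exI[of _ "if -1 < r then r else -1"] exI[of _ "if s < 1 then s else 1"])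
   (auto simp: gp gn split: if_splits)
qed

lemma sgn_pf: "sgn (pf e n l k x) = sgn (k - Kf e (n^2) (l^2) x)"
 unfolding pf_Kf using one_plus_sq(1)[of x] by (simp add: sgn_mult)

text \<open>The sign pattern of \<open>k - Kf e (n^2) (l^2)\<close> on the interval \<open>{a..b}\<close> where \<open>gf\<close> is nonnegative determines
 the topology.\<close>

lemma Q3_homeomorphic_Mod_pat:
 fixes e n l h :: real
 defines "k == h - l^2"
 defines "f == (%x. k - Kf e (n^2) (l^2) x)"
 assumes n: "0 < n" and xc: "-1 < xc" "xc < 1" "0 < gf e n k xc" and ke: "k ~= e" "k ~= - e"
  and neg: "al0 \<in> sphere 0 1" "psi e n l h al0 < 0"
  and P: "continuous_on {-1..1} P" "pat s P (-1 # Ys @ [1])" "length ys = length Ys"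
  and pat: "!!a b. -1 <= a ==> a < b ==> b <= 1 ==> (k < e --> f a < 0) ==> (e < k --> a = -1 & 0 < f a)
   ==> (- e < k --> b = 1 & 0 < f b) ==> (k < - e --> f b < 0)
   ==> (!!y. -1 < y ==> y < 1 ==> f y = 0 ==> a < y & y < b)
   ==> pat s f (a # ys @ [b]) & sgn (f a) = sgn (P (-1))"
 shows "Q3 1 e n l h homeomorphic Mod P"
proof -
 obtain a b where ab: "-1 <= a" "a < b" "b <= 1" and g: "!!x. a < x ==> x < b ==> 0 < gf e n k x"
  "a = -1 & 0 < gf e n k a | gf e n k a = 0 & -1 < a" "b = 1 & 0 < gf e n k b | gf e n k b = 0 & b < 1"
  "!!x. -1 <= x ==> x <= 1 ==> x < a | b < x ==> gf e n k x < 0"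
  using gf_interval[OF n xc ke] by auto
 have gpole: "gf e n k 1 = k + e" "gf e n k (-1) = k - e" by (simp_all add: gf_def)
 have fpole: "f 1 = k + e" "f (-1) = k - e" by (simp_all add: f_def Kf_1)
 have fneg: "f x < 0" if "-1 < x" "x < 1" "gf e n k x <= 0" for x
 proof -
  have "pf e n l k x < 0" by (rule pf_neg[OF n _ that(3)]) (use that in \<open>auto simp: abs_square_less_1\<close>)
  then show ?thesis using sgn_pf[of e n l k x] unfolding f_def by (metis sgn_less)
 qed
 have p: "pat s f (a # ys @ [b]) & sgn (f a) = sgn (P (-1))"
 proof (rule pat[OF ab])
  show "k < e --> f a < 0" using g(2) fneg[of a] ab gpole by auto
  show "e < k --> a = -1 & 0 < f a" using g(2) g(4)[of "-1"] gpole fpole by force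
  show "- e < k --> b = 1 & 0 < f b" using g(3) g(4)[of 1] gpole fpole by force
  show "k < - e --> f b < 0" using g(3) fneg[of b] ab gpole by auto
  fix y assume y: "-1 < y" "y < 1" "f y = 0"
  then have "0 < gf e n k y" using fneg[of y] by force
  moreover have "~ (y < a | b < y)" using g(4)[of y] y \<open>0 < gf e n k y\<close> by force
  moreover have "y ~= a" "y ~= b" using g(2,3) y \<open>0 < gf e n k y\<close> by auto
  ultimately show "a < y & y < b" by force
 qed
 have "sim f a b P (-1) 1" using pat_sim[of s f "a # ys @ [b]" P "-1 # Ys @ [1]"] p P by simp
 then have "sim (pf e n l k) a b P (-1) 1" unfolding sim_def sgn_pf f_def .
 then show ?thesis
  using Q3_homeomorphic_Mod[OF n ab, of e h l P al0] g P(1) neg unfolding k_def by simp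
qed

lemma psi_neg_pole: "h - l^2 < e ==> vector [-1, 0, 0] \<in> sphere (0::real^3) 1 & psi e n l h (vector [-1, 0, 0]) < 0"
 unfolding sphere3 by (simp add: psi_def gf_def vector_3)

lemma psi_neg_Kf:
 assumes n: "0 < n" and x: "x^2 < 1" and K: "h - l^2 < Kf e (n^2) (l^2) x"
 shows "EX al. al \<in> sphere (0::real^3) 1 & psi e n l h al < 0"
proof -
 define d where "d = sqrt ((n*(1 + x^2))^2 + (2*l)^2)"
 have s0: "0 < (n*(1 + x^2))^2" using n one_plus_sq[of x] by simp
 have d: "0 < d" "d^2 = (n*(1 + x^2))^2 + (2*l)^2" using s0 by (auto simp: d_def intro!: add_pos_nonneg)
 define r where "r = sqrt (1 - x^2)"
 have r: "0 < r" "r^2 = 1 - x^2" using x by (auto simp: r_def)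
 define y z where "y = r*(n*(1 + x^2))/d" and "z = r*(2*l)/d"
 have "y^2 + z^2 = r^2*((n*(1 + x^2))^2 + (2*l)^2)/d^2"
  unfolding y_def z_def power_divide power_mult_distrib[of r] add_divide_distrib[symmetric] distrib_left[symmetric] ..
 also have "... = r^2" unfolding d(2)[symmetric] using d(1) by simp
 finally have yz: "x^2 + y^2 + z^2 = 1" using r by simp
 have "n*y + l*z = r/d*(n^2*(1 + x^2) + 2*l^2)" using d by (simp add: y_def z_def field_simps power2_eq_square)
 moreover have "0 < n^2*(1 + x^2)" using n one_plus_sq[of x] by simp
 then have w: "0 < n^2*(1 + x^2) + 2*l^2" by (simp add: add_pos_nonneg)
 ultimately have \<eta>: "n*y + l*z ~= 0" using r d by simp
 have ze: "n*(1 + x^2)*z - 2*l*y = 0" using d by (simp add: y_def z_def)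
 have "sgn (pf e n l (h - l^2) x) = -1" using K by (simp add: sgn_pf)
 then have "pf e n l (h - l^2) x < 0" by (simp add: sgn_if split: if_splits)
 then have "pf e n l (h - l^2) x*(n*y + l*z)^2 < 0" using \<eta> by (simp add: mult_less_0_iff)
 then have "(1 - x^2)*(2*l^2 + n^2*(1 + x^2))*((2 - z^2)*gf e n (h - l^2) x - (n*y + l*z)^2) < 0"
  using psi_identity[OF yz, of l n "gf e n (h - l^2) x"] ze by (simp add: pf_def)
 moreover have "0 < (1 - x^2)*(2*l^2 + n^2*(1 + x^2))" using w x by (intro mult_pos_pos) auto
 moreover have "B < 0" if "A*B < 0" "0 < A" for A B :: real using that by (simp add: mult_less_0_iff)
 ultimately have "(2 - z^2)*gf e n (h - l^2) x - (n*y + l*z)^2 < 0" by blast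
 then have *: "(2 - z^2)*gf e n (h - l^2) x < (n*y + l*z)^2" by simp
 have z2: "0 < 2 - z^2" using yz zero_le_power2[of x] zero_le_power2[of y] by linarith
 have "psi e n l h (vector [x, y, z]) = gf e n (h - l^2) x - (n*y + l*z)^2/(2 - z^2)"
  by (simp add: psi_def vector_3)
 also have "... < 0" using * z2 by (simp add: pos_less_divide_eq mult.commute)
 finally show ?thesis using yz unfolding sphere3 by (intro exI[of _ "vector [x, y, z]"]) (simp add: vector_3)
qed

lemma psi_pos_Kf:
 assumes n: "0 < n" and K: "!!x. -1 <= x ==> x <= 1 ==> Kf e (n^2) (l^2) x < h - l^2" and al: "al \<in> sphere (0::real^3) 1"
 shows "0 < psi e n l h al"
proof -
 define x y z where "x = al$1" and "y = al$2" and "z = al$3"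
 have yz: "x^2 + y^2 + z^2 = 1" using al unfolding sphere3 x_def y_def z_def .
 have z2: "0 < 2 - z^2" and x2: "x^2 <= 1" using sphere_z[OF al] by (auto simp: x_def z_def)
 have x1: "-1 <= x" "x <= 1" using x2 by (auto simp: abs_square_le_1)
 have p: "0 < pf e n l (h - l^2) x" using K[OF x1] sgn_pf[of e n l "h - l^2" x] by (metis diff_gt_0_iff_gt sgn_greater)
 have psi: "psi e n l h al = gf e n (h - l^2) x - (n*y + l*z)^2/(2 - z^2)"
  by (simp add: psi_def x_def y_def z_def)
 show ?thesis
 proof (cases "x^2 = 1")
  case True
  then have "y^2 + z^2 = 0" using yz by simp
  then have "y = 0" "z = 0" by (simp_all add: sum_power2_eq_zero_iff)
  moreover have "x = 1 | x = -1" using True by (simp add: power2_eq_1_iff)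
  ultimately show ?thesis using p pf_pole[of e n l "h - l^2"] unfolding psi by auto
 next
  case False
  then have x1': "x^2 < 1" using x2 by simp
  have g: "0 < gf e n (h - l^2) x" using pf_neg[OF n x1', of e "h - l^2" l] p by force
  let ?\<eta> = "n*y + l*z" and ?\<zeta> = "n*(1 + x^2)*z - 2*l*y"
  have "0 < n^2*(1 + x^2)" using n one_plus_sq[of x] by simp
  then have w: "0 < 2*l^2 + n^2*(1 + x^2)" by (simp add: add_nonneg_pos)
  have "?\<eta> ~= 0 | ?\<zeta> ~= 0"
  proof (rule ccontr)
   assume "~ ?thesis"
   then have 0: "?\<eta> = 0" "?\<zeta> = 0" by auto
   have "(2*l^2 + n^2*(1 + x^2))*z = 2*l*?\<eta> + n*?\<zeta>"
    "(2*l^2 + n^2*(1 + x^2))*y = n*(1 + x^2)*?\<eta> - l*?\<zeta>"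
    by (simp_all add: power2_eq_square algebra_simps)
   then have "z = 0" "y = 0" using 0 w by auto
   then show False using yz False by simp
  qed
  then have "0 < gf e n (h - l^2) x*?\<zeta>^2 + pf e n l (h - l^2) x*?\<eta>^2"
  proof
   assume "?\<eta> ~= 0"
   then show ?thesis using g p by (intro add_nonneg_pos mult_nonneg_nonneg mult_pos_pos) auto
  next
   assume "?\<zeta> ~= 0"
   then show ?thesis using g p by (intro add_pos_nonneg mult_nonneg_nonneg mult_pos_pos) auto
  qed
  then have "0 < (1 - x^2)*(2*l^2 + n^2*(1 + x^2))*((2 - z^2)*gf e n (h - l^2) x - ?\<eta>^2)"
   using psi_identity[OF yz, of l n "gf e n (h - l^2) x"] by (simp add: pf_def)
  moreover have "0 < (1 - x^2)*(2*l^2 + n^2*(1 + x^2))" using w x1' by (intro mult_pos_pos) auto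
  ultimately have "?\<eta>^2 < (2 - z^2)*gf e n (h - l^2) x" by (simp add: zero_less_mult_iff)
  then have "?\<eta>^2/(2 - z^2) < gf e n (h - l^2) x" using z2 by (simp add: pos_divide_less_eq mult.commute)
  then show ?thesis unfolding psi by simp
 qed
qed

lemma Q3_RP3_unit:
 assumes n: "0 < n" and e: "0 < e" and k: "e < h - l^2" "~ crit e (n^2) (l^2) (h - l^2)"
  and K: "!!w. 0 < w ==> w < 1 ==> Kf e (n^2) (l^2) (- w) <= h - l^2"
 shows "is_RP3 (top_of_set (Q3 1 e n l h))"
 by (rule Q3_RP3) (rule psi_pos_Kf[OF n pattern_B[OF e k K]])

lemma pat_half:
 "pat 1 (%x. x^2 - 1/2) [-1, - sqrt (1/2), sqrt (1/2), 1]" "pat (-1) (%x. 1/2 - x^2) [-1, - sqrt (1/2), sqrt (1/2), 1]"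
proof -
 define c where "c = sqrt (1/2 :: real)"
 have c: "0 < c" "c < 1" by (auto simp: c_def)
 have "c^2 = 1/2" by (simp add: c_def)
 then have f: "x^2 - 1/2 = (x - c)*(x + c)" "1/2 - x^2 = (c - x)*(x + c)" for x :: real
  by (simp_all add: algebra_simps power2_eq_square)
 show "pat 1 (%x. x^2 - 1/2) [-1, - sqrt (1/2), sqrt (1/2), 1]" "pat (-1) (%x. 1/2 - x^2) [-1, - sqrt (1/2), sqrt (1/2), 1]"
  unfolding f c_def[symmetric] pat.simps sgn_mult using c by (auto simp: sgn_pos sgn_neg)
qed

lemma Q3_S2xS1_unit_above:
 assumes n: "0 < n" and e: "0 < e" and k: "e < h - l^2" and w: "0 < w" "w < 1" "h - l^2 < Kf e (n^2) (l^2) (- w)"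
 shows "Q3 1 e n l h homeomorphic Mod (%x. 1/2 - x^2)"
proof -
 obtain y1 y2 where y: "-1 < y1" "y2 < 1" "pat 1 (%x. h - l^2 - Kf e (n^2) (l^2) x) [-1, y1, y2, 1]"
  using pattern_C(1)[of "n^2" e "l^2" "h - l^2" w] assms by auto
 obtain al where al: "al \<in> sphere (0::real^3) 1" "psi e n l h al < 0"
  using psi_neg_Kf[OF n, of "- w" h l e] w by (auto simp: abs_square_less_1)
 have "pat 1 (%x. x^2 - 1/2) [-1, - sqrt (1/2), sqrt (1/2), 1]" by (rule pat_half(1))
 moreover have "0 < gf e n (h - l^2) 0" using n e k by (simp add: gf_def add_pos_pos)
 ultimately have "Q3 1 e n l h homeomorphic Mod (%x. x^2 - 1/2)"
  by (intro Q3_homeomorphic_Mod_pat[OF n _ _ _ _ _ al, where xc = 0 and s = 1 and ys = "[y1, y2]" and Ys = "[- sqrt (1/2), sqrt (1/2)]"])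
   (use e k y in \<open>auto intro!: continuous_intros simp: power2_eq_square\<close>)
 then show ?thesis using Mod_swap homeomorphic_trans by blast
qed

lemma Q3_N3_2_unit:
 assumes n: "0 < n" and e: "0 < e" and k: "- e < h - l^2" "h - l^2 < e" and W: "W e (n^2) (l^2) (h - l^2)"
 shows "Q3 1 e n l h homeomorphic Mod P2"
proof -
 have "EX y1 y2 y3. -1 < y1 & y3 < 1 & (ALL x0. -1 <= x0 --> x0 < y1 -->
   pat (-1) (%x. h - l^2 - Kf e (n^2) (l^2) x) [x0, y1, y2, y3, 1])"
  using pattern_D[OF _ e _ k W] n by simp
 then obtain y1 y2 y3 where y: "-1 < y1" "y3 < 1"
   "!!x0. -1 <= x0 ==> x0 < y1 ==> pat (-1) (%x. h - l^2 - Kf e (n^2) (l^2) x) [x0, y1, y2, y3, 1]"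
  by (auto simp del: pat.simps)
 have y1: "y1 < 1" "h - l^2 - Kf e (n^2) (l^2) y1 = 0" using y(3)[of "-1"] y(1) by auto
 have "0 < gf e n (h - l^2) y1"
  using pf_neg[OF n, of y1 e "h - l^2" l] y1 y(1) by (force simp: pf_Kf abs_square_less_1)
 then show ?thesis
  by (intro Q3_homeomorphic_Mod_pat[OF n _ _ _ _ _ conjunct1[OF psi_neg_pole[OF k(2)]] conjunct2[OF psi_neg_pole[OF k(2)]],
    where xc = y1 and s = "-1" and ys = "[y1, y2, y3]" and Ys = "[0, sqrt (1 - (2/3)^2), sqrt (1 - (1/3)^2)]"])
   (use e k y y1 P23_props in \<open>auto simp del: pat.simps\<close>)
qed

lemma Q3_N3_3_unit:
 assumes n: "0 < n" and e: "0 < e" and k: "h - l^2 < - e" and W: "W e (n^2) (l^2) (h - l^2)"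
 shows "Q3 1 e n l h homeomorphic Mod P3"
proof -
 have ke: "h - l^2 < e" using k e by simp
 have "EX y1 y2 y3 y4. -1 < y1 & y4 < 1 & (ALL x0 x1. x0 < y1 --> y4 < x1 -->
   pat (-1) (%x. h - l^2 - Kf e (n^2) (l^2) x) [x0, y1, y2, y3, y4, x1])"
  using pattern_G[OF _ e _ k W] n by simp
 then obtain y1 y2 y3 y4 where y0: "-1 < y1" "y4 < 1"
   "ALL x0 x1. x0 < y1 --> y4 < x1 --> pat (-1) (%x. h - l^2 - Kf e (n^2) (l^2) x) [x0, y1, y2, y3, y4, x1]"
  by (elim exE conjE)
 then have y: "-1 < y1" "y4 < 1"
   "!!x0 x1. x0 < y1 ==> y4 < x1 ==> pat (-1) (%x. h - l^2 - Kf e (n^2) (l^2) x) [x0, y1, y2, y3, y4, x1]"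
  by (simp_all del: pat.simps)
 have y1: "y1 < 1" "h - l^2 - Kf e (n^2) (l^2) y1 = 0" "-1 < y4" "h - l^2 - Kf e (n^2) (l^2) y4 = 0"
  using y(3)[of "-1" 1] y(1,2) by auto
 have "0 < gf e n (h - l^2) y1"
  using pf_neg[OF n, of y1 e "h - l^2" l] y1 y(1) by (force simp: pf_Kf abs_square_less_1)
 then show ?thesis
  by (intro Q3_homeomorphic_Mod_pat[OF n _ _ _ _ _ conjunct1[OF psi_neg_pole[OF ke]] conjunct2[OF psi_neg_pole[OF ke]],
    where xc = y1 and s = "-1" and ys = "[y1, y2, y3, y4]" and Ys = "[0, sqrt (1 - (9/10)^2), sqrt (1 - (4/5)^2), sqrt (1 - (1/5)^2)]"])
   (use e k y y1 P23_props in \<open>auto simp del: pat.simps\<close>)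
qed

lemma Q3_S3_unit:
 assumes n: "0 < n" and e: "0 < e" and k: "- e < h - l^2" "h - l^2 < e"
  and nW: "~ W e (n^2) (l^2) (h - l^2)" "~ crit e (n^2) (l^2) (h - l^2)"
 shows "Q3 1 e n l h homeomorphic Mod (%x. x)"
proof -
 obtain y where y: "-1 < y" "y < 1" "Kf e (n^2) (l^2) y = h - l^2" "!!x. -1 <= x ==> x < y ==> h - l^2 < Kf e (n^2) (l^2) x"
   "!!x. y < x ==> x <= 1 ==> Kf e (n^2) (l^2) x < h - l^2"
  using pattern_A[OF e _ k nW] by auto
 have "0 < gf e n (h - l^2) y"
  using pf_neg[OF n, of y e "h - l^2" l] y(1-3) by (force simp: pf_Kf abs_square_less_1)
 then show ?thesis
  by (intro Q3_homeomorphic_Mod_pat[OF n _ _ _ _ _ conjunct1[OF psi_neg_pole[OF k(2)]] conjunct2[OF psi_neg_pole[OF k(2)]],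
    where xc = y and s = "-1" and ys = "[y]" and Ys = "[0]"])
   (use e k y in auto)
qed

lemma Q3_S2xS1_unit_below:
 assumes n: "0 < n" and e: "0 < e" and k: "h - l^2 < - e"
  and nW: "~ W e (n^2) (l^2) (h - l^2)" "~ crit e (n^2) (l^2) (h - l^2)"
  and c: "0 < c" "c < 1" "Kf e (n^2) (l^2) c < h - l^2"
 shows "Q3 1 e n l h homeomorphic Mod (%x. 1/2 - x^2)"
proof -
 have ke: "h - l^2 < e" using k e by simp
 obtain y1 y2 where y: "-1 < y1" "y1 < y2" "y2 < 1" "Kf e (n^2) (l^2) y1 = h - l^2" "Kf e (n^2) (l^2) y2 = h - l^2"
   "!!x. -1 <= x ==> x < y1 ==> h - l^2 < Kf e (n^2) (l^2) x"
   "!!x. y1 < x ==> x < y2 ==> Kf e (n^2) (l^2) x < h - l^2"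
   "!!x. y2 < x ==> x <= 1 ==> h - l^2 < Kf e (n^2) (l^2) x"
  using pattern_F[OF e _ k nW c] by auto
 have "pat (-1) (%x. 1/2 - x^2) [-1, - sqrt (1/2), sqrt (1/2), 1]" by (rule pat_half(2))
 moreover have "0 < gf e n (h - l^2) y1"
  using pf_neg[OF n, of y1 e "h - l^2" l] y(1-4) by (force simp: pf_Kf abs_square_less_1)
 ultimately show ?thesis
  by (intro Q3_homeomorphic_Mod_pat[OF n _ _ _ _ _ conjunct1[OF psi_neg_pole[OF ke]] conjunct2[OF psi_neg_pole[OF ke]],
    where xc = y1 and s = "-1" and ys = "[y1, y2]" and Ys = "[- sqrt (1/2), sqrt (1/2)]"])
   (use e k y in \<open>auto intro!: continuous_intros simp: power2_eq_square\<close>)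
qed

lemma Q3_two_S3_unit:
 assumes n: "0 < n" and e: "0 < e" and k: "h - l^2 < - e" and nc: "~ crit e (n^2) (l^2) (h - l^2)"
  and K: "!!x. 0 < x ==> x < 1 ==> h - l^2 <= Kf e (n^2) (l^2) x"
  and x0: "-1 < x0" "x0 < 1" "0 < gf e n (h - l^2) x0"
 shows "Q3 1 e n l h homeomorphic Mod (%_. -1)"
proof -
 have ke: "h - l^2 < e" using k e by simp
 have lt: "h - l^2 < Kf e (n^2) (l^2) x" if "-1 <= x" "x <= 1" for x
  using pattern_E[OF e k nc K that] .
 show ?thesis
  by (intro Q3_homeomorphic_Mod_pat[OF n x0 _ _ conjunct1[OF psi_neg_pole[OF ke]] conjunct2[OF psi_neg_pole[OF ke]],
    where s = "-1" and ys = "[]" and Ys = "[]"])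
   (use e k lt in \<open>auto intro!: continuous_intros\<close>)
qed

section \<open>The critical values\<close>

lemma image_pair_not_UNIV:
 fixes f g :: "'a::real_vector => real"
 assumes T: "subspace T" and lin: "linear f" "linear g"
 shows "(%v. (f v, g v)) ` T ~= UNIV \<longleftrightarrow> (EX p q. (p, q) ~= (0, 0) & (\<forall>v\<in>T. p*f v + q*g v = 0))"
proof
 have l: "linear (%v. (f v, g v))"
  using lin by (auto intro!: linearI simp: linear_add linear_scale)
 let ?S = "(%v. (f v, g v)) ` T"
 have S: "subspace ?S" by (rule linear_subspace_image[OF l T])
 assume "?S ~= UNIV"
 moreover have "span ?S = ?S" using S by (rule span_eq_iff[THEN iffD2])
 ultimately have "span ?S ~= UNIV" by (rule back_subst[where P = "%U. U ~= UNIV", OF _ sym])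
 then have "dim ?S < DIM(real \<times> real)" using dim_eq_full[of ?S] dim_subset_UNIV[of ?S] by linarith
 then obtain x where x: "x ~= 0" "!!y. y \<in> span ?S ==> orthogonal x y"
  by (rule orthogonal_to_subspace_exists) blast
 have "fst x*f v + snd x*g v = 0" if "v \<in> T" for v
  using x(2)[of "(f v, g v)"] that by (auto simp: orthogonal_def span_base inner_prod_def)
 then show "EX p q. (p, q) ~= (0, 0) & (\<forall>v\<in>T. p*f v + q*g v = 0)"
  using x(1) by (intro exI[of _ "fst x"] exI[of _ "snd x"]) (auto simp: prod_eq_iff)
next
 assume "EX p q. (p, q) ~= (0, 0) & (\<forall>v\<in>T. p*f v + q*g v = 0)"
 then obtain p q where pq: "(p, q) ~= (0, 0)" "!!v. v \<in> T ==> p*f v + q*g v = 0" by auto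
 show "(%v. (f v, g v)) ` T ~= UNIV"
 proof
  assume "(%v. (f v, g v)) ` T = UNIV"
  then have "(p, q) \<in> (%v. (f v, g v)) ` T" by simp
  then obtain v where "v \<in> T" "f v = p" "g v = q" by auto
  then have "p*p + q*q = 0" using pq(2)[of v] by simp
  then show False using pq(1) by (simp add: sum_squares_eq_zero_iff)
 qed
qed

text \<open>The differentials of \<open>ksL\<close> and \<open>ksH\<close>.\<close>
definition dL :: "phase => phase => real" where
 "dL = (%(M, al) (V, \<beta>). (V \<bullet> al + M \<bullet> \<beta>)/2)"

definition dH :: "real => real => phase => phase => real" where
 "dH e0 e1 = (%(M, al) (V, \<beta>). (M$1*V$1 + M$2*V$2 + 2*M$3*V$3)/2
  + e1*(\<beta>$3*M$2 + al$3*V$2 - \<beta>$2*M$3 - al$2*V$3) - e0*\<beta>$1)"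

lemma has_derivative_nth: "((%x. f x $ i) has_derivative (%v. f' v $ i)) F" if "(f has_derivative f') F"
 using bounded_linear.has_derivative[OF bounded_linear_vec_nth that] .

lemma ks_derivatives:
 "(alpha_sq has_derivative (%v. 2*(snd x \<bullet> snd v))) (at x)"
 "(ksL has_derivative dL x) (at x)"
 "(ksH e0 e1 has_derivative dH e0 e1 x) (at x)"
proof -
 have "((%x. snd x \<bullet> snd x) has_derivative (%v. snd x \<bullet> snd v + snd v \<bullet> snd x)) (at x)"
  by (auto intro!: derivative_eq_intros)
 then show "(alpha_sq has_derivative (%v. 2*(snd x \<bullet> snd v))) (at x)"
  by (simp add: alpha_sq_def case_prod_unfold inner_commute)
 have "((%x. (fst x \<bullet> snd x)/2) has_derivative (%v. (fst x \<bullet> snd v + fst v \<bullet> snd x)/2)) (at x)"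
  by (auto intro!: derivative_eq_intros)
 then show "(ksL has_derivative dL x) (at x)"
  by (simp add: ksL_def dL_def case_prod_unfold add.commute)
 have f: "((%x. fst x $ i) has_derivative (%v. fst v $ i)) (at x)" "((%x. snd x $ i) has_derivative (%v. snd v $ i)) (at x)"
  for i and x :: phase
  by (auto intro!: has_derivative_nth derivative_eq_intros)
 have "((%x. ((fst x $ 1)^2 + (fst x $ 2)^2 + 2*(fst x $ 3)^2)/4
  + e1*(snd x $ 3*fst x $ 2 - snd x $ 2*fst x $ 3) - e0 * snd x $ 1) has_derivative dH e0 e1 x) (at x)"
  by (rule has_derivative_eq_rhs, (rule f derivative_intros | simp)+)
   (simp add: dH_def case_prod_unfold fun_eq_iff algebra_simps add_divide_distrib)
 then show "(ksH e0 e1 has_derivative dH e0 e1 x) (at x)"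
  by (simp add: ksH_def case_prod_unfold)
qed

lemma parallel_if_orthogonal:
 fixes al G :: "'a::real_inner"
 assumes "al ~= 0" "!!\<beta>. al \<bullet> \<beta> = 0 ==> G \<bullet> \<beta> = 0"
 shows "EX \<mu>. G = \<mu> *\<^sub>R al"
proof -
 define \<mu> where "\<mu> = (G \<bullet> al)/(al \<bullet> al)"
 have 0: "al \<bullet> (G - \<mu> *\<^sub>R al) = 0" using assms(1) by (simp add: \<mu>_def inner_diff_right inner_commute)
 then have "G \<bullet> (G - \<mu> *\<^sub>R al) = 0" by (rule assms(2))
 then have "(G - \<mu> *\<^sub>R al) \<bullet> (G - \<mu> *\<^sub>R al) = 0" using 0 by (simp add: inner_diff_left)
 then show ?thesis by (auto intro!: exI[of _ \<mu>])
qed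

text \<open>The Lagrange condition, with the multiplier \<open>c\<close> of \<open>2 L\<close> and the multiplier \<open>\<nu> - 2 c^2\<close> of
 \<open>al \<bullet> al / 2\<close>.\<close>

lemma critical_points_iff:
 assumes a: "0 < a"
 shows "(M, al) \<in> critical_points a e0 e1 \<longleftrightarrow> al \<bullet> al = a^2 & (EX c \<nu>. M$1 = 2*c*al$1 & M$2 = 2*(c*al$2 - e1*al$3) &
  M$3 = c*al$3 + e1*al$2 & \<nu>*al$1 = - e0 & c*e1*al$3 = (\<nu> + e1^2)*al$2 &
  c*e1*al$2 = (\<nu> + 2*e1^2 - c^2)*al$3)" (is "_ \<longleftrightarrow> _ & ?R")
proof (cases "al \<bullet> al = a^2")
 case False
 then show ?thesis by (auto simp: critical_points_def P5_def alpha_sq_def)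
next
 case True
 let ?x = "(M, al)" and ?T = "{v. al \<bullet> snd v = 0}"
 have al0: "al ~= 0" using True a by auto
 have T: "tangent_P5 ?x = ?T"
  unfolding tangent_P5_def frechet_derivative_at[OF ks_derivatives(1), symmetric] by simp
 have F: "frechet_derivative (%y. (ksL y, ksH e0 e1 y)) (at ?x) = (%v. (dL ?x v, dH e0 e1 ?x v))"
  by (rule frechet_derivative_at[symmetric]) (rule has_derivative_Pair[OF ks_derivatives(2,3)])
 have sT: "subspace ?T" by (auto simp: subspace_def inner_add_right)
 have lin: "linear (dL ?x)" "linear (dH e0 e1 ?x)"
  using has_derivative_linear[OF ks_derivatives(2)] has_derivative_linear[OF ks_derivatives(3)] by auto
 have "?x \<in> critical_points a e0 e1 \<longleftrightarrow> (EX p q. (p, q) ~= (0, 0) & (\<forall>v\<in>?T. p*dL ?x v + q*dH e0 e1 ?x v = 0))"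
  unfolding image_pair_not_UNIV[OF sT lin, symmetric]
  using True by (simp add: critical_points_def P5_def alpha_sq_def T F)
 also have "... \<longleftrightarrow> ?R"
 proof
  assume "EX p q. (p, q) ~= (0, 0) & (\<forall>v\<in>?T. p*dL ?x v + q*dH e0 e1 ?x v = 0)"
  then obtain p q where pq: "(p, q) ~= (0, 0)" "!!v. v \<in> ?T ==> p*dL ?x v + q*dH e0 e1 ?x v = 0" by blast
  have q: "q ~= 0"
  proof
   assume "q = 0"
   then have "p ~= 0" "dL ?x (al, 0) = 0" using pq(1) pq(2)[of "(al, 0)"] by auto
   then show False using al0 by (simp add: dL_def)
  qed
  define c where "c = - p/(2*q)"
  have eq: "dH e0 e1 ?x v = 2*c*dL ?x v" if "al \<bullet> snd v = 0" for v
  proof -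
   have "q*dH e0 e1 ?x v = - p*dL ?x v" using pq(2)[of v] that by simp
   then show ?thesis using q by (simp add: c_def field_simps)
  qed
  have V: "dH e0 e1 ?x (axis i 1, 0) = 2*c*dL ?x (axis i 1, 0)" for i by (rule eq) simp
  have M: "M$1 = 2*c*al$1" "M$2 = 2*(c*al$2 - e1*al$3)" "M$3 = c*al$3 + e1*al$2"
   using V[of 1] V[of 2] V[of 3] by (simp_all add: dH_def dL_def axis_def inner_vec_def sum_3)
  define G :: "real^3" where "G = vector [- e0 - c*M$1, - e1*M$3 - c*M$2, e1*M$2 - c*M$3]"
  have "G \<bullet> \<beta> = 0" if "al \<bullet> \<beta> = 0" for \<beta>
  proof -
   have "dH e0 e1 ?x (0, \<beta>) = 2*c*dL ?x (0, \<beta>)" by (rule eq) (simp add: that)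
   then show ?thesis by (simp add: dH_def dL_def G_def inner_vec_def sum_3 vector_3 algebra_simps)
  qed
  then obtain \<mu> where "G = \<mu> *\<^sub>R al" using parallel_if_orthogonal[OF al0] by blast
  then have "G$1 = \<mu>*al$1" "G$2 = \<mu>*al$2" "G$3 = \<mu>*al$3" by simp_all
  then have "- e0 - c*M$1 = \<mu>*al$1" "- e1*M$3 - c*M$2 = \<mu>*al$2" "e1*M$2 - c*M$3 = \<mu>*al$3"
   by (simp_all add: G_def vector_3)
  then show ?R using M
   by (intro exI[of _ c] exI[of _ "\<mu> + 2*c^2"]) (simp add: algebra_simps power2_eq_square)
 next
  assume ?R
  then obtain c \<nu> where M: "M$1 = 2*c*al$1" "M$2 = 2*(c*al$2 - e1*al$3)" "M$3 = c*al$3 + e1*al$2"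
   and G: "\<nu>*al$1 = - e0" "c*e1*al$3 = (\<nu> + e1^2)*al$2" "c*e1*al$2 = (\<nu> + 2*e1^2 - c^2)*al$3" by auto
  have "- 2*c*dL ?x v + 1*dH e0 e1 ?x v = 0" if "v \<in> ?T" for v
  proof -
   obtain V \<beta> where v: "v = (V, \<beta>)" by (cases v)
   have o: "al$1*\<beta>$1 + al$2*\<beta>$2 + al$3*\<beta>$3 = 0" using that v by (simp add: inner_vec_def sum_3)
   have "- 2*c*dL ?x v + dH e0 e1 ?x v = (\<nu> - 2*c^2)*(al$1*\<beta>$1 + al$2*\<beta>$2 + al$3*\<beta>$3)
    - (e0 + \<nu>*al$1)*\<beta>$1 + (c*e1*al$3 - (\<nu> + e1^2)*al$2)*\<beta>$2
    + (c*e1*al$2 - (\<nu> + 2*e1^2 - c^2)*al$3)*\<beta>$3"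
    by (simp add: v dL_def dH_def inner_vec_def sum_3 M field_simps power2_eq_square)
   then show ?thesis using G o by simp
  qed
  then show "EX p q. (p, q) ~= (0, 0) & (\<forall>v\<in>?T. p*dL ?x v + q*dH e0 e1 ?x v = 0)"
   by (intro exI[of _ "- 2*c"] exI[of _ 1]) auto
 qed
 finally show ?thesis using True by simp
qed

lemma smale_diagram_iff:
 assumes a: "0 < a"
 shows "(l, h) \<in> smale_diagram a e0 e1 \<longleftrightarrow> (EX x y z c \<nu>. x^2 + y^2 + z^2 = a^2 & \<nu>*x = - e0 & c*e1*z = (\<nu> + e1^2)*y &
  c*e1*y = (\<nu> + 2*e1^2 - c^2)*z & 2*l = 2*c*a^2 - c*z^2 - e1*y*z &
  h = c^2*a^2 - c^2*z^2/2 - e1^2*z^2 - e1^2*y^2/2 - e0*x)" (is "_ \<longleftrightarrow> ?R")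
proof -
 have LH: "2*ksL (M, al) = 2*c*a^2 - c*(al$3)^2 - e1*al$2*al$3 &
   ksH e0 e1 (M, al) = c^2*a^2 - c^2*(al$3)^2/2 - e1^2*(al$3)^2 - e1^2*(al$2)^2/2 - e0*al$1"
  if M: "M$1 = 2*c*al$1" "M$2 = 2*(c*al$2 - e1*al$3)" "M$3 = c*al$3 + e1*al$2"
   and al: "(al$1)^2 + (al$2)^2 + (al$3)^2 = a^2" for M al :: "real^3" and c
  unfolding al[symmetric] by (simp add: ksL_def ksH_def inner_vec_def sum_3 M field_simps power2_eq_square)
 show ?thesis
 proof
  assume "(l, h) \<in> smale_diagram a e0 e1"
  then obtain M al where x: "(M, al) \<in> critical_points a e0 e1" "l = ksL (M, al)" "h = ksH e0 e1 (M, al)"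
   by (auto simp: smale_diagram_def)
  then obtain c \<nu> where c: "M$1 = 2*c*al$1" "M$2 = 2*(c*al$2 - e1*al$3)" "M$3 = c*al$3 + e1*al$2"
   and G: "\<nu>*al$1 = - e0" "c*e1*al$3 = (\<nu> + e1^2)*al$2" "c*e1*al$2 = (\<nu> + 2*e1^2 - c^2)*al$3"
   and "al \<bullet> al = a^2" unfolding critical_points_iff[OF a] by blast
  then have al: "(al$1)^2 + (al$2)^2 + (al$3)^2 = a^2" by (simp add: inner_vec_def sum_3 power2_eq_square)
  show ?R
   by (rule exI[of _ "al$1"], rule exI[of _ "al$2"], rule exI[of _ "al$3"], rule exI[of _ c], rule exI[of _ \<nu>])
    (use LH[OF c al] G al x(2,3) in auto)
 next
  assume ?R
  then obtain x y z c \<nu> where *: "x^2 + y^2 + z^2 = a^2" "\<nu>*x = - e0" "c*e1*z = (\<nu> + e1^2)*y"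
   "c*e1*y = (\<nu> + 2*e1^2 - c^2)*z" "2*l = 2*c*a^2 - c*z^2 - e1*y*z"
   "h = c^2*a^2 - c^2*z^2/2 - e1^2*z^2 - e1^2*y^2/2 - e0*x" by blast
  define al M :: "real^3" where "al = vector [x, y, z]" and "M = vector [2*c*x, 2*(c*y - e1*z), c*z + e1*y]"
  have M: "M$1 = 2*c*al$1" "M$2 = 2*(c*al$2 - e1*al$3)" "M$3 = c*al$3 + e1*al$2"
   and al: "(al$1)^2 + (al$2)^2 + (al$3)^2 = a^2" using * by (simp_all add: M_def al_def vector_3)
  have "(M, al) \<in> critical_points a e0 e1"
   unfolding critical_points_iff[OF a]
  proof (rule conjI)
   show "al \<bullet> al = a^2" using al by (simp add: inner_vec_def sum_3 power2_eq_square)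
   have "al$1 = x" "al$2 = y" "al$3 = z" by (simp_all add: al_def vector_3)
   then show "EX c \<nu>. M$1 = 2*c*al$1 & M$2 = 2*(c*al$2 - e1*al$3) & M$3 = c*al$3 + e1*al$2 &
     \<nu>*al$1 = - e0 & c*e1*al$3 = (\<nu> + e1^2)*al$2 & c*e1*al$2 = (\<nu> + 2*e1^2 - c^2)*al$3"
    using M *(2-4) by - (rule exI[of _ c], rule exI[of _ \<nu>], simp)
  qed
  moreover have "l = ksL (M, al)" "h = ksH e0 e1 (M, al)" using LH[OF M al] * by (simp_all add: al_def vector_3)
  ultimately show "(l, h) \<in> smale_diagram a e0 e1" unfolding smale_diagram_def by blast
 qed
qed

text \<open>Scaling a critical point by \<open>b\<close> in the second component scales its multiplier \<open>c\<close> by \<open>1 / b\<close>.\<close>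
lemma smale_scale_imp:
 assumes a: "0 < a" and b: "0 < b" and s: "(l, h) \<in> smale_diagram a e0 e1"
 shows "(b*l, h) \<in> smale_diagram (b*a) (e0/b) (e1/b)"
proof -
 obtain x y z c \<nu> where *: "x^2 + y^2 + z^2 = a^2" "\<nu>*x = - e0" "c*e1*z = (\<nu> + e1^2)*y"
   "c*e1*y = (\<nu> + 2*e1^2 - c^2)*z" "2*l = 2*c*a^2 - c*z^2 - e1*y*z"
   "h = c^2*a^2 - c^2*z^2/2 - e1^2*z^2 - e1^2*y^2/2 - e0*x" using s unfolding smale_diagram_iff[OF a] by blast
 define d e f u where "d = c/b" and "e = e1/b" and "f = e0/b" and "u = \<nu>/b^2"
 have r: "c = b*d" "e1 = b*e" "e0 = b*f" "\<nu> = b^2*u" using b by (simp_all add: d_def e_def f_def u_def)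
 note eqs = *[unfolded r]
 have can: "A = B" if "b*A = b*B" for A B using that b by simp
 show ?thesis unfolding smale_diagram_iff[OF mult_pos_pos[OF b a]] e_def[symmetric] f_def[symmetric]
 proof (rule exI[of _ "b*x"], rule exI[of _ "b*y"], rule exI[of _ "b*z"], rule exI[of _ d], rule exI[of _ u], intro conjI)
  show "(b*x)^2 + (b*y)^2 + (b*z)^2 = (b*a)^2" by (simp add: power_mult_distrib distrib_left flip: *(1))
  show "u*(b*x) = - f" by (rule can) (use eqs(2) in \<open>simp add: power2_eq_square ac_simps\<close>)
  show "d*e*(b*z) = (u + e^2)*(b*y)" by (rule can) (use eqs(3) in \<open>simp add: power2_eq_square algebra_simps\<close>)
  show "d*e*(b*y) = (u + 2*e^2 - d^2)*(b*z)" by (rule can) (use eqs(4) in \<open>simp add: power2_eq_square algebra_simps\<close>)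
  show "2*(b*l) = 2*d*(b*a)^2 - d*(b*z)^2 - e*(b*y)*(b*z)"
   using arg_cong[OF eqs(5), of "%t. b*t"] by (simp add: power2_eq_square algebra_simps)
  show "h = d^2*(b*a)^2 - d^2*(b*z)^2/2 - e^2*(b*z)^2 - e^2*(b*y)^2/2 - f*(b*x)"
   using eqs(6) by (simp add: power2_eq_square ac_simps)
 qed
qed

lemma smale_scale:
 assumes a: "0 < a"
 shows "(l, h) \<in> smale_diagram a e0 e1 \<longleftrightarrow> (l/a, h) \<in> smale_diagram 1 (a*e0) (a*e1)"
 using smale_scale_imp[OF a, of "1/a" l h e0 e1] smale_scale_imp[of 1 a "l/a" h "a*e0" "a*e1"] a
 by (auto simp: mult.commute)

lemma Kd_zero_iff: "x ~= 0 ==> Kd e E m x = 0 \<longleftrightarrow> 4*m = (E - e/x)*(1 + x^2)^2"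
proof -
 assume x: "x ~= 0"
 have "(1 + x^2)^2*Kd e E m x = x*((E - e/x)*(1 + x^2)^2 - 4*m)"
  using x one_plus_sq[of x] unfolding Kd_def right_diff_distrib by (simp add: field_simps)
 then show ?thesis using x one_plus_sq[of x] by (metis diff_eq_diff_eq eq_iff_diff_eq_0 mult_eq_0_iff power_not_zero)
qed

text \<open>The value at a critical point, for use with the parametrisation of \<open>\<delta>\<^sub>3\<close>.\<close>

lemma Kf_crit_value:
 assumes x: "x ~= 0" and m: "4*m = (E - e/x)*(1 + x^2)^2"
 shows "Kf e E m x = (E - e/x) - (1 - x^2)*(2*E - e/x)/2 - e*x - m"
proof -
 define A where "A = E - e/x"
 have E: "e/x = E - A" by (simp add: A_def)
 have mA: "m = A*(1 + x^2)^2/4" using m by (simp add: A_def)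
 have B: "m*(1 - x^2)/(1 + x^2) = A*(1 + x^2)*(1 - x^2)/4"
 proof -
  have "A*q^2/4 * s/q = A*q * s/4" if "q ~= 0" for q s :: real using that by (simp add: power2_eq_square)
  then show ?thesis unfolding mA using one_plus_sq(2) by blast
 qed
 show ?thesis unfolding Kf_def B A_def[symmetric] E
  by (simp add: mA field_simps power2_eq_square)
qed

text \<open>The two equations for \<open>(y, z)\<close> are linear with determinant \<open>(\<nu> + 2 n^2) (\<nu> + n^2 - c^2)\<close>. A zero solution
 gives the poles; the first factor gives \<open>\<delta>\<^sub>4\<close>, the second the critical points of the profile.\<close>
lemma smale_unit_cases:
 assumes n: "0 < n" and e: "0 < e" and s: "(l, h) \<in> smale_diagram 1 e n"
 shows "h - l^2 = e | h - l^2 = - e | crit e (n^2) (l^2) (h - l^2) | h - l^2 = - e\<^sup>2/(4*n^2) - n^2"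
proof -
 obtain x y z c \<nu> where *: "x^2 + y^2 + z^2 = 1" "\<nu>*x = - e" "c*n*z = (\<nu> + n^2)*y"
   "c*n*y = (\<nu> + 2*n^2 - c^2)*z" "2*l = 2*c - c*z^2 - n*y*z"
   "h = c^2 - c^2*z^2/2 - n^2*z^2 - n^2*y^2/2 - e*x"
  using s unfolding smale_diagram_iff[OF zero_less_one] by auto
 have x0: "x ~= 0" using *(2) e by auto
 show ?thesis
 proof (cases "y = 0 & z = 0")
  case True
  then have "x = 1 | x = -1" using * by (simp add: power2_eq_1_iff)
  then show ?thesis using * True by auto
 next
  case False
  have "(\<nu> + 2*n^2)*(\<nu> + n^2 - c^2)*y = 0" "(\<nu> + 2*n^2)*(\<nu> + n^2 - c^2)*z = 0"
  proof -
   have "(\<nu> + 2*n^2)*(\<nu> + n^2 - c^2)*y = (\<nu> + 2*n^2 - c^2)*((\<nu> + n^2)*y) - c*n*(c*n*y)"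
    by (simp add: algebra_simps power2_eq_square)
   also have "... = 0" unfolding *(3)[symmetric] *(4) by (simp add: algebra_simps)
   finally show "(\<nu> + 2*n^2)*(\<nu> + n^2 - c^2)*y = 0" .
   have "(\<nu> + 2*n^2)*(\<nu> + n^2 - c^2)*z = (\<nu> + n^2)*((\<nu> + 2*n^2 - c^2)*z) - c*n*(c*n*z)"
    by (simp add: algebra_simps power2_eq_square)
   also have "... = 0" unfolding *(4)[symmetric] *(3) by (simp add: algebra_simps)
   finally show "(\<nu> + 2*n^2)*(\<nu> + n^2 - c^2)*z = 0" .
  qed
  then consider "\<nu> = - 2*n^2" | "\<nu> = c^2 - n^2" using False by force
  then show ?thesis
  proof cases
   case 1
   have yz: "c*z = - n*y"
   proof -
    have "n*(c*z) = n*(- n*y)" using *(3) unfolding 1 by (simp add: algebra_simps power2_eq_square)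
    then show ?thesis using n by (metis less_irrefl mult_left_cancel)
   qed
   have "2*l = 2*c - z*(c*z + n*y)" using *(5) by (simp add: power2_eq_square algebra_simps)
   then have l: "l = c" using yz by simp
   have "h = c^2 - (c*z)^2/2 - n^2*z^2 - n^2*y^2/2 - e*x" using *(6) by (simp add: power_mult_distrib)
   also have "... = c^2 - n^2*(y^2 + z^2) - e*x" unfolding yz by (simp add: power_mult_distrib algebra_simps)
   also have "y^2 + z^2 = 1 - x^2" using *(1) by simp
   finally have h: "h - l^2 = - n\<^sup>2*(1 - x^2) - e*x" using l by simp
   have e2: "e = 2*n^2*x" using *(2) unfolding 1 by simp
   have "e^2/(4*n^2) = n^2*x^2" "e*x = 2*(n^2*x^2)" using n unfolding e2 by (simp_all add: power2_eq_square)
   then have "h - l^2 = - e\<^sup>2/(4*n^2) - n^2" unfolding h by (simp add: algebra_simps)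
   then show ?thesis by blast
  next
   case 2
   have yz: "n*z = c*y | (c = 0 & z = 0)"
   proof (cases "z = 0 & c = 0")
    case False
    have "c*(n*z) = c*(c*y)" "n*(c*y) = n*(n*z)"
     using *(3,4) unfolding 2 by (simp_all add: power2_eq_square algebra_simps)
    then show ?thesis using n by (metis less_irrefl mult_left_cancel)
   qed auto
   then have yz: "n*z = c*y" using n by auto
   define t where "t = y/n"
   have y: "y = n*t" "z = c*t" using n yz by (simp_all add: t_def field_simps)
   have s: "t^2*(n^2 + c^2) = 1 - x^2" using *(1) unfolding y by (simp add: power_mult_distrib algebra_simps)
   have "2*l = 2*c - c*(t^2*(n^2 + c^2))" using *(5) unfolding y by (simp add: power2_eq_square algebra_simps)
   then have l: "2*l = c*(1 + x^2)" unfolding s by (simp add: algebra_simps)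
   have "h = c^2 - (t^2*(n^2 + c^2))*(n^2 + c^2)/2 - e*x"
    using *(6) unfolding y by (simp add: power2_eq_square field_simps)
   then have h: "h = c^2 - (1 - x^2)*(n^2 + c^2)/2 - e*x" unfolding s .
   have c2: "c^2 = n^2 - e/x" using *(2) x0 unfolding 2 by (simp add: field_simps)
   have "4*l^2 = (2*l)^2" by (simp add: power_mult_distrib)
   then have m: "4*l^2 = (n^2 - e/x)*(1 + x^2)^2" unfolding l by (simp add: power_mult_distrib c2)
   have K: "Kf e (n^2) (l^2) x = h - l^2" unfolding Kf_crit_value[OF x0 m] h c2 by simp
   have "x^2 <= 1" using *(1) zero_le_power2[of y] zero_le_power2[of z] by linarith
   then have "-1 <= x" "x <= 1" by (auto simp: abs_square_le_1)
   then consider "x = -1" | "x = 1" | "-1 < x" "x < 1" by linarith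
   then show ?thesis
   proof cases
    case 3
    then show ?thesis using K m Kd_zero_iff[OF x0, of e "n^2" "l^2"] unfolding crit_def by blast
   qed (use K Kf_1[of e "n^2" "l^2"] in auto)
  qed
 qed
qed

lemma smale_unit_pole:
 assumes "h - l^2 = e | h - l^2 = - e" shows "(l, h) \<in> smale_diagram 1 e n"
proof -
 obtain s :: real where s: "h - l^2 = - e * s" "s^2 = 1" using assms by (elim disjE) (force intro: that[of "-1"] that[of 1])+
 have "s * s = 1" using s(2) by (simp add: power2_eq_square)
 then show ?thesis unfolding smale_diagram_iff[OF zero_less_one]
  by - (rule exI[of _ s], rule exI[of _ 0], rule exI[of _ 0], rule exI[of _ l], rule exI[of _ "- e * s"], use s in auto)
qed

lemma smale_unit_crit:
 assumes n: "0 < n" and e: "0 < e" and c: "crit e (n^2) (l^2) (h - l^2)" shows "(l, h) \<in> smale_diagram 1 e n"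
proof -
 obtain x where x: "-1 < x" "x < 1" "Kd e (n^2) (l^2) x = 0" "Kf e (n^2) (l^2) x = h - l^2" using c crit_def by auto
 have x0: "x ~= 0" using x(3) e by (auto simp: Kd_def)
 have m: "4*l^2 = (n^2 - e/x)*(1 + x^2)^2" using x Kd_zero_iff[OF x0] by blast
 define c t where "c = 2*l/(1 + x^2)" and "t = sqrt ((1 - x^2)/(n^2 + c^2))"
 have l: "2*l = c*(1 + x^2)" using one_plus_sq[of x] by (simp add: c_def)
 have c2: "c^2 = n^2 - e/x" using m one_plus_sq[of x] by (simp add: c_def power_divide power_mult_distrib field_simps)
 have nc: "0 < n^2 + c^2" using n by (simp add: add_pos_nonneg)
 have "x^2 <= 1" using x by (simp add: abs_square_le_1)
 then have "t^2 = (1 - x^2)/(n^2 + c^2)" using nc by (simp add: t_def)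
 then have s: "t^2*(n^2 + c^2) = 1 - x^2" using nc by (metis less_irrefl nonzero_eq_divide_eq)
 have h: "h = c^2 - (1 - x^2)*(n^2 + c^2)/2 - e*x"
  using x(4) unfolding Kf_crit_value[OF x0 m] c2 by simp
 show ?thesis unfolding smale_diagram_iff[OF zero_less_one]
 proof (rule exI[of _ x], rule exI[of _ "n*t"], rule exI[of _ "c*t"], rule exI[of _ c], rule exI[of _ "c^2 - n^2"], intro conjI)
  show "x^2 + (n*t)^2 + (c*t)^2 = 1^2" using s by (simp add: power_mult_distrib algebra_simps)
  show "(c^2 - n^2)*x = - e" using x0 c2 by simp
  have "c*(t^2*(n^2 + c^2)) = c*(1 - x^2)" using s by simp
  then show "2*l = 2*c*1^2 - c*(c*t)^2 - n*(n*t)*(c*t)"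
   unfolding l by (simp add: power2_eq_square algebra_simps)
  have "(t^2*(n^2 + c^2))*(n^2 + c^2) = (1 - x^2)*(n^2 + c^2)" using s by simp
  then show "h = c^2*1^2 - c^2*(c*t)^2/2 - n^2*(c*t)^2 - n^2*(n*t)^2/2 - e*x"
   unfolding h by (simp add: power2_eq_square field_simps)
 qed (simp_all add: power2_eq_square algebra_simps)
qed

lemma smale_unit_delta4:
 assumes n: "0 < n" and e: "0 < e" "e/2 < n^2" and k: "h - l^2 = - e\<^sup>2/(4*n^2) - n^2"
 shows "(l, h) \<in> smale_diagram 1 e n"
proof -
 define x t where "x = e/(2*n^2)" and "t = sqrt ((1 - x^2)/(n^2 + l^2))"
 have x: "0 < x" "x < 1" using n e by (simp_all add: x_def)
 have nc: "0 < n^2 + l^2" using n by (simp add: add_pos_nonneg)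
 have "x^2 <= 1" using x by (simp add: abs_square_le_1)
 then have "t^2 = (1 - x^2)/(n^2 + l^2)" using nc by (simp add: t_def)
 then have s: "t^2*(n^2 + l^2) = 1 - x^2" using nc by (metis less_irrefl nonzero_eq_divide_eq)
 have nx: "2*n^2*x = e" using n by (simp add: x_def)
 have "h - l^2 = - n\<^sup>2*(1 - x^2) - e*x" unfolding k x_def using n by (simp add: field_simps power2_eq_square)
 then have h: "h = l^2 - n^2*(1 - x^2) - e*x" by simp
 show ?thesis unfolding smale_diagram_iff[OF zero_less_one]
 proof (rule exI[of _ x], rule exI[of _ "l*t"], rule exI[of _ "- n*t"], rule exI[of _ l], rule exI[of _ "- 2*n^2"], intro conjI)
  show "x^2 + (l*t)^2 + (- n*t)^2 = 1^2" using s by (simp add: power_mult_distrib algebra_simps)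
  show "- 2*n^2*x = - e" using nx by simp
  have "n^2*(t^2*(n^2 + l^2)) = n^2*(1 - x^2)" using s by simp
  then show "h = l^2*1^2 - l^2*(- n*t)^2/2 - n^2*(- n*t)^2 - n^2*(l*t)^2/2 - e*x"
   unfolding h by (simp add: power2_eq_square field_simps)
 qed (simp_all add: power2_eq_square algebra_simps)
qed

lemma psi_le_gf: "al \<in> sphere 0 1 ==> psi e n l h al <= gf e n (h - l^2) (al$1)"
 using sphere_z[of al] unfolding psi_def by (simp add: zero_le_divide_iff)

lemma Q3_unit_nonempty_iff:
 assumes n: "0 < n"
 shows "Q3 1 e n l h ~= {} \<longleftrightarrow> (EX x. -1 <= x & x <= 1 & 0 <= gf e n (h - l^2) x)"
proof
 assume "Q3 1 e n l h ~= {}"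
 then obtain M al where Q: "(M, al) \<in> Q3 1 e n l h" by auto
 obtain w where w: "w \<bullet> bet al = 0" "fib n l al w = (M, al)" "al \<in> sphere 0 1" using Q3_fib[OF Q] by auto
 have "(norm w)^2 = 4*psi e n l h al" using fib_in_Q3[OF w(3,1)] w(2) Q by metis
 then have "0 <= psi e n l h al" using zero_le_power2[of "norm w"] by linarith
 then have "0 <= gf e n (h - l^2) (al$1)" using psi_le_gf[OF w(3), of e n l h] by linarith
 moreover have "(al$1)^2 <= 1" using sphere_z[OF w(3)] by simp
 then have "-1 <= al$1" "al$1 <= 1" by (auto simp: abs_square_le_1)
 ultimately show "EX x. -1 <= x & x <= 1 & 0 <= gf e n (h - l^2) x" by blast
next
 assume "EX x. -1 <= x & x <= 1 & 0 <= gf e n (h - l^2) x"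
 then obtain x where x: "-1 <= x" "x <= 1" "0 <= gf e n (h - l^2) x" by auto
 define d r where "d = sqrt (n^2 + l^2)" and "r = sqrt (1 - x^2)"
 have "0 < n^2 + l^2" using n by (simp add: add_pos_nonneg)
 then have d: "d ~= 0" "n^2 + l^2 = d^2" by (auto simp: d_def)
 have "x^2 <= 1" using x by (simp add: abs_square_le_1)
 then have r: "r^2 = 1 - x^2" by (simp add: r_def)
 define al :: "real^3" where "al = vector [x, - (r*l/d), r*n/d]"
 have al: "al$1 = x" "al$2 = - (r*l/d)" "al$3 = r*n/d" by (simp_all add: al_def vector_3)
 have "(r*l/d)^2 + (r*n/d)^2 = r^2*(n^2 + l^2)/d^2"
  by (simp add: power_divide power_mult_distrib add_divide_distrib distrib_left)
 also have "... = 1 - x^2" using d r by simp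
 finally have S: "al \<in> sphere 0 1" unfolding sphere3 al by simp
 have "psi e n l h al = gf e n (h - l^2) x" unfolding psi_def al by simp
 then have psi: "0 <= psi e n l h al" using x by simp
 obtain v where v: "v ~= 0" "orthogonal (bet al) v" using orthogonal_to_vector_exists[of "bet al"] by auto
 define w where "w = (2 * sqrt (psi e n l h al)/norm v) *\<^sub>R v"
 have "w \<bullet> bet al = 0" using v by (simp add: w_def orthogonal_def inner_commute)
 moreover have "(norm w)^2 = 4*psi e n l h al" using v psi by (simp add: w_def power_mult_distrib)
 ultimately show "Q3 1 e n l h ~= {}" using fib_in_Q3[OF S, of w n l e h] by auto
qed

section \<open>The seven classes of regular values\<close>

text \<open>In the normalised parameters \<open>e = a e0\<close>, \<open>E = (a e1)^2\<close>, \<open>m = (l / a)^2\<close>, \<open>k = h - m\<close>, the conditions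
 that distinguish the sign patterns of the profile.\<close>

definition Reg where "Reg e E m k \<longleftrightarrow> k ~= e & k ~= - e & ~ crit e E m k & (EX x. -1 < x & x < 1 & 0 < k + e*x + E*(1 - x^2))"

definition RA where "RA e E m k \<longleftrightarrow> - e < k & k < e & ~ W e E m k & ~ crit e E m k"
definition RB where "RB e E m k \<longleftrightarrow> e < k & ~ crit e E m k & (ALL w. 0 < w --> w < 1 --> Kf e E m (- w) <= k)"
definition RC where "RC e E m k \<longleftrightarrow> e < k & (EX w. 0 < w & w < 1 & k < Kf e E m (- w))"
definition RD where "RD e E m k \<longleftrightarrow> - e < k & k < e & W e E m k"
definition RE where "RE e E m k \<longleftrightarrow> k < - e & ~ crit e E m k & (ALL x. 0 < x --> x < 1 --> k <= Kf e E m x) &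
  (EX x. -1 < x & x < 1 & 0 < k + e*x + E*(1 - x^2))"
definition RF where "RF e E m k \<longleftrightarrow> k < - e & ~ W e E m k & ~ crit e E m k & (EX x. 0 < x & x < 1 & Kf e E m x < k)"
definition RG where "RG e E m k \<longleftrightarrow> k < - e & W e E m k"

lemmas R_defs = RA_def RB_def RC_def RD_def RE_def RF_def RG_def

lemma g_pos_if_Kf_less:
 assumes "0 < E" "0 <= m" "-1 < x" "x < 1" "Kf e E m x <= k"
 shows "0 < k + e*x + E*(1 - x^2)"
proof -
 have x2: "0 < 1 - x^2" using assms by (simp add: abs_square_less_1)
 have "0 <= m*(1 - x^2)/(1 + x^2)" using assms x2 one_plus_sq[of x] by (intro divide_nonneg_nonneg mult_nonneg_nonneg) auto
 then have "0 <= k + E/2*(1 - x^2) + e*x" using assms(5) unfolding Kf_def by linarith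
 moreover have "E/2*(1 - x^2) < E*(1 - x^2)" using assms x2 by (intro mult_strict_right_mono) auto
 ultimately show ?thesis by linarith
qed

lemma Reg_iff:
 assumes e: "0 < e" and E: "0 < E" and m: "0 <= m"
 shows "Reg e E m k \<longleftrightarrow> RA e E m k | RB e E m k | RC e E m k | RD e E m k | RE e E m k | RF e E m k | RG e E m k" (is "_ \<longleftrightarrow> ?R")
proof
 assume r: "Reg e E m k"
 then have r': "k ~= e" "k ~= - e" "~ crit e E m k" by (auto simp: Reg_def)
 consider "e < k" | "- e < k" "k < e" | "k < - e" using r' by linarith
 then show ?R
 proof cases
  case 1 then show ?thesis using r' unfolding R_defs by (meson not_less)
 next
  case 2 then show ?thesis using r' unfolding R_defs by blast
 next
  case 3
  show ?thesis
  proof (cases "W e E m k | (EX x. 0 < x & x < 1 & Kf e E m x < k)")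
   case True then show ?thesis using r' 3 unfolding RF_def RG_def by blast
  next
   case False then show ?thesis using r r' 3 unfolding RE_def Reg_def by (meson not_less)
  qed
 qed
next
 assume R: ?R
 have 0: "EX x. -1 < x & x < 1 & 0 < k + e*x + E*(1 - x^2)" if "- e < k"
 proof -
  have "Kf e E m 1 < k" using that Kf_1 by simp
  then have "0 < k + e*1 + E*(1 - 1^2)" using that by simp
  moreover have "((%x. k + e*x + E*(1 - x^2)) \<longlongrightarrow> k + e*1 + E*(1 - 1^2)) (at_left 1)"
   by (intro tendsto_intros)
  ultimately have "eventually (%x. 0 < k + e*x + E*(1 - x^2)) (at_left 1)"
   using order_tendstoD(1) by blast
  moreover have "eventually (%x::real. -1 < x & x < 1) (at_left 1)"
   using eventually_at_left_real[of "-1" 1] by simp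
  ultimately have "eventually (%x. -1 < x & x < 1 & 0 < k + e*x + E*(1 - x^2)) (at_left 1)"
   by eventually_elim auto
  then show ?thesis using eventually_happens trivial_limit_at_left_real by blast
 qed
 have 1: "EX x. -1 < x & x < 1 & 0 < k + e*x + E*(1 - x^2)" if "-1 < x" "x < 1" "Kf e E m x < k" for x
  using g_pos_if_Kf_less[OF E m, of x e k] that by auto
 have W1: "EX x. -1 < x & x < 1 & 0 < k + e*x + E*(1 - x^2)" if "W e E m k"
  using W_below[OF e that] 1 by force
 show "Reg e E m k"
  using R
 proof (elim disjE)
  assume "RA e E m k" then show ?thesis using 0 e unfolding RA_def Reg_def by auto
 next
  assume "RB e E m k" then show ?thesis using 0 e unfolding RB_def Reg_def by auto
 next
  assume a: "RC e E m k"
  then obtain w where "0 < w" "w < 1" "k < Kf e E m (- w)" "e < k" unfolding RC_def by blast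
  then show ?thesis using 0 e pattern_C(2)[OF E e m] unfolding Reg_def by auto
 next
  assume "RD e E m k" then show ?thesis using 0 e W_not_crit[OF E e m] unfolding RD_def Reg_def by auto
 next
  assume "RE e E m k" then show ?thesis using e unfolding RE_def Reg_def by auto
 next
  assume a: "RF e E m k"
  then obtain x where "0 < x" "x < 1" "Kf e E m x < k" unfolding RF_def by blast
  then show ?thesis using a e 1[of x] unfolding RF_def Reg_def by auto
 next
  assume "RG e E m k" then show ?thesis using e W_not_crit[OF E e m, of k] W1 unfolding RG_def Reg_def by auto
 qed
qed

lemma regular_values_iff:
 assumes a: "0 < a" and e0: "0 < e0"
 shows "(l, h, e1) \<in> regular_values a e0 \<longleftrightarrow>
  0 < e1 & Reg (a*e0) ((a*e1)^2) ((l/a)^2) (h - (l/a)^2)"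
proof (cases "0 < e1")
 case False then show ?thesis by (simp add: regular_values_def)
next
 case True
 define e n m k where "e = a*e0" and "n = a*e1" and "m = l/a" and "k = h - m^2"
 have e: "0 < e" and n: "0 < n" using a e0 True by (auto simp: e_def n_def)
 have s: "(l, h) \<in> smale_diagram a e0 e1 \<longleftrightarrow> (m, h) \<in> smale_diagram 1 e n"
  unfolding e_def n_def m_def by (rule smale_scale[OF a])
 have "Q3 a e0 e1 l h homeomorphic Q3 1 e n m h" unfolding e_def n_def m_def by (rule Q3_scale[OF a])
 then have Q: "Q3 a e0 e1 l h ~= {} \<longleftrightarrow> (EX x. -1 <= x & x <= 1 & 0 <= gf e n k x)"
  unfolding k_def Q3_unit_nonempty_iff[OF n, symmetric] using homeomorphic_empty by metis
 have "Q3 a e0 e1 l h ~= {} & (l, h) \<notin> smale_diagram a e0 e1 \<longleftrightarrow> Reg e (n^2) (m^2) k"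
 proof
  assume *: "Q3 a e0 e1 l h ~= {} & (l, h) \<notin> smale_diagram a e0 e1"
  then have ns: "k ~= e" "k ~= - e" "~ crit e (n^2) (m^2) k" "~ (e/2 < n^2 & k = - e\<^sup>2/(4*n^2) - n^2)"
   unfolding s k_def using smale_unit_pole[of h m e n] smale_unit_crit[OF n e] smale_unit_delta4[OF n e] by blast+
  obtain x where x: "-1 <= x" "x <= 1" "0 <= gf e n k x" using * Q by auto
  have sq: "4*n^2*gf e n k t = (e^2 + 4*n^2*(k + n^2)) - (2*n^2*t - e)^2" for t
   by (simp add: gf_def power2_eq_square algebra_simps)
  have "EX x. -1 < x & x < 1 & 0 < gf e n k x"
  proof (cases "- e < k")
   case True
   then consider "RA e (n^2) (m^2) k" | "RD e (n^2) (m^2) k" | "RB e (n^2) (m^2) k" | "RC e (n^2) (m^2) k"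
    using ns unfolding R_defs by (metis linorder_neqE_linordered_idom not_less)
   then show ?thesis using Reg_iff[OF e, of "n^2" "m^2" k] n unfolding Reg_def gf_def by auto
  next
   case False
   then have k: "k < - e" using ns by simp
   have "gf e n k 1 < 0" "gf e n k (-1) < 0" using k e by (auto simp: gf_def)
   then have x1: "-1 < x" "x < 1" using x by (auto simp: less_le)
   show ?thesis
   proof (rule ccontr)
    assume "~ ?thesis"
    then have le: "gf e n k t <= 0" if "-1 < t" "t < 1" for t using that by force
    have gx: "gf e n k x = 0" using le[OF x1] x by simp
    define d where "d = e - 2*n^2*x"
    have "((%t. gf e n k t) has_real_derivative d) (at x)"
     unfolding gf_def d_def by (auto intro!: derivative_eq_intros simp: algebra_simps)
    then have "d = 0"
     by (rule DERIV_local_max[where d = "min (x + 1) (1 - x)"]) (use x1 gx le in \<open>auto simp: abs_if split: if_splits\<close>)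
    then have ex: "e = 2*n^2*x" by (simp add: d_def)
    have "e/2 < n^2" using ex x1 n by (simp add: mult_less_cancel_left1)
    moreover have "0 = e^2 + 4*n^2*(k + n^2)" using sq[of x] gx ex by simp
    then have "k = - e\<^sup>2/(4*n^2) - n^2" using n by (simp add: field_simps)
    ultimately show False using ns by blast
   qed
  qed
  then show "Reg e (n^2) (m^2) k" unfolding Reg_def gf_def using ns by blast
 next
  assume R: "Reg e (n^2) (m^2) k"
  then obtain x where x: "-1 < x" "x < 1" "0 < gf e n k x" unfolding Reg_def gf_def by auto
  have "k ~= - e\<^sup>2/(4*n^2) - n^2"
  proof
   assume "k = - e\<^sup>2/(4*n^2) - n^2"
   then have "4*n^2*(k + n^2) = - e\<^sup>2" using n by (simp add: field_simps)
   moreover have "4*n^2*gf e n k x = (e^2 + 4*n^2*(k + n^2)) - (2*n^2*x - e)^2"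
    by (simp add: gf_def power2_eq_square algebra_simps)
   ultimately have "4*n^2*gf e n k x <= 0" by simp
   then show False using x n by (simp add: mult_le_0_iff)
  qed
  then have "(m, h) \<notin> smale_diagram 1 e n"
   using smale_unit_cases[OF n e, of m h] R unfolding Reg_def k_def by blast
  moreover have "EX x. -1 <= x & x <= 1 & 0 <= gf e n k x" using x by (intro exI[of _ x]) auto
  ultimately show "Q3 a e0 e1 l h ~= {} & (l, h) \<notin> smale_diagram a e0 e1" using s Q by blast
 qed
 then show ?thesis using True unfolding regular_values_def e_def n_def m_def k_def by simp
qed

lemma Q3_empty:
 assumes a: "0 < a" and e0: "0 < e0" and e1: "0 < e1" and h: "h < delta1 a e0 l"
  and d4: "zeta1 a e0 < e1^2 --> h < delta4 a e0 e1 l"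
 shows "Q3 a e0 e1 l h = {}"
proof -
 define e n m k where "e = a*e0" and "n = a*e1" and "m = l/a" and "k = h - m^2"
 have e: "0 < e" and n: "0 < n" using a e0 e1 by (auto simp: e_def n_def)
 have k: "k < - e" using h by (simp add: delta1_def e_def k_def m_def power_divide mult.commute)
 have k4: "k < - e\<^sup>2/(4*n^2) - n^2" if "e/2 < n^2"
 proof -
  have "a*e0 < a*(e1^2*(2*a))" using that by (simp add: e_def n_def power2_eq_square algebra_simps)
  then have "e0 < e1^2*(2*a)" using a mult_less_cancel_left_pos by blast
  then have "zeta1 a e0 < e1^2" using a by (simp add: zeta1_def pos_divide_less_eq)
  then have "h < delta4 a e0 e1 l" using d4 by blast
  moreover have "e^2/(4*n^2) = e0^2/(4*e1^2)" using a by (simp add: e_def n_def power_mult_distrib)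
  ultimately show ?thesis by (simp add: delta4_def k_def m_def n_def power_divide power_mult_distrib mult.commute)
 qed
 have "~ (EX x. -1 <= x & x <= 1 & 0 <= gf e n k x)"
 proof clarify
  fix x assume x: "-1 <= x" "x <= 1" "0 <= gf e n k x"
  show False
  proof (cases "e/2 < n^2")
   case True
   have "4*n^2*k < 4*n^2*(- e\<^sup>2/(4*n^2) - n^2)" using k4[OF True] n by (intro mult_strict_left_mono) auto
   also have "... = - e\<^sup>2 - 4*n^2*n^2" using n by (simp add: right_diff_distrib)
   finally have "4*n^2*k + e^2 + 4*n^2*n^2 < 0" by simp
   moreover have "4*n^2*gf e n k x = (4*n^2*k + e^2 + 4*n^2*n^2) - (2*n^2*x - e)^2"
    by (simp add: gf_def power2_eq_square algebra_simps)
   ultimately have "4*n^2*gf e n k x < 0" using zero_le_power2[of "2*n^2*x - e"] by linarith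
   then show False using x n by (simp add: mult_less_0_iff)
  next
   case False
   have "n^2*(1 + x) <= n^2*2" using x by (intro mult_left_mono) auto
   then have "0 <= (1 - x)*(e - n^2*(1 + x))" using False x by (intro mult_nonneg_nonneg) auto
   moreover have "gf e n k x = k + e - (1 - x)*(e - n^2*(1 + x))"
    by (simp add: gf_def power2_eq_square algebra_simps)
   ultimately show False using x k by simp
  qed
 qed
 then have "Q3 1 e n m h = {}" using Q3_unit_nonempty_iff[OF n, of e m h] unfolding k_def by blast
 moreover have "Q3 a e0 e1 l h homeomorphic Q3 1 e n m h" unfolding e_def n_def m_def by (rule Q3_scale[OF a])
 ultimately show ?thesis by simp
qed

lemma is_RP3_homeomorphic:
 assumes "is_RP3 Y" "Y homeomorphic_space X" shows "is_RP3 X"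
proof -
 obtain p where p: "quotient_map S3 Y p" "\<forall>x\<in>sphere 0 1. \<forall>y\<in>sphere 0 1. p x = p y \<longleftrightarrow> x = y | x = - y"
  using assms(1) unfolding is_RP3_def by blast
 obtain f where f: "homeomorphic_map Y X f" using assms(2) homeomorphic_space by blast
 have "quotient_map S3 X (f \<circ> p)"
  using quotient_map_compose[OF p(1)] f unfolding homeomorphic_map_def by blast
 moreover have "(f \<circ> p) x = (f \<circ> p) y \<longleftrightarrow> x = y | x = - y" if "x \<in> sphere 0 1" "y \<in> sphere 0 1" for x y
 proof -
  have "p x \<in> topspace Y" "p y \<in> topspace Y"
   using that p(1) quotient_imp_surjective_map[OF p(1)] by auto
  then have "f (p x) = f (p y) \<longleftrightarrow> p x = p y" using f homeomorphic_imp_injective_map inj_on_eq_iff by metis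
  then show ?thesis using p(2) that by simp
 qed
 ultimately show ?thesis unfolding is_RP3_def by blast
qed

lemma Q3_topology:
 fixes a e0 e1 l h :: real
 assumes a: "0 < a" and e0: "0 < e0" and e1: "0 < e1"
 defines "e == a*e0" and "E == (a*e1)^2" and "m == (l/a)^2"
 defines "k == h - m" and "X == top_of_set (Q3 a e0 e1 l h)"
 shows "RA e E m k ==> X homeomorphic_space S3" "RB e E m k ==> is_RP3 X" "RC e E m k ==> X homeomorphic_space S2xS1"
  "RD e E m k ==> is_N3 2 X" "RE e E m k ==> X homeomorphic_space two_S3" "RF e E m k ==> X homeomorphic_space S2xS1"
  "RG e E m k ==> is_N3 3 X"
proof -
 have e: "0 < e" and n: "0 < a*e1" using a e0 e1 by (auto simp: e_def)
 have sc: "Q3 a e0 e1 l h homeomorphic Q3 1 e (a*e1) (l/a) h" unfolding e_def by (rule Q3_scale[OF a])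
 have tr: "X homeomorphic_space top_of_set (Mod P)" if "Q3 1 e (a*e1) (l/a) h homeomorphic Mod P" for P
  unfolding X_def by (rule homeomorphic_space_top_of_set) (rule homeomorphic_trans[OF sc that])
 show "X homeomorphic_space S3" if "RA e E m k"
 proof -
  have "Q3 1 e (a*e1) (l/a) h homeomorphic Mod (%x. x)"
   by (rule Q3_S3_unit[OF n e]) (use that in \<open>auto simp: RA_def E_def m_def k_def\<close>)
  then show ?thesis by (rule homeomorphic_space_trans[OF tr homeomorphic_space_top_of_set[OF Mod_S3]])
 qed
 show "is_RP3 X" if "RB e E m k"
 proof (rule is_RP3_homeomorphic)
  show "is_RP3 (top_of_set (Q3 1 e (a*e1) (l/a) h))"
   by (rule Q3_RP3_unit[OF n e]) (use that in \<open>auto simp: RB_def E_def m_def k_def\<close>)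
  show "top_of_set (Q3 1 e (a*e1) (l/a) h) homeomorphic_space X"
   unfolding X_def by (rule homeomorphic_space_top_of_set) (rule homeomorphic_sym[THEN iffD1, OF sc])
 qed
 show "X homeomorphic_space S2xS1" if "RC e E m k"
 proof -
  have "e < k" and ex: "EX w. 0 < w & w < 1 & k < Kf e E m (- w)" using that RC_def by auto
  from ex obtain w where w: "0 < w" "w < 1" "k < Kf e E m (- w)" by (elim exE conjE)
  show ?thesis
   by (rule homeomorphic_space_trans[OF tr Mod_S2xS1], rule Q3_S2xS1_unit_above[OF n e _ w(1,2)])
    (use w \<open>e < k\<close> in \<open>simp_all add: k_def m_def E_def\<close>)
 qed
 show "X homeomorphic_space S2xS1" if "RF e E m k"
 proof -
  have r: "k < - e" "~ W e E m k" "~ crit e E m k" and ex: "EX x. 0 < x & x < 1 & Kf e E m x < k"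
   using that RF_def by auto
  from ex obtain x where x: "0 < x" "x < 1" "Kf e E m x < k" by (elim exE conjE)
  show ?thesis
   by (rule homeomorphic_space_trans[OF tr Mod_S2xS1], rule Q3_S2xS1_unit_below[OF n e _ _ _ x(1,2)])
    (use r x in \<open>simp_all add: k_def m_def E_def\<close>)
 qed
 show "is_N3 2 X" if "RD e E m k"
  unfolding X_def
  by (rule Mod_N3_2) (rule tr[OF Q3_N3_2_unit[OF n e], unfolded X_def], use that in \<open>auto simp: RD_def E_def m_def k_def\<close>)
 show "is_N3 3 X" if "RG e E m k"
  unfolding X_def
  by (rule Mod_N3_3) (rule tr[OF Q3_N3_3_unit[OF n e], unfolded X_def], use that in \<open>auto simp: RG_def E_def m_def k_def\<close>)
 show "X homeomorphic_space two_S3" if "RE e E m k"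
 proof -
  have "EX x. -1 < x & x < 1 & 0 < k + e*x + E*(1 - x^2)" using that RE_def by auto
  then obtain x where "-1 < x" "x < 1" "0 < k + e*x + E*(1 - x^2)" by (elim exE conjE)
  then have x: "-1 < x" "x < 1" "0 < gf e (a*e1) (h - (l/a)^2) x" by (simp_all add: gf_def k_def m_def E_def)
  have "Q3 1 e (a*e1) (l/a) h homeomorphic Mod (%_. -1)"
   by (rule Q3_two_S3_unit[OF n e _ _ _ x]) (use that in \<open>auto simp: RE_def E_def m_def k_def\<close>)
  then show ?thesis by (rule homeomorphic_space_trans[OF tr Mod_two_S3])
 qed
qed

section \<open>The curve and the triangle\<close>

text \<open>The parameter \<open>\<Omega>\<close> of \<open>\<delta>\<^sub>3\<close> corresponds to the critical point \<open>x\<close> of the profile with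
 \<open>e / x = E - (a \<Omega>)^2\<close>: it lies in \<open>(0, 1]\<close> on \<open>\<delta>\<^sub>3''\<close> and in \<open>[-1, 0)\<close> on \<open>\<delta>\<^sub>3'\<close>.\<close>

lemma curve_at:
 fixes a e0 e1 w l x :: real
 assumes a: "0 < a" and e0: "0 < e0" and w: "0 <= w" and l: "0 <= l" and x: "x ~= 0" "a*e0/x = (a*e1)^2 - (a*w)^2"
 shows "ell3 a e0 e1 w = l \<longleftrightarrow> 4*(l/a)^2 = ((a*e1)^2 - a*e0/x)*(1 + x^2)^2"
  and "ell3 a e0 e1 w = l ==> h3 a e0 e1 w = Kf (a*e0) ((a*e1)^2) ((l/a)^2) x + (l/a)^2"
proof -
 define d where "d = e1^2 - w^2"
 have "a*e0 = a*(a*x*d)" using x by (simp add: d_def field_simps power2_eq_square)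
 then have e0d: "e0 = a*x*d" using a by simp
 then have d: "d ~= 0" using e0 by auto
 have "e0^2 + a^2*d^2 = d^2*(a^2*(1 + x^2))" unfolding e0d by (simp add: power2_eq_square algebra_simps)
 then have ell: "ell3 a e0 e1 w = a*(a*w*(1 + x^2))/2"
  unfolding ell3_def d_def[symmetric] using d by (simp add: power2_eq_square)
 have aw: "(a*e1)^2 - a*e0/x = (a*w)^2" using x by simp
 have "ell3 a e0 e1 w = l \<longleftrightarrow> 2*(l/a) = a*w*(1 + x^2)" unfolding ell using a by (auto simp: field_simps)
 also have "... \<longleftrightarrow> (2*(l/a))^2 = (a*w*(1 + x^2))^2"
  by (rule power2_eq_iff_nonneg[symmetric]) (use a l w in auto)
 also have "... \<longleftrightarrow> 4*(l/a)^2 = ((a*e1)^2 - a*e0/x)*(1 + x^2)^2"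
  unfolding aw unfolding power_mult_distrib by simp
 finally show 1: "ell3 a e0 e1 w = l \<longleftrightarrow> 4*(l/a)^2 = ((a*e1)^2 - a*e0/x)*(1 + x^2)^2" .
 assume "ell3 a e0 e1 w = l"
 then have m: "4*(l/a)^2 = ((a*e1)^2 - a*e0/x)*(1 + x^2)^2" using 1 by simp
 have "e0^2*(d - 2*w^2) + a^2*d^3 = d^2*(a^2*(x^2*(d - 2*w^2) + d))"
  unfolding e0d by (simp add: power2_eq_square power3_eq_cube algebra_simps)
 moreover have "e1^2 - 3*w^2 = d - 2*w^2" by (simp add: d_def)
 ultimately have h: "h3 a e0 e1 w = - (a^2*(x^2*(d - 2*w^2) + d))/2"
  unfolding h3_def d_def[symmetric] using d by simp
 have E: "(a*e1)^2 = a^2*(d + w^2)" by (simp add: d_def power_mult_distrib)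
 have ex: "a*e0/x = a^2*d" using x(1) unfolding e0d by (simp add: power2_eq_square)
 have "Kf (a*e0) ((a*e1)^2) ((l/a)^2) x = (a*w)^2 - (1 - x^2)*(2*(a*e1)^2 - a*e0/x)/2 - a*e0*x - (l/a)^2"
  unfolding Kf_crit_value[OF x(1) m] aw ..
 also have "... = h3 a e0 e1 w - (l/a)^2"
  unfolding h E ex unfolding e0d by (simp add: power2_eq_square field_simps)
 finally show "h3 a e0 e1 w = Kf (a*e0) ((a*e1)^2) ((l/a)^2) x + (l/a)^2" by simp
qed

text \<open>The critical point \<open>-w\<close> occurs for the parameter \<open>mcr e E w\<close> and has the value \<open>kap e E w\<close>.\<close>

definition mcr :: "real => real => real => real" where "mcr e E w = (E + e/w)*(1 + w^2)^2/4"
definition kap :: "real => real => real => real" where "kap e E w = Kf e E (mcr e E w) (- w)"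

lemma mcr_pos: "0 < e ==> 0 < E ==> 0 < w ==> 0 < mcr e E w"
 using one_plus_sq[of w] unfolding mcr_def by (simp add: add_pos_pos)

lemma fz_mcr: "0 < w ==> fz e E m w = 4*w*(mcr e E w - m)"
 by (simp add: fz_def mcr_def field_simps)

lemma fz_mcr_iff: "0 < w ==> fz e E m w = 0 \<longleftrightarrow> m = mcr e E w" "0 < w ==> 0 < fz e E m w \<longleftrightarrow> m < mcr e E w"
 "0 < w ==> fz e E m w < 0 \<longleftrightarrow> mcr e E w < m"
 by (auto simp: fz_mcr zero_less_mult_iff mult_less_0_iff)

lemma kap_eq:
 assumes "w ~= 0"
 shows "kap e E w = (E + e/w) - (1 - w^2)*(2*E + e/w)/2 + e*w - mcr e E w"
proof -
 have "4*mcr e E w = (E - e/(- w))*(1 + (- w)^2)^2" by (simp add: mcr_def)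
 from Kf_crit_value[OF _ this] show ?thesis using assms by (simp add: kap_def)
qed

text \<open>The values of the profile at its critical points, compared with the two parabolas.\<close>
lemma kap_minus_e:
 assumes "w ~= 0"
 shows "4*w*(kap e E w - e) = - (1 - w)\<^sup>2*(E*w*(1 + w)^2 + e*(w^2 + 2*w - 1))"
proof -
 have m: "4*w*mcr e E w = (E*w + e)*(1 + w^2)^2" using assms by (simp add: mcr_def field_simps)
 have "4*w*(kap e E w - e) = 4*(E*w + e) - 2*(1 - w^2)*(2*E*w + e) + 4*e*w*w - 4*w*mcr e E w - 4*e*w"
  using assms unfolding kap_eq[OF assms] by (simp add: field_simps)
 then show ?thesis unfolding m by (simp add: power2_eq_square algebra_simps)
qed

lemma kap_plus_e:
 assumes "w ~= 0"
 shows "4*w*(kap e E w + e) = (1 + w)^2*(- E*w*(1 - w)^2 + e*(1 + 2*w - w^2))"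
proof -
 have m: "4*w*mcr e E w = (E*w + e)*(1 + w^2)^2" using assms by (simp add: mcr_def field_simps)
 have "4*w*(kap e E w + e) = 4*(E*w + e) - 2*(1 - w^2)*(2*E*w + e) + 4*e*w*w - 4*w*mcr e E w + 4*e*w"
  using assms unfolding kap_eq[OF assms] by (simp add: field_simps)
 then show ?thesis unfolding m by (simp add: power2_eq_square algebra_simps)
qed

text \<open>The parameter of the point \<open>I\<^sub>1\<close>.\<close>

definition wI :: "real => real => real" where
 "wI e E = (SOME w. 0 < w & w < 1 & E*w*(1 + w)^2 + e*(w^2 + 2*w - 1) = 0)"

lemma wI:
 assumes e: "0 < e" and E: "0 < E"
 shows "0 < wI e E" "wI e E < 1" "E*wI e E*(1 + wI e E)^2 + e*((wI e E)^2 + 2*wI e E - 1) = 0"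
proof -
 let ?q = "%w. E*w*(1 + w)^2 + e*(w^2 + 2*w - 1)"
 have "EX w. 0 <= w & w <= 1 & ?q w = 0"
  by (rule IVT') (use e E in \<open>auto intro!: continuous_intros\<close>)
 then obtain w where w: "0 <= w" "w <= 1" "?q w = 0" by blast
 then have "w ~= 0" "w ~= 1" using e E by auto
 then have "0 < w & w < 1 & ?q w = 0" using w by auto
 then have "0 < wI e E & wI e E < 1 & ?q (wI e E) = 0"
  unfolding wI_def by (rule someI)
 then show "0 < wI e E" "wI e E < 1" "?q (wI e E) = 0" by auto
qed

lemma kap_sign:
 assumes e: "0 < e" and E: "0 < E" and w: "0 < w" "w < 1"
 shows "kap e E w < e \<longleftrightarrow> wI e E < w" "kap e E w = e \<longleftrightarrow> w = wI e E" "e < kap e E w \<longleftrightarrow> w < wI e E"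
proof -
 let ?q = "%w. E*w*(1 + w)^2 + e*(w^2 + 2*w - 1)"
 have mono: "?q u < ?q v" if "0 < u" "u < v" for u v
 proof -
  have sq: "(1 + u)^2 <= (1 + v)^2" "u^2 <= v^2" using that by (auto intro!: power_mono)
  have "E*u*(1 + u)^2 <= E * v * (1 + v)^2" using sq that E by (intro mult_mono) auto
  moreover have "u^2 + 2*u - 1 < v^2 + 2 * v - 1" using sq(2) that by linarith
  then have "e*(u^2 + 2*u - 1) < e*(v^2 + 2 * v - 1)" using e by (rule mult_strict_left_mono)
  ultimately show ?thesis by linarith
 qed
 have s: "4*w*(kap e E w - e) = - (1 - w)\<^sup>2*?q w" using kap_minus_e w by simp
 have p: "0 < 4*w" "0 < (1 - w)^2" using w by auto
 have sgn: "kap e E w < e \<longleftrightarrow> 0 < ?q w" "kap e E w = e \<longleftrightarrow> ?q w = 0" "e < kap e E w \<longleftrightarrow> ?q w < 0"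
 proof -
  have "A < 0 \<longleftrightarrow> 0 < Q" "A = 0 \<longleftrightarrow> Q = 0" "0 < A \<longleftrightarrow> Q < 0" if "c*A = - b*Q" "0 < c" "0 < b" for A Q b c :: real
  proof -
   have c: "c*A < 0 \<longleftrightarrow> A < 0" "0 < c*A \<longleftrightarrow> 0 < A" "c*A = 0 \<longleftrightarrow> A = 0" using that(2) by (auto simp: mult_less_0_iff zero_less_mult_iff)
   have b: "- b*Q < 0 \<longleftrightarrow> 0 < Q" "0 < - b*Q \<longleftrightarrow> Q < 0" "- b*Q = 0 \<longleftrightarrow> Q = 0" using that(3) by (auto simp: mult_less_0_iff zero_less_mult_iff)
   show "A < 0 \<longleftrightarrow> 0 < Q" "A = 0 \<longleftrightarrow> Q = 0" "0 < A \<longleftrightarrow> Q < 0" using c b that(1) by metis+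
  qed
  from this[OF s p] show "kap e E w < e \<longleftrightarrow> 0 < ?q w" "kap e E w = e \<longleftrightarrow> ?q w = 0" "e < kap e E w \<longleftrightarrow> ?q w < 0" by auto
 qed
 have "wI e E < w ==> 0 < ?q w" "w < wI e E ==> ?q w < 0" "w = wI e E ==> ?q w = 0"
  using mono[of "wI e E" w] mono[of w "wI e E"] wI[OF e E] w by auto
 then show "kap e E w < e \<longleftrightarrow> wI e E < w" "kap e E w = e \<longleftrightarrow> w = wI e E" "e < kap e E w \<longleftrightarrow> w < wI e E"
  unfolding sgn by (metis less_asym less_irrefl linorder_less_linear)+
qed

lemma kap_1: "mcr e E 1 = E + e" "kap e E 1 = e"
 by (simp_all add: mcr_def kap_def Kf_1)

lemma kap_le_e_iff:
 assumes e: "0 < e" and E: "0 < E" and w: "0 < w" "w <= 1"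
 shows "kap e E w <= e \<longleftrightarrow> wI e E <= w"
proof (cases "w = 1")
 case True then show ?thesis using kap_1 wI(2)[OF e E] by simp
next
 case False then show ?thesis using kap_sign[OF e E w(1)] w by auto
qed

lemma mcr_wI_less:
 assumes e: "0 < e" and E: "0 < E" shows "mcr e E (wI e E) < E + e"
proof -
 let ?m = "mcr e E (wI e E)" and ?u = "wI e E"
 have u: "0 < ?u" "?u < 1" using wI[OF e E] by auto
 have K: "Kf e E ?m (- ?u) = Kf e E ?m (- 1)" using kap_sign(2)[OF e E u] by (simp add: kap_def Kf_1)
 obtain z where z: "?u < z" "z < 1" "Kf e E ?m (- 1) - Kf e E ?m (- ?u) = (1 - ?u)*(fz e E ?m z/(1 + z^2)^2)"
  using MVT2[OF u(2), of "%w. Kf e E ?m (- w)" "%w. fz e E ?m w/(1 + w^2)^2"] Kt_deriv by auto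
 then have "fz e E ?m z = 0" using K u one_plus_sq[of z] by simp
 moreover have "fz e E ?m ?u = 0" using fz_mcr_iff(1) u by simp
 ultimately have "0 < fz e E ?m 1" using fz_after[OF e E _ z(1,2)] u by simp
 then show ?thesis using fz_mcr_iff(2)[of 1 e E ?m] kap_1 by simp
qed

text \<open>The parameter \<open>\<Omega>\<close> of the critical point \<open>-w\<close>.\<close>
definition om :: "real => real => real => real => real" where "om a e0 e1 w = sqrt (e1^2 + zeta2 a e0/w)"

lemma om:
 assumes a: "0 < a" and e0: "0 < e0" and w: "0 < w"
 shows "0 <= om a e0 e1 w" "a*e0/(- w) = (a*e1)^2 - (a * om a e0 e1 w)^2"
  "ell3 a e0 e1 (om a e0 e1 w) = a * sqrt (mcr (a*e0) ((a*e1)^2) w)"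
  "h3 a e0 e1 (om a e0 e1 w) = kap (a*e0) ((a*e1)^2) w + mcr (a*e0) ((a*e1)^2) w"
proof -
 have z: "0 < zeta2 a e0/w" using a e0 w by (simp add: zeta2_def)
 then show 0: "0 <= om a e0 e1 w" by (simp add: om_def)
 have sq: "(om a e0 e1 w)^2 = e1^2 + zeta2 a e0/w" using z by (simp add: om_def)
 show x: "a*e0/(- w) = (a*e1)^2 - (a * om a e0 e1 w)^2"
  using a unfolding power_mult_distrib sq by (simp add: zeta2_def power2_eq_square field_simps)
 let ?m = "mcr (a*e0) ((a*e1)^2) w"
 have m: "0 <= ?m" using a e0 w one_plus_sq[of w] unfolding mcr_def by (intro divide_nonneg_nonneg mult_nonneg_nonneg add_nonneg_nonneg) auto
 have ma: "(a * sqrt ?m/a)^2 = ?m" using a m by simp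
 have "4*?m = ((a*e1)^2 - a*e0/(- w))*(1 + (- w)^2)^2" by (simp add: mcr_def)
 then show l: "ell3 a e0 e1 (om a e0 e1 w) = a * sqrt ?m"
  using curve_at(1)[OF a e0 0 _ _ x, of "a * sqrt ?m"] ma a m w by simp
 show "h3 a e0 e1 (om a e0 e1 w) = kap (a*e0) ((a*e1)^2) w + ?m"
  using curve_at(2)[OF a e0 0 _ _ x l] ma a m w by (simp add: kap_def)
qed

lemma om_mono:
 assumes a: "0 < a" and e0: "0 < e0" and w: "0 < u" "0 < w"
 shows "om a e0 e1 u <= om a e0 e1 w \<longleftrightarrow> w <= u"
proof -
 have z: "0 < zeta2 a e0" using a e0 by (simp add: zeta2_def)
 have "zeta2 a e0/u <= zeta2 a e0/w \<longleftrightarrow> w <= u" using z w by (simp add: field_simps)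
 then show ?thesis by (simp add: om_def)
qed

lemma om_surj:
 assumes a: "0 < a" and e0: "0 < e0" and w: "omega_T1 a e0 e1 <= w"
 shows "EX u. 0 < u & u <= 1 & w = om a e0 e1 u"
proof -
 have z: "0 < zeta2 a e0" using a e0 by (simp add: zeta2_def)
 have T: "0 < omega_T1 a e0 e1" "(omega_T1 a e0 e1)^2 = e1^2 + zeta2 a e0"
  using z by (auto simp: omega_T1_def add_nonneg_pos)
 then have "e1^2 + zeta2 a e0 <= w^2" using w by (metis power_mono less_imp_le)
 then have d: "zeta2 a e0 <= w^2 - e1^2" by simp
 define u where "u = zeta2 a e0/(w^2 - e1^2)"
 have "0 < u" "u <= 1" using d z by (auto simp: u_def)
 moreover have "zeta2 a e0/u = w^2 - e1^2" using z d by (simp add: u_def)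
 then have "om a e0 e1 u = w" unfolding om_def using w T by simp
 ultimately show ?thesis by metis
qed

lemma omega_T1_om: "omega_T1 a e0 e1 = om a e0 e1 1"
 by (simp add: omega_T1_def om_def)

lemma delta2_eq: "0 < a ==> delta2 a e0 l = a*e0 + (l/a)^2" and delta1_eq: "0 < a ==> delta1 a e0 l = - (a*e0) + (l/a)^2"
 by (simp_all add: delta1_def delta2_def power_divide mult.commute)

lemma omega_I1_om:
 assumes a: "0 < a" and e0: "0 < e0" and e1: "0 < e1"
 shows "omega_I1 a e0 e1 = om a e0 e1 (wI (a*e0) ((a*e1)^2))"
proof -
 let ?e = "a*e0" and ?E = "(a*e1)^2"
 have e: "0 < ?e" and E: "0 < ?E" using a e0 e1 by auto
 note I = wI[OF e E]
 have iff: "h3 a e0 e1 (om a e0 e1 u) = delta2 a e0 (ell3 a e0 e1 (om a e0 e1 u)) \<longleftrightarrow> kap ?e ?E u = ?e" if "0 < u" for u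
  using om(3,4)[OF a e0 that, of e1] mcr_pos[OF e E that] a by (simp add: delta2_eq)
 show ?thesis unfolding omega_I1_def
 proof (rule the_equality)
  show "omega_T1 a e0 e1 < om a e0 e1 (wI ?e ?E) &
   h3 a e0 e1 (om a e0 e1 (wI ?e ?E)) = delta2 a e0 (ell3 a e0 e1 (om a e0 e1 (wI ?e ?E)))"
   using iff[OF I(1)] kap_sign(2)[OF e E I(1,2)] om_mono[OF a e0 I(1), of 1 e1] I unfolding omega_T1_om by auto
  fix w assume w: "omega_T1 a e0 e1 < w & h3 a e0 e1 w = delta2 a e0 (ell3 a e0 e1 w)"
  obtain u where u: "0 < u" "u <= 1" "w = om a e0 e1 u" using om_surj[OF a e0, of e1 w] w by auto
  have "u ~= 1" using w u omega_T1_om by auto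
  then have "u = wI ?e ?E" using kap_sign(2)[OF e E u(1)] iff[OF u(1)] u w by auto
  then show "w = om a e0 e1 (wI ?e ?E)" using u by simp
 qed
qed

lemma triangle_boundary_iff:
 fixes a e0 e1 l h :: real
 assumes a: "0 < a" and e0: "0 < e0" and e1: "0 < e1"
 defines "e == a*e0" and "E == (a*e1)^2" and "m == (l/a)^2"
 defines "k == h - m"
 shows "(l, h) \<in> triangle_boundary a e0 e1 \<longleftrightarrow> 0 < l &
  ((EX w. wI e E <= w & w <= 1 & m = mcr e E w & k = kap e E w) | (k = e & mcr e E (wI e E) <= m & m <= E + e))"
proof -
 have e: "0 < e" and E: "0 < E" using a e0 e1 by (auto simp: e_def E_def)
 note I = wI[OF e E]
 note omw = om[OF a e0, of _ e1, folded e_def E_def]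
 have sq: "l = a * sqrt M \<longleftrightarrow> m = M & 0 < l" if "0 < M" for M
 proof
  assume "m = M & 0 < l"
  then have "sqrt M = l/a" using a by (simp add: m_def real_sqrt_unique)
  then show "l = a * sqrt M" using a by simp
 qed (use a that in \<open>simp add: m_def\<close>)
 have sq2: "a * sqrt M <= l \<longleftrightarrow> M <= m" "l <= a * sqrt M \<longleftrightarrow> m <= M" if "0 < M" "0 < l" for M
 proof -
  have "a * sqrt M <= l \<longleftrightarrow> sqrt M <= l/a" "l <= a * sqrt M \<longleftrightarrow> l/a <= sqrt M" using a by (simp_all add: field_simps)
  moreover have "l/a = sqrt m" using a that by (simp add: m_def)
  ultimately show "a * sqrt M <= l \<longleftrightarrow> M <= m" "l <= a * sqrt M \<longleftrightarrow> m <= M" by auto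
 qed
 have 1: "(l, h) \<in> (%w. (ell3 a e0 e1 w, h3 a e0 e1 w)) ` {omega_T1 a e0 e1 .. omega_I1 a e0 e1} \<longleftrightarrow>
  0 < l & (EX w. wI e E <= w & w <= 1 & m = mcr e E w & k = kap e E w)"
 proof
  assume "(l, h) \<in> (%w. (ell3 a e0 e1 w, h3 a e0 e1 w)) ` {omega_T1 a e0 e1 .. omega_I1 a e0 e1}"
  then obtain w where "(l, h) = (ell3 a e0 e1 w, h3 a e0 e1 w)" "w \<in> {omega_T1 a e0 e1 .. omega_I1 a e0 e1}" by (rule imageE)
  then have w: "omega_T1 a e0 e1 <= w" "w <= omega_I1 a e0 e1" "l = ell3 a e0 e1 w" "h = h3 a e0 e1 w" by simp_all
  obtain u where u: "0 < u" "u <= 1" "w = om a e0 e1 u" using om_surj[OF a e0 w(1)] by (elim exE conjE)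
  have "wI e E <= u" using w(2) om_mono[OF a e0 u(1) I(1), of e1] unfolding u(3) omega_I1_om[OF a e0 e1] e_def E_def by simp
  moreover have l: "l = a * sqrt (mcr e E u)" "h = kap e E u + mcr e E u"
   unfolding w(3,4) u(3) by (rule omw[OF u(1)])+
  moreover have "m = mcr e E u & 0 < l" using sq[OF mcr_pos[OF e E u(1)]] l(1) by blast
  moreover have "k = kap e E u" unfolding k_def using calculation by simp
  ultimately show "0 < l & (EX w. wI e E <= w & w <= 1 & m = mcr e E w & k = kap e E w)"
   using u(2) by blast
 next
  assume "0 < l & (EX w. wI e E <= w & w <= 1 & m = mcr e E w & k = kap e E w)"
  then obtain u where u: "0 < l" "wI e E <= u" "u <= 1" "m = mcr e E u" "k = kap e E u" by (elim exE conjE)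
  have u0: "0 < u" using u(2) I(1) by linarith
  have "l = a * sqrt (mcr e E u)" using sq[OF mcr_pos[OF e E u0]] u(1,4) by blast
  then have "l = ell3 a e0 e1 (om a e0 e1 u)" using omw(3)[OF u0] by simp
  moreover have "h = kap e E u + mcr e E u" unfolding u(4,5)[symmetric] k_def by simp
  then have "h = h3 a e0 e1 (om a e0 e1 u)" using omw(4)[OF u0] by simp
  moreover have "omega_T1 a e0 e1 <= om a e0 e1 u" unfolding omega_T1_om om_mono[OF a e0 zero_less_one u0] by (rule u(3))
  moreover have "om a e0 e1 u <= omega_I1 a e0 e1"
   unfolding omega_I1_om[OF a e0 e1] e_def[symmetric] E_def[symmetric] om_mono[OF a e0 u0 I(1)] by (rule u(2))
  ultimately show "(l, h) \<in> (%w. (ell3 a e0 e1 w, h3 a e0 e1 w)) ` {omega_T1 a e0 e1 .. omega_I1 a e0 e1}"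
   by (intro image_eqI[of _ _ "om a e0 e1 u"]) simp_all
 qed
 have lI: "ell3 a e0 e1 (omega_I1 a e0 e1) = a * sqrt (mcr e E (wI e E))" "ell3 a e0 e1 (omega_T1 a e0 e1) = a * sqrt (E + e)"
  using omw(3)[OF I(1)] omw(3)[of 1] unfolding omega_T1_om omega_I1_om[OF a e0 e1] e_def E_def by (simp_all add: kap_1)
 have le: "a * sqrt (mcr e E (wI e E)) <= a * sqrt (E + e)" using mcr_wI_less[OF e E] a by simp
 have pos: "0 < a * sqrt (mcr e E (wI e E))" using mcr_pos[OF e E I(1)] a by simp
 have 2: "(l, h) \<in> (%l. (l, delta2 a e0 l)) ` closed_segment (ell3 a e0 e1 (omega_I1 a e0 e1)) (ell3 a e0 e1 (omega_T1 a e0 e1))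
  \<longleftrightarrow> 0 < l & k = e & mcr e E (wI e E) <= m & m <= E + e"
 proof -
  have "(l, h) \<in> (%l. (l, delta2 a e0 l)) ` closed_segment (ell3 a e0 e1 (omega_I1 a e0 e1)) (ell3 a e0 e1 (omega_T1 a e0 e1))
   \<longleftrightarrow> (a * sqrt (mcr e E (wI e E)) <= l & l <= a * sqrt (E + e)) & h = delta2 a e0 l"
   unfolding lI closed_segment_eq_real_ivl using le by auto
  also have "h = delta2 a e0 l \<longleftrightarrow> k = e" using a by (auto simp: k_def e_def m_def delta2_eq)
  also have "a * sqrt (mcr e E (wI e E)) <= l & l <= a * sqrt (E + e) \<longleftrightarrow> 0 < l & mcr e E (wI e E) <= m & m <= E + e"
  proof
   assume *: "a * sqrt (mcr e E (wI e E)) <= l & l <= a * sqrt (E + e)"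
   then have "0 < l" using pos by linarith
   then show "0 < l & mcr e E (wI e E) <= m & m <= E + e"
    using sq2(1)[OF mcr_pos[OF e E I(1)]] sq2(2)[OF add_pos_pos[OF E e]] * by simp
  next
   assume *: "0 < l & mcr e E (wI e E) <= m & m <= E + e"
   then show "a * sqrt (mcr e E (wI e E)) <= l & l <= a * sqrt (E + e)"
    using sq2(1)[OF mcr_pos[OF e E I(1)], of] sq2(2)[OF add_pos_pos[OF E e]] by simp
  qed
  finally show ?thesis by blast
 qed
 show ?thesis unfolding triangle_boundary_def using 1 2 by blast
qed

lemma Kf_crit_pos_min:
 assumes e: "0 < e" and m: "0 <= m" and x: "0 < x" "Kd e E m x = 0" and y: "0 <= y" "y ~= x"
 shows "Kf e E m x < Kf e E m y"
proof -
 have f: "Kd e E m z = z*(E - e/z - 4*m/(1 + z^2)^2)" if "0 < z" for z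
  using that by (simp add: Kd_def algebra_simps)
 have g0: "E - e/x - 4*m/(1 + x^2)^2 = 0" using x f[of x] by simp
 have mono: "E - e/u - 4*m/(1 + u^2)^2 < E - e/v - 4*m/(1 + v^2)^2" if "0 < u" "u < v" for u v
 proof -
  have "e/v < e/u" using that e by (intro divide_strict_left_mono) auto
  moreover have "(1 + u^2)^2 <= (1 + v^2)^2" using that by (intro power_mono add_left_mono) auto
  then have "4*m/(1 + v^2)^2 <= 4*m/(1 + u^2)^2"
   using m one_plus_sq[of u] one_plus_sq[of v] by (intro divide_left_mono) (auto intro!: mult_pos_pos zero_less_power)
  ultimately show ?thesis by linarith
 qed
 show ?thesis
 proof (cases "x < y")
  case True
  obtain z where z: "x < z" "z < y" "Kf e E m y - Kf e E m x = (y - x)*Kd e E m z"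
   using MVT2[of x y "Kf e E m" "Kd e E m"] Kf_deriv True by auto
  have "0 < Kd e E m z" using f[of z] mono[of x z] g0 z x by simp
  then have "0 < (y - x)*Kd e E m z" using True by simp
  then show ?thesis using z by linarith
 next
  case False
  then have yx: "y < x" using y by simp
  obtain z where z: "y < z" "z < x" "Kf e E m x - Kf e E m y = (x - y)*Kd e E m z"
   using MVT2[of y x "Kf e E m" "Kd e E m"] Kf_deriv yx by auto
  have z0: "0 < z" using z y by simp
  then have "Kd e E m z < 0" unfolding f[OF z0] using mono[of z x] g0 z by (intro mult_pos_neg) auto
  then have "(x - y)*Kd e E m z < 0" using yx by (intro mult_pos_neg) auto
  then show ?thesis using z by linarith
 qed
qed

text \<open>The triangle is bounded.\<close>
lemma W_bounds:
 assumes E: "0 < E" and e: "0 < e" and k: "k < e" "W e E m k"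
 shows "0 < m" "m < E + e" "0 <= m ==> - E/2 < k"
proof -
 obtain s t where st: "0 < s" "s < t" "t < 1" "fz e E m s = 0" "fz e E m t = 0" "Kf e E m (- t) < k"
  using W_crit_points[OF e k] by blast
 have "0 < fz e E m 1" by (rule fz_after[OF e E _ st(2,3,4,5)]) (use st in simp)
 then show "m < E + e" using fz_mcr_iff(2)[of 1 e E m] kap_1 by simp
 show m: "0 < m" using fz_mcr_iff(1)[OF st(1)] mcr_pos[OF e E st(1)] st(4) by metis
 have "t^2 <= 1" using st by (simp add: abs_square_le_1)
 then have "0 <= m*(1 - t^2)/(1 + t^2)" "E/2*(1 - t^2) <= E/2*1"
  using m one_plus_sq[of t] E by (intro divide_nonneg_nonneg mult_nonneg_nonneg mult_left_mono; simp)+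
 then have "- E/2 < Kf e E m (- t)" using mult_pos_pos[OF e, of t] st unfolding Kf_def by simp
 then show "- E/2 < k" using st by simp
qed

lemma continuous_on_Kf_param:
 assumes "continuous_on S A" "continuous_on S B"
 shows "continuous_on S (%p. Kf e (A p) (B p) x)"
 unfolding Kf_def using assms one_plus_sq(2)[of x] by (auto intro!: continuous_intros)

lemma open_W:
 fixes A B k :: "'a::topological_space => real"
 assumes "continuous_on UNIV A" "continuous_on UNIV B" "continuous_on UNIV k"
 shows "open {p. W e (A p) (B p) (k p)}"
 unfolding W_def
 by (intro open_Collect_ex open_Collect_conj open_Collect_const open_Collect_less continuous_on_Kf_param assms)

text \<open>In the limit the critical points of \<open>W_crit_points\<close> may coincide or reach the end point.\<close>

lemma W_limit:
 assumes e: "0 < e" and lim: "E \<longlonglongrightarrow> E0" "m \<longlonglongrightarrow> m0" "k \<longlonglongrightarrow> k0"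
  and W: "!!n. k n < e" "!!n. W e (E n) (m n) (k n)"
 shows "k0 <= e & (EX s t. 0 < s & s <= t & t <= 1 & fz e E0 m0 s = 0 & fz e E0 m0 t = 0 &
  Kf e E0 m0 (- t) <= k0 & k0 <= Kf e E0 m0 (- s))"
proof -
 have "ALL n. EX p. 0 < fst p & fst p < snd p & snd p < 1 & fz e (E n) (m n) (fst p) = 0 & fz e (E n) (m n) (snd p) = 0 &
   k n < Kf e (E n) (m n) (- fst p) & Kf e (E n) (m n) (- snd p) < k n"
  using W_crit_points[OF e W] by (metis fst_conv snd_conv)
 then obtain p where p: "!!n. 0 < fst (p n)" "!!n. fst (p n) < snd (p n)" "!!n. snd (p n) < 1" "!!n. fz e (E n) (m n) (fst (p n)) = 0"
   "!!n. fz e (E n) (m n) (snd (p n)) = 0" "!!n. k n < Kf e (E n) (m n) (- fst (p n))" "!!n. Kf e (E n) (m n) (- snd (p n)) < k n"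
  by metis
 have "ALL n. p n \<in> {0..1} \<times> {0..1}"
 proof
  fix n show "p n \<in> {0..1} \<times> {0..1}" using p(1-3)[of n] by (simp add: mem_Times_iff)
 qed
 moreover have "compact ({0..1::real} \<times> {0..1::real})" by (intro compact_Times) auto
 ultimately obtain q r where r: "strict_mono (r :: nat => nat)" "(p \<circ> r) \<longlonglongrightarrow> q"
  unfolding compact_def by metis
 define s t where "s = fst q" and "t = snd q"
 have ls: "(%n. fst (p (r n))) \<longlonglongrightarrow> s" "(%n. snd (p (r n))) \<longlonglongrightarrow> t"
  using tendsto_fst[OF r(2)] tendsto_snd[OF r(2)] by (simp_all add: s_def t_def o_def)
 have lr: "(%n. E (r n)) \<longlonglongrightarrow> E0" "(%n. m (r n)) \<longlonglongrightarrow> m0" "(%n. k (r n)) \<longlonglongrightarrow> k0"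
  using lim[THEN LIMSEQ_subseq_LIMSEQ, OF r(1)] by (simp_all add: o_def)
 have fz: "(%n. fz e (E (r n)) (m (r n)) (w n)) \<longlonglongrightarrow> fz e E0 m0 w0" if "w \<longlonglongrightarrow> w0" for w w0
  unfolding fz_def by (intro tendsto_intros lr that)
 have K: "(%n. Kf e (E (r n)) (m (r n)) (- w n)) \<longlonglongrightarrow> Kf e E0 m0 (- w0)" if "w \<longlonglongrightarrow> w0" for w w0
  unfolding Kf_def by (intro tendsto_intros lr that) (use one_plus_sq(2)[of "- w0"] in simp_all)
 have "k0 <= e" using LIMSEQ_le_const2[OF lim(3), of e] W(1) less_imp_le by blast
 moreover have "0 <= s" using LIMSEQ_le_const[OF ls(1), of 0] p(1) less_imp_le by blast
 moreover have "s <= t" using LIMSEQ_le[OF ls] p(2) less_imp_le by blast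
 moreover have "t <= 1" using LIMSEQ_le_const2[OF ls(2), of 1] p(3) less_imp_le by blast
 moreover have "fz e E0 m0 s = 0" using LIMSEQ_unique[OF fz[OF ls(1)]] p(4) by simp
 moreover have "fz e E0 m0 t = 0" using LIMSEQ_unique[OF fz[OF ls(2)]] p(5) by simp
 moreover have "Kf e E0 m0 (- t) <= k0" using LIMSEQ_le[OF K[OF ls(2)] lr(3)] p(7) less_imp_le by blast
 moreover have "k0 <= Kf e E0 m0 (- s)" using LIMSEQ_le[OF lr(3) K[OF ls(1)]] p(6) less_imp_le by blast
 moreover have "s ~= 0" using \<open>fz e E0 m0 s = 0\<close> e by (auto simp: fz_def)
 ultimately show ?thesis by (metis order_le_less)
qed

lemma Kf_between_crit:
 assumes e: "0 < e" and E: "0 < E" and st: "0 < s" "s < t" "fz e E m s = 0" "fz e E m t = 0"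
 shows "Kf e E m (- t) < Kf e E m (- s)"
proof -
 obtain z where z: "s < z" "z < t" "Kf e E m (- t) - Kf e E m (- s) = (t - s)*(fz e E m z/(1 + z^2)^2)"
  using MVT2[OF st(2), of "%w. Kf e E m (- w)" "%w. fz e E m w/(1 + w^2)^2"] Kt_deriv by auto
 have "fz e E m z < 0" by (rule fz_zeros[OF e E _ st(2,3) _ z(1,2)]) (use st in auto)
 then have "(t - s)*(fz e E m z/(1 + z^2)^2) < 0"
  using st one_plus_sq[of z] by (intro mult_pos_neg divide_neg_pos) auto
 then show ?thesis using z by linarith
qed

lemma not_insideI:
 assumes "connected C" "x \<in> C" "C \<inter> S = {}" "~ bounded C"
 shows "x \<notin> inside S"
proof
 assume "x \<in> inside S"
 then have "bounded (connected_component_set (- S) x)" by (simp add: inside_def)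
 moreover have "C \<subseteq> connected_component_set (- S) x"
  by (rule connected_component_maximal) (use assms in auto)
 ultimately show False using assms(4) bounded_subset by blast
qed

lemma insideI:
 fixes T :: "'a::euclidean_space set"
 assumes "open T" "bounded T" "closure T \<subseteq> T \<union> S" "T \<inter> S = {}" "x \<in> T"
 shows "x \<in> inside S"
proof -
 let ?C = "connected_component_set (- S) x"
 have "?C \<inter> frontier T = {}" using assms(1,3) connected_component_subset[of "- S" x]
  by (auto simp: frontier_def interior_open)
 moreover have x: "x \<in> ?C" using assms(4,5) by auto
 ultimately have "?C \<subseteq> T"
  using connected_Int_frontier[of ?C T] assms(5) by blast
 then have "bounded ?C" using assms(2) bounded_subset by blast
 then show ?thesis using assms(4,5) by (auto simp: inside_def)
qed

lemma unbounded_vertical: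
 fixes C :: "(real \<times> real) set"
 assumes "!!N. EX t. N < \<bar>t\<bar> & (l, t) \<in> C" shows "~ bounded C"
proof
 assume "bounded C"
 then obtain N where N: "!!p. p \<in> C ==> norm p <= N" unfolding bounded_iff by blast
 obtain t where t: "N < \<bar>t\<bar>" "(l, t) \<in> C" using assms by blast
 show False using N[OF t(2)] t(1) norm_snd_le[of t l] by simp
qed

lemma curve_below_iff:
 assumes e: "0 < e" and E: "0 < E" and k: "k < e"
 shows "(EX w. wI e E <= w & w <= 1 & m = mcr e E w & k = kap e E w) \<longleftrightarrow>
  (EX w. 0 < w & w < 1 & fz e E m w = 0 & Kf e E m (- w) = k)"
proof
 assume "EX w. wI e E <= w & w <= 1 & m = mcr e E w & k = kap e E w"
 then obtain w where w: "wI e E <= w" "w <= 1" "m = mcr e E w" "k = kap e E w" by blast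
 have "0 < w" "w ~= 1" using w k wI(1)[OF e E] kap_1 by auto
 then show "EX w. 0 < w & w < 1 & fz e E m w = 0 & Kf e E m (- w) = k"
  using w fz_mcr_iff(1)[of w e E m] unfolding kap_def by (intro exI[of _ w]) auto
next
 assume "EX w. 0 < w & w < 1 & fz e E m w = 0 & Kf e E m (- w) = k"
 then obtain w where w: "0 < w" "w < 1" "fz e E m w = 0" "Kf e E m (- w) = k" by blast
 then have m: "m = mcr e E w" using fz_mcr_iff(1) by blast
 then have "k = kap e E w" using w unfolding kap_def by simp
 then show "EX w. wI e E <= w & w <= 1 & m = mcr e E w & k = kap e E w"
  using kap_sign(1)[OF e E w(1,2)] k w m by (intro exI[of _ w]) auto
qed

text \<open>The inside of the triangle is where \<open>k < e\<close> and \<open>W\<close>. That this set is closed up to the boundary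
 follows from the limits of critical points. The other points off the boundary escape along a vertical
 line: two obstacles, one below and one above, would yield \<open>W\<close>.\<close>

lemma open_triangle_iff:
 fixes a e0 e1 l h :: real
 assumes a: "0 < a" and e0: "0 < e0" and e1: "0 < e1"
 defines "e == a*e0" and "E == (a*e1)^2"
 shows "(l, h) \<in> open_triangle a e0 e1 \<longleftrightarrow> 0 < l & h - (l/a)^2 < e & W e E ((l/a)^2) (h - (l/a)^2)"
proof -
 have e: "0 < e" and E: "0 < E" using a e0 e1 by (auto simp: e_def E_def)
 note I = wI[OF e E]
 define m k where "m l = (l/a)^2" and "k p = snd p - m (fst p)" for l :: real and p :: "real \<times> real"
 define arc where "arc p \<longleftrightarrow> (EX w. wI e E <= w & w <= 1 & m (fst p) = mcr e E w & k p = kap e E w)" for p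
 let ?B = "triangle_boundary a e0 e1"
 have B: "p \<in> ?B \<longleftrightarrow> 0 < fst p & (arc p | (k p = e & mcr e E (wI e E) <= m (fst p) & m (fst p) <= E + e))" for p
  using triangle_boundary_iff[OF a e0 e1, of "fst p" "snd p"] unfolding e_def E_def m_def k_def arc_def by simp
 have arc_le: "k p <= e" if "arc p" for p
  using that kap_le_e_iff[OF e E] I(1) unfolding arc_def by force
 have arc_iff: "arc p \<longleftrightarrow> (EX w. 0 < w & w < 1 & fz e E (m (fst p)) w = 0 & Kf e E (m (fst p)) (- w) = k p)" if "k p < e" for p
  unfolding arc_def by (rule curve_below_iff[OF e E that])
 have arcI: "arc p" if "0 < w" "w <= 1" "fz e E (m (fst p)) w = 0" "Kf e E (m (fst p)) (- w) = k p" "k p <= e" for p w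
 proof -
  have m: "m (fst p) = mcr e E w" using that fz_mcr_iff(1) by blast
  then have "k p = kap e E w" using that unfolding kap_def by simp
  then show ?thesis using kap_le_e_iff[OF e E that(1,2)] that m unfolding arc_def by auto
 qed
 define Tri where "Tri = {p. 0 < fst p & k p < e & W e E (m (fst p)) (k p)}"
 have cm: "continuous_on UNIV (%p. m (fst p))" and ck: "continuous_on UNIV k"
  unfolding m_def k_def using a by (auto intro!: continuous_intros)
 have m0: "0 <= m l" for l unfolding m_def by simp
 have disj: "Tri \<inter> ?B = {}"
 proof (rule ccontr)
  assume "Tri \<inter> ?B ~= {}"
  then obtain p where p: "k p < e" "W e E (m (fst p)) (k p)" "p \<in> ?B" unfolding Tri_def by blast
  have "arc p" using p(3) B p(1) by auto
  then obtain w where w: "0 < w" "w < 1" "fz e E (m (fst p)) w = 0" "Kf e E (m (fst p)) (- w) = k p" using arc_iff[OF p(1)] by blast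
  then have "crit e E (m (fst p)) (k p)" unfolding crit_def using Kd_minus_iff(1) by (intro exI[of _ "- w"]) auto
  then show False using W_not_crit[OF E e m0 p(1,2)] by blast
 qed
 have op: "open Tri"
 proof -
  have "Tri = {p. 0 < fst p} \<inter> {p. k p < e} \<inter> {p. W e E (m (fst p)) (k p)}" unfolding Tri_def by blast
  moreover have "open {p::real\<times>real. 0 < fst p}" "open {p. k p < e}"
   by (intro open_Collect_less continuous_intros ck)+
  moreover have "open {p. W e E (m (fst p)) (k p)}" by (intro open_W cm ck continuous_intros)
  ultimately show ?thesis by (metis open_Int)
 qed
 have bd: "bounded Tri"
 proof (rule bounded_subset)
  show "bounded ({0..a * sqrt (E + e)} \<times> {- E..e + (E + e)})" by (intro bounded_Times bounded_closed_interval)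
  show "Tri \<subseteq> {0..a * sqrt (E + e)} \<times> {- E..e + (E + e)}"
  proof
   fix p assume "p \<in> Tri"
   then have p: "0 < fst p" "k p < e" "W e E (m (fst p)) (k p)" by (auto simp: Tri_def)
   note b = W_bounds[OF E e p(2,3)]
   have "fst p/a <= sqrt (E + e)" by (rule real_le_rsqrt) (use b(2) in \<open>simp add: m_def\<close>)
   then have "fst p <= a * sqrt (E + e)" using a by (simp add: pos_divide_le_eq mult.commute)
   moreover have "- E <= snd p" "snd p <= e + (E + e)" using b p(2) E unfolding k_def by auto
   ultimately show "p \<in> {0..a * sqrt (E + e)} \<times> {- E..e + (E + e)}" using p by (simp add: mem_Times_iff)
  qed
 qed
 have cl: "closure Tri \<subseteq> Tri \<union> ?B"
 proof
  fix p assume "p \<in> closure Tri"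
  then obtain f where f: "!!n. f n \<in> Tri" "f \<longlonglongrightarrow> p" unfolding closure_sequential by blast
  have lim: "(%n. m (fst (f n))) \<longlonglongrightarrow> m (fst p)" "(%n. k (f n)) \<longlonglongrightarrow> k p"
   using continuous_on_tendsto_compose[OF cm f(2)] continuous_on_tendsto_compose[OF ck f(2)] by simp_all
  have "k p <= e & (EX s t. 0 < s & s <= t & t <= 1 & fz e E (m (fst p)) s = 0 & fz e E (m (fst p)) t = 0 &
    Kf e E (m (fst p)) (- t) <= k p & k p <= Kf e E (m (fst p)) (- s))"
   by (rule W_limit[OF e tendsto_const lim]) (use f(1) in \<open>auto simp: Tri_def\<close>)
  then have ke: "k p <= e" and "EX s t. 0 < s & s <= t & t <= 1 & fz e E (m (fst p)) s = 0 & fz e E (m (fst p)) t = 0 &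
    Kf e E (m (fst p)) (- t) <= k p & k p <= Kf e E (m (fst p)) (- s)" by auto
  then obtain s t where st: "0 < s" "s <= t" "t <= 1" "fz e E (m (fst p)) s = 0" "fz e E (m (fst p)) t = 0"
    "Kf e E (m (fst p)) (- t) <= k p" "k p <= Kf e E (m (fst p)) (- s)" by blast
  have "0 <= fst p" using LIMSEQ_le_const[OF tendsto_fst[OF f(2)], of 0] f(1) by (auto simp: Tri_def intro: less_imp_le)
  moreover have "0 < m (fst p)" using fz_mcr_iff(1)[OF st(1)] mcr_pos[OF e E st(1)] st(4) by metis
  ultimately have l: "0 < fst p" by (auto simp: m_def less_le)
  show "p \<in> Tri \<union> ?B"
  proof (cases "arc p")
   case True then show ?thesis using B l by blast
  next
   case False
   have "Kf e E (m (fst p)) (- t) ~= k p" "Kf e E (m (fst p)) (- s) ~= k p"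
    using arcI[of t p] arcI[of s p] st ke False by auto
   then have lt: "Kf e E (m (fst p)) (- t) < k p" "k p < Kf e E (m (fst p)) (- s)" using st by auto
   then have st': "s < t" using st by (cases "s = t") auto
   have t1: "t < 1" using lt ke st Kf_1(2)[of e E "m (fst p)"]
   proof (cases "t = 1")
    case True
    have "fz e E (m (fst p)) s = 0" "s < 1" using st st' by auto
    then show ?thesis using Kf_between_crit[OF e E st(1) st' st(4,5)] lt ke True Kf_1(2)[of e E "m (fst p)"] by auto
   qed auto
   show ?thesis
   proof (cases "k p = e")
    case False
    then show ?thesis using lt l ke st st' t1 unfolding Tri_def W_def by fastforce
   next
    case True
    have mt: "m (fst p) = mcr e E t" "m (fst p) = mcr e E s" using st st' fz_mcr_iff(1) by auto
    have "kap e E t < e" using lt True mt(1) by (simp add: kap_def)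
    moreover have "e < kap e E s" using lt True mt(2) by (simp add: kap_def)
    ultimately have "wI e E < t" "s < wI e E"
     using kap_sign(1)[OF e E, of t] kap_sign(3)[OF e E, of s] st st' t1 by auto
    then have "fz e E (m (fst p)) (wI e E) < 0" using fz_zeros[OF e E _ st' st(4)] st by auto
    then have "mcr e E (wI e E) < m (fst p)" using fz_mcr_iff(3)[OF I(1)] by blast
    moreover have "0 < fz e E (m (fst p)) 1" using fz_after[OF e E _ st' t1 st(4,5)] st by simp
    then have "m (fst p) < E + e" using fz_mcr_iff(2)[of 1 e E "m (fst p)"] kap_1 by simp
    ultimately show ?thesis using B l True by auto
   qed
  qed
 qed
 have out: "p \<notin> inside ?B" if "p \<notin> Tri" "p \<notin> ?B" for p
 proof -
  define l where "l = fst p"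
  define h where "h = snd p"
  have p: "p = (l, h)" by (simp add: l_def h_def)
  have ray: "connected ((%t. (l, t)) ` S)" if "connected S" for S
   by (rule connected_continuous_image) (use that in \<open>auto intro!: continuous_intros\<close>)
  have kp: "k (l, t) = t - m l" for t by (simp add: k_def)
  have up: ?thesis if "!!t. h <= t ==> (l, t) \<notin> ?B"
  proof (rule not_insideI)
   show "connected ((%t. (l, t)) ` {h..})" by (rule ray) simp
   show "~ bounded ((%t. (l, t)) ` {h..})"
   proof (rule unbounded_vertical)
    fix N show "EX t. N < \<bar>t\<bar> & (l, t) \<in> (%t. (l, t)) ` {h..}"
     by (intro exI[of _ "\<bar>N\<bar> + \<bar>h\<bar> + 1"]) auto
   qed
  qed (use that p in auto)
  have down: ?thesis if "!!t. t <= h ==> (l, t) \<notin> ?B"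
  proof (rule not_insideI)
   show "connected ((%t. (l, t)) ` {..h})" by (rule ray) simp
   show "~ bounded ((%t. (l, t)) ` {..h})"
   proof (rule unbounded_vertical)
    fix N show "EX t. N < \<bar>t\<bar> & (l, t) \<in> (%t. (l, t)) ` {..h}"
     by (intro exI[of _ "- (\<bar>N\<bar> + \<bar>h\<bar> + 1)"]) auto
   qed
  qed (use that p in auto)
  show ?thesis
  proof (cases "l <= 0 | e <= k p")
   case True
   have "(l, t) \<notin> ?B" if "h <= t" for t
   proof
    assume b: "(l, t) \<in> ?B"
    then have "0 < l" "k (l, t) <= e" using B[of "(l, t)"] arc_le[of "(l, t)"] by auto
    then have "t = h" using True that p kp by force
    then show False using b \<open>p \<notin> ?B\<close> p by simp
   qed
   then show ?thesis by (rule up)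
  next
   case False
   then have l: "0 < l" and ke: "k p < e" by auto
   have nW: "~ W e E (m l) (k p)" using \<open>p \<notin> Tri\<close> l ke unfolding Tri_def l_def by simp
   show ?thesis
   proof (rule ccontr)
    assume "~ ?thesis"
    then obtain t1 t2 where t: "h <= t1" "(l, t1) \<in> ?B" "t2 <= h" "(l, t2) \<in> ?B" using up down by blast
    have "t1 ~= h" "t2 ~= h" using t \<open>p \<notin> ?B\<close> p by auto
    then have k12: "k p < k (l, t1)" "k (l, t2) < k p" using t p kp by auto
    then have "arc (l, t2)" using B[of "(l, t2)"] t ke by auto
    then obtain t where tt: "0 < t" "t < 1" "fz e E (m l) t = 0" "Kf e E (m l) (- t) = k (l, t2)"
     using arc_iff[of "(l, t2)"] k12 ke by auto
    have mt: "m l = mcr e E t" using tt fz_mcr_iff(1) by blast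
    then have wt: "wI e E < t" using kap_sign(1)[OF e E tt(1,2)] tt(4) k12 ke by (simp add: kap_def)
    have nu: "~ k p < Kf e E (m l) (- u)" if "0 < u" "u < t" for u
     using nW that tt k12 unfolding W_def by metis
    consider "arc (l, t1)" | "mcr e E (wI e E) <= m l" using B[of "(l, t1)"] t by auto
    then show False
    proof cases
     case 1
     then obtain s where s: "wI e E <= s" "s <= 1" "m l = mcr e E s" "k (l, t1) = kap e E s" unfolding arc_def by auto
     have s0: "0 < s" using s I by simp
     have fs: "fz e E (m l) s = 0" using fz_mcr_iff(1)[OF s0] s by blast
     have Ks: "Kf e E (m l) (- s) = k (l, t1)" using s by (simp add: kap_def)
     have "s ~= t" using Ks tt k12 by auto
     moreover have "~ s < t" using nu[OF s0] Ks k12 by auto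
     ultimately have "t < s" by simp
     from Kf_between_crit[OF e E tt(1) this tt(3) fs] show False using Ks tt k12 by simp
    next
     case 2
     have "wI e E <= 1" using I by simp
     then have "(- wI e E)^2 <= 1" using I(1) by (simp add: abs_square_le_1)
     then have "Kf e E (mcr e E (wI e E)) (- wI e E) <= Kf e E (m l) (- wI e E)" using Kf_mono_m[OF 2] by blast
     then have "e <= Kf e E (m l) (- wI e E)" using kap_sign(2)[OF e E I(1,2)] by (simp add: kap_def)
     then show False using nu[OF I(1) wt] ke by simp
    qed
   qed
  qed
 qed
 have "p \<in> inside ?B \<longleftrightarrow> p \<in> Tri" for p
 proof
  assume "p \<in> inside ?B"
  moreover have "p \<notin> ?B" using \<open>p \<in> inside ?B\<close> by (simp add: inside_def)
  ultimately show "p \<in> Tri" using out by blast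
 qed (rule insideI[OF op bd cl disj])
 then show ?thesis unfolding open_triangle_def Tri_def k_def m_def by simp
qed

section \<open>The regions\<close>

lemma crit_split:
 assumes "0 < e"
 shows "crit e E m k \<longleftrightarrow> (EX w. 0 < w & w < 1 & fz e E m w = 0 & Kf e E m (- w) = k) |
  (EX x. 0 < x & x < 1 & Kd e E m x = 0 & Kf e E m x = k)" (is "_ \<longleftrightarrow> ?N | ?P")
proof
 assume "crit e E m k"
 then obtain x where x: "-1 < x" "x < 1" "Kd e E m x = 0" "Kf e E m x = k" unfolding crit_def by blast
 consider "x < 0" | "x = 0" | "0 < x" by linarith
 then show "?N | ?P"
 proof cases
  case 1
  then have ?N using x Kd_minus_iff(1)[of e E m "- x"] by (intro exI[of _ "- x"]) auto
  then show ?thesis ..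
 next
  case 2 then show ?thesis using x(3) assms by (simp add: Kd_def)
 next
  case 3 then show ?thesis using x by blast
 qed
next
 assume "?N | ?P"
 then show "crit e E m k"
 proof
  assume ?N
  then obtain w where "0 < w" "w < 1" "fz e E m w = 0" "Kf e E m (- w) = k" by blast
  then show ?thesis unfolding crit_def using Kd_minus_iff(1)[of e E m w] by (intro exI[of _ "- w"]) auto
 next
  assume ?P
  then obtain x where "0 < x" "x < 1" "Kd e E m x = 0" "Kf e E m x = k" by blast
  then show ?thesis unfolding crit_def by (intro exI[of _ x]) auto
 qed
qed

lemma Kf_max_left:
 assumes e: "0 < e"
 shows "EX u. 0 < u & u <= 1 & (u = 1 | fz e E m u = 0) & (ALL w. 0 <= w --> w <= 1 --> Kf e E m (- w) <= Kf e E m (- u))"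
proof -
 have "\<exists>u\<in>{0..1}. \<forall>w\<in>{0..1}. Kf e E m (- w) <= Kf e E m (- u)"
  by (rule continuous_attains_sup) (auto intro!: continuous_at_imp_continuous_on DERIV_isCont[OF Kt_deriv])
 then obtain u where u: "0 <= u" "u <= 1" "!!w. 0 <= w ==> w <= 1 ==> Kf e E m (- w) <= Kf e E m (- u)" by auto
 have "u ~= 0"
 proof
  assume "u = 0"
  moreover have "EX y. 0 < y & y < 0 + 1 & Kf e E m (- 0) < Kf e E m (- y)"
   by (intro deriv_pos_nearby(1)[OF Kt_deriv]) (use e in \<open>auto simp: fz_def\<close>)
  then obtain y where "0 < y" "y < 0 + 1" "Kf e E m (- 0) < Kf e E m (- y)" by (elim exE conjE)
  ultimately show False using u(3)[of y] by simp
 qed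
 moreover have "fz e E m u = 0" if "u ~= 0" "u ~= 1"
 proof -
  have "fz e E m u/(1 + u^2)^2 = 0"
   by (rule DERIV_local_max[OF Kt_deriv, where d = "min u (1 - u)"]) (use u that in \<open>auto simp: abs_if split: if_splits\<close>)
  then show ?thesis using one_plus_sq[of u] by simp
 qed
 ultimately show ?thesis using u by (intro exI[of _ u]) auto
qed

lemma Kf_min_right:
 assumes e: "0 < e"
 shows "EX u. 0 < u & u <= 1 & (u = 1 | Kd e E m u = 0) & (ALL w. 0 <= w --> w <= 1 --> Kf e E m u <= Kf e E m w)"
proof -
 have "\<exists>u\<in>{0..1}. \<forall>w\<in>{0..1}. Kf e E m u <= Kf e E m w"
  by (rule continuous_attains_inf) (auto intro: continuous_on_Kf)
 then obtain u where u: "0 <= u" "u <= 1" "!!w. 0 <= w ==> w <= 1 ==> Kf e E m u <= Kf e E m w" by auto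
 have "u ~= 0"
 proof
  assume "u = 0"
  moreover have "EX y. 0 < y & y < 0 + 1 & Kf e E m y < Kf e E m 0"
   by (intro deriv_neg_nearby(1)[OF Kf_deriv]) (use e in \<open>auto simp: Kd_def\<close>)
  then obtain y where "0 < y" "y < 0 + 1" "Kf e E m y < Kf e E m 0" by (elim exE conjE)
  ultimately show False using u(3)[of y] by simp
 qed
 moreover have "Kd e E m u = 0" if "u ~= 0" "u ~= 1"
  by (rule DERIV_local_min[OF Kf_deriv, where d = "min u (1 - u)"]) (use u that in \<open>auto simp: abs_if split: if_splits\<close>)
 ultimately show ?thesis using u by (intro exI[of _ u]) auto
qed

lemma Kf_le_left: "0 < e ==> Kf e E m x <= Kf e E m (- \<bar>x\<bar>)" and Kf_ge_right: "0 < e ==> Kf e E m \<bar>x\<bar> <= Kf e E m x"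
proof -
 assume e: "0 < e"
 have "Kf e E m (- \<bar>x\<bar>) - Kf e E m \<bar>x\<bar> = 2*e*\<bar>x\<bar>" by (rule Kf_reflect)
 moreover have "0 <= 2*e*\<bar>x\<bar>" using e by simp
 moreover have "x = \<bar>x\<bar> | x = - \<bar>x\<bar>" by auto
 ultimately show "Kf e E m x <= Kf e E m (- \<bar>x\<bar>)" "Kf e E m \<bar>x\<bar> <= Kf e E m x"
  by (metis diff_ge_0_iff_ge order_refl)+
qed

text \<open>The constant \<open>5 + 3 \<surd>3\<close> is the minimum of \<open>(1 + 2 t - t^2) / (t (1 - t)^2)\<close> on \<open>(0, 1)\<close>, attained at
 \<open>t = 2 - \<surd>3\<close>: the difference has a double root there.\<close>
lemma zeta3_bound:
 fixes t e E :: real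
 assumes t: "0 < t" "t < 1" and e: "0 < e" and lt: "e*(1 + 2*t - t^2) < E*t*(1 - t)^2"
 shows "(5 + 3 * sqrt 3)*e < E"
proof -
 define s :: real where "s = sqrt 3"
 have s: "s * s = 3" "0 < s" by (auto simp: s_def)
 have eq: "(1 + 2*t - t^2) - (5 + 3 * s)*t*(1 - t)^2 = (t - 2 + s)^2*(7 + 4 * s - (5 + 3 * s)*t)"
 proof -
  have ss: "s*(s*x) = 3*x" for x using s(1) by (simp add: mult.assoc[symmetric])
  show ?thesis by (simp add: power2_eq_square algebra_simps s(1) ss)
 qed
 have "(5 + 3 * s)*t <= (5 + 3 * s)*1" using s t by (intro mult_left_mono) auto
 moreover have "(5 + 3 * s)*1 <= 7 + 4 * s" using s by simp
 ultimately have "(5 + 3 * s)*t <= 7 + 4 * s" by (rule order_trans)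
 then have "0 <= 7 + 4 * s - (5 + 3 * s)*t" by simp
 then have "0 <= (t - 2 + s)^2*(7 + 4 * s - (5 + 3 * s)*t)" by (intro mult_nonneg_nonneg) auto
 then have "(5 + 3 * s)*t*(1 - t)^2 <= 1 + 2*t - t^2" unfolding eq[symmetric] by simp
 then have "e*((5 + 3 * s)*t*(1 - t)^2) <= e*(1 + 2*t - t^2)" using e by (intro mult_left_mono) auto
 then have "(t*(1 - t)^2)*((5 + 3 * s)*e) < (t*(1 - t)^2)*E" using lt by (simp add: algebra_simps)
 moreover have "0 < t*(1 - t)^2" using t by simp
 ultimately show ?thesis unfolding s_def[symmetric] by (metis mult_less_cancel_left_pos)
qed

lemma delta3'_exists_iff:
 fixes a e0 e1 l h :: real
 assumes a: "0 < a" and e0: "0 < e0" and e1: "0 < e1" and l: "0 <= l"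
 defines "e == a*e0" and "E == (a*e1)^2" and "m == (l/a)^2"
 shows "(\<exists>w\<ge>omega_I1 a e0 e1. ell3 a e0 e1 w = l & P (h3 a e0 e1 w)) \<longleftrightarrow>
  (EX u. 0 < u & u <= wI e E & fz e E m u = 0 & P (Kf e E m (- u) + m))"
proof -
 have e: "0 < e" and E: "0 < E" using a e0 e1 by (auto simp: e_def E_def)
 note I = wI[OF e E]
 have om_iff: "ell3 a e0 e1 (om a e0 e1 u) = l \<longleftrightarrow> fz e E m u = 0"
  "ell3 a e0 e1 (om a e0 e1 u) = l ==> h3 a e0 e1 (om a e0 e1 u) = Kf e E m (- u) + m" if u: "0 < u" for u
 proof -
  have u': "- u ~= 0" using u by simp
  have "ell3 a e0 e1 (om a e0 e1 u) = l \<longleftrightarrow> 4*m = (E - e/(- u))*(1 + (- u)^2)^2"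
   unfolding e_def E_def m_def by (rule curve_at(1)[OF a e0 om(1)[OF a e0 u] l u' om(2)[OF a e0 u]])
  also have "... \<longleftrightarrow> fz e E m u = 0" unfolding Kd_zero_iff[OF u', symmetric] by (rule Kd_minus_iff(1))
  finally show "ell3 a e0 e1 (om a e0 e1 u) = l \<longleftrightarrow> fz e E m u = 0" .
  assume "ell3 a e0 e1 (om a e0 e1 u) = l"
  then show "h3 a e0 e1 (om a e0 e1 u) = Kf e E m (- u) + m"
   unfolding e_def E_def m_def by (rule curve_at(2)[OF a e0 om(1)[OF a e0 u] l u' om(2)[OF a e0 u]])
 qed
 have I1: "omega_I1 a e0 e1 = om a e0 e1 (wI e E)" unfolding e_def E_def by (rule omega_I1_om[OF a e0 e1])
 show ?thesis
 proof
  assume "\<exists>w\<ge>omega_I1 a e0 e1. ell3 a e0 e1 w = l & P (h3 a e0 e1 w)"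
  then obtain w where w: "omega_I1 a e0 e1 <= w" "ell3 a e0 e1 w = l" "P (h3 a e0 e1 w)" by blast
  have "omega_T1 a e0 e1 <= omega_I1 a e0 e1"
   unfolding I1 omega_T1_om om_mono[OF a e0 zero_less_one I(1)] using I by simp
  then obtain u where u: "0 < u" "w = om a e0 e1 u" using om_surj[OF a e0, of e1 w] w(1) by force
  have "u <= wI e E" using w(1) unfolding I1 u(2) om_mono[OF a e0 I(1) u(1)] .
  then show "EX u. 0 < u & u <= wI e E & fz e E m u = 0 & P (Kf e E m (- u) + m)"
   using w om_iff[OF u(1)] u by (intro exI[of _ u]) simp
 next
  assume "EX u. 0 < u & u <= wI e E & fz e E m u = 0 & P (Kf e E m (- u) + m)"
  then obtain u where u: "0 < u" "u <= wI e E" "fz e E m u = 0" "P (Kf e E m (- u) + m)" by blast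
  have "omega_I1 a e0 e1 <= om a e0 e1 u" unfolding I1 om_mono[OF a e0 I(1) u(1)] by (rule u)
  then show "\<exists>w\<ge>omega_I1 a e0 e1. ell3 a e0 e1 w = l & P (h3 a e0 e1 w)"
   using om_iff[OF u(1)] u by (intro exI[of _ "om a e0 e1 u"]) simp
 qed
qed

lemma delta3''_exists_iff:
 fixes a e0 e1 l h :: real
 assumes a: "0 < a" and e0: "0 < e0" and e1: "0 < e1" and l: "0 <= l"
 defines "e == a*e0" and "E == (a*e1)^2" and "m == (l/a)^2"
 shows "(\<exists>w\<in>delta3''_params a e0 e1. ell3 a e0 e1 w = l & P (h3 a e0 e1 w)) \<longleftrightarrow>
  e < E & (EX x. 0 < x & x <= 1 & Kd e E m x = 0 & P (Kf e E m x + m))"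
proof -
 have e: "0 < e" and E: "0 < E" using a e0 e1 by (auto simp: e_def E_def)
 have z2: "zeta2 a e0 < e1^2 \<longleftrightarrow> e < E"
 proof -
  have "a^2*zeta2 a e0 = e" "a^2*e1^2 = E" using a by (simp_all add: zeta2_def e_def E_def power2_eq_square)
  moreover have "a^2*zeta2 a e0 < a^2*e1^2 \<longleftrightarrow> zeta2 a e0 < e1^2" using a by simp
  ultimately show ?thesis by simp
 qed
 have c: "ell3 a e0 e1 w = l \<longleftrightarrow> Kd e E m x = 0" "ell3 a e0 e1 w = l ==> h3 a e0 e1 w = Kf e E m x + m"
  if w: "0 <= w" and x: "x ~= 0" "e/x = E - (a*w)^2" for w x
  unfolding Kd_zero_iff[OF x(1)] unfolding e_def E_def m_def
  using curve_at[OF a e0 w l x(1) x(2)[unfolded e_def E_def]] by blast+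
 show ?thesis
 proof
  assume "\<exists>w\<in>delta3''_params a e0 e1. ell3 a e0 e1 w = l & P (h3 a e0 e1 w)"
  then obtain w where w: "0 <= w" "w^2 <= e1^2 - zeta2 a e0" "zeta2 a e0 < e1^2" "ell3 a e0 e1 w = l" "P (h3 a e0 e1 w)"
   unfolding delta3''_params_def by blast
  have "a^2*w^2 <= a^2*(e1^2 - zeta2 a e0)" using w(2) by (intro mult_left_mono) auto
  moreover have "a^2*zeta2 a e0 = e" using a by (simp add: zeta2_def e_def power2_eq_square)
  ultimately have d: "e <= E - (a*w)^2" by (simp add: E_def power_mult_distrib right_diff_distrib)
  define x where "x = e/(E - (a*w)^2)"
  have "0 < x" "x <= 1" "e/x = E - (a*w)^2" using d e by (auto simp: x_def)
  then show "e < E & (EX x. 0 < x & x <= 1 & Kd e E m x = 0 & P (Kf e E m x + m))"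
   using c[OF w(1), of x] w z2 by auto
 next
  assume "e < E & (EX x. 0 < x & x <= 1 & Kd e E m x = 0 & P (Kf e E m x + m))"
  then obtain x where x: "e < E" "0 < x" "x <= 1" "Kd e E m x = 0" "P (Kf e E m x + m)" by blast
  have "4*m = (E - e/x)*(1 + x^2)^2" using Kd_zero_iff[of x e E m] x by simp
  moreover have "0 <= m" by (simp add: m_def)
  moreover have "0 < (1 + x^2)^2" using one_plus_sq[of x] by simp
  ultimately have d: "0 <= E - e/x" by (metis mult_le_cancel_right_pos mult_nonneg_nonneg mult_zero_left zero_le_numeral)
  define w where "w = sqrt (E - e/x)/a"
  have w: "0 <= w" "(a*w)^2 = E - e/x" using d a by (auto simp: w_def)
  have "e <= e/x" using x e by (simp add: field_simps)
  moreover have "a^2*zeta2 a e0 = e" using a by (simp add: zeta2_def e_def power2_eq_square)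
  ultimately have "a^2*w^2 <= a^2*(e1^2 - zeta2 a e0)"
   using w(2) by (simp add: E_def power_mult_distrib right_diff_distrib)
  then have "w^2 <= e1^2 - zeta2 a e0" using a by simp
  then have "w \<in> delta3''_params a e0 e1" using w x(1) z2 by (simp add: delta3''_params_def)
  then show "\<exists>w\<in>delta3''_params a e0 e1. ell3 a e0 e1 w = l & P (h3 a e0 e1 w)"
   using c[OF w(1), of x] w x by auto
 qed
qed

lemma regions_iff:
 fixes a e0 e1 l h :: real
 assumes a: "0 < a" and e0: "0 < e0" and e1: "0 < e1" and l: "0 <= l"
 defines "e == a*e0" and "E == (a*e1)^2" and "m == (l/a)^2"
 defines "k == h - m"
 shows "(l, h, e1) \<in> regionA a e0 \<longleftrightarrow> RA e E m k" "(l, h, e1) \<in> regionB a e0 \<longleftrightarrow> RB e E m k"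
  "(l, h, e1) \<in> regionC a e0 \<longleftrightarrow> RC e E m k" "(l, h, e1) \<in> regionD a e0 \<longleftrightarrow> RD e E m k"
  "(l, h, e1) \<in> regionE a e0 \<longleftrightarrow> RE e E m k" "(l, h, e1) \<in> regionF a e0 \<longleftrightarrow> RF e E m k"
  "(l, h, e1) \<in> regionG a e0 \<longleftrightarrow> RG e E m k"
proof -
 have e: "0 < e" and E: "0 < E" and m: "0 <= m" using a e0 e1 by (auto simp: e_def E_def m_def)
 note I = wI[OF e E]
 have d1: "delta1 a e0 l < h \<longleftrightarrow> - e < k" "h < delta1 a e0 l \<longleftrightarrow> k < - e"
  and d2: "delta2 a e0 l < h \<longleftrightarrow> e < k" "h < delta2 a e0 l \<longleftrightarrow> k < e"
  using a by (auto simp: delta1_eq delta2_eq e_def k_def m_def)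
 have hk: "h = k + m" by (simp add: k_def)
 have lpos: "0 < l" if "0 < m" using that l by (auto simp: m_def less_le)
 have T: "(l, h) \<in> open_triangle a e0 e1 \<longleftrightarrow> k < e & W e E m k"
  using open_triangle_iff[OF a e0 e1, of l h] lpos W_bounds(1)[OF E e, of k m]
  unfolding e_def[symmetric] E_def[symmetric] m_def[symmetric] k_def[symmetric] by blast
 define N where "N \<longleftrightarrow> (EX w. 0 < w & w < 1 & fz e E m w = 0 & Kf e E m (- w) = k)"
 have B: "(l, h) \<in> triangle_boundary a e0 e1 \<longleftrightarrow> N" if k: "k < e"
 proof -
  have "N ==> 0 < m" unfolding N_def using fz_mcr_iff(1)[of _ e E m] mcr_pos[OF e E] by auto
  then show ?thesis
   using triangle_boundary_iff[OF a e0 e1, of l h] curve_below_iff[OF e E k, of m] k lpos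
   unfolding e_def[symmetric] E_def[symmetric] m_def[symmetric] k_def[symmetric] N_def[symmetric] by blast
 qed
 have cs: "crit e E m k \<longleftrightarrow> N | (EX x. 0 < x & x < 1 & Kd e E m x = 0 & Kf e E m x = k)"
  unfolding N_def by (rule crit_split[OF e])
 have pmin: "Kf e E m x < - e" if "0 < x" "x < 1" "Kd e E m x = 0" for x
  using Kf_crit_pos_min[OF e m that(1,3), of 1] that Kf_1(1)[of e E m] by simp
 have ct: "(l, h) \<in> closed_triangle a e0 e1 \<longleftrightarrow> N | W e E m k" if "k < e"
  unfolding closed_triangle_def using B[OF that] T that by blast
 have eE: "e < E" if "0 < x" "x < 1" "Kd e E m x = 0" for x
 proof -
  have "4*m = (E - e/x)*(1 + x^2)^2" using Kd_zero_iff that by force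
  moreover have "0 < (1 + x^2)^2" using one_plus_sq[of x] by simp
  ultimately have "e/x <= E" using m by (metis diff_ge_0_iff_ge mult_nonneg_nonneg zero_le_mult_iff not_less zero_le_numeral)
  moreover have "e < e/x" using that e by (simp add: field_simps)
  ultimately show ?thesis by simp
 qed
 show "(l, h, e1) \<in> regionA a e0 \<longleftrightarrow> RA e E m k"
 proof -
  have "crit e E m k \<longleftrightarrow> N" if "- e < k" using cs pmin that by (metis less_asym)
  then show ?thesis using ct d1 d2 e1 l unfolding regionA_def RA_def by auto
 qed
 show "(l, h, e1) \<in> regionD a e0 \<longleftrightarrow> RD e E m k"
  using T d1 e1 l unfolding regionD_def RD_def by auto
 show "(l, h, e1) \<in> regionC a e0 \<longleftrightarrow> RC e E m k"
 proof -
  have "(\<exists>w\<ge>omega_I1 a e0 e1. ell3 a e0 e1 w = l & h < h3 a e0 e1 w) \<longleftrightarrow>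
    (EX u. 0 < u & u <= wI e E & fz e E m u = 0 & k < Kf e E m (- u))"
   using delta3'_exists_iff[OF a e0 e1 l, of "%t. h < t"] unfolding hk e_def[symmetric] E_def[symmetric] m_def[symmetric] by simp
  moreover have "(EX u. 0 < u & u <= wI e E & fz e E m u = 0 & k < Kf e E m (- u)) \<longleftrightarrow>
   (EX w. 0 < w & w < 1 & k < Kf e E m (- w))" if k: "e < k"
  proof
   assume "EX w. 0 < w & w < 1 & k < Kf e E m (- w)"
   then obtain w where w: "0 < w" "w < 1" "k < Kf e E m (- w)" by blast
   obtain u where u: "0 < u" "u <= 1" "u = 1 | fz e E m u = 0" "!!w. 0 <= w ==> w <= 1 ==> Kf e E m (- w) <= Kf e E m (- u)"
    using Kf_max_left[OF e, of E m] by blast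
   have ku: "k < Kf e E m (- u)" using u(4)[of w] w by simp
   then have "u ~= 1" using Kf_1(2)[of e E m] k by auto
   then have u1: "u < 1" "fz e E m u = 0" using u by auto
   then have "kap e E u = Kf e E m (- u)" using fz_mcr_iff(1)[OF u(1)] by (metis kap_def)
   then have "u < wI e E" using kap_sign(3)[OF e E u(1) u1(1)] ku k by simp
   then show "EX u. 0 < u & u <= wI e E & fz e E m u = 0 & k < Kf e E m (- u)"
    using u1 u ku by (intro exI[of _ u]) auto
  qed (use I in force)
  ultimately show ?thesis using d2 e1 l unfolding regionC_def RC_def by auto
 qed
 show "(l, h, e1) \<in> regionB a e0 \<longleftrightarrow> RB e E m k"
 proof -
  have 1: "(\<forall>w\<ge>omega_I1 a e0 e1. ell3 a e0 e1 w = l --> h3 a e0 e1 w < h) \<longleftrightarrow>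
    (ALL u. 0 < u & u <= wI e E & fz e E m u = 0 --> Kf e E m (- u) < k)"
   using delta3'_exists_iff[OF a e0 e1 l, of "%t. ~ t < h"] unfolding hk e_def[symmetric] E_def[symmetric] m_def[symmetric] by auto
  have 2: "(ALL u. 0 < u & u <= wI e E & fz e E m u = 0 --> Kf e E m (- u) < k) \<longleftrightarrow>
   ~ crit e E m k & (ALL w. 0 < w --> w < 1 --> Kf e E m (- w) <= k)" if k: "e < k"
  proof
   assume A: "ALL u. 0 < u & u <= wI e E & fz e E m u = 0 --> Kf e E m (- u) < k"
   obtain u where u: "0 < u" "u <= 1" "u = 1 | fz e E m u = 0" "!!w. 0 <= w ==> w <= 1 ==> Kf e E m (- w) <= Kf e E m (- u)"
    using Kf_max_left[OF e, of E m] by blast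
   have ku: "Kf e E m (- u) < k"
   proof (cases "u = 1")
    case True then show ?thesis using k Kf_1(2)[of e E m] by simp
   next
    case False
    then have u1: "u < 1" "fz e E m u = 0" using u by auto
    then have "kap e E u = Kf e E m (- u)" using fz_mcr_iff(1)[OF u(1)] by (metis kap_def)
    then show ?thesis using kap_sign(1)[OF e E u(1) u1(1)] A u(1) u1 k by force
   qed
   have lt: "Kf e E m x < k" if "-1 < x" "x < 1" for x
   proof -
    have "\<bar>x\<bar> <= 1" using that by (simp add: abs_le_iff)
    then show ?thesis using Kf_le_left[OF e, of E m x] u(4)[of "\<bar>x\<bar>"] ku by simp
   qed
   then show "~ crit e E m k & (ALL w. 0 < w --> w < 1 --> Kf e E m (- w) <= k)"
    unfolding crit_def by (auto intro!: less_imp_le)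
  next
   assume A: "~ crit e E m k & (ALL w. 0 < w --> w < 1 --> Kf e E m (- w) <= k)"
   show "ALL u. 0 < u & u <= wI e E & fz e E m u = 0 --> Kf e E m (- u) < k"
   proof clarify
    fix u assume u: "0 < u" "u <= wI e E" "fz e E m u = 0"
    have "u < 1" using u I by simp
    then have "Kf e E m (- u) ~= k" using A u cs unfolding N_def by blast
    then show "Kf e E m (- u) < k" using A u \<open>u < 1\<close> by (simp add: order_less_le)
   qed
  qed
  show ?thesis using 1 2 d2 e1 l unfolding regionB_def RB_def by auto
 qed
 show "(l, h, e1) \<in> regionE a e0 \<longleftrightarrow> RE e E m k"
 proof -
  have z1: "zeta1 a e0 < e1^2 \<longleftrightarrow> e < 2*E"
  proof -
   have "2*a^2*zeta1 a e0 = e" "2*a^2*e1^2 = 2*E" using a by (simp_all add: zeta1_def e_def E_def power2_eq_square)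
   moreover have "2*a^2*zeta1 a e0 < 2*a^2*e1^2 \<longleftrightarrow> zeta1 a e0 < e1^2" using a by simp
   ultimately show ?thesis by metis
  qed
  have d4: "delta4 a e0 e1 l < h \<longleftrightarrow> 0 < e^2 + 4*E*(k + E)"
  proof -
   have "e^2/(4*E) = e0^2/(4*e1^2)" using a by (simp add: e_def E_def power_mult_distrib)
   then have "delta4 a e0 e1 l = - e\<^sup>2/(4*E) - E + m"
    by (simp add: delta4_def E_def m_def power_divide power_mult_distrib mult.commute)
   then have "delta4 a e0 e1 l < h \<longleftrightarrow> 0 < e^2/(4*E) + (k + E)" by (auto simp: k_def)
   also have "... \<longleftrightarrow> 0 < 4*E*(e^2/(4*E) + (k + E))" using E by (simp add: zero_less_mult_iff)
   also have "4*E*(e^2/(4*E) + (k + E)) = e^2 + 4*E*(k + E)" using E by (simp add: distrib_left)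
   finally show ?thesis .
  qed
  have sq: "4*E*(k + e*t + E*(1 - t^2)) = (e^2 + 4*E*(k + E)) - (2*E*t - e)^2" for t
   by (simp add: power2_eq_square algebra_simps)
  have g: "(EX x. -1 < x & x < 1 & 0 < k + e*x + E*(1 - x^2)) \<longleftrightarrow> e < 2*E & 0 < e^2 + 4*E*(k + E)" if k: "k < - e"
  proof
   assume "EX x. -1 < x & x < 1 & 0 < k + e*x + E*(1 - x^2)"
   then obtain x where x: "-1 < x" "x < 1" "0 < k + e*x + E*(1 - x^2)" by blast
   have "0 < 4*E*(k + e*x + E*(1 - x^2))" using x(3) E by simp
   then have "0 < e^2 + 4*E*(k + E)" using sq[of x] zero_le_power2[of "2*E*x - e"] by linarith
   moreover have "k + e*x + E*(1 - x^2) = k + e - (1 - x)*(e - E*(1 + x))"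
    by (simp add: power2_eq_square algebra_simps)
   then have "(1 - x)*(e - E*(1 + x)) < 0" using x k by linarith
   then have "e < E*(1 + x)" using x by (simp add: mult_less_0_iff)
   moreover have "E*(1 + x) <= E*2" using E x by (intro mult_left_mono) auto
   ultimately show "e < 2*E & 0 < e^2 + 4*E*(k + E)" by simp
  next
   assume A: "e < 2*E & 0 < e^2 + 4*E*(k + E)"
   define x where "x = e/(2*E)"
   have "0 < x" using e E by (simp add: x_def)
   then have x: "-1 < x" "x < 1" "2*E*x - e = 0" using A E by (auto simp: x_def)
   have "0 < 4*E*(k + e*x + E*(1 - x^2))" unfolding sq x(3) using A by simp
   then have "0 < k + e*x + E*(1 - x^2)" using E by (simp add: zero_less_mult_iff)
   then show "EX x. -1 < x & x < 1 & 0 < k + e*x + E*(1 - x^2)" using x by blast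
  qed
  have 1: "(\<forall>w\<in>delta3''_params a e0 e1. ell3 a e0 e1 w = l --> h < h3 a e0 e1 w) \<longleftrightarrow>
    (e < E --> (ALL x. 0 < x & x <= 1 & Kd e E m x = 0 --> k < Kf e E m x))"
   using delta3''_exists_iff[OF a e0 e1 l, of "%t. ~ h < t"] unfolding hk e_def[symmetric] E_def[symmetric] m_def[symmetric] by auto
  have 2: "(e < E --> (ALL x. 0 < x & x <= 1 & Kd e E m x = 0 --> k < Kf e E m x)) \<longleftrightarrow>
   ~ crit e E m k & (ALL x. 0 < x --> x < 1 --> k <= Kf e E m x)" if k: "k < - e"
  proof
   assume A: "e < E --> (ALL x. 0 < x & x <= 1 & Kd e E m x = 0 --> k < Kf e E m x)"
   obtain u where u: "0 < u" "u <= 1" "u = 1 | Kd e E m u = 0" "!!w. 0 <= w ==> w <= 1 ==> Kf e E m u <= Kf e E m w"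
    using Kf_min_right[OF e, of E m] by blast
   have ku: "k < Kf e E m u"
   proof (cases "u = 1")
    case True then show ?thesis using k Kf_1(1)[of e E m] by simp
   next
    case False
    then show ?thesis using A eE[of u] u by auto
   qed
   have lt: "k < Kf e E m x" if "-1 < x" "x < 1" for x
   proof -
    have "\<bar>x\<bar> <= 1" using that by (simp add: abs_le_iff)
    then show ?thesis using Kf_ge_right[OF e, of E m x] u(4)[of "\<bar>x\<bar>"] ku by simp
   qed
   then show "~ crit e E m k & (ALL x. 0 < x --> x < 1 --> k <= Kf e E m x)"
    unfolding crit_def by (auto intro!: less_imp_le)
  next
   assume A: "~ crit e E m k & (ALL x. 0 < x --> x < 1 --> k <= Kf e E m x)"
   show "e < E --> (ALL x. 0 < x & x <= 1 & Kd e E m x = 0 --> k < Kf e E m x)"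
   proof clarify
    fix x assume x: "0 < x" "x <= 1" "Kd e E m x = 0"
    show "k < Kf e E m x"
    proof (cases "x = 1")
     case True then show ?thesis using k Kf_1(1)[of e E m] by simp
    next
     case False
     then have "x < 1" using x by simp
     then have "Kf e E m x ~= k" using A x cs by blast
     then show ?thesis using A x \<open>x < 1\<close> by (simp add: order_less_le)
    qed
   qed
  qed
  show ?thesis using 1 2 g d1 z1 d4 e1 l unfolding regionE_def RE_def by auto
 qed
 show "(l, h, e1) \<in> regionF a e0 \<longleftrightarrow> RF e E m k"
 proof -
  have z2: "zeta2 a e0 < e1^2" if "w \<in> delta3''_params a e0 e1" for w
   using that by (simp add: delta3''_params_def)
  have 1: "(\<exists>w\<in>delta3''_params a e0 e1. ell3 a e0 e1 w = l & h3 a e0 e1 w < h) \<longleftrightarrow>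
    e < E & (EX x. 0 < x & x <= 1 & Kd e E m x = 0 & Kf e E m x < k)"
   using delta3''_exists_iff[OF a e0 e1 l, of "%t. t < h"] unfolding hk e_def[symmetric] E_def[symmetric] m_def[symmetric] by simp
  have 2: "(e < E & (EX x. 0 < x & x <= 1 & Kd e E m x = 0 & Kf e E m x < k)) & ~ (N | W e E m k) \<longleftrightarrow>
   ~ W e E m k & ~ crit e E m k & (EX x. 0 < x & x < 1 & Kf e E m x < k)" if k: "k < - e"
  proof
   assume A: "(e < E & (EX x. 0 < x & x <= 1 & Kd e E m x = 0 & Kf e E m x < k)) & ~ (N | W e E m k)"
   then obtain x where x: "0 < x" "x <= 1" "Kd e E m x = 0" "Kf e E m x < k" by blast
   have "x ~= 1" using x(4) k Kf_1(1)[of e E m] by auto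
   then have x1: "x < 1" using x by simp
   have "~ (EX y. 0 < y & y < 1 & Kd e E m y = 0 & Kf e E m y = k)"
   proof clarify
    fix y assume y: "0 < y" "y < 1" "Kd e E m y = 0" "k = Kf e E m y"
    then have "y ~= x" using x by auto
    then show False using Kf_crit_pos_min[OF e m y(1,3), of x] x y by auto
   qed
   then show "~ W e E m k & ~ crit e E m k & (EX x. 0 < x & x < 1 & Kf e E m x < k)"
    using A cs x x1 by blast
  next
   assume A: "~ W e E m k & ~ crit e E m k & (EX x. 0 < x & x < 1 & Kf e E m x < k)"
   then obtain x where x: "0 < x" "x < 1" "Kf e E m x < k" by blast
   obtain u where u: "0 < u" "u <= 1" "u = 1 | Kd e E m u = 0" "!!w. 0 <= w ==> w <= 1 ==> Kf e E m u <= Kf e E m w"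
    using Kf_min_right[OF e, of E m] by blast
   have ku: "Kf e E m u < k" using u(4)[of x] x by simp
   then have "u ~= 1" using Kf_1(1)[of e E m] k by auto
   then have "Kd e E m u = 0" "u < 1" using u by auto
   then show "(e < E & (EX x. 0 < x & x <= 1 & Kd e E m x = 0 & Kf e E m x < k)) & ~ (N | W e E m k)"
    using A cs u ku eE[OF u(1)] by blast
  qed
  show ?thesis
  proof (cases "k < - e")
   case True
   then have "k < e" using e by simp
   then show ?thesis using 1 2[OF True] ct d1 z2 e1 l True unfolding regionF_def RF_def by auto
  next
   case False then show ?thesis using d1 unfolding regionF_def RF_def by auto
  qed
 qed
 show "(l, h, e1) \<in> regionG a e0 \<longleftrightarrow> RG e E m k"
 proof -
  have "zeta3 a e0 < e1^2" if k: "k < - e" "W e E m k"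
  proof -
   have "k < e" using k e by simp
   then obtain s t where st: "0 < s" "s < t" "t < 1" "fz e E m t = 0" "Kf e E m (- t) < k"
    using W_crit_points[OF e _ k(2)] by (elim exE conjE meta_impE)
   then have t: "0 < t" "t < 1" "fz e E m t = 0" "Kf e E m (- t) < k" by auto
   have "kap e E t < - e" using t fz_mcr_iff(1)[OF t(1), of e E m] k by (simp add: kap_def)
   then have "4*t*(kap e E t + e) < 0" using t by (intro mult_pos_neg) auto
   then have "(1 + t)^2*(- E*t*(1 - t)^2 + e*(1 + 2*t - t^2)) < 0" using kap_plus_e[of t e E] t by simp
   moreover have "0 < (1 + t)^2" using t by simp
   ultimately have "- E*t*(1 - t)^2 + e*(1 + 2*t - t^2) < 0" by (metis mult_less_0_iff not_less_iff_gr_or_eq)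
   then have "(5 + 3 * sqrt 3)*e < E" by (intro zeta3_bound[OF t(1,2) e]) simp
   moreover have "a^2*zeta3 a e0 = (5 + 3 * sqrt 3)*e" "a^2*e1^2 = E"
    using a by (simp_all add: zeta3_def e_def E_def power2_eq_square)
   ultimately have "a^2*zeta3 a e0 < a^2*e1^2" by simp
   then show ?thesis using a by simp
  qed
  then show ?thesis using T d1 e1 l e unfolding regionG_def RG_def by auto
 qed
qed

section \<open>Connectedness of the classes\<close>

text \<open>A union of connected sets is connected if a continuous selection over a connected index set exists.\<close>
lemma connected_UN_selection:
 assumes "connected X" "continuous_on X s" "!!x. x \<in> X ==> s x \<in> C x" "!!x. x \<in> X ==> connected (C x)"
 shows "connected (\<Union>x\<in>X. C x)"
proof -
 have "connected (C x \<union> s ` X)" if "x \<in> X" for x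
  by (rule connected_Un) (use assms that in \<open>auto intro: connected_continuous_image\<close>)
 then have "connected (\<Union>x\<in>X. C x \<union> s ` X)"
  by (intro connected_Union) auto
 also have "(\<Union>x\<in>X. C x \<union> s ` X) = (\<Union>x\<in>X. C x)" using assms(3) by auto
 finally show ?thesis .
qed

text \<open>All conditions at a fixed point of the profile are affine in \<open>(E, m, k)\<close>.\<close>

definition aff :: "('a::real_vector => real) => bool" where
 "aff f \<longleftrightarrow> (ALL p q u v. 0 <= u --> 0 <= v --> u + v = 1 --> f (u *\<^sub>R p + v *\<^sub>R q) = u*f p + v * f q)"

lemma aff_lin: "aff (%p::real\<times>real\<times>real. fst p*a + fst (snd p)*b + snd (snd p)*c + d)"
 unfolding aff_def
proof (intro allI impI)
 fix p q :: "real \<times> real \<times> real" and u v :: real assume "u + v = 1"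
 then have u: "u = 1 - v" by simp
 show "fst (u *\<^sub>R p + v *\<^sub>R q)*a + fst (snd (u *\<^sub>R p + v *\<^sub>R q))*b + snd (snd (u *\<^sub>R p + v *\<^sub>R q))*c + d =
   u*(fst p*a + fst (snd p)*b + snd (snd p)*c + d) + v * (fst q*a + fst (snd q)*b + snd (snd q)*c + d)"
  unfolding u by (simp add: algebra_simps)
qed

lemma aff_Kf: "aff (%p::real\<times>real\<times>real. Kf e (fst p) (fst (snd p)) x)" "aff (%p::real\<times>real\<times>real. Kd e (fst p) (fst (snd p)) x)"
 and aff_proj: "aff (%p::real\<times>real\<times>real. snd (snd p) + c)" "aff (%p::real\<times>real\<times>real. - (fst p*c))"
 "aff (%p::real\<times>real\<times>real. fst p)" "aff (%p::real\<times>real\<times>real. fst (snd p))" "aff (%p::real\<times>real\<times>real. snd (snd p))"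
 "aff (%p::real\<times>real\<times>real. c)"
 using aff_lin[of "- (1 - x^2)/2" "(1 - x^2)/(1 + x^2)" 0 "- e*x"] aff_lin[of x "- 4*x/(1 + x^2)^2" 0 "- e"]
  aff_lin[of 0 0 1 c] aff_lin[of "- c" 0 0 0] aff_lin[of 1 0 0 0] aff_lin[of 0 1 0 0] aff_lin[of 0 0 1 0] aff_lin[of 0 0 0 c]
 by (simp_all add: Kf_def[abs_def] Kd_def[abs_def] algebra_simps diff_divide_distrib)

lemma convex_Collect_aff:
 assumes "aff f" "aff g" shows "convex {p. f p < g p}" "convex {p. f p <= g p}" "convex {p. f p = g p}"
proof -
 have lt: "u*a + v * b < u*c + v * d" if "0 <= u" "0 <= v" "u + v = 1" "a < c" "b < d" for a b c d u v :: real
 proof (cases "u = 0")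
  case False
  then have "u*a < u*c" "v * b <= v * d" using that by (auto intro: mult_left_mono)
  then show ?thesis by linarith
 qed (use that in simp)
 show "convex {p. f p < g p}" using assms by (auto simp: convex_def aff_def intro: lt)
 show "convex {p. f p <= g p}" using assms by (auto simp: convex_def aff_def intro!: add_mono mult_left_mono)
 show "convex {p. f p = g p}" using assms by (auto simp: convex_def aff_def)
qed

lemma convex_Collect_logic:
 "(!!y. convex {p. P y p}) ==> convex {p. ALL y. P y p}"
 "(c ==> convex {p. Q p}) ==> convex {p. c --> Q p}"
 "convex {p. Q p} ==> convex {p. R p} ==> convex {p. Q p & R p}"
 by (auto simp: convex_def)

lemmas convex_Kf = convex_Collect_logic convex_Collect_aff aff_Kf aff_proj

text \<open>The normalised parameters of a class.\<close>

definition PR :: "(real => real => real => real => bool) => real => (real \<times> real \<times> real) set" where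
 "PR R e = {p. 0 < fst p & 0 <= fst (snd p) & R e (fst p) (fst (snd p)) (snd (snd p))}"

lemma PR_I: "0 < E ==> 0 <= m ==> R e E m k ==> (E, m, k) \<in> PR R e"
 by (simp add: PR_def)

lemma PR_selection:
 assumes R: "!!E m k. 0 < E ==> 0 <= m ==> R e E m k \<longleftrightarrow> (\<exists>x\<in>X. Q x E m k)"
  and X: "connected X" "X ~= {}"
  and cv: "!!x. x \<in> X ==> convex {p. Q x (fst p) (fst (snd p)) (snd (snd p))}"
  and s: "continuous_on X A" "continuous_on X B" "continuous_on X k"
  and sQ: "!!x. x \<in> X ==> 0 < A x & 0 <= B x & Q x (A x) (B x) (k x)"
 shows "connected (PR R e) & PR R e ~= {}"
proof -
 have eq: "PR R e = (\<Union>x\<in>X. {p. 0 < fst p & 0 <= fst (snd p) & Q x (fst p) (fst (snd p)) (snd (snd p))})"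
  using R by (auto simp: PR_def)
 have "connected (PR R e)" unfolding eq
 proof (rule connected_UN_selection[where s = "%x. (A x, B x, k x)"])
  fix x assume "x \<in> X"
  then show "connected {p. 0 < fst p & 0 <= fst (snd p) & Q x (fst p) (fst (snd p)) (snd (snd p))}"
   by (intro convex_connected convex_Kf cv)
 qed (use X s sQ in \<open>auto intro!: continuous_intros\<close>)
 moreover obtain x where "x \<in> X" using X by auto
 then have "(A x, B x, k x) \<in> PR R e" using sQ unfolding eq by auto
 ultimately show ?thesis by blast
qed

lemma PR_RB:
 assumes e: "0 < e" shows "connected (PR RB e) & PR RB e ~= {}"
proof -
 define Q where "Q y E m k \<longleftrightarrow> (ALL x. -1 <= x --> x <= 1 --> Kf e E m x < k)" for y E m k :: real
 have "RB e E m k" if Q: "Q 0 E m k" for E m k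
 proof -
  have lt: "!!x. -1 <= x ==> x <= 1 ==> Kf e E m x < k" using Q Q_def by simp
  have "e < k" using lt[of "-1"] by (simp add: Kf_1)
  moreover have "Kf e E m x ~= k" if "-1 < x" "x < 1" for x using lt[of x] that by simp
  ultimately show ?thesis using lt unfolding RB_def crit_def by (auto intro!: less_imp_le)
 qed
 then have R: "RB e E m k \<longleftrightarrow> (\<exists>x\<in>{0}. Q x E m k)" for E m k
  using pattern_B[OF e, of k E m] by (auto simp: RB_def Q_def)
 have cv: "convex {p. Q x (fst p) (fst (snd p)) (snd (snd p))}" for x unfolding Q_def by (intro convex_Kf)
 have "Kf e 1 0 y < e + 1" if "-1 <= y" "y <= 1" for y
 proof -
  have "y^2 <= 1" using that by (simp add: abs_square_le_1 abs_le_iff)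
  moreover have "e*(- y) <= e*1" using that e by (intro mult_left_mono) auto
  ultimately show ?thesis by (simp add: Kf_def field_simps)
 qed
 then have s: "0 < (1::real) & (0::real) <= 0 & Q x 1 0 (e + 1)" for x by (simp add: Q_def)
 from PR_selection[where R = RB and Q = Q and A = "%_. 1" and B = "%_. 0" and k = "%_. e + 1",
   OF R _ _ cv continuous_on_const continuous_on_const continuous_on_const s] show ?thesis by simp
qed

lemma PR_RC:
 assumes e: "0 < e" shows "connected (PR RC e) & PR RC e ~= {}"
proof -
 define Q where "Q w E m k \<longleftrightarrow> e < k & k < Kf e E m (- w)" for w E m k :: real
 (* Chosen such that the first term of Kf (- w) is 2 e + 1. *)
 define B where "B w = (2*e + 1)*(1 + w^2)/(1 - w^2)" for w :: real
 have R: "RC e E m k \<longleftrightarrow> (\<exists>w\<in>{0<..<1}. Q w E m k)" for E m k by (auto simp: RC_def Q_def)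
 have cv: "convex {p. Q x (fst p) (fst (snd p)) (snd (snd p))}" for x unfolding Q_def by (intro convex_Kf)
 have s: "0 < (1::real) & 0 <= B w & Q w 1 (B w) (2*e)" if "w \<in> {0<..<1}" for w
 proof -
  have w: "0 < w" "0 < 1 - w^2" using that by (auto simp: abs_square_less_1)
  have "B w*(1 - w^2)/(1 + w^2) = 2*e + 1" using w one_plus_sq[of w] by (simp add: B_def)
  then have "Kf e 1 (B w) (- w) = (2*e + 1) - (1 - w^2)/2 + e*w" by (simp add: Kf_def)
  moreover have "0 < e*w" "0 <= w^2" using e w by auto
  moreover have "2*e < X" if "X = (2*e + 1) - (1 - q)/2 + r" "0 < r" "0 <= q" for X q r
   using that by (simp add: field_simps)
  ultimately have "2*e < Kf e 1 (B w) (- w)" by blast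
  moreover have "0 <= B w" unfolding B_def using e w one_plus_sq[of w] by (intro divide_nonneg_nonneg mult_nonneg_nonneg) auto
  ultimately show ?thesis using e by (simp add: Q_def)
 qed
 have "1 - w^2 ~= 0" if "w \<in> {0<..<1}" for w :: real using that by (auto simp: power2_eq_1_iff)
 then have "continuous_on {0<..<1} B" unfolding B_def by (intro continuous_intros) auto
 from PR_selection[where R = RC and Q = Q and A = "%_. 1" and B = B and k = "%_. 2*e",
   OF R _ _ cv continuous_on_const this continuous_on_const s] show ?thesis by simp
qed

text \<open>For \<open>k <= 0\<close> and \<open>0 < u < v < 1\<close> there are parameters with \<open>Kf (-v) < k < Kf (-u)\<close>, depending
 continuously on \<open>(u, v)\<close>.\<close>

lemma W_selection:
 assumes e: "0 < e" and kc: "kc <= 0" and R: "!!E m k. R e E m k \<longleftrightarrow> I k & W e E m k"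
  and I: "I kc" "convex {p::real\<times>real\<times>real. I (snd (snd p))}"
 shows "connected (PR R e) & PR R e ~= {}"
proof -
 (* (1 - w^2) (m d w - E / 2 + c w) is Kf (- w) - kc. The bracket is made to take opposite values at u and
  v, which determines E from m; the summand 1 in B makes its value at u positive. *)
 define d c where "d w = 1/(1 + w^2)" and "c w = (e*w - kc)/(1 - w^2)" for w :: real
 define X where "X = {p::real\<times>real. 0 < fst p & fst p < snd p & snd p < 1}"
 define B where "B p = (c (snd p) - c (fst p))/(d (fst p) - d (snd p)) + 1" for p
 define A where "A p = B p*(d (fst p) + d (snd p)) + (c (fst p) + c (snd p))" for p
 have Kfcd: "Kf e E m (- w) - kc = (1 - w^2)*(m*d w - E/2 + c w)" if "0 < w" "w < 1" for E m w
 proof -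
  have "1 - w^2 ~= 0" using that by (auto simp: power2_eq_1_iff)
  then have "(1 - w^2)*c w = e*w - kc" by (simp add: c_def)
  then show ?thesis by (simp add: Kf_def d_def algebra_simps)
 qed
 have d: "d v < d u" "0 < d v" if "0 < u" "u < v" for u v
 proof -
  have "u^2 < v^2" using that by (intro power_strict_mono) auto
  then show "d v < d u" "0 < d v" unfolding d_def using one_plus_sq[of u] one_plus_sq[of v] by (auto intro!: divide_strict_left_mono mult_pos_pos)
 qed
 have c: "c u < c v" "0 < c u" if "0 < u" "u < v" "v < 1" for u v
 proof -
  have "u^2 < v^2" "v^2 < 1" using that by (auto intro!: power_strict_mono simp: abs_square_less_1)
  moreover have "e*u < e * v" "0 < e*u" using that e by auto
  ultimately show "c u < c v" "0 < c u" unfolding c_def using kc by (auto intro!: frac_less divide_pos_pos)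
 qed
 define Q where "Q x E m k \<longleftrightarrow> I k & Kf e E m (- snd x) < k & k < Kf e E m (- fst x)" for E m k :: real and x :: "real \<times> real"
 have RQ: "R e E m k \<longleftrightarrow> (\<exists>x\<in>X. Q x E m k)" for E m k unfolding R W_def X_def Q_def by auto
 have cv: "convex {p. Q x (fst p) (fst (snd p)) (snd (snd p))}" for x unfolding Q_def by (intro convex_Kf I)
 have "convex X" unfolding X_def
  by (intro convex_Collect_logic convex_Collect_aff) (auto simp: aff_def simp flip: distrib_right)
 then have cX: "connected X" by (rule convex_connected)
 have "(1/3, 2/3) \<in> X" by (simp add: X_def)
 then have X0: "X ~= {}" by blast
 have s: "0 < A x & 0 <= B x & Q x (A x) (B x) kc" if "x \<in> X" for x
 proof -
  have x: "0 < fst x" "fst x < snd x" "snd x < 1" using that by (auto simp: X_def)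
  define u v where "u = fst x" and "v = snd x"
  have uv: "0 < u" "u < v" "v < 1" "0 < v" "u < 1" using x by (auto simp: u_def v_def)
  have du: "0 < d u - d v" using d uv by simp
  have cu: "0 < c v - c u" using c uv by simp
  have B: "0 < B x" unfolding B_def u_def[symmetric] v_def[symmetric] using du cu by (intro add_pos_pos divide_pos_pos) auto
  have "(B x - 1)*(d u - d v) = c v - c u" unfolding B_def u_def[symmetric] v_def[symmetric] using du by simp
  then have Bd: "B x*d u - B x*d v = (c v - c u) + (d u - d v)" by (simp add: algebra_simps)
  have A: "A x = B x*d u + B x*d v + (c u + c v)" unfolding A_def u_def v_def by (simp add: algebra_simps)
  have "0 < d u" "0 < d v" "0 < c u" "0 < c v" using d[of "u/2" u] d(2)[of u v] c(2)[of u v] c(1)[of u v] uv by auto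
  then have Apos: "0 < A x" unfolding A using B by (intro add_pos_pos mult_pos_pos) auto
  have sq: "0 < 1 - u^2" "0 < 1 - v^2" using uv by (auto simp: abs_square_less_1)
  have "B x*d u - A x/2 + c u = (d u - d v)/2" "B x*d v - A x/2 + c v = - (d u - d v)/2"
   unfolding A using Bd by (simp_all add: field_simps)
  then have "0 < Kf e (A x) (B x) (- u) - kc" "Kf e (A x) (B x) (- v) - kc < 0"
   unfolding Kfcd[OF uv(1,5)] Kfcd[OF uv(4,3)] using sq du by (simp_all add: mult_pos_neg)
  then show ?thesis using Apos B I by (simp add: Q_def u_def v_def)
 qed
 have nz: "1 - (fst p)^2 ~= 0" "1 - (snd p)^2 ~= 0" "1/(1 + (fst p)^2) - 1/(1 + (snd p)^2) ~= 0" if "p \<in> X" for p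
  using that d(1)[of "fst p" "snd p"] unfolding d_def X_def by (auto simp: power2_eq_1_iff)
 have cB: "continuous_on X B" unfolding B_def c_def d_def using one_plus_sq(2) nz by (intro continuous_intros) auto
 then have "continuous_on X A" unfolding A_def c_def d_def using one_plus_sq(2) nz by (intro continuous_intros) auto
 from PR_selection[where R = R and Q = Q and A = A and B = B and k = "%_. kc", OF RQ cX X0 cv this cB continuous_on_const s] show ?thesis .
qed

lemma PR_RD: "0 < e ==> connected (PR RD e) & PR RD e ~= {}"
 by (rule W_selection[where kc = 0 and I = "%k. - e < k & k < e"]) (auto simp: RD_def intro!: convex_Kf)

lemma PR_RG: "0 < e ==> connected (PR RG e) & PR RG e ~= {}"
 by (rule W_selection[where kc = "- 2*e" and I = "%k. k < - e"]) (auto simp: RG_def intro!: convex_Kf)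

text \<open>The index is a point \<open>x\<close> with \<open>k + e x + E (1 - x^2) > 0\<close>; for \<open>E = m\<close> the profile is at least \<open>- e\<close>,
 so \<open>k = - 2 e\<close> and \<open>E = 4 e / (1 - x^2)\<close> are suitable.\<close>
lemma PR_RE:
 assumes e: "0 < e" shows "connected (PR RE e) & PR RE e ~= {}"
proof -
 define Q where "Q x E m k \<longleftrightarrow> (ALL y. -1 <= y --> y <= 1 --> k < Kf e E m y) & - (E*(1 - x^2)) < k + e*x" for x E m k :: real
 define A where "A x = 4*e/(1 - x^2)" for x :: real
 have R: "RE e E m k \<longleftrightarrow> (\<exists>x\<in>{-1<..<1}. Q x E m k)" (is "_ \<longleftrightarrow> ?R") for E m k
 proof
  assume R: "RE e E m k"
  then obtain x where x: "-1 < x" "x < 1" "0 < k + e*x + E*(1 - x^2)" unfolding RE_def by blast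
  have "k < Kf e E m y" if "-1 <= y" "y <= 1" for y
   using pattern_E[OF e, of k E m y] R that unfolding RE_def by blast
  then show ?R using x by (intro bexI[of _ x]) (auto simp: Q_def)
 next
  assume ?R
  then obtain x where x: "-1 < x" "x < 1" "- (E*(1 - x^2)) < k + e*x" and lt: "!!y. -1 <= y ==> y <= 1 ==> k < Kf e E m y"
   unfolding Q_def by auto
  have "k < - e" using lt[of 1] by (simp add: Kf_1)
  moreover have "Kf e E m x ~= k" if "-1 < x" "x < 1" for x using lt[of x] that by simp
  moreover have "0 < k + e*x + E*(1 - x^2)" using x(3) by simp
  ultimately show "RE e E m k" using lt x(1,2) unfolding RE_def crit_def by (auto intro!: less_imp_le)
 qed
 have cv: "convex {p. Q x (fst p) (fst (snd p)) (snd (snd p))}" for x unfolding Q_def by (intro convex_Kf)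
 have s: "0 < A x & 0 <= A x & Q x (A x) (A x) (- 2*e)" if "x \<in> {-1<..<1}" for x
 proof -
  have x: "-1 < x" "0 < 1 - x^2" using that by (auto simp: abs_square_less_1 abs_less_iff)
  have E: "0 < A x" "A x*(1 - x^2) = 4*e" using x e by (auto simp: A_def)
  have "- 2*e < Kf e (A x) (A x) y" if y: "-1 <= y" "y <= 1" for y
  proof -
   have y2: "y^2 <= 1" using y by (simp add: abs_square_le_1 abs_le_iff)
   have "(A x*(1 - y^2))*(1/2) <= (A x*(1 - y^2))*(1/(1 + y^2))"
    using y2 E one_plus_sq[of y] by (intro mult_left_mono mult_nonneg_nonneg divide_left_mono) auto
   then have "A x/2*(1 - y^2) <= A x*(1 - y^2)/(1 + y^2)" by simp
   moreover have "e*y <= e*1" using y e by (intro mult_left_mono) auto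
   ultimately show ?thesis unfolding Kf_def using e by linarith
  qed
  moreover have "- e < e*x" using x e by (metis mult_less_cancel_left_pos mult_minus1_right)
  ultimately show ?thesis unfolding Q_def using E e by auto
 qed
 have "1 - x^2 ~= 0" if "x \<in> {-1<..<1}" for x :: real using that by (auto simp: power2_eq_1_iff)
 then have "continuous_on {-1<..<1} A" unfolding A_def by (auto intro!: continuous_intros)
 from PR_selection[where R = RE and Q = Q and A = A and B = A and k = "%_. - 2*e", OF R _ _ cv this this continuous_on_const s] show ?thesis by simp
qed

lemma Kd_neg_crossing:
 assumes y: "y < b" and k: "Kf e E m y = k" "!!x. y < x ==> x < b ==> Kf e E m x < k" and nz: "Kd e E m y ~= 0"
 shows "Kd e E m y < 0"
proof (rule ccontr)
 assume "~ ?thesis"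
 then have "0 < Kd e E m y" "0 < b - y" using nz y by auto
 then have "EX z. y < z & z < y + (b - y) & Kf e E m y < Kf e E m z" by (rule deriv_pos_nearby(1)[OF Kf_deriv])
 then obtain z where "y < z" "z < y + (b - y)" "Kf e E m y < Kf e E m z" by (elim exE conjE)
 then show False using k(2)[of z] k(1) by simp
qed

lemma Kd_pos_crossing:
 assumes y: "y < b" and k: "Kf e E m y = k" "!!x. y < x ==> x < b ==> k < Kf e E m x" and nz: "Kd e E m y ~= 0"
 shows "0 < Kd e E m y"
proof (rule ccontr)
 assume "~ ?thesis"
 then have "Kd e E m y < 0" "0 < b - y" using nz y by auto
 then have "EX z. y < z & z < y + (b - y) & Kf e E m z < Kf e E m y" by (rule deriv_neg_nearby(1)[OF Kf_deriv])
 then obtain z where "y < z" "z < y + (b - y)" "Kf e E m z < Kf e E m y" by (elim exE conjE)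
 then show False using k(2)[of z] k(1) by simp
qed

text \<open>The index is the only crossing \<open>y\<close>; for \<open>m = 0\<close>, \<open>E = e / 2\<close> the profile decreases on \<open>[-1, 1]\<close>.\<close>
lemma PR_RA:
 assumes e: "0 < e" shows "connected (PR RA e) & PR RA e ~= {}"
proof -
 define Q where "Q y E m k \<longleftrightarrow> Kf e E m y = k & Kd e E m y < 0 & (ALL x. -1 <= x --> x < y --> k < Kf e E m x) &
  (ALL x. y < x --> x <= 1 --> Kf e E m x < k)" for y E m k :: real
 have R: "RA e E m k \<longleftrightarrow> (\<exists>y\<in>{-1<..<1}. Q y E m k)" (is "_ \<longleftrightarrow> ?R") if m: "0 <= m" for E m k
 proof
  assume "RA e E m k"
  then have R: "- e < k" "k < e" "~ W e E m k" "~ crit e E m k" by (auto simp: RA_def)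
  from pattern_A[OF e m R] obtain y where y: "-1 < y" "y < 1" "Kf e E m y = k" "ALL x. -1 <= x --> x < y --> k < Kf e E m x"
   "ALL x. y < x --> x <= 1 --> Kf e E m x < k" by (elim exE conjE)
  have "Kd e E m y ~= 0" using R(4) y(1-3) unfolding crit_def by blast
  then have "Kd e E m y < 0" using Kd_neg_crossing[OF y(2,3)] y(5) by simp
  then show ?R using y by (intro bexI[of _ y]) (auto simp: Q_def)
 next
  assume ?R
  then obtain y where y: "-1 < y" "y < 1" "Kf e E m y = k" "Kd e E m y < 0" and lt: "!!x. -1 <= x ==> x < y ==> k < Kf e E m x"
   "!!x. y < x ==> x <= 1 ==> Kf e E m x < k" unfolding Q_def by auto
  have "k < e" "- e < k" using lt(1)[of "-1"] lt(2)[of 1] y by (auto simp: Kf_1)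
  moreover have "~ W e E m k"
  proof
   assume "W e E m k"
   then obtain u v where uv: "0 < u" "u < v" "v < 1" "Kf e E m (- v) < k" "k < Kf e E m (- u)" unfolding W_def by blast
   have "y < - v" using lt(1)[of "- v"] uv y by (cases "y = - v") force+
   then show False using lt(2)[of "- u"] uv by simp
  qed
  moreover have "~ crit e E m k"
  proof
   assume "crit e E m k"
   then obtain x where x: "-1 < x" "x < 1" "Kd e E m x = 0" "Kf e E m x = k" unfolding crit_def by blast
   then show False using lt(1)[of x] lt(2)[of x] y by (cases x y rule: linorder_cases) auto
  qed
  ultimately show "RA e E m k" by (simp add: RA_def)
 qed
 have cv: "convex {p. Q x (fst p) (fst (snd p)) (snd (snd p))}" for x unfolding Q_def by (intro convex_Kf)
 have s: "0 < e/2 & (0::real) <= 0 & Q y (e/2) 0 (Kf e (e/2) 0 y)" if "y \<in> {-1<..<1}" for y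
 proof -
  have y: "-1 < y" "y < 1" using that by auto
  have dif: "Kf e (e/2) 0 x - Kf e (e/2) 0 y = (x - y)*(e/4*(x + y - 4))" for x
   by (simp add: Kf_def power2_eq_square field_simps)
  have neg: "e/4*(x + y - 4) < 0" if "x <= 1" for x using e y that by (intro mult_pos_neg) auto
  have "Kf e (e/2) 0 y < Kf e (e/2) 0 x" if "x < y" for x
   using mult_neg_neg[of "x - y", OF _ neg[of x]] dif[of x] that y by simp
  moreover have "Kf e (e/2) 0 x < Kf e (e/2) 0 y" if "y < x" "x <= 1" for x
   using mult_pos_neg[of "x - y", OF _ neg[of x]] dif[of x] that y by simp
  moreover have "Kd e (e/2) 0 y < 0" using mult_strict_left_mono[OF y(2) e] e by (simp add: Kd_def)
  ultimately show ?thesis using e by (simp add: Q_def)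
 qed
 from PR_selection[where R = RA and Q = Q and A = "%_. e/2" and B = "%_. 0" and k = "Kf e (e/2) 0", OF R _ _ cv continuous_on_const continuous_on_const continuous_on_Kf s] show ?thesis by simp
qed

text \<open>The indices are the two crossings; for \<open>m = 0\<close> the profile is a parabola with axis
 \<open>e / E = (y1 + y2) / 2\<close>. Their sum is positive because \<open>Kf (- y) > Kf y\<close> for \<open>y > 0\<close>.\<close>
lemma PR_RF:
 assumes e: "0 < e" shows "connected (PR RF e) & PR RF e ~= {}"
proof -
 define X where "X = {y::real\<times>real. -1 < fst y & fst y < snd y & snd y < 1 & 0 < fst y + snd y}"
 define A where "A y = 2*e/(fst y + snd y)" for y :: "real \<times> real"
 define K where "K y = Kf e (A y) 0 (fst y)" for y
 define Q where "Q y E m k \<longleftrightarrow> Kf e E m (fst y) = k & Kf e E m (snd y) = k & Kd e E m (fst y) < 0 & 0 < Kd e E m (snd y) &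
  (ALL x. -1 <= x --> x < fst y --> k < Kf e E m x) & (ALL x. fst y < x --> x < snd y --> Kf e E m x < k) &
  (ALL x. snd y < x --> x <= 1 --> k < Kf e E m x)" for E m k :: real and y :: "real \<times> real"
 have R: "RF e E m k \<longleftrightarrow> (\<exists>y\<in>X. Q y E m k)" (is "_ \<longleftrightarrow> ?R") if m: "0 <= m" for E m k
 proof
  assume "RF e E m k"
  then have R: "k < - e" "~ W e E m k" "~ crit e E m k" "EX x. 0 < x & x < 1 & Kf e E m x < k" by (auto simp: RF_def)
  from R(4) obtain c where c: "0 < c" "c < 1" "Kf e E m c < k" by (elim exE conjE)
  from pattern_F[OF e m R(1-3) c] obtain y1 y2 where y: "-1 < y1" "y1 < y2" "y2 < 1" "Kf e E m y1 = k" "Kf e E m y2 = k"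
   "ALL x. -1 <= x --> x < y1 --> k < Kf e E m x" "ALL x. y1 < x --> x < y2 --> Kf e E m x < k"
   "ALL x. y2 < x --> x <= 1 --> k < Kf e E m x" by (elim exE conjE)
  have "Kd e E m y1 ~= 0" "Kd e E m y2 ~= 0" using R(3) y(1-5) less_trans[of y1 y2 1] less_trans[of "-1" y1 y2] unfolding crit_def by auto
  then have "Kd e E m y1 < 0" "0 < Kd e E m y2"
   using Kd_neg_crossing[OF y(2,4)] Kd_pos_crossing[OF y(3,5)] y(7,8) by auto
  moreover have "c < y2" using y(5,8) c by (metis less_asym less_imp_le linorder_neqE_linordered_idom)
  then have y2: "0 < y2" using c by simp
  have "0 < y1 + y2"
  proof (rule ccontr)
   assume "~ ?thesis"
   then have "y1 <= - y2" "- y2 < y2" using y2 by auto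
   then have "Kf e E m (- y2) <= k" using y(4) y(7)[rule_format, of "- y2"] by (cases "y1 = - y2") auto
   moreover have "Kf e E m (- y2) - Kf e E m y2 = 2*e*y2" by (rule Kf_reflect)
   moreover have "0 < 2*e*y2" using e y2 by simp
   ultimately show False using y(5) by linarith
  qed
  ultimately show ?R using y by (intro bexI[of _ "(y1, y2)"]) (auto simp: X_def Q_def)
 next
  assume ?R
  then obtain y1 y2 where y: "-1 < y1" "y1 < y2" "y2 < 1" "0 < y1 + y2" "Kf e E m y1 = k" "Kf e E m y2 = k" "Kd e E m y1 < 0" "0 < Kd e E m y2"
   and lt: "!!x. -1 <= x ==> x < y1 ==> k < Kf e E m x" "!!x. y1 < x ==> x < y2 ==> Kf e E m x < k"
   "!!x. y2 < x ==> x <= 1 ==> k < Kf e E m x" unfolding X_def Q_def by auto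
  have y2: "0 < y2" using y by simp
  have "k < - e" using lt(3)[of 1] y by (auto simp: Kf_1)
  moreover have "~ W e E m k"
  proof
   assume "W e E m k"
   then obtain u v where uv: "0 < u" "u < v" "v < 1" "Kf e E m (- v) < k" "k < Kf e E m (- u)" unfolding W_def by blast
   have "y1 < - v" using lt(1)[of "- v"] uv y by (cases "y1 = - v") force+
   then show False using lt(2)[of "- u"] uv y2 by simp
  qed
  moreover have "~ crit e E m k"
  proof
   assume "crit e E m k"
   then obtain x where x: "-1 < x" "x < 1" "Kd e E m x = 0" "Kf e E m x = k" unfolding crit_def by blast
   then have "x ~= y1" "x ~= y2" using y by auto
   then consider "x < y1" | "y1 < x" "x < y2" | "y2 < x" by linarith
   then show False using lt(1)[of x] lt(2)[of x] lt(3)[of x] x by cases auto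
  qed
  moreover have "max 0 y1 < y2" using y y2 by simp
  then obtain x where "max 0 y1 < x" "x < y2" using dense by blast
  then have "EX x. 0 < x & x < 1 & Kf e E m x < k" using lt(2)[of x] y by (intro exI[of _ x]) auto
  ultimately show "RF e E m k" by (simp add: RF_def)
 qed
 have "convex X" unfolding X_def
  by (intro convex_Collect_logic convex_Collect_aff) (auto simp: aff_def algebra_simps simp flip: distrib_right)
 then have cX: "connected X" by (rule convex_connected)
 have "(1/3, 2/3) \<in> X" by (simp add: X_def)
 then have X0: "X ~= {}" by blast
 have cv: "convex {p. Q x (fst p) (fst (snd p)) (snd (snd p))}" for x unfolding Q_def by (intro convex_Kf)
 have s: "0 < A y & (0::real) <= 0 & Q y (A y) 0 (K y)" if "y \<in> X" for y
 proof -
  have y: "-1 < fst y" "fst y < snd y" "snd y < 1" "0 < fst y + snd y" using that by (auto simp: X_def)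
  have A: "0 < A y" "e = A y*(fst y + snd y)/2" using y e by (auto simp: A_def)
  have dif: "Kf e (A y) 0 x = K y + A y/2*((x - fst y)*(x - snd y))" for x
   unfolding K_def Kf_def A(2) by (simp add: power2_eq_square field_simps)
  have kd: "Kd e (A y) 0 x = A y/2*((x - fst y) + (x - snd y))" for x
   unfolding Kd_def A(2) by (simp add: field_simps)
  show ?thesis unfolding Q_def dif kd using A y by (auto simp: zero_less_mult_iff mult_less_0_iff)
 qed
 have "fst y + snd y ~= 0" if "y \<in> X" for y using that by (auto simp: X_def)
 then have cA: "continuous_on X A" unfolding A_def by (intro continuous_intros) auto
 then have cK: "continuous_on X K" unfolding K_def Kf_def using one_plus_sq(2) by (auto intro!: continuous_intros)
 from PR_selection[where R = RF and Q = Q and A = A and B = "%_. 0" and k = K, OF R cX X0 cv cA continuous_on_const cK s] show ?thesis .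
qed

section \<open>The components of the set of regular values\<close>

lemma components_eqI:
 assumes S: "\<Union>F = S" and F: "!!A. A \<in> F ==> openin (top_of_set S) A" "!!A. A \<in> F ==> connected A & A ~= {}"
  and dj: "pairwise disjnt F"
 shows "components S = F"
proof -
 have comp: "A \<in> components S" if A: "A \<in> F" for A
 proof -
  have "\<Union>(F - {A}) = S - A" using S A dj unfolding pairwise_def disjnt_def by blast
  moreover have "openin (top_of_set S) (\<Union>(F - {A}))" using F by (intro openin_Union) blast
  moreover have AS: "A \<subseteq> S" using A S by blast
  ultimately have cl: "closedin (top_of_set S) A" by (simp add: closedin_def)
  show ?thesis unfolding in_components_maximal
  proof (intro conjI allI impI)
   fix d assume d: "d ~= {} & A \<subseteq> d & d \<subseteq> S & connected d"
   then have "openin (top_of_set d) A" "closedin (top_of_set d) A"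
    using openin_subset_trans[OF F(1)[OF A]] closedin_subset_trans[OF cl] by blast+
   then show "d = A" using d F(2)[OF A] unfolding connected_clopen by blast
  qed (use AS F(2)[OF A] in auto)
 qed
 moreover have "C \<in> F" if C: "C \<in> components S" for C
 proof -
  obtain p where p: "p \<in> C" using C in_components_nonempty by blast
  then obtain A where "A \<in> F" "p \<in> A" using C S in_components_subset by blast
  then show ?thesis using components_eq[OF C comp] p by blast
 qed
 ultimately show ?thesis by blast
qed

lemma closedin_sequentialI:
 fixes S :: "'a::metric_space set"
 assumes "C \<subseteq> S" "!!f p. (!!n. f n \<in> C) ==> f \<longlonglongrightarrow> p ==> p \<in> S ==> p \<in> C"
 shows "closedin (top_of_set S) C"
 unfolding closedin_limpt
proof (intro conjI allI impI assms(1))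
 fix p assume "p islimpt C & p \<in> S"
 then show "p \<in> C" using assms(2) unfolding islimpt_sequential by blast
qed

lemma Kf_limit:
 assumes lim: "E \<longlonglongrightarrow> E0" "m \<longlonglongrightarrow> m0" "k \<longlonglongrightarrow> k0"
  and x: "!!n. -1 <= x n & x n <= 1 & 0 <= s*(Kf e (E n) (m n) (x n) - k n)"
 shows "EX y. -1 <= y & y <= 1 & 0 <= s*(Kf e E0 m0 y - k0)"
proof -
 have "ALL n. x n \<in> {-1..1}" using x by auto
 then obtain y r where r: "y \<in> {-1..1}" "strict_mono (r :: nat => nat)" "(x \<circ> r) \<longlonglongrightarrow> y"
  using compact_Icc[of "-1::real" 1] unfolding compact_def by metis
 have lr: "(%n. E (r n)) \<longlonglongrightarrow> E0" "(%n. m (r n)) \<longlonglongrightarrow> m0" "(%n. k (r n)) \<longlonglongrightarrow> k0" "(%n. x (r n)) \<longlonglongrightarrow> y"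
  using lim[THEN LIMSEQ_subseq_LIMSEQ, OF r(2)] r(3) by (simp_all add: o_def)
 have "(%n. s*(Kf e (E (r n)) (m (r n)) (x (r n)) - k (r n))) \<longlonglongrightarrow> s*(Kf e E0 m0 y - k0)"
  unfolding Kf_def by (intro tendsto_intros lr) (use one_plus_sq(2)[of y] in simp_all)
 then have "0 <= s*(Kf e E0 m0 y - k0)" by (rule LIMSEQ_le_const) (use x in auto)
 then show ?thesis using r(1) by auto
qed

text \<open>The points \<open>(l, h, e1)\<close> with \<open>l \<ge> 0\<close> in a class.\<close>

definition RS :: "real => real => (real => real => real => real => bool) => (real \<times> real \<times> real) set" where
 "RS a e0 R = {(l, h, e1). 0 < e1 & 0 <= l & R (a*e0) ((a*e1)^2) ((l/a)^2) (h - (l/a)^2)}"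

lemma region_eq_RS:
 assumes a: "0 < a" and e0: "0 < e0"
 shows "regionA a e0 = RS a e0 RA" "regionB a e0 = RS a e0 RB" "regionC a e0 = RS a e0 RC" "regionD a e0 = RS a e0 RD"
  "regionE a e0 = RS a e0 RE" "regionF a e0 = RS a e0 RF" "regionG a e0 = RS a e0 RG"
proof -
 have eq: "X = RS a e0 R" if "!!l h e1. (l, h, e1) \<in> X ==> 0 < e1 & 0 <= l"
  "!!l h e1. 0 < e1 ==> 0 <= l ==> (l, h, e1) \<in> X \<longleftrightarrow> R (a*e0) ((a*e1)^2) ((l/a)^2) (h - (l/a)^2)" for X R
  using that unfolding RS_def by blast
 note r = regions_iff[OF a e0]
 show "regionA a e0 = RS a e0 RA" by (rule eq, simp add: regionA_def, rule r(1))
 show "regionB a e0 = RS a e0 RB" by (rule eq, simp add: regionB_def, rule r(2))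
 show "regionC a e0 = RS a e0 RC" by (rule eq, simp add: regionC_def, rule r(3))
 show "regionD a e0 = RS a e0 RD" by (rule eq, simp add: regionD_def, rule r(4))
 show "regionE a e0 = RS a e0 RE" by (rule eq, simp add: regionE_def, rule r(5))
 show "regionF a e0 = RS a e0 RF" by (rule eq, simp add: regionF_def, rule r(6))
 show "regionG a e0 = RS a e0 RG" by (rule eq, simp add: regionG_def, rule r(7))
qed

lemma RS_image:
 assumes a: "0 < a"
 shows "RS a e0 R = (%p. (a * sqrt (fst (snd p)), snd (snd p) + fst (snd p), sqrt (fst p)/a)) ` PR R (a*e0)" (is "_ = ?G ` _")
proof (intro set_eqI iffI)
 fix q assume "q \<in> RS a e0 R"
 then obtain l h e1 where q: "q = (l, h, e1)" "0 < e1" "0 <= l" "R (a*e0) ((a*e1)^2) ((l/a)^2) (h - (l/a)^2)"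
  unfolding RS_def by blast
 then have "((a*e1)^2, (l/a)^2, h - (l/a)^2) \<in> PR R (a*e0)" using a by (intro PR_I) auto
 moreover have "q = ?G ((a*e1)^2, (l/a)^2, h - (l/a)^2)" using a q by simp
 ultimately show "q \<in> ?G ` PR R (a*e0)" by blast
next
 fix q assume "q \<in> ?G ` PR R (a*e0)"
 then obtain E m k where "q = ?G (E, m, k)" "0 < E" "0 <= m" "R (a*e0) E m k" unfolding PR_def by force
 then show "q \<in> RS a e0 R" using a by (simp add: RS_def)
qed

lemma RS_connected:
 assumes a: "0 < a" and P: "connected (PR R (a*e0)) & PR R (a*e0) ~= {}"
 shows "connected (RS a e0 R) & RS a e0 R ~= {}"
 unfolding RS_image[OF a] using P a by (auto intro!: connected_continuous_image continuous_intros)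

lemma class_iff:
 assumes e: "0 < e" and E: "0 < E" and m: "0 <= m"
 shows "RA e E m k \<longleftrightarrow> Reg e E m k & - e < k & k < e & ~ W e E m k"
  "RB e E m k \<longleftrightarrow> Reg e E m k & e < k & ~ (EX w. 0 < w & w < 1 & k < Kf e E m (- w))"
  "RC e E m k \<longleftrightarrow> Reg e E m k & e < k & (EX w. 0 < w & w < 1 & k < Kf e E m (- w))"
  "RD e E m k \<longleftrightarrow> Reg e E m k & - e < k & k < e & W e E m k"
  "RE e E m k \<longleftrightarrow> Reg e E m k & k < - e & ~ (EX x. 0 < x & x < 1 & Kf e E m x < k)"
  "RF e E m k \<longleftrightarrow> Reg e E m k & k < - e & (EX x. 0 < x & x < 1 & Kf e E m x < k) & ~ W e E m k"
  "RG e E m k \<longleftrightarrow> Reg e E m k & k < - e & W e E m k"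
proof -
 have R: "RA e E m k ==> Reg e E m k" "RB e E m k ==> Reg e E m k" "RC e E m k ==> Reg e E m k" "RD e E m k ==> Reg e E m k"
  "RE e E m k ==> Reg e E m k" "RF e E m k ==> Reg e E m k" "RG e E m k ==> Reg e E m k"
  using Reg_iff[OF e E m, of k] by blast+
 show "RA e E m k \<longleftrightarrow> Reg e E m k & - e < k & k < e & ~ W e E m k" using R(1) unfolding RA_def Reg_def by blast
 show "RB e E m k \<longleftrightarrow> Reg e E m k & e < k & ~ (EX w. 0 < w & w < 1 & k < Kf e E m (- w))"
  using R(2) unfolding RB_def Reg_def not_less[symmetric] by blast
 show "RC e E m k \<longleftrightarrow> Reg e E m k & e < k & (EX w. 0 < w & w < 1 & k < Kf e E m (- w))" using R(3) unfolding RC_def by blast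
 show "RD e E m k \<longleftrightarrow> Reg e E m k & - e < k & k < e & W e E m k" using R(4) unfolding RD_def by blast
 show "RE e E m k \<longleftrightarrow> Reg e E m k & k < - e & ~ (EX x. 0 < x & x < 1 & Kf e E m x < k)"
  using R(5) unfolding RE_def Reg_def not_less[symmetric] by blast
 show "RF e E m k \<longleftrightarrow> Reg e E m k & k < - e & (EX x. 0 < x & x < 1 & Kf e E m x < k) & ~ W e E m k"
  using R(6) unfolding RF_def Reg_def by blast
 show "RG e E m k \<longleftrightarrow> Reg e E m k & k < - e & W e E m k" using R(7) unfolding RG_def by blast
qed

text \<open>Each class is cut out of the regular set by conditions that are both relatively open and relatively
 closed: in the limit a strict inequality becomes an equality only at a critical level.\<close>
lemma RS_open:
 assumes a: "0 < a" and e0: "0 < e0" and R: "R \<in> {RA, RB, RC, RD, RE, RF, RG}"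
 shows "openin (top_of_set (RS a e0 Reg)) (RS a e0 R)"
proof -
 define e where "e = a*e0"
 have e: "0 < e" using a e0 by (simp add: e_def)
 define A m k :: "real \<times> real \<times> real => real" where "A p = (a * snd (snd p))^2" and "m p = (fst p/a)^2" and "k p = fst (snd p) - m p" for p
 let ?S = "RS a e0 Reg"
 have RSp: "RS a e0 R = {p. 0 < snd (snd p) & 0 <= fst p & R e (A p) (m p) (k p)}" for R
  unfolding RS_def A_def m_def k_def e_def by auto
 have c: "continuous_on UNIV A" "continuous_on UNIV m" "continuous_on UNIV k"
  unfolding A_def m_def k_def using a by (auto intro!: continuous_intros)
 have lim: "(%n. A (f n)) \<longlonglongrightarrow> A p" "(%n. m (f n)) \<longlonglongrightarrow> m p" "(%n. k (f n)) \<longlonglongrightarrow> k p" if "f \<longlonglongrightarrow> p" for f p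
  using c[THEN continuous_on_tendsto_compose, OF that] by simp_all
 have Am: "0 < A p" "0 <= m p" if "0 < snd (snd p)" for p using that a by (auto simp: A_def m_def)
 define U V X Y Z where "U = {p. e < k p}" and "V = {p. - e < k p} \<inter> {p. k p < e}" and "X = {p. k p < - e}"
  and "Y = {p. EX w. 0 < w & w < 1 & k p < Kf e (A p) (m p) (- w)}" and "Z = {p. EX x. 0 < x & x < 1 & Kf e (A p) (m p) x < k p}"
 define N where "N = {p. k p < e & W e (A p) (m p) (k p)}"
 have op: "open U" "open V" "open X" "open Y" "open Z" "open N"
  unfolding U_def V_def X_def Y_def Z_def N_def
  by (intro open_Int open_Collect_ex open_Collect_conj open_Collect_const open_W open_Collect_less continuous_on_Kf_param c continuous_on_const)+
 have clN: "closedin (top_of_set ?S) (?S \<inter> N)"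
 proof (rule closedin_sequentialI)
  fix f p assume f: "!!n. f n \<in> ?S \<inter> N" "f \<longlonglongrightarrow> p" and p: "p \<in> ?S"
  then have r: "k p ~= e" "~ crit e (A p) (m p) (k p)" by (auto simp: RSp Reg_def)
  have "k p <= e & (EX s t. 0 < s & s <= t & t <= 1 & fz e (A p) (m p) s = 0 & fz e (A p) (m p) t = 0 &
    Kf e (A p) (m p) (- t) <= k p & k p <= Kf e (A p) (m p) (- s))"
   by (rule W_limit[OF e lim[OF f(2)]]) (use f(1) in \<open>auto simp: N_def\<close>)
  then obtain s t where ke: "k p < e" and st: "0 < s" "s <= t" "t <= 1" "fz e (A p) (m p) s = 0"
    "Kf e (A p) (m p) (- t) <= k p" "k p <= Kf e (A p) (m p) (- s)" using r(1) by (elim exE conjE) simp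
  have "s ~= t"
  proof
   assume s: "s = t"
   then have "Kf e (A p) (m p) (- s) = k p" using st by simp
   moreover have "s ~= 1" using calculation ke Kf_1(2)[of e "A p" "m p"] by auto
   ultimately have "crit e (A p) (m p) (k p)" using st s crit_split[OF e] by (metis order_le_less)
   then show False using r by simp
  qed
  then have "W e (A p) (m p) (k p)" using W_upgrade[OF e _ _ st(3,5,6) ke r(2)] st by simp
  then show "p \<in> ?S \<inter> N" using p ke by (simp add: N_def)
 qed auto
 have clY: "closedin (top_of_set ?S) (?S \<inter> U \<inter> Y)"
 proof (rule closedin_sequentialI)
  fix f p assume f: "!!n. f n \<in> ?S \<inter> U \<inter> Y" "f \<longlonglongrightarrow> p" and p: "p \<in> ?S"
  then have r: "k p ~= e" "~ crit e (A p) (m p) (k p)" by (auto simp: RSp Reg_def)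
  have "e <= k p" by (rule LIMSEQ_le_const[OF lim(3)[OF f(2)]]) (use f(1) in \<open>auto simp: U_def intro: less_imp_le\<close>)
  then have ke: "e < k p" using r by simp
  have "ALL n. EX x. -1 <= x & x <= 1 & 0 <= 1*(Kf e (A (f n)) (m (f n)) x - k (f n))"
  proof
   fix n
   have "EX w. 0 < w & w < 1 & k (f n) < Kf e (A (f n)) (m (f n)) (- w)" using f(1)[of n] by (simp add: Y_def)
   then obtain w where "0 < w" "w < 1" "k (f n) < Kf e (A (f n)) (m (f n)) (- w)" by (elim exE conjE)
   then show "EX x. -1 <= x & x <= 1 & 0 <= 1*(Kf e (A (f n)) (m (f n)) x - k (f n))" by (intro exI[of _ "- w"]) simp
  qed
  from choice[OF this] obtain x where "ALL n. -1 <= x n & x n <= 1 & 0 <= 1*(Kf e (A (f n)) (m (f n)) (x n) - k (f n))" by (rule exE)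
  then have x: "!!n. -1 <= x n & x n <= 1 & 0 <= 1*(Kf e (A (f n)) (m (f n)) (x n) - k (f n))" by (rule spec)
  from Kf_limit[OF lim[OF f(2)] x] obtain y where y: "-1 <= y" "y <= 1" "0 <= 1*(Kf e (A p) (m p) y - k p)" by (elim exE conjE)
  have "p \<in> Y"
  proof (rule ccontr)
   assume "p \<notin> Y"
   have "Kf e (A p) (m p) (- w) <= k p" if "0 < w" "w < 1" for w
    by (rule leI) (use \<open>p \<notin> Y\<close> that in \<open>auto simp: Y_def\<close>)
   then show False using pattern_B[OF e ke r(2) _ y(1,2)] y(3) by simp
  qed
  then show "p \<in> ?S \<inter> U \<inter> Y" using p ke by (simp add: U_def)
 qed auto
 have clZ: "closedin (top_of_set ?S) (?S \<inter> X \<inter> Z)"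
 proof (rule closedin_sequentialI)
  fix f p assume f: "!!n. f n \<in> ?S \<inter> X \<inter> Z" "f \<longlonglongrightarrow> p" and p: "p \<in> ?S"
  then have r: "k p ~= - e" "~ crit e (A p) (m p) (k p)" by (auto simp: RSp Reg_def)
  have "k p <= - e" by (rule LIMSEQ_le_const2[OF lim(3)[OF f(2)]]) (use f(1) in \<open>auto simp: X_def intro: less_imp_le\<close>)
  then have ke: "k p < - e" using r by simp
  have "ALL n. EX x. -1 <= x & x <= 1 & 0 <= - 1*(Kf e (A (f n)) (m (f n)) x - k (f n))"
  proof
   fix n
   have "EX x. 0 < x & x < 1 & Kf e (A (f n)) (m (f n)) x < k (f n)" using f(1)[of n] by (simp add: Z_def)
   then obtain x where "0 < x" "x < 1" "Kf e (A (f n)) (m (f n)) x < k (f n)" by (elim exE conjE)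
   then show "EX x. -1 <= x & x <= 1 & 0 <= - 1*(Kf e (A (f n)) (m (f n)) x - k (f n))" by (intro exI[of _ x]) simp
  qed
  from choice[OF this] obtain x where "ALL n. -1 <= x n & x n <= 1 & 0 <= - 1*(Kf e (A (f n)) (m (f n)) (x n) - k (f n))" by (rule exE)
  then have x: "!!n. -1 <= x n & x n <= 1 & 0 <= - 1*(Kf e (A (f n)) (m (f n)) (x n) - k (f n))" by (rule spec)
  from Kf_limit[OF lim[OF f(2)] x] obtain y where y: "-1 <= y" "y <= 1" "0 <= - 1*(Kf e (A p) (m p) y - k p)" by (elim exE conjE)
  have "p \<in> Z"
  proof (rule ccontr)
   assume "p \<notin> Z"
   have "k p <= Kf e (A p) (m p) x" if "0 < x" "x < 1" for x
    by (rule leI) (use \<open>p \<notin> Z\<close> that in \<open>auto simp: Z_def\<close>)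
   then show False using pattern_E[OF e ke r(2) _ y(1,2)] y(3) by simp
  qed
  then show "p \<in> ?S \<inter> X \<inter> Z" using p ke by (simp add: X_def)
 qed auto
 have eq: "RS a e0 R = ?S \<inter> T" if "!!p. 0 < snd (snd p) ==> R e (A p) (m p) (k p) \<longleftrightarrow> Reg e (A p) (m p) (k p) & p \<in> T" for R T
  unfolding RSp using that by blast
 note ci = class_iff[OF e Am]
 have "RS a e0 RA = ?S \<inter> (V - N)" by (rule eq) (auto simp: ci(1) V_def N_def)
 moreover have "RS a e0 RB = ?S \<inter> (U - Y)" by (rule eq) (auto simp: ci(2) U_def Y_def)
 moreover have "RS a e0 RE = ?S \<inter> (X - Z)" by (rule eq) (auto simp: ci(5) X_def Z_def)
 moreover have "RS a e0 RF = ?S \<inter> (X \<inter> Z - N)" by (rule eq) (use e in \<open>auto simp: ci(6) X_def Z_def N_def\<close>)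
 ultimately have eqs: "RS a e0 RA = ?S \<inter> V - ?S \<inter> N" "RS a e0 RB = ?S \<inter> U - ?S \<inter> U \<inter> Y"
  "RS a e0 RE = ?S \<inter> X - ?S \<inter> X \<inter> Z" "RS a e0 RF = ?S \<inter> (X \<inter> Z) - ?S \<inter> N" by blast+
 have eqC: "RS a e0 RC = ?S \<inter> (U \<inter> Y)" by (rule eq) (auto simp: ci(3) U_def Y_def)
 have eqD: "RS a e0 RD = ?S \<inter> (V \<inter> N)" by (rule eq) (auto simp: ci(4) V_def N_def)
 have eqG: "RS a e0 RG = ?S \<inter> (X \<inter> N)" by (rule eq) (use e in \<open>auto simp: ci(7) X_def N_def\<close>)
 have oi: "openin (top_of_set ?S) (?S \<inter> T)" if "open T" for T using that by (rule openin_open_Int)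
 have "openin (top_of_set ?S) (RS a e0 RA)" unfolding eqs(1) by (intro openin_diff oi op clN)
 moreover have "openin (top_of_set ?S) (RS a e0 RB)" unfolding eqs(2) by (intro openin_diff oi op clY)
 moreover have "openin (top_of_set ?S) (RS a e0 RE)" unfolding eqs(3) by (intro openin_diff oi op clZ)
 moreover have "openin (top_of_set ?S) (RS a e0 RF)" unfolding eqs(4) by (intro openin_diff oi open_Int op clN)
 moreover have "openin (top_of_set ?S) (RS a e0 RC)" unfolding eqC by (intro oi open_Int op)
 moreover have "openin (top_of_set ?S) (RS a e0 RD)" unfolding eqD by (intro oi open_Int op)
 moreover have "openin (top_of_set ?S) (RS a e0 RG)" unfolding eqG by (intro oi open_Int op)
 ultimately show ?thesis using R by auto
qed

text \<open>The number of the class, to tell the regions apart.\<close>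

definition cls :: "real => real => real => real => nat" where
 "cls e E m k = (if e < k then (if EX w. 0 < w & w < 1 & k < Kf e E m (- w) then 2 else 1)
  else if - e < k then (if W e E m k then 3 else 0)
  else if W e E m k then 6 else if EX x. 0 < x & x < 1 & Kf e E m x < k then 5 else 4)"

lemma cls:
 assumes "0 < e"
 shows "RA e E m k ==> cls e E m k = 0" "RB e E m k ==> cls e E m k = 1" "RC e E m k ==> cls e E m k = 2" "RD e E m k ==> cls e E m k = 3"
  "RE e E m k ==> cls e E m k = 4" "RF e E m k ==> cls e E m k = 5" "RG e E m k ==> cls e E m k = 6"
 using assms W_below[OF assms, of E m k] unfolding R_defs cls_def by (auto simp: not_less[symmetric])

lemma components_regular_values:
 assumes a: "0 < a" and e0: "0 < e0"
 shows "components (RS a e0 Reg) = set (regions a e0)" "distinct (regions a e0)" "\<Union>(set (regions a e0)) = RS a e0 Reg"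
proof -
 have e: "0 < a*e0" using a e0 by simp
 have rg: "regions a e0 = map (RS a e0) [RA, RB, RC, RD, RE, RF, RG]" by (simp add: regions_def region_eq_RS[OF a e0])
 define c where "c = (%(l, h, e1). cls (a*e0) ((a*e1)^2) ((l/a)^2) (h - (l/a)^2))"
 note co = RS_connected[OF a PR_RA[OF e]] RS_connected[OF a PR_RB[OF e]] RS_connected[OF a PR_RC[OF e]] RS_connected[OF a PR_RD[OF e]]
  RS_connected[OF a PR_RE[OF e]] RS_connected[OF a PR_RF[OF e]] RS_connected[OF a PR_RG[OF e]]
 have im: "c ` RS a e0 R = {i}" if "!!E m k. R (a*e0) E m k ==> cls (a*e0) E m k = i" "connected (RS a e0 R) & RS a e0 R ~= {}" for R i
 proof -
  have "c p = i" if p: "p \<in> RS a e0 R" for p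
  proof -
   obtain l h e1 where q: "p = (l, h, e1)" by (cases p)
   have "R (a*e0) ((a*e1)^2) ((l/a)^2) (h - (l/a)^2)" using p by (simp add: q RS_def)
   then show ?thesis unfolding q c_def by (simp add: \<open>!!E m k. R (a * e0) E m k ==> cls (a * e0) E m k = i\<close>)
  qed
  then show ?thesis using that(2) by blast
 qed
 have c0: "c ` RS a e0 RA = {0}" by (rule im) (rule cls(1)[OF e], assumption, rule co(1))
 have c1: "c ` RS a e0 RB = {1}" by (rule im) (rule cls(2)[OF e], assumption, rule co(2))
 have c2: "c ` RS a e0 RC = {2}" by (rule im) (rule cls(3)[OF e], assumption, rule co(3))
 have c3: "c ` RS a e0 RD = {3}" by (rule im) (rule cls(4)[OF e], assumption, rule co(4))
 have c4: "c ` RS a e0 RE = {4}" by (rule im) (rule cls(5)[OF e], assumption, rule co(5))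
 have c5: "c ` RS a e0 RF = {5}" by (rule im) (rule cls(6)[OF e], assumption, rule co(6))
 have c6: "c ` RS a e0 RG = {6}" by (rule im) (rule cls(7)[OF e], assumption, rule co(7))
 have mp: "map (image c) (regions a e0) = map (%i. {i}) [0, 1, 2, 3, 4, 5, 6]"
  unfolding rg list.map c0 c1 c2 c3 c4 c5 c6 ..
 have "distinct (map (image c) (regions a e0))" unfolding mp by simp
 then have d: "distinct (regions a e0)" "inj_on (image c) (set (regions a e0))"
  unfolding distinct_map by (rule conjunct1, rule conjunct2)
 have st: "set (map (image c) (regions a e0)) = (%i. {i}) ` {0, 1, 2, 3, 4, 5, 6}" unfolding mp by simp
 have s: "EX i. c ` P = {i}" if "P \<in> set (regions a e0)" for P
 proof -
  have "c ` P \<in> (%i. {i}) ` {0, 1, 2, 3, 4, 5, 6}" unfolding st[symmetric] set_map using that by (rule imageI)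
  then show ?thesis by (rule imageE) (rule exI)
 qed
 show "distinct (regions a e0)" by (rule d)
 have dj: "pairwise disjnt (set (regions a e0))"
 proof (rule pairwiseI)
  fix P Q assume PQ: "P \<in> set (regions a e0)" "Q \<in> set (regions a e0)" "P ~= Q"
  obtain i where i: "c ` P = {i}" using s[OF PQ(1)] by (rule exE)
  obtain j where j: "c ` Q = {j}" using s[OF PQ(2)] by (rule exE)
  have "i ~= j" using inj_onD[OF d(2) _ PQ(1,2)] PQ(3) i j by metis
  moreover have "i = j" if "p \<in> P" "p \<in> Q" for p using imageI[OF that(1), of c] imageI[OF that(2), of c] i j by simp
  ultimately show "disjnt P Q" unfolding disjnt_iff by metis
 qed
 show U: "\<Union>(set (regions a e0)) = RS a e0 Reg"
 proof -
  have "0 < (a*e1)^2" if "0 < e1" for e1 using a that by simp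
  then show ?thesis unfolding rg using Reg_iff[OF e] by (auto simp: RS_def)
 qed
 show "components (RS a e0 Reg) = set (regions a e0)"
 proof (rule components_eqI[OF U _ _ dj])
  show "openin (top_of_set (RS a e0 Reg)) P" if "P \<in> set (regions a e0)" for P
   using that RS_open[OF a e0] unfolding rg by auto
  show "connected P & P ~= {}" if "P \<in> set (regions a e0)" for P
   using that co unfolding rg by auto
 qed
qed

theorem mainTheorem6:
  fixes a e0 :: real
  assumes "a > 0" and "e0 > 0"
  shows "regular_values a e0 = (\<Union>R \<in> set (regions a e0). symm R) \<and>
    components (regular_values a e0 \<inter> {(l, h, e1). 0 \<le> l}) = set (regions a e0) \<and>
    distinct (regions a e0) \<and>
    (\<forall>l h e1. 0 < e1 \<and> h < delta1 a e0 l \<and> h < delta2 a e0 l \<and>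
       (zeta1 a e0 < e1\<^sup>2 \<longrightarrow> h < delta4 a e0 e1 l) \<longrightarrow> Q3 a e0 e1 l h = {}) \<and>
    (\<forall>(l, h, e1) \<in> symm (regionA a e0).
       top_of_set (Q3 a e0 e1 l h) homeomorphic_space S3) \<and>
    (\<forall>(l, h, e1) \<in> symm (regionB a e0).
       is_RP3 (top_of_set (Q3 a e0 e1 l h))) \<and>
    (\<forall>(l, h, e1) \<in> symm (regionC a e0).
       top_of_set (Q3 a e0 e1 l h) homeomorphic_space S2xS1) \<and>
    (\<forall>(l, h, e1) \<in> symm (regionD a e0).
       is_N3 2 (top_of_set (Q3 a e0 e1 l h))) \<and>
    (\<forall>(l, h, e1) \<in> symm (regionE a e0).
       top_of_set (Q3 a e0 e1 l h) homeomorphic_space two_S3) \<and>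
    (\<forall>(l, h, e1) \<in> symm (regionF a e0).
       top_of_set (Q3 a e0 e1 l h) homeomorphic_space S2xS1) \<and>
    (\<forall>(l, h, e1) \<in> symm (regionG a e0).
       is_N3 3 (top_of_set (Q3 a e0 e1 l h)))"
proof -
 note a = assms(1) and e0 = assms(2)
 note RS = region_eq_RS[OF a e0]
 have S: "regular_values a e0 \<inter> {(l, h, e1). 0 <= l} = RS a e0 Reg"
  using regular_values_iff[OF a e0] by (auto simp: RS_def)
 have sy: "(l, h, e1) \<in> symm (RS a e0 R) \<longleftrightarrow> 0 < e1 & R (a*e0) ((a*e1)^2) ((l/a)^2) (h - (l/a)^2)" for l h e1 R
  by (simp add: symm_def RS_def power_divide)
 have "(l, h, e1) \<in> regular_values a e0 \<longleftrightarrow> (l, h, e1) \<in> (\<Union>R \<in> set (regions a e0). symm R)" for l h e1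
 proof -
  have "(l, h, e1) \<in> regular_values a e0 \<longleftrightarrow> (l, h, e1) \<in> symm (RS a e0 Reg)"
   unfolding sy by (rule regular_values_iff[OF a e0])
  also have "... \<longleftrightarrow> (l, h, e1) \<in> (\<Union>R \<in> set (regions a e0). symm R)"
   unfolding components_regular_values(3)[OF a e0, symmetric] by (auto simp: symm_def)
  finally show ?thesis .
 qed
 then have 1: "regular_values a e0 = (\<Union>R \<in> set (regions a e0). symm R)" by auto
 note T = Q3_topology[OF a e0]
 show ?thesis unfolding S components_regular_values(1)[OF a e0]
 proof (intro conjI allI impI ballI)
  show "regular_values a e0 = (\<Union>R \<in> set (regions a e0). symm R)" by (rule 1)
  show "distinct (regions a e0)" by (rule components_regular_values(2)[OF a e0])
  show "Q3 a e0 e1 l h = {}" if "0 < e1 & h < delta1 a e0 l & h < delta2 a e0 l &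
   (zeta1 a e0 < e1^2 --> h < delta4 a e0 e1 l)" for l h e1
   using Q3_empty[OF a e0] that by blast
 qed (use T in \<open>auto simp: RS sy\<close>)
qed

end
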